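(* Let $\alpha>1$ be a constant, let $(M,g)$ be a compact Riemannian manifold, $(N,h)$ a Riemannian manifold, $\psi:(M,g)\to(N,h)$ an $\alpha$-harmonic map, and $\{\psi_{t,s}:M\to N\}_{-\epsilon<s,t<\epsilon}$ a smooth 2-parameter variation of $\psi$ with $\psi_{0,0}=\psi$. Put $$\upsilon=\frac{\partial\psi_{t,s}}{\partial t}\Big|_{s=t=0},\qquad \omega=\frac{\partial\psi_{t,s}}{\partial s}\Big|_{s=t=0}.$$ Then $$\frac{\partial^{2}}{\partial t\,\partial s}E_{\alpha}(\psi_{t,s})\Big|_{t=s=0}=-\int_M h(J_\alpha(\upsilon),\omega)\,dV_g,$$ where $J_\alpha(\upsilon)\in\Gamma(\psi^{-1}TN)$ is given by $$J_\alpha(\upsilon)=2\alpha(1+|d\psi|^2)^{\alpha-1}\,\mathrm{Tr}_g R^N(\upsilon,d\psi)d\psi+4\alpha(\alpha-1)\,\mathrm{Tr}_g\nabla\Big(\langle\nabla\upsilon,d\psi\rangle(1+|d\psi|^2)^{\alpha-2}d\psi\Big)+2\alpha\,\mathrm{Tr}_g\nabla\Big((1+|d\psi|^2)^{\alpha-1}\nabla\upsilon\Big).$$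
   Context: For a smooth map $\psi:(M,g)\to(N,h)$, $|d\psi|$ is the Hilbert–Schmidt norm of $d\psi$ with respect to $g$ and $h$, and $E_\alpha(\psi)=\int_M(1+|d\psi|^2)^\alpha\,dV_g$. The map $\psi$ is $\alpha$-harmonic if it is a critical point of $E_\alpha$ (with respect to smooth variations). $\nabla$ is the connection on $\psi^{-1}TN$ induced from the Levi-Civita connection of $N$ (and, together with the Levi-Civita connection of $M$, on $T^*M\otimes\psi^{-1}TN$). $\langle\,,\rangle$ is the induced inner product on $T^*M\otimes\psi^{-1}TN$. $R^N$ is the curvature tensor of $(N,h)$, with the sign convention that $h(R^N(X,Y)Y,X)$ is the sectional curvature for orthonormal $X,Y$; $\mathrm{Tr}_gR^N(\upsilon,d\psi)d\psi=\sum_iR^N(\upsilon,d\psi(e_i))d\psi(e_i)$ for a local orthonormal frame $\{e_i\}$ of $M$. For a $\psi^{-1}TN$-valued 1-form $\theta$ on $M$, $\mathrm{Tr}_g\nabla\theta=\sum_i(\nabla_{e_i}\theta)(e_i)$. *)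

theory Defs
  imports "HOL-Analysis.Analysis"
begin

section \<open>Smooth functions between normed spaces\<close>

text \<open>These notions are meant for open sets \<open>S\<close> only.\<close>

primrec C_on :: "nat \<Rightarrow> 'v::real_normed_vector set \<Rightarrow> ('v \<Rightarrow> 'w::real_normed_vector) \<Rightarrow> bool" where
  "C_on 0 S f \<longleftrightarrow> continuous_on S f"
| "C_on (Suc k) S f \<longleftrightarrow>
     (\<forall>x\<in>S. f differentiable (at x)) \<and> (\<forall>v. C_on k S (\<lambda>x. frechet_derivative f (at x) v))"

definition smooth_on :: "'v::real_normed_vector set \<Rightarrow> ('v \<Rightarrow> 'w::real_normed_vector) \<Rightarrow> bool" where
  "smooth_on S f \<longleftrightarrow> (\<forall>k. C_on k S f)"


section \<open>Manifolds, tangent vectors and Riemannian metrics\<close>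

text \<open>A manifold is a whole type, Hausdorff and second countable through the type classes imposed in
  the definitions below, with a smooth atlas (not necessarily maximal) of charts into
  \<open>real ^ 'm\<close>.  There is no boundary, and connectedness is not required.\<close>

type_synonym ('a, 'm) chart = "'a set \<times> ('a \<Rightarrow> real ^ 'm)"

definition chart_dom :: "('a, 'm::finite) chart \<Rightarrow> 'a set" where
  "chart_dom c = fst c"

definition coord :: "('a, 'm::finite) chart \<Rightarrow> 'a \<Rightarrow> real ^ 'm" where
  "coord c = snd c"

definition chart_img :: "('a, 'm::finite) chart \<Rightarrow> (real ^ 'm) set" where
  "chart_img c = coord c ` chart_dom c"

definition param :: "('a, 'm::finite) chart \<Rightarrow> real ^ 'm \<Rightarrow> 'a" where
  "param c = inv_into (chart_dom c) (coord c)"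

definition is_chart :: "('a::topological_space, 'm::finite) chart \<Rightarrow> bool" where
  "is_chart c \<longleftrightarrow> open (chart_dom c) \<and> open (chart_img c) \<and>
     homeomorphism (chart_dom c) (chart_img c) (coord c) (param c)"

definition smooth_atlas ::
  "('a::{t2_space,second_countable_topology}, 'm::finite) chart set \<Rightarrow> bool" where
  "smooth_atlas A \<longleftrightarrow>
     (\<forall>c\<in>A. is_chart c) \<and> (\<Union>c\<in>A. chart_dom c) = UNIV \<and>
     (\<forall>c\<in>A. \<forall>d\<in>A. smooth_on (coord c ` (chart_dom c \<inter> chart_dom d)) (coord d \<circ> param c))"

text \<open>A tangent vector at \<open>p\<close> is the family of its coordinate vectors in all charts around \<open>p\<close>,
  subject to the usual transformation rule; it is padded by 0 at all other charts, so
  that linear combinations can be formed componentwise.\<close>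

type_synonym ('a, 'm) tvec = "('a, 'm) chart \<Rightarrow> real ^ 'm"

record ('a, 'm) riemannian =
  atlas :: "('a, 'm) chart set"
  metric :: "'a \<Rightarrow> ('a, 'm) tvec \<Rightarrow> ('a, 'm) tvec \<Rightarrow> real"

definition charts_at :: "('a, 'm::finite) riemannian \<Rightarrow> 'a \<Rightarrow> ('a, 'm) chart set" where
  "charts_at M p = {c \<in> atlas M. p \<in> chart_dom c}"

definition tangent_space :: "('a, 'm::finite) riemannian \<Rightarrow> 'a \<Rightarrow> ('a, 'm) tvec set" where
  "tangent_space M p = {v.
     (\<forall>c. c \<notin> charts_at M p \<longrightarrow> v c = 0) \<and>
     (\<forall>c\<in>charts_at M p. \<forall>d\<in>charts_at M p.
        v d = frechet_derivative (coord d \<circ> param c) (at (coord c p)) (v c))}"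

text \<open>The tangent vector at \<open>p\<close> with coordinate vector \<open>w\<close> in the chart \<open>c\<close>; for fixed \<open>w\<close>, as a
  function of \<open>p\<close>, the vector field on the domain of \<open>c\<close> with constant coefficients.\<close>

definition coord_vec ::
  "('a, 'm::finite) riemannian \<Rightarrow> ('a, 'm) chart \<Rightarrow> real ^ 'm \<Rightarrow> 'a \<Rightarrow> ('a, 'm) tvec" where
  "coord_vec M c w p = (\<lambda>d. if d \<in> charts_at M p
     then frechet_derivative (coord d \<circ> param c) (at (coord c p)) w else 0)"

definition riemannian_metric :: "('a, 'm::finite) riemannian \<Rightarrow> bool" where
  "riemannian_metric M \<longleftrightarrow>
     (\<forall>p. \<forall>u\<in>tangent_space M p. \<forall>v\<in>tangent_space M p.
        metric M p u v = metric M p v u \<and>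
        (\<forall>w\<in>tangent_space M p. \<forall>a b.
           metric M p (\<lambda>c. a *\<^sub>R u c + b *\<^sub>R v c) w = a * metric M p u w + b * metric M p v w)) \<and>
     (\<forall>p. \<forall>u\<in>tangent_space M p. u \<noteq> (\<lambda>_. 0) \<longrightarrow> metric M p u u > 0) \<and>
     (\<forall>c\<in>atlas M. \<forall>u v. smooth_on (chart_img c)
        (\<lambda>x. metric M (param c x) (coord_vec M c u (param c x)) (coord_vec M c v (param c x))))"

definition riemannian_manifold ::
  "('a::{t2_space,second_countable_topology}, 'm::finite) riemannian \<Rightarrow> bool" where
  "riemannian_manifold M \<longleftrightarrow> smooth_atlas (atlas M) \<and> riemannian_metric M"

definition gram :: "('a, 'm::finite) riemannian \<Rightarrow> ('a, 'm) chart \<Rightarrow> real ^ 'm \<Rightarrow> real ^ 'm ^ 'm" where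
  "gram M c x = (\<chi> i j. metric M (param c x)
     (coord_vec M c (axis i 1) (param c x)) (coord_vec M c (axis j 1) (param c x)))"

text \<open>The Riemannian volume measure: the Borel measure given in every chart by
  the density \<open>sqrt (det (g\<^sub>i\<^sub>j))\<close> with respect to Lebesgue measure.\<close>

definition riemannian_volume ::
  "('a::{t2_space,second_countable_topology}, 'm::finite) riemannian \<Rightarrow> 'a measure" where
  "riemannian_volume M = (THE \<mu>. sets \<mu> = sets borel \<and>
     (\<forall>c\<in>atlas M. \<forall>X\<in>sets borel. X \<subseteq> chart_dom c \<longrightarrow>
        emeasure \<mu> X =
          (\<integral>\<^sup>+x. ennreal (sqrt (det (gram M c x))) * indicator (coord c ` X) x \<partial>lborel)))"

definition orthonormal_frame ::
  "('a, 'm::finite) riemannian \<Rightarrow> 'a \<Rightarrow> ('m \<Rightarrow> ('a, 'm) tvec) \<Rightarrow> bool" where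
  "orthonormal_frame M p e \<longleftrightarrow> (\<forall>i. e i \<in> tangent_space M p) \<and>
     (\<forall>i j. metric M p (e i) (e j) = (if i = j then 1 else 0))"

text \<open>The traces below do not depend on which orthonormal frame is chosen.\<close>

definition frame_at :: "('a, 'm::finite) riemannian \<Rightarrow> 'a \<Rightarrow> 'm \<Rightarrow> ('a, 'm) tvec" where
  "frame_at M p = (SOME e. orthonormal_frame M p e)"


section \<open>Levi-Civita connection and curvature\<close>

text \<open>The Levi-Civita connection is given by its Christoffel symbols in each chart;
  \<open>\<partial>\<^sub>k g\<^sub>i\<^sub>j\<close> is the \<open>(i,j)\<close> entry of the directional derivative of the Gram matrix.\<close>

definition gram_deriv ::
  "('a, 'm::finite) riemannian \<Rightarrow> ('a, 'm) chart \<Rightarrow> real ^ 'm \<Rightarrow> 'm \<Rightarrow> 'm \<Rightarrow> 'm \<Rightarrow> real" where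
  "gram_deriv M c x k i j = frechet_derivative (\<lambda>y. gram M c y $ i $ j) (at x) (axis k 1)"

definition christoffel_symbol ::
  "('a, 'm::finite) riemannian \<Rightarrow> ('a, 'm) chart \<Rightarrow> real ^ 'm \<Rightarrow> 'm \<Rightarrow> 'm \<Rightarrow> 'm \<Rightarrow> real" where
  "christoffel_symbol M c x k i j = 1 / 2 * (\<Sum>l\<in>UNIV. matrix_inv (gram M c x) $ k $ l *
     (gram_deriv M c x i j l + gram_deriv M c x j i l - gram_deriv M c x l i j))"

text \<open>As a check: this connection is torsion-free and compatible with the metric.\<close>

lemma christoffel_symbol_torsion_free:
  assumes "\<And>y i j. gram M c y $ i $ j = gram M c y $ j $ i"
  shows "christoffel_symbol M c x k i j = christoffel_symbol M c x k j i"
proof -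
  have "gram_deriv M c x a b d = gram_deriv M c x a d b" for a b d
    unfolding gram_deriv_def using assms[of _ b d] by simp
  then show ?thesis
    unfolding christoffel_symbol_def by (simp add: algebra_simps)
qed

lemma christoffel_symbol_metric:
  assumes sym: "\<And>y i j. gram M c y $ i $ j = gram M c y $ j $ i"
    and inv: "invertible (gram M c x)"
  shows "gram_deriv M c x k i j =
    (\<Sum>l\<in>UNIV. gram M c x $ j $ l * christoffel_symbol M c x l k i) +
    (\<Sum>l\<in>UNIV. gram M c x $ i $ l * christoffel_symbol M c x l k j)"
proof -
  have dsym: "gram_deriv M c x a b d = gram_deriv M c x a d b" for a b d
    unfolding gram_deriv_def using sym[of _ b d] by simp
  have right_inverse: "gram M c x ** matrix_inv (gram M c x) = mat 1"
    using someI_ex[OF inv[unfolded invertible_def]] by (simp add: matrix_inv_def)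
  have lower: "(\<Sum>l\<in>UNIV. gram M c x $ e $ l * christoffel_symbol M c x l a b) =
      1 / 2 * (gram_deriv M c x a b e + gram_deriv M c x b a e - gram_deriv M c x e a b)"
    (is "?L = 1 / 2 * ?w e") for e a b
  proof -
    define w where "w = (\<chi> e. gram_deriv M c x a b e + gram_deriv M c x b a e - gram_deriv M c x e a b)"
    have "(\<chi> l. christoffel_symbol M c x l a b) = (1 / 2) *\<^sub>R (matrix_inv (gram M c x) *v w)"
      by (simp add: vec_eq_iff christoffel_symbol_def matrix_vector_mult_def w_def)
    then have "gram M c x *v (\<chi> l. christoffel_symbol M c x l a b) =
        (1 / 2) *\<^sub>R (gram M c x *v (matrix_inv (gram M c x) *v w))"
      by (simp add: matrix_vector_mult_scaleR)
    also have "\<dots> = (1 / 2) *\<^sub>R w"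
      by (simp add: matrix_vector_mul_assoc right_inverse)
    finally have "(gram M c x *v (\<chi> l. christoffel_symbol M c x l a b)) $ e = 1 / 2 * w $ e"
      by simp
    then show ?thesis
      by (simp add: matrix_vector_mult_def w_def)
  qed
  show ?thesis
    unfolding lower by (simp add: dsym[of k j i] dsym[of i k j] dsym[of j k i] field_simps)
qed

definition christoffel ::
  "('a, 'm::finite) riemannian \<Rightarrow> ('a, 'm) chart \<Rightarrow> real ^ 'm \<Rightarrow> real ^ 'm \<Rightarrow> real ^ 'm \<Rightarrow> real ^ 'm" where
  "christoffel M c x u v =
     (\<chi> k. \<Sum>i\<in>UNIV. \<Sum>j\<in>UNIV. christoffel_symbol M c x k i j * u $ i * v $ j)"

definition cov_coord ::
  "('a, 'm::finite) riemannian \<Rightarrow> ('a, 'm) chart \<Rightarrow>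
   (real ^ 'm \<Rightarrow> real ^ 'm) \<Rightarrow> (real ^ 'm \<Rightarrow> real ^ 'm) \<Rightarrow> real ^ 'm \<Rightarrow> real ^ 'm" where
  "cov_coord M c X Y x = frechet_derivative Y (at x) (X x) + christoffel M c x (X x) (Y x)"

text \<open>\<open>R(X,Y)Z = \<nabla>\<^sub>X \<nabla>\<^sub>Y Z - \<nabla>\<^sub>Y \<nabla>\<^sub>X Z - \<nabla>\<^bsub>[X,Y]\<^esub> Z\<close>, evaluated with the extensions of the three
  vectors that have constant coefficients in the chart, for which \<open>[X,Y] = 0\<close>.\<close>

definition curvature ::
  "('a, 'm::finite) riemannian \<Rightarrow> 'a \<Rightarrow> ('a, 'm) tvec \<Rightarrow> ('a, 'm) tvec \<Rightarrow> ('a, 'm) tvec \<Rightarrow> ('a, 'm) tvec"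
where
  "curvature M p X Y Z = (\<lambda>c. if c \<in> charts_at M p
     then cov_coord M c (\<lambda>_. X c) (cov_coord M c (\<lambda>_. Y c) (\<lambda>_. Z c)) (coord c p)
        - cov_coord M c (\<lambda>_. Y c) (cov_coord M c (\<lambda>_. X c) (\<lambda>_. Z c)) (coord c p)
     else 0)"


section \<open>Maps between manifolds and the induced connections\<close>

text \<open>Families of maps \<open>M \<rightarrow> N\<close> depending smoothly on a parameter in an open set \<open>P\<close>.\<close>

definition smooth_family ::
  "('a::topological_space, 'm::finite) riemannian \<Rightarrow> ('b::topological_space, 'n::finite) riemannian \<Rightarrow>
   'p::euclidean_space set \<Rightarrow> ('p \<Rightarrow> 'a \<Rightarrow> 'b) \<Rightarrow> bool" where
  "smooth_family M N P F \<longleftrightarrow>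
     continuous_on (P \<times> UNIV) (\<lambda>(r, p). F r p) \<and>
     (\<forall>c\<in>atlas M. \<forall>d\<in>atlas N.
        smooth_on {(r, x). r \<in> P \<and> x \<in> chart_img c \<and> F r (param c x) \<in> chart_dom d}
          (\<lambda>(r, x). coord d (F r (param c x))))"

definition smooth_map ::
  "('a::topological_space, 'm::finite) riemannian \<Rightarrow> ('b::topological_space, 'n::finite) riemannian \<Rightarrow>
   ('a \<Rightarrow> 'b) \<Rightarrow> bool" where
  "smooth_map M N \<psi> \<longleftrightarrow>
     continuous_on UNIV \<psi> \<and>
     (\<forall>c\<in>atlas M. \<forall>d\<in>atlas N.
        smooth_on {x \<in> chart_img c. \<psi> (param c x) \<in> chart_dom d} (coord d \<circ> \<psi> \<circ> param c))"

text \<open>The space \<open>\<Gamma>(\<psi>\<^sup>-\<^sup>1TN)\<close> of smooth sections.\<close>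

definition sections_along ::
  "('a, 'm::finite) riemannian \<Rightarrow> ('b, 'n::finite) riemannian \<Rightarrow> ('a \<Rightarrow> 'b) \<Rightarrow>
   ('a \<Rightarrow> ('b, 'n) tvec) set" where
  "sections_along M N \<psi> = {\<sigma>.
     (\<forall>p. \<sigma> p \<in> tangent_space N (\<psi> p)) \<and>
     (\<forall>c\<in>atlas M. \<forall>d\<in>atlas N.
        smooth_on {x \<in> chart_img c. \<psi> (param c x) \<in> chart_dom d} (\<lambda>x. \<sigma> (param c x) d))}"

text \<open>The derivative of a vector-valued function in the direction of a tangent vector at \<open>p\<close>; it does
  not depend on the chart around \<open>p\<close>.\<close>

definition chart_at :: "('a, 'm::finite) riemannian \<Rightarrow> 'a \<Rightarrow> ('a, 'm) chart" where
  "chart_at M p = (SOME c. c \<in> charts_at M p)"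

definition dir_deriv ::
  "('a, 'm::finite) riemannian \<Rightarrow> 'a \<Rightarrow> ('a, 'm) tvec \<Rightarrow> ('a \<Rightarrow> 'w::real_normed_vector) \<Rightarrow> 'w" where
  "dir_deriv M p v f =
     (let c = chart_at M p in frechet_derivative (f \<circ> param c) (at (coord c p)) (v c))"

definition differential ::
  "('a, 'm::finite) riemannian \<Rightarrow> ('b, 'n::finite) riemannian \<Rightarrow> ('a \<Rightarrow> 'b) \<Rightarrow>
   'a \<Rightarrow> ('a, 'm) tvec \<Rightarrow> ('b, 'n) tvec" where
  "differential M N \<psi> p v =
     (\<lambda>d. if d \<in> charts_at N (\<psi> p) then dir_deriv M p v (coord d \<circ> \<psi>) else 0)"

definition velocity ::
  "('b, 'n::finite) riemannian \<Rightarrow> (real \<Rightarrow> 'b) \<Rightarrow> real \<Rightarrow> ('b, 'n) tvec" where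
  "velocity N \<gamma> t =
     (\<lambda>d. if d \<in> charts_at N (\<gamma> t) then vector_derivative (\<lambda>r. coord d (\<gamma> r)) (at t) else 0)"

text \<open>The induced connection on \<open>\<psi>\<^sup>-\<^sup>1TN\<close>: \<open>cov_along M N \<psi> \<sigma> p v\<close> is \<open>\<nabla>\<^sub>v \<sigma>\<close> at \<open>p\<close>.  For \<open>N = M\<close> and
  \<open>\<psi> = id\<close> it is the Levi-Civita connection of \<open>M\<close>.\<close>

definition cov_along ::
  "('a, 'm::finite) riemannian \<Rightarrow> ('b, 'n::finite) riemannian \<Rightarrow> ('a \<Rightarrow> 'b) \<Rightarrow>
   ('a \<Rightarrow> ('b, 'n) tvec) \<Rightarrow> 'a \<Rightarrow> ('a, 'm) tvec \<Rightarrow> ('b, 'n) tvec" where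
  "cov_along M N \<psi> \<sigma> p v = (\<lambda>d. if d \<in> charts_at N (\<psi> p)
     then dir_deriv M p v (\<lambda>q. \<sigma> q d)
        + christoffel N d (coord d (\<psi> p)) (differential M N \<psi> p v d) (\<sigma> p d)
     else 0)"

text \<open>The induced connection on \<open>T\<^sup>*M \<otimes> \<psi>\<^sup>-\<^sup>1TN\<close>: \<open>(\<nabla>\<^sub>v \<theta>)(w) = \<nabla>\<^sub>v (\<theta>(Y)) - \<theta>(\<nabla>\<^sub>v Y)\<close> for a local vector
  field \<open>Y\<close> extending \<open>w\<close>.\<close>

definition cov_form ::
  "('a, 'm::finite) riemannian \<Rightarrow> ('b, 'n::finite) riemannian \<Rightarrow> ('a \<Rightarrow> 'b) \<Rightarrow>
   ('a \<Rightarrow> ('a, 'm) tvec \<Rightarrow> ('b, 'n) tvec) \<Rightarrow> 'a \<Rightarrow> ('a, 'm) tvec \<Rightarrow> ('a, 'm) tvec \<Rightarrow> ('b, 'n) tvec"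
where
  "cov_form M N \<psi> \<theta> p v w =
     (let Y = coord_vec M (chart_at M p) (w (chart_at M p))
      in (\<lambda>d. cov_along M N \<psi> (\<lambda>q. \<theta> q (Y q)) p v d - \<theta> p (cov_along M M id Y p v) d))"

definition trace_cov ::
  "('a, 'm::finite) riemannian \<Rightarrow> ('b, 'n::finite) riemannian \<Rightarrow> ('a \<Rightarrow> 'b) \<Rightarrow>
   ('a \<Rightarrow> ('a, 'm) tvec \<Rightarrow> ('b, 'n) tvec) \<Rightarrow> 'a \<Rightarrow> ('b, 'n) tvec" where
  "trace_cov M N \<psi> \<theta> p =
     (\<lambda>d. \<Sum>i\<in>UNIV. cov_form M N \<psi> \<theta> p (frame_at M p i) (frame_at M p i) d)"

definition trace_curvature ::
  "('a, 'm::finite) riemannian \<Rightarrow> ('b, 'n::finite) riemannian \<Rightarrow> ('a \<Rightarrow> 'b) \<Rightarrow>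
   ('a \<Rightarrow> ('b, 'n) tvec) \<Rightarrow> 'a \<Rightarrow> ('b, 'n) tvec" where
  "trace_curvature M N \<psi> \<sigma> p =
     (\<lambda>d. \<Sum>i\<in>UNIV. curvature N (\<psi> p) (\<sigma> p)
        (differential M N \<psi> p (frame_at M p i)) (differential M N \<psi> p (frame_at M p i)) d)"

text \<open>The inner product on \<open>T\<^sub>p\<^sup>*M \<otimes> T\<^bsub>\<psi>(p)\<^esub>N\<close> and the Hilbert--Schmidt norm.\<close>

definition hs_inner ::
  "('a, 'm::finite) riemannian \<Rightarrow> ('b, 'n::finite) riemannian \<Rightarrow> ('a \<Rightarrow> 'b) \<Rightarrow> 'a \<Rightarrow>
   (('a, 'm) tvec \<Rightarrow> ('b, 'n) tvec) \<Rightarrow> (('a, 'm) tvec \<Rightarrow> ('b, 'n) tvec) \<Rightarrow> real" where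
  "hs_inner M N \<psi> p \<theta> \<eta> =
     (\<Sum>i\<in>UNIV. metric N (\<psi> p) (\<theta> (frame_at M p i)) (\<eta> (frame_at M p i)))"

definition hs_norm ::
  "('a, 'm::finite) riemannian \<Rightarrow> ('b, 'n::finite) riemannian \<Rightarrow> ('a \<Rightarrow> 'b) \<Rightarrow> 'a \<Rightarrow>
   (('a, 'm) tvec \<Rightarrow> ('b, 'n) tvec) \<Rightarrow> real" where
  "hs_norm M N \<psi> p \<theta> = sqrt (hs_inner M N \<psi> p \<theta> \<theta>)"


section \<open>The \<open>\<alpha>\<close>-energy, \<open>\<alpha>\<close>-harmonic maps and the Jacobi operator\<close>

definition alpha_energy ::
  "real \<Rightarrow> ('a::{t2_space,second_countable_topology}, 'm::finite) riemannian \<Rightarrow>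
   ('b, 'n::finite) riemannian \<Rightarrow> ('a \<Rightarrow> 'b) \<Rightarrow> real" where
  "alpha_energy \<alpha> M N \<psi> =
     (\<integral>p. (1 + (hs_norm M N \<psi> p (differential M N \<psi> p))\<^sup>2) powr \<alpha> \<partial>riemannian_volume M)"

definition alpha_harmonic ::
  "real \<Rightarrow> ('a::{t2_space,second_countable_topology}, 'm::finite) riemannian \<Rightarrow>
   ('b::{t2_space,second_countable_topology}, 'n::finite) riemannian \<Rightarrow> ('a \<Rightarrow> 'b) \<Rightarrow> bool" where
  "alpha_harmonic \<alpha> M N \<psi> \<longleftrightarrow> smooth_map M N \<psi> \<and>
     (\<forall>\<epsilon>>0. \<forall>\<Psi>. smooth_family M N {-\<epsilon><..<\<epsilon>} \<Psi> \<and> \<Psi> 0 = \<psi> \<longrightarrow>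
        ((\<lambda>t. alpha_energy \<alpha> M N (\<Psi> t)) has_real_derivative 0) (at 0))"

definition alpha_jacobi ::
  "real \<Rightarrow> ('a, 'm::finite) riemannian \<Rightarrow> ('b, 'n::finite) riemannian \<Rightarrow> ('a \<Rightarrow> 'b) \<Rightarrow>
   ('a \<Rightarrow> ('b, 'n) tvec) \<Rightarrow> 'a \<Rightarrow> ('b, 'n) tvec" where
  "alpha_jacobi \<alpha> M N \<psi> \<upsilon> p =
    (let d\<psi> = differential M N \<psi>;
         \<rho> = (\<lambda>q. 1 + (hs_norm M N \<psi> q (d\<psi> q))\<^sup>2);
         D\<upsilon> = cov_along M N \<psi> \<upsilon>
     in (\<lambda>d.
          (2 * \<alpha> * \<rho> p powr (\<alpha> - 1)) *\<^sub>R trace_curvature M N \<psi> \<upsilon> p d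
        + (4 * \<alpha> * (\<alpha> - 1)) *\<^sub>R
            trace_cov M N \<psi> (\<lambda>q v d.
              (hs_inner M N \<psi> q (D\<upsilon> q) (d\<psi> q) * \<rho> q powr (\<alpha> - 2)) *\<^sub>R d\<psi> q v d) p d
        + (2 * \<alpha>) *\<^sub>R
            trace_cov M N \<psi> (\<lambda>q v d. (\<rho> q powr (\<alpha> - 1)) *\<^sub>R D\<upsilon> q v d) p d))"

end

theory Submission
  imports Defs
begin

text \<open>The density \<open>1 + |d\<psi>|\<^sup>2\<close> of a smooth family of maps is differentiated twice at a point, in charts and with
  a frame that does not depend on the parameters.  Moving the covariant derivative in a parameter
  past the one along \<open>M\<close> produces the curvature, and there remains a term with the covariant derivative of the
  second-order variation field.  That term integrates to \<open>0\<close>: by a partition of unity the field is a sum of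
  fields supported in charts, each of which is the velocity of a variation \<open>param d (coord d \<psi> + t \<sigma>)\<close>,
  so that \<open>\<alpha>\<close>-harmonicity applies.  The divergence theorem, proved in charts through another partition of
  unity, turns the other terms into \<open>- h(J\<^sub>\<alpha>(\<upsilon>), \<omega>)\<close>.\<close>

section \<open>Smooth calculus\<close>

text \<open>In charts a family of maps becomes one map on the product of the parameter space with a
  coordinate space, and \<open>nab\<close> differentiates fields along such a map in any direction
  of the product. Moving a parameter derivative past one along M is then the commutation rule for
  two constant directions, without a bracket term. The squared norm at p needs an orthonormal basis
  at p only, so the connection of M enters through the divergences and not through the variation
  formula. Frames are arbitrary pointwise choices without any smoothness in p; every regularity
  claim therefore first replaces the frame by the inverse Gram matrix. \<alpha>-harmonicity speaks
  of actual variations, while the second-order field is just some section along \<psi>. Realising it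
  as a velocity would usually call for an exponential map; pieces that live in single charts of N
  make straight lines in coordinates enough. The volume is a definite description, so its existence
  and uniqueness have to be proved before its values in charts are known.\<close>

lemma has_derivative_cong_open:
  assumes "open S" "x \<in> S" "\<And>y. y \<in> S \<Longrightarrow> f y = g y"
  shows "(f has_derivative D) (at x) \<longleftrightarrow> (g has_derivative D) (at x)"
  using has_derivative_transform_within_open[OF _ assms(1,2)] assms(3) by metis

lemma frechet_derivative_cong_open:
  assumes "open S" "x \<in> S" "\<And>y. y \<in> S \<Longrightarrow> f y = g y"
  shows "frechet_derivative f (at x) = frechet_derivative g (at x)"
  unfolding frechet_derivative_def using has_derivative_cong_open[OF assms] by simp

lemma differentiable_cong_open:
  assumes "open S" "x \<in> S" "\<And>y. y \<in> S \<Longrightarrow> f y = g y"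
  shows "f differentiable (at x) \<longleftrightarrow> g differentiable (at x)"
  unfolding differentiable_def using has_derivative_cong_open[OF assms] by simp

lemma frechet_derivative_eqI:
  "(f has_derivative D) (at x) \<Longrightarrow> frechet_derivative f (at x) = D"
  by (metis frechet_derivative_at)

lemma has_derivative_frechet:
  "f differentiable (at x) \<Longrightarrow> (f has_derivative frechet_derivative f (at x)) (at x)"
  by (simp add: frechet_derivative_works)

lemma C_on_cong:
  assumes "open S" "\<And>x. x \<in> S \<Longrightarrow> f x = g x"
  shows "C_on k S f \<longleftrightarrow> C_on k S g"
  using assms(2)
proof (induction k arbitrary: f g)
  case 0
  then show ?case by (auto intro: continuous_on_cong[THEN iffD1])
next
  case (Suc k)
  have "C_on k S (\<lambda>x. frechet_derivative f (at x) v) \<longleftrightarrow> C_on k S (\<lambda>x. frechet_derivative g (at x) v)" for v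
    by (rule Suc.IH, rule fun_cong[where x=v], rule frechet_derivative_cong_open[OF assms(1)],
        assumption, erule Suc.prems)
  moreover have "\<And>x. x \<in> S \<Longrightarrow> f differentiable (at x) \<longleftrightarrow> g differentiable (at x)"
    by (rule differentiable_cong_open[OF assms(1)], assumption, erule Suc.prems)
  ultimately show ?case by simp
qed

lemma C_on_SucI:
  assumes "open S" "\<And>x. x \<in> S \<Longrightarrow> (f has_derivative D x) (at x)" "\<And>v. C_on k S (\<lambda>x. D x v)"
  shows "C_on (Suc k) S f"
proof -
  have "C_on k S (\<lambda>x. frechet_derivative f (at x) v) \<longleftrightarrow> C_on k S (\<lambda>x. D x v)" for v
    by (rule C_on_cong[OF assms(1)], rule fun_cong[where x=v], rule frechet_derivative_eqI)
      (rule assms(2))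
  then have "C_on k S (\<lambda>x. frechet_derivative f (at x) v)" for v
    using assms(3) by simp
  then show ?thesis using assms(2) by (auto simp: differentiable_def)
qed

lemma C_on_Suc_imp: "C_on (Suc k) S f \<Longrightarrow> C_on k S f"
proof (induction k arbitrary: f)
  case 0
  then show ?case
    by (simp add: continuous_at_imp_continuous_on differentiable_imp_continuous_within)
next
  case (Suc k)
  then show ?case by (metis C_on.simps(2))
qed

lemma C_on_subset: "C_on k S f \<Longrightarrow> T \<subseteq> S \<Longrightarrow> C_on k T f"
  by (induction k arbitrary: f) (auto intro: continuous_on_subset)

lemma C_on_Union:
  assumes "\<And>T. T \<in> \<T> \<Longrightarrow> open T" "\<And>T. T \<in> \<T> \<Longrightarrow> C_on k T f"
  shows "C_on k (\<Union>\<T>) f"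
  using assms
  by (induction k arbitrary: f) (auto intro: continuous_on_open_Union)

lemma C_on_const [simp]: "open S \<Longrightarrow> C_on k S (\<lambda>x. c)"
proof (induction k arbitrary: c)
  case (Suc k)
  show ?case by (rule C_on_SucI[where D="\<lambda>x v. 0"]) (use Suc in auto)
qed simp

lemma C_on_bounded_linear:
  assumes L: "bounded_linear L" and "open S" "C_on k S f"
  shows "C_on k S (\<lambda>x. L (f x))"
  using assms(3)
proof (induction k arbitrary: f)
  case 0
  then show ?case by (auto intro: bounded_linear.continuous_on[OF L])
next
  case (Suc k)
  show ?case
    by (rule C_on_SucI[where D="\<lambda>x v. L (frechet_derivative f (at x) v)", OF assms(2)])
      (use Suc in \<open>auto intro!: bounded_linear.has_derivative[OF L] has_derivative_frechet\<close>)
qed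

lemma C_on_id [simp]: "open S \<Longrightarrow> C_on k S (\<lambda>x. x)"
proof (induction k)
  case (Suc k)
  show ?case by (rule C_on_SucI[where D="\<lambda>x v. v"]) (use Suc in auto)
qed simp

lemma C_on_add:
  assumes "open S" "C_on k S f" "C_on k S g"
  shows "C_on k S (\<lambda>x. f x + g x)"
  using assms(2,3)
proof (induction k arbitrary: f g)
  case 0
  then show ?case by (auto intro: continuous_intros)
next
  case (Suc k)
  show ?case
    by (rule C_on_SucI[where D="\<lambda>x v. frechet_derivative f (at x) v + frechet_derivative g (at x) v", OF assms(1)])
      (use Suc in \<open>auto intro!: has_derivative_add has_derivative_frechet\<close>)
qed

lemma C_on_bilinear:
  assumes B: "bounded_bilinear B" and "open S" "C_on k S f" "C_on k S g"
  shows "C_on k S (\<lambda>x. B (f x) (g x))"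
  using assms(3,4)
proof (induction k arbitrary: f g)
  case 0
  then show ?case by (auto intro: bounded_bilinear.continuous_on[OF B])
next
  case (Suc k)
  note fg = C_on_Suc_imp[OF Suc.prems(1)] C_on_Suc_imp[OF Suc.prems(2)]
  show ?case
  proof (rule C_on_SucI[where D="\<lambda>x v. B (f x) (frechet_derivative g (at x) v)
      + B (frechet_derivative f (at x) v) (g x)", OF assms(2)])
    show "((\<lambda>x. B (f x) (g x)) has_derivative (\<lambda>v. B (f x) (frechet_derivative g (at x) v)
      + B (frechet_derivative f (at x) v) (g x))) (at x)" if "x \<in> S" for x
      using Suc.prems that by (intro bounded_bilinear.FDERIV[OF B] has_derivative_frechet) auto
    show "C_on k S (\<lambda>x. B (f x) (frechet_derivative g (at x) v)
      + B (frechet_derivative f (at x) v) (g x))" for v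
      using Suc.prems fg by (intro C_on_add assms(2) Suc.IH) auto
  qed
qed

lemma C_on_sum:
  assumes "open S" "\<And>i. i \<in> I \<Longrightarrow> C_on k S (f i)"
  shows "C_on k S (\<lambda>x. \<Sum>i\<in>I. f i x)"
  using assms(2) by (induction I rule: infinite_finite_induct) (auto intro: C_on_add C_on_const assms(1))

lemma frechet_derivative_basis:
  fixes f :: "'v::euclidean_space \<Rightarrow> 'w::real_normed_vector"
  assumes "f differentiable (at x)"
  shows "frechet_derivative f (at x) v = (\<Sum>b\<in>Basis. (v \<bullet> b) *\<^sub>R frechet_derivative f (at x) b)"
proof -
  have "linear (frechet_derivative f (at x))" using assms by (rule linear_frechet_derivative)
  then show ?thesis
    by (subst euclidean_representation[of v, symmetric]) (simp only: linear_sum linear_scale)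
qed

lemma C_on_compose:
  fixes f :: "'u::real_normed_vector \<Rightarrow> 'v::euclidean_space"
  assumes "open S" "open T" "C_on k T g" "C_on k S f" "\<And>x. x \<in> S \<Longrightarrow> f x \<in> T"
  shows "C_on k S (\<lambda>x. g (f x))"
  using assms(3,4)
proof (induction k arbitrary: g)
  case 0
  then show ?case by (auto intro: continuous_on_compose2 assms(5))
next
  case (Suc k)
  let ?D = "\<lambda>x v. frechet_derivative g (at (f x)) (frechet_derivative f (at x) v)"
  show ?case
  proof (rule C_on_SucI[where D="?D", OF assms(1)])
    fix x assume x: "x \<in> S"
    have "(f has_derivative frechet_derivative f (at x)) (at x)"
      using Suc x by (auto intro: has_derivative_frechet)
    moreover have "(g has_derivative frechet_derivative g (at (f x))) (at (f x))"
      using Suc x assms(5) by (auto intro: has_derivative_frechet)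
    ultimately show "((\<lambda>x. g (f x)) has_derivative (\<lambda>v. ?D x v)) (at x)"
      by (rule has_derivative_compose)
  next
    fix v
    have f: "C_on k S f" by (rule C_on_Suc_imp[OF Suc.prems(2)])
    \<comment> \<open>Regularity of a derivative is available for fixed directions only, but here
      the direction \<open>frechet_derivative f (at x) v\<close> moves with x; expanding it in the
      basis leaves fixed directions with scalar coefficients.\<close>
    have "C_on k S (\<lambda>x. \<Sum>b\<in>Basis. (frechet_derivative f (at x) v \<bullet> b) *\<^sub>R frechet_derivative g (at (f x)) b)"
      using Suc.prems f
      by (intro C_on_sum C_on_bilinear[OF bounded_bilinear_scaleR] Suc.IH assms(1)
            C_on_bounded_linear[OF bounded_linear_inner_left]) auto
    then show "C_on k S (\<lambda>x. ?D x v)"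
      by (subst C_on_cong[OF assms(1)])
        (use Suc.prems assms(5) in \<open>auto intro!: frechet_derivative_basis\<close>)
  qed
qed

named_theorems smooth_intros

lemma smooth_on_cong:
  assumes "open S" "\<And>x. x \<in> S \<Longrightarrow> f x = g x"
  shows "smooth_on S f \<longleftrightarrow> smooth_on S g"
  unfolding smooth_on_def using C_on_cong[OF assms] by simp

lemma smooth_on_subset: "smooth_on S f \<Longrightarrow> T \<subseteq> S \<Longrightarrow> smooth_on T f"
  unfolding smooth_on_def using C_on_subset by blast

lemma smooth_on_locally:
  assumes "\<And>x. x \<in> S \<Longrightarrow> \<exists>T. open T \<and> x \<in> T \<and> smooth_on T f"
  shows "smooth_on S f"
proof -
  obtain T where T: "\<And>x. x \<in> S \<Longrightarrow> open (T x) \<and> x \<in> T x \<and> smooth_on (T x) f"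
    using assms by metis
  have "smooth_on (\<Union>(T ` S)) f"
    using T C_on_Union[of "T ` S"] unfolding smooth_on_def by blast
  then show ?thesis by (rule smooth_on_subset) (use T in auto)
qed

lemma smooth_on_imp_continuous: "smooth_on S f \<Longrightarrow> continuous_on S f"
  unfolding smooth_on_def using C_on.simps(1) by blast

lemma smooth_on_differentiable: "smooth_on S f \<Longrightarrow> x \<in> S \<Longrightarrow> f differentiable (at x)"
  unfolding smooth_on_def using C_on.simps(2)[of 0] by blast

lemma smooth_on_has_derivative:
  "smooth_on S f \<Longrightarrow> x \<in> S \<Longrightarrow> (f has_derivative frechet_derivative f (at x)) (at x)"
  by (intro has_derivative_frechet smooth_on_differentiable)

lemma smooth_on_const [smooth_intros]: "open S \<Longrightarrow> smooth_on S (\<lambda>x. c)"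
  by (simp add: smooth_on_def)

lemma smooth_on_id [smooth_intros]: "open S \<Longrightarrow> smooth_on S (\<lambda>x. x)"
  by (simp add: smooth_on_def)

lemma smooth_on_bounded_linear:
  "bounded_linear L \<Longrightarrow> open S \<Longrightarrow> smooth_on S f \<Longrightarrow> smooth_on S (\<lambda>x. L (f x))"
  by (simp add: smooth_on_def C_on_bounded_linear)

lemma smooth_on_bilinear:
  "bounded_bilinear B \<Longrightarrow> open S \<Longrightarrow> smooth_on S f \<Longrightarrow> smooth_on S g \<Longrightarrow> smooth_on S (\<lambda>x. B (f x) (g x))"
  by (simp add: smooth_on_def C_on_bilinear)

lemma smooth_on_add [smooth_intros]:
  "open S \<Longrightarrow> smooth_on S f \<Longrightarrow> smooth_on S g \<Longrightarrow> smooth_on S (\<lambda>x. f x + g x)"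
  by (simp add: smooth_on_def C_on_add)

lemma smooth_on_sum [smooth_intros]:
  "open S \<Longrightarrow> (\<And>i. i \<in> I \<Longrightarrow> smooth_on S (f i)) \<Longrightarrow> smooth_on S (\<lambda>x. \<Sum>i\<in>I. f i x)"
  by (simp add: smooth_on_def C_on_sum)

lemmas smooth_on_scaleR [smooth_intros] = smooth_on_bilinear[OF bounded_bilinear_scaleR]
lemmas smooth_on_inner [smooth_intros] = smooth_on_bilinear[OF bounded_bilinear_inner]
lemmas smooth_on_mult [smooth_intros] =
  smooth_on_bilinear[OF bounded_bilinear_mult[where 'a="'x::real_normed_algebra"]]
lemmas smooth_on_minus [smooth_intros] = smooth_on_bounded_linear[OF bounded_linear_minus[OF bounded_linear_ident]]
lemmas smooth_on_vec_nth [smooth_intros] = smooth_on_bounded_linear[OF bounded_linear_vec_nth]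

lemma smooth_on_diff [smooth_intros]:
  "open S \<Longrightarrow> smooth_on S f \<Longrightarrow> smooth_on S g \<Longrightarrow> smooth_on S (\<lambda>x. f x - g x)"
  using smooth_on_add[of S f "\<lambda>x. - g x"] smooth_on_minus[of S g] by simp

lemma smooth_on_prod [smooth_intros]:
  fixes f :: "'i \<Rightarrow> 'v::real_normed_vector \<Rightarrow> real"
  shows "open S \<Longrightarrow> (\<And>i. i \<in> I \<Longrightarrow> smooth_on S (f i)) \<Longrightarrow> smooth_on S (\<lambda>x. \<Prod>i\<in>I. f i x)"
  by (induction I rule: infinite_finite_induct) (auto intro!: smooth_intros)

lemma smooth_on_Pair [smooth_intros]:
  fixes f :: "'v::real_normed_vector \<Rightarrow> 'w::real_normed_vector" and g :: "'v \<Rightarrow> 'u::real_normed_vector"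
  assumes "open S" "smooth_on S f" "smooth_on S g"
  shows "smooth_on S (\<lambda>x. (f x, g x))"
proof -
  have "bounded_linear (\<lambda>u::'w. (u, 0::'u))" "bounded_linear (\<lambda>u::'u. (0::'w, u))"
    by (intro bounded_linear_Pair bounded_linear_ident bounded_linear_zero)+
  from smooth_on_bounded_linear[OF this(1) assms(1,2)] smooth_on_bounded_linear[OF this(2) assms(1,3)]
  have "smooth_on S (\<lambda>x. (f x, 0) + (0, g x))" by (rule smooth_on_add[OF assms(1)])
  then show ?thesis by simp
qed

lemmas smooth_on_fst [smooth_intros] = smooth_on_bounded_linear[OF bounded_linear_fst]
lemmas smooth_on_snd [smooth_intros] = smooth_on_bounded_linear[OF bounded_linear_snd]

lemma smooth_on_compose:
  fixes f :: "'u::real_normed_vector \<Rightarrow> 'v::euclidean_space"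
  assumes "open S" "open T" "smooth_on T g" "smooth_on S f" "\<And>x. x \<in> S \<Longrightarrow> f x \<in> T"
  shows "smooth_on S (\<lambda>x. g (f x))"
  using assms C_on_compose unfolding smooth_on_def by blast

lemma smooth_on_frechet_derivative [smooth_intros]:
  "smooth_on S f \<Longrightarrow> smooth_on S (\<lambda>x. frechet_derivative f (at x) v)"
  unfolding smooth_on_def using C_on.simps(2) by blast

lemma smooth_on_vec_lambda [smooth_intros]:
  fixes f :: "'i::finite \<Rightarrow> 'v::real_normed_vector \<Rightarrow> real"
  assumes "open S" "\<And>i. smooth_on S (f i)"
  shows "smooth_on S (\<lambda>x. \<chi> i. f i x)"
proof -
  have "(\<chi> i. f i x) = (\<Sum>i\<in>UNIV. f i x *\<^sub>R axis i 1)" for x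
    by (simp add: vec_eq_iff axis_def if_distrib cong: if_cong)
  moreover have "smooth_on S (\<lambda>x. \<Sum>i\<in>UNIV. f i x *\<^sub>R (axis i 1 :: real^'i))"
    by (intro smooth_intros assms)
  ultimately show ?thesis by simp
qed

lemma smooth_on_det [smooth_intros]:
  fixes f :: "'i::finite \<Rightarrow> 'i \<Rightarrow> 'v::real_normed_vector \<Rightarrow> real"
  assumes "open S" "\<And>i j. smooth_on S (\<lambda>x. A x $ i $ j)"
  shows "smooth_on S (\<lambda>x. det (A x :: real^'i^'i))"
  unfolding det_def by (intro smooth_intros assms)

text \<open>The derivative of one member of the family may involve other members (another exponent,
  another polynomial), so the induction on the order of differentiability runs over the whole family
  at once.\<close>

lemma smooth_on_DERIV_family:
  fixes f :: "'i \<Rightarrow> real \<Rightarrow> real"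
  assumes "open S" "\<And>i x. i \<in> I \<Longrightarrow> x \<in> S \<Longrightarrow> (f i has_real_derivative g i x) (at x)"
    and "\<And>i k. i \<in> I \<Longrightarrow> (\<And>j. j \<in> I \<Longrightarrow> C_on k S (f j)) \<Longrightarrow> C_on k S (g i)" and "i \<in> I"
  shows "smooth_on S (f i)"
proof -
  have "\<forall>i\<in>I. C_on k S (f i)" for k
  proof (induction k)
    case 0
    show ?case
      using assms(2) by (auto intro!: continuous_at_imp_continuous_on DERIV_isCont)
  next
    case (Suc k)
    show ?case
    proof
      fix i assume i: "i \<in> I"
      have "C_on k S (g i)" using Suc assms(3)[OF i] by blast
      then have "C_on k S (\<lambda>x. g i x * v)" for v
        using C_on_bilinear[OF bounded_bilinear_mult[where 'a=real], of S k "g i" "\<lambda>x. v"] assms(1) by simp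
      then show "C_on (Suc k) S (f i)"
        using assms(2)[OF i] unfolding has_field_derivative_def
        by (intro C_on_SucI[OF assms(1), where D="\<lambda>x v. g i x * v"]) auto
    qed
  qed
  then show ?thesis using assms(4) unfolding smooth_on_def by blast
qed

lemma smooth_on_powr_real: "smooth_on {0<..} (\<lambda>x::real. x powr a)"
proof (rule smooth_on_DERIV_family[where I=UNIV and i=a and f="\<lambda>a x. x powr a"])
  show "((\<lambda>x. x powr i) has_real_derivative i * x powr (i - 1)) (at x)" if "x \<in> {0<..}" for i x :: real
    using that by (auto intro!: derivative_eq_intros)
  show "C_on k {0<..} (\<lambda>x. i * x powr (i - 1))" if "\<And>j. j \<in> UNIV \<Longrightarrow> C_on k {0<..} (\<lambda>x::real. x powr j)" for i :: real and k
    using C_on_bilinear[OF bounded_bilinear_mult[where 'a=real], of "{0<..}" k "\<lambda>x. i" "\<lambda>x. x powr (i-1)"] that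
    by simp
qed auto

lemma smooth_on_powr [smooth_intros]:
  assumes "open S" "smooth_on S f" "\<And>x. x \<in> S \<Longrightarrow> f x > (0::real)"
  shows "smooth_on S (\<lambda>x. f x powr a)"
  by (rule smooth_on_compose[OF assms(1) _ smooth_on_powr_real assms(2)]) (use assms in auto)

lemma smooth_on_inverse [smooth_intros]:
  assumes "open S" "smooth_on S f" "\<And>x. x \<in> S \<Longrightarrow> f x \<noteq> (0::real)"
  shows "smooth_on S (\<lambda>x. inverse (f x))"
proof -
  \<comment> \<open>Powers are smooth on the positive reals only; squaring removes the sign of f,
    and the extra factor f restores it.\<close>
  have "smooth_on S (\<lambda>x. f x * (f x * f x) powr (-1))"
    by (intro smooth_intros assms) (use assms(3) in \<open>auto simp: zero_less_mult_iff linorder_neq_iff\<close>)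
  moreover have "f x * (f x * f x) powr (-1) = inverse (f x)" if "x \<in> S" for x
    using assms(3)[OF that] by (simp add: powr_minus field_simps)
  ultimately show ?thesis by (subst smooth_on_cong[OF assms(1)]) auto
qed

lemma smooth_on_divide [smooth_intros]:
  assumes "open S" "smooth_on S f" "smooth_on S g" "\<And>x. x \<in> S \<Longrightarrow> g x \<noteq> (0::real)"
  shows "smooth_on S (\<lambda>x. f x / g x)"
  unfolding divide_inverse by (intro smooth_intros assms)

lemma smooth_on_sqrt [smooth_intros]:
  assumes "open S" "smooth_on S f" "\<And>x. x \<in> S \<Longrightarrow> f x > (0::real)"
  shows "smooth_on S (\<lambda>x. sqrt (f x))"
proof -
  have "smooth_on S (\<lambda>x. f x powr (1/2))" by (intro smooth_intros assms)
  moreover have "f x powr (1/2) = sqrt (f x)" if "x \<in> S" for x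
    using assms(3)[OF that] by (simp add: powr_half_sqrt)
  ultimately show ?thesis by (subst smooth_on_cong[OF assms(1)]) auto
qed

section \<open>Symmetry of mixed second derivatives\<close>

lemma frechet_derivative_inner:
  assumes "f differentiable (at x)"
  shows "frechet_derivative (\<lambda>x. f x \<bullet> b) (at x) v = frechet_derivative f (at x) v \<bullet> b"
  by (rule fun_cong[where x=v], rule frechet_derivative_eqI)
    (intro bounded_linear.has_derivative[OF bounded_linear_inner_left] has_derivative_frechet assms)

lemma has_derivative_line:
  assumes "f differentiable (at (a + t *\<^sub>R v))"
  shows "((\<lambda>t. f (a + t *\<^sub>R v) :: real) has_real_derivative frechet_derivative f (at (a + t *\<^sub>R v)) v) (at t)"
proof -
  let ?D = "frechet_derivative f (at (a + t *\<^sub>R v))"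
  have "((\<lambda>t. a + t *\<^sub>R v) has_derivative (\<lambda>s. s *\<^sub>R v)) (at t)"
    by (auto intro!: derivative_eq_intros)
  from has_derivative_compose[OF this has_derivative_frechet[OF assms]]
  have "((\<lambda>t. f (a + t *\<^sub>R v)) has_derivative (\<lambda>s. ?D (s *\<^sub>R v))) (at t)" by simp
  moreover have "?D (s *\<^sub>R v) = ?D v * s" for s
    using linear_frechet_derivative[OF assms] by (simp add: linear_scale)
  ultimately show ?thesis by (simp add: has_field_derivative_def)
qed

text \<open>The second difference of \<open>f\<close> over a small parallelogram equals, by the mean value theorem
  applied in either order, a value of either mixed derivative near \<open>x\<close>.\<close>

lemma second_difference_mean_value:
  fixes f :: "'v::real_normed_vector \<Rightarrow> real"
  assumes h: "h > 0" and f: "\<And>s t. 0 \<le> s \<Longrightarrow> s \<le> h \<Longrightarrow> 0 \<le> t \<Longrightarrow> t \<le> h \<Longrightarrow> f differentiable (at (x + s *\<^sub>R u + t *\<^sub>R v))"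
    and f': "\<And>s t. 0 \<le> s \<Longrightarrow> s \<le> h \<Longrightarrow> 0 \<le> t \<Longrightarrow> t \<le> h \<Longrightarrow>
      (\<lambda>y. frechet_derivative f (at y) u) differentiable (at (x + s *\<^sub>R u + t *\<^sub>R v))"
  obtains s t where "0 \<le> s" "s \<le> h" "0 \<le> t" "t \<le> h"
    "f (x + h *\<^sub>R u + h *\<^sub>R v) - f (x + h *\<^sub>R v) - f (x + h *\<^sub>R u) + f x =
      h * h * frechet_derivative (\<lambda>y. frechet_derivative f (at y) u) (at (x + s *\<^sub>R u + t *\<^sub>R v)) v"
proof -
  let ?g = "\<lambda>s. f (x + s *\<^sub>R u + h *\<^sub>R v) - f (x + s *\<^sub>R u)"
  let ?g' = "\<lambda>s. frechet_derivative f (at (x + s *\<^sub>R u + h *\<^sub>R v)) u - frechet_derivative f (at (x + s *\<^sub>R u)) u"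
  have "(?g has_real_derivative ?g' s) (at s)" if "0 \<le> s" "s \<le> h" for s
    using has_derivative_line[of f "x + h *\<^sub>R v" s u] has_derivative_line[of f x s u]
      f[OF that, of h] f[OF that, of 0] h
    by (auto intro!: DERIV_diff simp: algebra_simps)
  from MVT2[OF h this] obtain s where s: "0 < s" "s < h" and 1: "?g h - ?g 0 = h * ?g' s"
    by auto
  let ?k = "\<lambda>t. frechet_derivative f (at (x + s *\<^sub>R u + t *\<^sub>R v)) u"
  let ?k' = "\<lambda>t. frechet_derivative (\<lambda>y. frechet_derivative f (at y) u) (at (x + s *\<^sub>R u + t *\<^sub>R v)) v"
  have "(?k has_real_derivative ?k' t) (at t)" if "0 \<le> t" "t \<le> h" for t
    by (rule has_derivative_line) (use f' s that in auto)
  from MVT2[OF h this] obtain t where t: "0 < t" "t < h" and 2: "?k h - ?k 0 = h * ?k' t"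
    by auto
  show thesis
    by (rule that[of s t]) (use s t 1 2 in \<open>auto simp: algebra_simps\<close>)
qed

text \<open>Both mixed derivatives are continuous, and one and the same second difference is a value
  of either of them near x; so their values at x differ by at most e for every positive e.
  Vector-valued functions are reduced to their real components.\<close>

lemma frechet_derivative_commute:
  fixes f :: "'v::real_normed_vector \<Rightarrow> 'w::euclidean_space"
  assumes S: "open S" "x \<in> S" and f: "smooth_on S f"
  shows "frechet_derivative (\<lambda>y. frechet_derivative f (at y) u) (at x) v =
    frechet_derivative (\<lambda>y. frechet_derivative f (at y) v) (at x) u"
proof -
  have *: "frechet_derivative (\<lambda>y. frechet_derivative f (at y) u) (at x) v =
    frechet_derivative (\<lambda>y. frechet_derivative f (at y) v) (at x) u"
    if f: "smooth_on S f" for f :: "'v \<Rightarrow> real"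
  proof -
    define A where "A y = frechet_derivative (\<lambda>y. frechet_derivative f (at y) u) (at y) v" for y
    define B where "B y = frechet_derivative (\<lambda>y. frechet_derivative f (at y) v) (at y) u" for y
    have cont: "isCont A x" "isCont B x"
      unfolding A_def B_def using S f
      by (metis continuous_on_eq_continuous_at smooth_on_imp_continuous smooth_on_frechet_derivative)+
    have "\<bar>A x - B x\<bar> \<le> e" if "e > 0" for e
    proof -
      obtain d1 where d1: "d1 > 0" "\<And>y. dist y x < d1 \<Longrightarrow> dist (A y) (A x) < e/2"
        using cont(1) \<open>e > 0\<close> unfolding continuous_at_eps_delta by (metis half_gt_zero)
      obtain d2 where d2: "d2 > 0" "\<And>y. dist y x < d2 \<Longrightarrow> dist (B y) (B x) < e/2"
        using cont(2) \<open>e > 0\<close> unfolding continuous_at_eps_delta by (metis half_gt_zero)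
      obtain d3 where d3: "d3 > 0" "ball x d3 \<subseteq> S" using S openE by blast
      define d where "d = min d1 (min d2 d3)"
      \<comment> \<open>The 1 keeps the denominator positive also when u and v vanish; halving
        leaves room for a strict bound by d.\<close>
      define h where "h = d / (norm u + norm v + 1) / 2"
      have d: "d > 0" using d1 d2 d3 by (simp add: d_def)
      have n: "norm u + norm v + 1 > 0" by (smt (verit) norm_ge_zero)
      have h: "h > 0" using d n by (simp add: h_def)
      have hd: "h * (norm u + norm v) < d"
      proof -
        have "h * (norm u + norm v) \<le> h * (norm u + norm v + 1)" using h by simp
        also have "\<dots> = d / 2"
          unfolding h_def using less_imp_neq[OF n] by (metis nonzero_eq_divide_eq times_divide_eq_left)
        finally show ?thesis using d by linarith
      qed
      have near: "dist (x + s *\<^sub>R u + t *\<^sub>R v) x < d" "dist (x + t *\<^sub>R v + s *\<^sub>R u) x < d"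
        if "0 \<le> s" "s \<le> h" "0 \<le> t" "t \<le> h" for s t
      proof -
        have "norm (s *\<^sub>R u + t *\<^sub>R v) \<le> s * norm u + t * norm v"
          using that norm_triangle_ineq[of "s *\<^sub>R u" "t *\<^sub>R v"] by simp
        also have "\<dots> \<le> h * norm u + h * norm v"
          using that by (intro add_mono mult_right_mono) auto
        finally have "norm (s *\<^sub>R u + t *\<^sub>R v) < d" using hd by (simp add: algebra_simps)
        then show "dist (x + s *\<^sub>R u + t *\<^sub>R v) x < d" "dist (x + t *\<^sub>R v + s *\<^sub>R u) x < d"
          by (simp_all add: dist_norm algebra_simps)
      qed
      have inS: "y \<in> S" if "dist y x < d" for y
        using that d3 by (auto simp: d_def dist_commute)
      have diff: "f differentiable (at y)" "(\<lambda>z. frechet_derivative f (at z) w) differentiable (at y)"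
        if "dist y x < d" for y w
        using inS[OF that] f by (auto intro: smooth_on_differentiable smooth_on_frechet_derivative)
      obtain s t where st: "0 \<le> s" "s \<le> h" "0 \<le> t" "t \<le> h"
        "f (x + h *\<^sub>R u + h *\<^sub>R v) - f (x + h *\<^sub>R v) - f (x + h *\<^sub>R u) + f x =
          h * h * A (x + s *\<^sub>R u + t *\<^sub>R v)"
        by (rule second_difference_mean_value[of h f x u v, folded A_def])
          (rule h diff near | assumption)+
      obtain s' t' where st': "0 \<le> s'" "s' \<le> h" "0 \<le> t'" "t' \<le> h"
        "f (x + h *\<^sub>R v + h *\<^sub>R u) - f (x + h *\<^sub>R u) - f (x + h *\<^sub>R v) + f x =
          h * h * B (x + s' *\<^sub>R v + t' *\<^sub>R u)"
        by (rule second_difference_mean_value[of h f x v u, folded B_def])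
          (rule h diff near | assumption)+
      \<comment> \<open>The second differences for (u, v) and for (v, u) are the same
        number.\<close>
      have "h * h * A (x + s *\<^sub>R u + t *\<^sub>R v) = h * h * B (x + s' *\<^sub>R v + t' *\<^sub>R u)"
        using st(5) st'(5) by (simp add: algebra_simps)
      then have "A (x + s *\<^sub>R u + t *\<^sub>R v) = B (x + s' *\<^sub>R v + t' *\<^sub>R u)" using h by simp
      moreover have "dist (A (x + s *\<^sub>R u + t *\<^sub>R v)) (A x) < e/2"
        using d1(2) near(1)[OF st(1-4)] by (simp add: d_def)
      moreover have "dist (B (x + s' *\<^sub>R v + t' *\<^sub>R u)) (B x) < e/2"
        using d2(2) near(2)[OF st'(3,4,1,2)] by (simp add: d_def)
      ultimately show ?thesis unfolding dist_real_def by linarith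
    qed
    then have "\<bar>A x - B x\<bar> \<le> 0" by (rule field_le_epsilon) simp
    then show ?thesis by (simp add: A_def B_def)
  qed
  have D: "frechet_derivative (\<lambda>y. frechet_derivative f (at y) u) (at x) v \<bullet> b =
      frechet_derivative (\<lambda>y. frechet_derivative (\<lambda>z. f z \<bullet> b) (at y) u) (at x) v" for u v b
  proof -
    have "frechet_derivative (\<lambda>y. frechet_derivative f (at y) u) (at x) v \<bullet> b =
      frechet_derivative (\<lambda>y. frechet_derivative f (at y) u \<bullet> b) (at x) v"
      by (rule frechet_derivative_inner[symmetric])
        (use f S in \<open>auto intro!: smooth_on_differentiable smooth_on_frechet_derivative\<close>)
    also have "\<dots> = frechet_derivative (\<lambda>y. frechet_derivative (\<lambda>z. f z \<bullet> b) (at y) u) (at x) v"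
      by (rule fun_cong[where x=v], rule frechet_derivative_cong_open[OF S],
          rule frechet_derivative_inner[symmetric])
        (use f S in \<open>auto intro!: smooth_on_differentiable\<close>)
    finally show ?thesis .
  qed
  show ?thesis
  proof (rule euclidean_eqI)
    fix b :: 'w
    show "frechet_derivative (\<lambda>y. frechet_derivative f (at y) u) (at x) v \<bullet> b =
      frechet_derivative (\<lambda>y. frechet_derivative f (at y) v) (at x) u \<bullet> b"
      unfolding D by (rule *) (intro smooth_intros S f)
  qed
qed

section \<open>Bump functions\<close>

text \<open>The derivatives of \<open>exp (- 1 / x)\<close> are polynomials in \<open>1 / x\<close> times the function itself.\<close>

definition flat :: "real poly \<Rightarrow> real \<Rightarrow> real" where
  "flat q x = (if x > 0 then poly q (1 / x) * exp (- 1 / x) else 0)"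

lemma poly_exp_tendsto_0: "((\<lambda>y. poly q y * exp (- y)) \<longlongrightarrow> 0) at_top" for q :: "real poly"
proof -
  have "((\<lambda>y. coeff q i * (y ^ i / exp y)) \<longlongrightarrow> 0) at_top" for i
    using tendsto_mult[OF tendsto_const[of "coeff q i"] tendsto_power_div_exp_0[of i]] by simp
  then have "((\<lambda>y. \<Sum>i\<le>degree q. coeff q i * (y ^ i / exp y)) \<longlongrightarrow> (\<Sum>i\<le>degree q. 0)) at_top"
    by (intro tendsto_sum)
  then show ?thesis
    by (simp add: poly_altdef exp_minus sum_divide_distrib divide_inverse sum_distrib_right mult.assoc)
qed

lemma flat_tendsto_0: "(flat q \<longlongrightarrow> 0) (at 0)"
proof -
  have "((\<lambda>x. poly q (inverse x) * exp (- inverse x)) \<longlongrightarrow> 0) (at_right 0)"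
    by (rule filterlim_compose[OF poly_exp_tendsto_0 filterlim_inverse_at_top_right])
  then have "(flat q \<longlongrightarrow> 0) (at_right 0)"
    by (rule Lim_transform_eventually)
      (auto simp: flat_def eventually_at_right_field divide_inverse intro: exI[of _ 1])
  moreover have "(flat q \<longlongrightarrow> 0) (at_left 0)"
    by (rule Lim_transform_eventually[OF tendsto_const])
      (auto simp: flat_def eventually_at_left_field intro: exI[of _ "-1"])
  ultimately show ?thesis by (simp add: filterlim_split_at)
qed

text \<open>With y = 1/x, the derivative of q(y) exp(-y) in x is y^2 (q(y) - q'(y)) exp(-y), which
  is again a \<open>flat\<close> function, now for the polynomial
  \<open>[:0, 0, 1:] * (q - pderiv q)\<close>.\<close>

lemma flat_has_derivative:
  "(flat q has_real_derivative flat ([:0, 0, 1:] * (q - pderiv q)) x) (at x)"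
proof -
  consider "x > 0" | "x < 0" | "x = 0" by linarith
  then show ?thesis
  proof cases
    case 1
    have "((\<lambda>x. poly q (1 / x) * exp (- 1 / x)) has_real_derivative
        flat ([:0, 0, 1:] * (q - pderiv q)) x) (at x)"
      using 1 by (auto simp: flat_def power2_eq_square field_simps
          intro!: derivative_eq_intros DERIV_chain2[OF poly_DERIV])
    then show ?thesis
      by (rule has_field_derivative_transform_within_open[of _ _ _ "{0<..}"]) (use 1 in \<open>auto simp: flat_def\<close>)
  next
    case 2
    have "((\<lambda>x. 0) has_real_derivative flat ([:0, 0, 1:] * (q - pderiv q)) x) (at x)"
      using 2 by (simp add: flat_def)
    then show ?thesis
      by (rule has_field_derivative_transform_within_open[of _ _ _ "{..<0}"]) (use 2 in \<open>auto simp: flat_def\<close>)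
  next
    case 3
    \<comment> \<open>At 0 the difference quotient is itself a flat function, for the polynomial X
      q, and so tends to 0.\<close>
    have "flat q y / y = flat (pCons 0 q) y" for y
      by (simp add: flat_def)
    then have "((\<lambda>y. (flat q y - flat q 0) / (y - 0)) \<longlongrightarrow> 0) (at 0)"
      using flat_tendsto_0[of "pCons 0 q"] by (simp add: flat_def[of q 0])
    then show ?thesis using 3 by (simp add: has_field_derivative_iff flat_def[of _ 0])
  qed
qed

lemma smooth_on_flat: "smooth_on UNIV (flat q)"
  by (rule smooth_on_DERIV_family[where f=flat and I=UNIV]) (auto intro: flat_has_derivative)

text \<open>The squared radius minus the squared distance is polynomial in x, so smoothness needs no
  care at the centre; \<open>flat 1\<close> is exp(-1/t) for positive t and 0 otherwise.\<close>

definition bump :: "'v::euclidean_space \<Rightarrow> real \<Rightarrow> 'v \<Rightarrow> real" where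
  "bump a r x = flat 1 (r\<^sup>2 - (x - a) \<bullet> (x - a))"

lemma smooth_on_bump: "smooth_on UNIV (bump a r)"
  unfolding bump_def
  by (rule smooth_on_compose[OF _ _ smooth_on_flat]) (auto intro!: smooth_intros)

lemma bump_pos: "r > 0 \<Longrightarrow> bump a r x > 0 \<longleftrightarrow> dist a x < r"
  using real_sqrt_less_iff[of "(x - a) \<bullet> (x - a)" "r\<^sup>2"]
  by (auto simp: bump_def flat_def dist_norm norm_eq_sqrt_inner[symmetric] norm_minus_commute)

lemma bump_nonneg: "bump a r x \<ge> 0"
  by (simp add: bump_def flat_def)

section \<open>Matrices\<close>

lemma matrix_inv_mult:
  fixes A :: "real^'i^'i"
  assumes "invertible A"
  shows "A ** matrix_inv A = mat 1" "matrix_inv A ** A = mat 1"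
  using someI_ex[OF assms[unfolded invertible_def]] by (simp_all add: matrix_inv_def)

text \<open>Each column of the inverse solves a linear system, so Cramer's rule applies. As
  quotients of determinants the entries visibly depend smoothly on those of A.\<close>

lemma matrix_inv_cramer:
  fixes A :: "real^'i^'i"
  assumes "det A \<noteq> 0"
  shows "matrix_inv A $ k $ l = det (\<chi> i j. if j = k then axis l 1 $ i else A $ i $ j) / det A"
proof -
  have "A *v (matrix_inv A *v axis l 1) = axis l 1"
    using assms by (simp add: matrix_vector_mul_assoc matrix_inv_mult(1) invertible_det_nz)
  then have "matrix_inv A *v axis l 1 = (\<chi> k. det(\<chi> i j. if j=k then axis l 1 $i else A$i$j) / det A)"
    using cramer[OF assms] by blast
  then have "(matrix_inv A *v axis l 1) $ k = det (\<chi> i j. if j = k then axis l 1 $ i else A $ i $ j) / det A"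
    by simp
  then show ?thesis by (simp add: matrix_vector_mul_component axis_def inner_vec_def if_distrib cong: if_cong)
qed

lemma smooth_on_matrix_inv:
  fixes A :: "'v::real_normed_vector \<Rightarrow> real^'i^'i"
  assumes S: "open S" and A: "\<And>i j. smooth_on S (\<lambda>x. A x $ i $ j)" and "\<And>x. x \<in> S \<Longrightarrow> det (A x) \<noteq> 0"
  shows "smooth_on S (\<lambda>x. matrix_inv (A x) $ k $ l)"
proof -
  have "smooth_on S (\<lambda>x. (\<chi> i j. if j = k then axis l 1 $ i else A x $ i $ j) $ i' $ j')" for i' j'
    by (cases "j' = k") (auto intro: smooth_intros S A)
  then have "smooth_on S (\<lambda>x. det (\<chi> i j. if j = k then axis l 1 $ i else A x $ i $ j) / det (A x))"
    by (intro smooth_on_divide smooth_on_det assms)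
  then show ?thesis
    by (subst smooth_on_cong[OF S]) (use assms(3) in \<open>auto simp: matrix_inv_cramer\<close>)
qed

text \<open>Jacobi's formula. The product rule in the Leibniz expansion replaces one row of A at a
  time by the corresponding row of the derivative, and each determinant obtained in this way is a
  multiple of det A.\<close>

lemma has_derivative_det:
  fixes A :: "'v::real_normed_vector \<Rightarrow> real^'i^'i"
  assumes A: "\<And>i j. ((\<lambda>x. A x $ i $ j) has_derivative (\<lambda>v. A' v $ i $ j)) (at x)"
    and inv: "invertible (A x)"
  shows "((\<lambda>x. det (A x)) has_derivative
    (\<lambda>v. det (A x) * (\<Sum>i\<in>UNIV. \<Sum>k\<in>UNIV. A' v $ i $ k * matrix_inv (A x) $ k $ i))) (at x)"
proof -
  let ?B = "\<lambda>v i. \<chi> j. if j = i then A' v $ i else A x $ j"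
  have "((\<lambda>x. det (A x)) has_derivative (\<lambda>v. \<Sum>p\<in>{p. p permutes UNIV}. of_int (sign p) *
      (\<Sum>i\<in>UNIV. A' v $ i $ p i * (\<Prod>j\<in>UNIV - {i}. A x $ j $ p j)))) (at x)"
    unfolding det_def by (intro has_derivative_sum has_derivative_mult_right has_derivative_prod A)
  moreover have "(\<Sum>p\<in>{p. p permutes UNIV}. of_int (sign p) *
      (\<Sum>i\<in>UNIV. A' v $ i $ p i * (\<Prod>j\<in>UNIV - {i}. A x $ j $ p j))) =
    det (A x) * (\<Sum>i\<in>UNIV. \<Sum>k\<in>UNIV. A' v $ i $ k * matrix_inv (A x) $ k $ i)" (is "?L = _") for v
  proof -
    have "A' v $ i $ p i * (\<Prod>j\<in>UNIV - {i}. A x $ j $ p j) = (\<Prod>j\<in>UNIV. ?B v i $ j $ p j)" for i p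
      by (subst (2) prod.remove[of _ i]) (auto intro!: prod.cong)
    then have "?L = (\<Sum>p\<in>{p. p permutes UNIV}. \<Sum>i\<in>UNIV. of_int (sign p) * (\<Prod>j\<in>UNIV. ?B v i $ j $ p j))"
      by (simp add: sum_distrib_left)
    also have "\<dots> = (\<Sum>i\<in>UNIV. det (?B v i))"
      unfolding det_def by (rule sum.swap)
    also have "\<dots> = (\<Sum>i\<in>UNIV. (A' v ** matrix_inv (A x)) $ i $ i * det (A x))"
    proof (rule sum.cong[OF refl])
      fix i
      \<comment> \<open>This writes row i of the derivative as a combination of the rows of A; in
        the determinant only the coefficient of row i itself survives.\<close>
      have "A' v = (A' v ** matrix_inv (A x)) ** A x"
        by (simp add: matrix_mul_assoc[symmetric] matrix_inv_mult[OF inv])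
      then have "A' v $ i = ((A' v ** matrix_inv (A x)) ** A x) $ i" by simp
      also have "\<dots> = (\<Sum>k\<in>UNIV. (A' v ** matrix_inv (A x)) $ i $ k *s row k (A x))"
        by (simp add: matrix_matrix_mult_def vec_eq_iff row_def)
      finally have "?B v i = (\<chi> j. if j = i
          then \<Sum>k\<in>UNIV. (A' v ** matrix_inv (A x)) $ i $ k *s row k (A x) else row j (A x))"
        by (simp add: vec_eq_iff row_def)
      then show "det (?B v i) = (A' v ** matrix_inv (A x)) $ i $ i * det (A x)"
        by (simp only: cramer_lemma_transpose)
    qed
    also have "\<dots> = det (A x) * (\<Sum>i\<in>UNIV. \<Sum>k\<in>UNIV. A' v $ i $ k * matrix_inv (A x) $ k $ i)"
      by (simp add: matrix_matrix_mult_def sum_distrib_left sum_distrib_right mult.commute)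
    finally show ?thesis .
  qed
  ultimately show ?thesis by simp
qed

section \<open>Charts, tangent vectors and the metric in coordinates\<close>

definition overlap :: "('a, 'm::finite) chart \<Rightarrow> ('a, 'm) chart \<Rightarrow> (real ^ 'm) set" where
  "overlap c d = {x \<in> chart_img c. param c x \<in> chart_dom d}"

definition transition :: "('a, 'm::finite) chart \<Rightarrow> ('a, 'm) chart \<Rightarrow> real ^ 'm \<Rightarrow> real ^ 'm" where
  "transition c d = coord d \<circ> param c"

definition dtrans :: "('a, 'm::finite) chart \<Rightarrow> ('a, 'm) chart \<Rightarrow> real ^ 'm \<Rightarrow> real ^ 'm \<Rightarrow> real ^ 'm" where
  "dtrans c d x = frechet_derivative (transition c d) (at x)"

definition gform ::
  "('a, 'm::finite) riemannian \<Rightarrow> ('a, 'm) chart \<Rightarrow> real ^ 'm \<Rightarrow> real ^ 'm \<Rightarrow> real ^ 'm \<Rightarrow> real" where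
  "gform M c x u v = metric M (param c x) (coord_vec M c u (param c x)) (coord_vec M c v (param c x))"

lemma coord_vec_alt: "coord_vec M c w p = (\<lambda>d. if d \<in> charts_at M p then dtrans c d (coord c p) w else 0)"
  unfolding coord_vec_def dtrans_def transition_def ..

lemma gram_eq_gform: "gram M c x $ i $ j = gform M c x (axis i 1) (axis j 1)"
  by (simp add: gram_def gform_def)

lemma vec_basis_expansion: "(u::real^'n) = (\<Sum>i\<in>UNIV. u $ i *\<^sub>R axis i 1)"
  by (simp add: vec_eq_iff axis_def if_distrib cong: if_cong)

lemma christoffel_add_left: "christoffel M c x (u + v) w = christoffel M c x u w + christoffel M c x v w"
  by (simp add: christoffel_def vec_eq_iff sum.distrib algebra_simps)

lemma christoffel_add_right: "christoffel M c x w (u + v) = christoffel M c x w u + christoffel M c x w v"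
  by (simp add: christoffel_def vec_eq_iff sum.distrib algebra_simps)

lemma christoffel_scaleR_left: "christoffel M c x (r *\<^sub>R u) w = r *\<^sub>R christoffel M c x u w"
  by (simp add: christoffel_def vec_eq_iff sum_distrib_left algebra_simps)

lemma christoffel_scaleR_right: "christoffel M c x w (r *\<^sub>R u) = r *\<^sub>R christoffel M c x w u"
  by (simp add: christoffel_def vec_eq_iff sum_distrib_left algebra_simps)

lemma linear_christoffel_left: "linear (\<lambda>u. christoffel M c x u w)"
  by (rule linearI) (simp_all add: christoffel_add_left christoffel_scaleR_left)

lemma linear_christoffel_right: "linear (\<lambda>u. christoffel M c x w u)"
  by (rule linearI) (simp_all add: christoffel_add_right christoffel_scaleR_right)

locale riem =
  fixes M :: "('a::{t2_space,second_countable_topology}, 'm::finite) riemannian"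
  assumes riemannian: "riemannian_manifold M"
begin

lemma atlas_chart: "c \<in> atlas M \<Longrightarrow> is_chart c"
  using riemannian by (auto simp: riemannian_manifold_def smooth_atlas_def)

lemma open_chart_dom: "c \<in> atlas M \<Longrightarrow> open (chart_dom c)"
  using atlas_chart by (auto simp: is_chart_def)

lemma open_chart_img: "c \<in> atlas M \<Longrightarrow> open (chart_img c)"
  using atlas_chart by (auto simp: is_chart_def)

lemma chart_homeomorphism: "c \<in> atlas M \<Longrightarrow> homeomorphism (chart_dom c) (chart_img c) (coord c) (param c)"
  using atlas_chart by (auto simp: is_chart_def)

lemma param_coord [simp]: "c \<in> atlas M \<Longrightarrow> p \<in> chart_dom c \<Longrightarrow> param c (coord c p) = p"
  using chart_homeomorphism by (auto simp: homeomorphism_def)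

lemma coord_param [simp]: "c \<in> atlas M \<Longrightarrow> x \<in> chart_img c \<Longrightarrow> coord c (param c x) = x"
  using chart_homeomorphism by (auto simp: homeomorphism_def)

lemma coord_in [simp]: "p \<in> chart_dom c \<Longrightarrow> coord c p \<in> chart_img c"
  by (simp add: chart_img_def)

lemma param_in [simp]: "c \<in> atlas M \<Longrightarrow> x \<in> chart_img c \<Longrightarrow> param c x \<in> chart_dom c"
  using chart_homeomorphism[of c] unfolding homeomorphism_def by blast

lemma continuous_coord: "c \<in> atlas M \<Longrightarrow> continuous_on (chart_dom c) (coord c)"
  using chart_homeomorphism by (auto simp: homeomorphism_def)

lemma continuous_param: "c \<in> atlas M \<Longrightarrow> continuous_on (chart_img c) (param c)"
  using chart_homeomorphism by (auto simp: homeomorphism_def)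

lemma open_param_preimage:
  "c \<in> atlas M \<Longrightarrow> open U \<Longrightarrow> open {x \<in> chart_img c. param c x \<in> U}"
  using continuous_open_preimage[OF continuous_param open_chart_img] by (simp add: vimage_def Int_def)

lemma open_coord_preimage:
  "c \<in> atlas M \<Longrightarrow> open U \<Longrightarrow> open {p \<in> chart_dom c. coord c p \<in> U}"
  using continuous_open_preimage[OF continuous_coord open_chart_dom] by (simp add: vimage_def Int_def)

lemma ex_chart: "\<exists>c\<in>atlas M. p \<in> chart_dom c"
  using riemannian by (auto simp: riemannian_manifold_def smooth_atlas_def)

lemma charts_at_iff: "c \<in> charts_at M p \<longleftrightarrow> c \<in> atlas M \<and> p \<in> chart_dom c"
  by (simp add: charts_at_def)

lemma chart_at_in: "chart_at M p \<in> charts_at M p"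
proof -
  obtain c where "c \<in> charts_at M p" using ex_chart[of p] unfolding charts_at_iff by blast
  then show ?thesis unfolding chart_at_def by (rule someI)
qed

lemma open_overlap: "c \<in> atlas M \<Longrightarrow> d \<in> atlas M \<Longrightarrow> open (overlap c d)"
  unfolding overlap_def by (intro open_param_preimage open_chart_dom)

lemma overlap_charts_at:
  "c \<in> charts_at M p \<Longrightarrow> d \<in> charts_at M p \<Longrightarrow> coord c p \<in> overlap c d"
  by (auto simp: overlap_def charts_at_iff)

lemma smooth_transition: "c \<in> atlas M \<Longrightarrow> d \<in> atlas M \<Longrightarrow> smooth_on (overlap c d) (transition c d)"
proof -
  assume cd: "c \<in> atlas M" "d \<in> atlas M"
  have "coord c ` (chart_dom c \<inter> chart_dom d) = overlap c d"
    using cd by (force simp: overlap_def)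
  then show ?thesis
    using riemannian cd unfolding riemannian_manifold_def smooth_atlas_def transition_def by metis
qed

lemma transition_in: "c \<in> atlas M \<Longrightarrow> d \<in> atlas M \<Longrightarrow> x \<in> overlap c d \<Longrightarrow> transition c d x \<in> overlap d c"
  by (auto simp: overlap_def transition_def)

lemma transition_in_img: "c \<in> atlas M \<Longrightarrow> d \<in> atlas M \<Longrightarrow> x \<in> overlap c d \<Longrightarrow> transition c d x \<in> chart_img d"
  by (auto simp: overlap_def transition_def)

lemma transition_coord: "c \<in> charts_at M p \<Longrightarrow> transition c d (coord c p) = coord d p"
  by (auto simp: charts_at_iff transition_def)

lemma transition_has_derivative:
  "c \<in> atlas M \<Longrightarrow> d \<in> atlas M \<Longrightarrow> x \<in> overlap c d \<Longrightarrow> (transition c d has_derivative dtrans c d x) (at x)"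
  unfolding dtrans_def by (rule smooth_on_has_derivative[OF smooth_transition])

lemma linear_dtrans: "c \<in> atlas M \<Longrightarrow> d \<in> atlas M \<Longrightarrow> x \<in> overlap c d \<Longrightarrow> linear (dtrans c d x)"
  using transition_has_derivative by (blast intro: has_derivative_linear)

text \<open>Chain rule for coordinate changes. This cocycle property is what makes the
  transformation rule of tangent vectors consistent between charts.\<close>

lemma dtrans_compose:
  assumes "c \<in> atlas M" "d \<in> atlas M" "e \<in> atlas M" "x \<in> overlap c d" "x \<in> overlap c e"
  shows "dtrans d e (transition c d x) (dtrans c d x w) = dtrans c e x w"
proof -
  have *: "transition c d x \<in> overlap d e" using assms by (auto simp: overlap_def transition_def)
  have "((\<lambda>y. transition d e (transition c d y)) has_derivative
      (\<lambda>w. dtrans d e (transition c d x) (dtrans c d x w))) (at x)"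
    using assms * by (intro has_derivative_compose[OF transition_has_derivative transition_has_derivative])
  moreover have "transition d e (transition c d y) = transition c e y" if "y \<in> overlap c d" for y
    using that assms by (auto simp: overlap_def transition_def)
  ultimately have "(transition c e has_derivative (\<lambda>w. dtrans d e (transition c d x) (dtrans c d x w))) (at x)"
    by (rule has_derivative_transform_within_open[OF _ open_overlap[OF assms(1,2)] assms(4)])
  from frechet_derivative_eqI[OF this] show ?thesis by (simp add: dtrans_def)
qed

lemma dtrans_self:
  assumes "c \<in> atlas M" "x \<in> chart_img c"
  shows "dtrans c c x w = w"
proof -
  have "(transition c c has_derivative (\<lambda>w. w)) (at x)"
    by (rule has_derivative_transform_within_open[OF has_derivative_ident open_chart_img[OF assms(1)] assms(2)])
      (use assms in \<open>simp add: transition_def\<close>)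
  from frechet_derivative_eqI[OF this] show ?thesis by (simp add: dtrans_def)
qed

lemma dtrans_inverse:
  assumes "c \<in> atlas M" "d \<in> atlas M" "x \<in> overlap c d"
  shows "dtrans d c (transition c d x) (dtrans c d x w) = w"
  using dtrans_compose[of c d c x] dtrans_self[of c x] assms by (auto simp: overlap_def)

lemma dtrans_surj:
  assumes "c \<in> atlas M" "d \<in> atlas M" "x \<in> overlap c d"
  obtains v where "w = dtrans c d x v"
proof -
  have "transition d c (transition c d x) = x" using assms by (auto simp: overlap_def transition_def)
  then show ?thesis using dtrans_inverse[of d c "transition c d x" w] transition_in assms that by metis
qed

lemma tangent_space_iff:
  "v \<in> tangent_space M p \<longleftrightarrow> (\<forall>c. c \<notin> charts_at M p \<longrightarrow> v c = 0) \<and>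
    (\<forall>c\<in>charts_at M p. \<forall>d\<in>charts_at M p. v d = dtrans c d (coord c p) (v c))"
  by (simp add: tangent_space_def dtrans_def transition_def)

text \<open>By the cocycle property of \<open>dtrans\<close>, the rule between arbitrary charts
  follows from the rule out of the single chart c.\<close>

lemma tangent_spaceI:
  assumes "c \<in> charts_at M p" "\<And>d. d \<notin> charts_at M p \<Longrightarrow> v d = 0"
    "\<And>d. d \<in> charts_at M p \<Longrightarrow> v d = dtrans c d (coord c p) (v c)"
  shows "v \<in> tangent_space M p"
  unfolding tangent_space_iff
proof (intro conjI ballI allI impI)
  fix d e assume de: "d \<in> charts_at M p" "e \<in> charts_at M p"
  have "dtrans d e (coord d p) (dtrans c d (coord c p) (v c)) = dtrans c e (coord c p) (v c)"
    using dtrans_compose[of c d e "coord c p" "v c"] assms(1) de overlap_charts_at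
    by (auto simp: charts_at_iff transition_def)
  then show "v e = dtrans d e (coord d p) (v d)" using assms(3) de by simp
qed (use assms in auto)

lemma tangent_transform:
  "v \<in> tangent_space M p \<Longrightarrow> c \<in> charts_at M p \<Longrightarrow> d \<in> charts_at M p \<Longrightarrow> v d = dtrans c d (coord c p) (v c)"
  unfolding tangent_space_iff by blast

lemma tangent_zero: "v \<in> tangent_space M p \<Longrightarrow> d \<notin> charts_at M p \<Longrightarrow> v d = 0"
  unfolding tangent_space_iff by blast

lemma coord_vec_self: "c \<in> charts_at M p \<Longrightarrow> coord_vec M c w p c = w"
  by (auto simp: coord_vec_alt dtrans_self charts_at_iff)

lemma coord_vec_tangent: "c \<in> charts_at M p \<Longrightarrow> coord_vec M c w p \<in> tangent_space M p"
  by (rule tangent_spaceI[of c]) (auto simp: coord_vec_alt dtrans_self charts_at_iff)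

lemma tangent_eq_coord_vec:
  "v \<in> tangent_space M p \<Longrightarrow> c \<in> charts_at M p \<Longrightarrow> v = coord_vec M c (v c) p"
  by (rule ext) (simp add: coord_vec_alt tangent_zero tangent_transform[symmetric])

lemma tangent_eqI:
  assumes "v \<in> tangent_space M p" "w \<in> tangent_space M p" "c \<in> charts_at M p" "v c = w c"
  shows "v = w"
  by (metis tangent_eq_coord_vec assms)

lemma tangent_0: "(\<lambda>_. 0) \<in> tangent_space M p"
  by (simp add: tangent_space_iff linear_0[OF linear_dtrans] charts_at_iff overlap_charts_at)

lemma tangent_lincomb:
  assumes "v \<in> tangent_space M p" "w \<in> tangent_space M p"
  shows "(\<lambda>c. a *\<^sub>R v c + b *\<^sub>R w c) \<in> tangent_space M p"
proof -
  have "dtrans c d (coord c p) (a *\<^sub>R v c + b *\<^sub>R w c) = a *\<^sub>R v d + b *\<^sub>R w d"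
    if "c \<in> charts_at M p" "d \<in> charts_at M p" for c d
  proof -
    have L: "linear (dtrans c d (coord c p))"
      by (rule linear_dtrans) (use that overlap_charts_at[OF that] in \<open>simp_all add: charts_at_iff\<close>)
    show ?thesis
      by (simp add: linear_add[OF L] linear_scale[OF L] tangent_transform[OF assms(1) that, symmetric]
          tangent_transform[OF assms(2) that, symmetric])
  qed
  then show ?thesis
    using tangent_zero[OF assms(1)] tangent_zero[OF assms(2)] unfolding tangent_space_iff by simp
qed

lemma tangent_scaleR: "v \<in> tangent_space M p \<Longrightarrow> (\<lambda>c. a *\<^sub>R v c) \<in> tangent_space M p"
  using tangent_lincomb[of v p v a 0] by simp

lemma tangent_add:
  "v \<in> tangent_space M p \<Longrightarrow> w \<in> tangent_space M p \<Longrightarrow> (\<lambda>c. v c + w c) \<in> tangent_space M p"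
  using tangent_lincomb[of v p w 1 1] by simp

lemma tangent_sum:
  "(\<And>i. i \<in> I \<Longrightarrow> v i \<in> tangent_space M p) \<Longrightarrow> (\<lambda>c. \<Sum>i\<in>I. v i c) \<in> tangent_space M p"
  by (induction I rule: infinite_finite_induct) (auto intro: tangent_0 tangent_add)

lemma metric_sym: "u \<in> tangent_space M p \<Longrightarrow> v \<in> tangent_space M p \<Longrightarrow> metric M p u v = metric M p v u"
  using riemannian by (auto simp: riemannian_manifold_def riemannian_metric_def)

lemma metric_lincomb_left:
  assumes "u \<in> tangent_space M p" "v \<in> tangent_space M p" "w \<in> tangent_space M p"
  shows "metric M p (\<lambda>c. a *\<^sub>R u c + b *\<^sub>R v c) w = a * metric M p u w + b * metric M p v w"
  using riemannian assms by (auto simp: riemannian_manifold_def riemannian_metric_def)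

lemma metric_pos: "u \<in> tangent_space M p \<Longrightarrow> u \<noteq> (\<lambda>_. 0) \<Longrightarrow> metric M p u u > 0"
  using riemannian by (auto simp: riemannian_manifold_def riemannian_metric_def)

lemma metric_eq_gform:
  assumes "u \<in> tangent_space M p" "v \<in> tangent_space M p" "c \<in> charts_at M p"
  shows "metric M p u v = gform M c (coord c p) (u c) (v c)"
proof -
  have "metric M p u v = metric M p (coord_vec M c (u c) p) (coord_vec M c (v c) p)"
    by (simp only: tangent_eq_coord_vec[OF assms(1,3), symmetric] tangent_eq_coord_vec[OF assms(2,3), symmetric])
  then show ?thesis using assms(3) by (simp add: gform_def charts_at_iff)
qed

context
  fixes c :: "('a, 'm) chart" and x :: "real^'m"
  assumes c: "c \<in> atlas M" and x: "x \<in> chart_img c"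
begin

lemma chart_at_param: "c \<in> charts_at M (param c x)"
  using c x by (simp add: charts_at_iff)

lemma coord_vec_lincomb:
  "coord_vec M c (a *\<^sub>R u + b *\<^sub>R v) (param c x) =
    (\<lambda>d. a *\<^sub>R coord_vec M c u (param c x) d + b *\<^sub>R coord_vec M c v (param c x) d)"
  by (rule tangent_eqI[OF _ _ chart_at_param])
    (use chart_at_param in \<open>auto intro: coord_vec_tangent tangent_lincomb simp: coord_vec_self\<close>)

lemma gform_sym: "gform M c x u v = gform M c x v u"
  unfolding gform_def by (intro metric_sym coord_vec_tangent chart_at_param)

lemma gform_lincomb_left: "gform M c x (a *\<^sub>R u + b *\<^sub>R v) w = a * gform M c x u w + b * gform M c x v w"
  unfolding gform_def coord_vec_lincomb by (intro metric_lincomb_left coord_vec_tangent chart_at_param)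

lemma linear_gform_left: "linear (\<lambda>u. gform M c x u w)"
proof (rule linearI)
  show "gform M c x (u + v) w = gform M c x u w + gform M c x v w" for u v
    using gform_lincomb_left[of 1 u 1 v w] by simp
  show "gform M c x (r *\<^sub>R u) w = r *\<^sub>R gform M c x u w" for r u
    using gform_lincomb_left[of r u 0 u w] by simp
qed

lemma linear_gform_right: "linear (\<lambda>u. gform M c x w u)"
  unfolding gform_sym[of w] by (rule linear_gform_left)

lemma gform_pos: "u \<noteq> 0 \<Longrightarrow> gform M c x u u > 0"
  unfolding gform_def
  by (intro metric_pos coord_vec_tangent chart_at_param) (metis coord_vec_self chart_at_param)

lemma gform_nondegenerate: "(\<And>w. gform M c x u w = 0) \<Longrightarrow> u = 0"
  using gform_pos[of u] by (metis less_irrefl)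

lemma gform_expand: "gform M c x u v = (\<Sum>i\<in>UNIV. \<Sum>j\<in>UNIV. gram M c x $ i $ j * u $ i * v $ j)"
proof -
  have "gform M c x u v = gform M c x (\<Sum>i\<in>UNIV. u $ i *\<^sub>R axis i 1) (\<Sum>j\<in>UNIV. v $ j *\<^sub>R axis j 1)"
    by (simp only: vec_basis_expansion[symmetric])
  also have "\<dots> = (\<Sum>j\<in>UNIV. \<Sum>i\<in>UNIV. v $ j * (u $ i * gform M c x (axis i 1) (axis j 1)))"
    by (simp only: linear_sum[OF linear_gform_left] linear_sum[OF linear_gform_right]
        linear_scale[OF linear_gform_left] linear_scale[OF linear_gform_right] real_scaleR_def sum_distrib_left)
  finally show ?thesis
    by (subst sum.swap) (simp add: gram_eq_gform mult_ac)
qed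

lemma gram_sym: "gram M c x $ i $ j = gram M c x $ j $ i"
  unfolding gram_eq_gform by (rule gform_sym)

text \<open>A vector in the kernel of the Gram matrix has zero length, hence vanishes by
  positivity.\<close>

lemma invertible_gram: "invertible (gram M c x)"
proof -
  have "u = 0" if "gram M c x *v u = 0" for u
  proof -
    have "gform M c x u u = (\<Sum>i\<in>UNIV. u $ i * (gram M c x *v u) $ i)"
      by (simp add: gform_expand matrix_vector_mult_def sum_distrib_left mult_ac)
    then show ?thesis using that gform_pos[of u] by force
  qed
  then show ?thesis
    by (metis invertible_left_inverse matrix_left_invertible_ker)
qed

end

end

section \<open>Orthonormal frames and sums in coordinates\<close>

lemma sum_axis: "(\<Sum>j\<in>UNIV. f j * axis b (1::real) $ j) = f b"
proof -
  have "(\<Sum>j\<in>UNIV. f j * axis b (1::real) $ j) = (\<Sum>j\<in>UNIV. if j = b then f j else 0)"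
    by (intro sum.cong) (auto simp: axis_def)
  then show ?thesis by simp
qed

lemma linear_eq_axis:
  fixes f g :: "real^'n \<Rightarrow> 'w::real_vector"
  assumes "linear f" "linear g" "\<And>i. f (axis i 1) = g (axis i 1)"
  shows "f u = g u"
  by (subst (1 2) vec_basis_expansion) (simp add: linear_sum[OF assms(1)] linear_sum[OF assms(2)]
      linear_scale[OF assms(1)] linear_scale[OF assms(2)] assms(3))

lemma bilinear_expand_axis:
  fixes B :: "real^'n \<Rightarrow> real^'n \<Rightarrow> 'w::real_vector"
  assumes l: "\<And>v. linear (\<lambda>u. B u v)" and r: "\<And>u. linear (\<lambda>v. B u v)"
  shows "B u v = (\<Sum>k\<in>UNIV. \<Sum>l\<in>UNIV. (u $ k * v $ l) *\<^sub>R B (axis k 1) (axis l 1))"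
proof -
  have "B u v = B (\<Sum>k\<in>UNIV. u $ k *\<^sub>R axis k 1) (\<Sum>l\<in>UNIV. v $ l *\<^sub>R axis l 1)"
    by (simp only: vec_basis_expansion[symmetric])
  also have "\<dots> = (\<Sum>l\<in>UNIV. \<Sum>k\<in>UNIV. v $ l *\<^sub>R u $ k *\<^sub>R B (axis k 1) (axis l 1))"
    by (simp only: linear_sum[OF l] linear_sum[OF r] linear_scale[OF l] linear_scale[OF r] scaleR_sum_right)
  finally show ?thesis by (subst sum.swap) (simp add: mult.commute)
qed

text \<open>With G the inverse Gram matrix, this turns traces over frames chosen pointwise into
  expressions that are smooth in the base point.\<close>

lemma sum_frame_bilinear:
  fixes B :: "real^'n \<Rightarrow> real^'n \<Rightarrow> 'w::real_vector" and G :: "real^'n^'n" and E :: "'n \<Rightarrow> real^'n"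
  assumes l: "\<And>v. linear (\<lambda>u. B u v)" and r: "\<And>u. linear (\<lambda>v. B u v)"
    and E: "\<And>k l. (\<Sum>i\<in>UNIV. E i $ k * E i $ l) = G $ k $ l"
  shows "(\<Sum>i\<in>UNIV. B (E i) (E i)) = (\<Sum>k\<in>UNIV. \<Sum>l\<in>UNIV. G $ k $ l *\<^sub>R B (axis k 1) (axis l 1))"
proof -
  have "(\<Sum>i\<in>UNIV. B (E i) (E i)) =
      (\<Sum>i\<in>UNIV. \<Sum>k\<in>UNIV. \<Sum>l\<in>UNIV. (E i $ k * E i $ l) *\<^sub>R B (axis k 1) (axis l 1))"
    by (subst bilinear_expand_axis[of B, OF l r]) simp
  also have "\<dots> = (\<Sum>k\<in>UNIV. \<Sum>i\<in>UNIV. \<Sum>l\<in>UNIV. (E i $ k * E i $ l) *\<^sub>R B (axis k 1) (axis l 1))"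
    by (rule sum.swap)
  also have "\<dots> = (\<Sum>k\<in>UNIV. \<Sum>l\<in>UNIV. \<Sum>i\<in>UNIV. (E i $ k * E i $ l) *\<^sub>R B (axis k 1) (axis l 1))"
    by (intro sum.cong refl sum.swap)
  also have "\<dots> = (\<Sum>k\<in>UNIV. \<Sum>l\<in>UNIV. G $ k $ l *\<^sub>R B (axis k 1) (axis l 1))"
    by (simp add: E[symmetric] scaleR_sum_left)
  finally show ?thesis .
qed

text \<open>The frame vectors are the rows of F, and orthonormality says
  \<open>F ** (G ** transpose F) = mat 1\<close>. One-sided inverses of square matrices are
  two-sided, so the factors may be rotated: \<open>transpose F ** F\<close> is the inverse of G, and
  det G is the inverse of a square.\<close>

lemma axis_frame_matrix:
  fixes G :: "real^'n^'n" and E :: "'n \<Rightarrow> real^'n"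
  assumes "\<And>i j. E i \<bullet> (G *v E j) = (if i = j then 1 else 0)"
  shows "(\<Sum>i\<in>UNIV. E i $ k * E i $ l) = matrix_inv G $ k $ l" and "det G > 0"
proof -
  define F where "F = (\<chi> i. E i)"
  have "F ** (G ** transpose F) = mat 1"
  proof -
    have "(F ** (G ** transpose F)) $ i $ j = E i \<bullet> (G *v E j)" for i j
      by (simp add: F_def matrix_matrix_mult_def matrix_vector_mult_def transpose_def inner_vec_def)
    then show ?thesis by (simp add: vec_eq_iff mat_def assms)
  qed
  then have *: "G ** (transpose F ** F) = mat 1"
    by (metis matrix_left_right_inverse matrix_mul_assoc)
  then have inv: "invertible G" by (metis invertible_right_inverse)
  have "transpose F ** F = matrix_inv G"
    by (metis * matrix_inv_mult(2)[OF inv] matrix_mul_assoc matrix_mul_lid matrix_mul_rid)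
  then have "(transpose F ** F) $ k $ l = matrix_inv G $ k $ l" by simp
  then show "(\<Sum>i\<in>UNIV. E i $ k * E i $ l) = matrix_inv G $ k $ l"
    by (simp add: F_def matrix_matrix_mult_def transpose_def)
  have "det G * (det F * det F) = 1"
    using arg_cong[OF *, of det] by (simp add: det_mul)
  then show "det G > 0"
    by (metis mult.assoc not_real_square_gt_zero zero_less_mult_iff zero_less_one mult_zero_left zero_le_square less_le_not_le)
qed

context riem
begin

lemma gform_inner: "c \<in> atlas M \<Longrightarrow> x \<in> chart_img c \<Longrightarrow> gform M c x u v = u \<bullet> (gram M c x *v v)"
  by (simp add: gform_expand inner_vec_def matrix_vector_mult_def sum_distrib_left mult_ac)

text \<open>Induction on the set of indices already treated. While fewer vectors than the dimension
  are present, some nonzero v is Euclidean-orthogonal to all \<open>gram M c x *v E i\<close>, hence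
  orthogonal to all \<open>E i\<close> in the metric; it is then normalised.\<close>

lemma ex_gform_orthonormal:
  assumes c: "c \<in> atlas M" "x \<in> chart_img c"
  shows "\<exists>E. \<forall>i j. gform M c x (E i) (E j) = (if i = (j::'m) then 1 else 0)"
proof -
  have "\<exists>E. \<forall>i\<in>I. \<forall>j\<in>I. gform M c x (E i) (E j) = (if i = (j::'m) then 1 else 0)" if "finite I" for I
    using that
  proof (induction I)
    case (insert k I)
    then obtain E where E: "\<forall>i\<in>I. \<forall>j\<in>I. gform M c x (E i) (E j) = (if i = (j::'m) then 1 else 0)"
      by blast
    let ?S = "(\<lambda>i. gram M c x *v E i) ` I"
    have "dim ?S \<le> card I"
      by (metis dim_le_card' card_image_le finite_imageI insert.hyps(1) le_trans)
    also have "card I < CARD('m)"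
      using insert.hyps by (intro psubset_card_mono) auto
    finally have "dim ?S < DIM(real^'m)" by simp
    from orthogonal_to_subspace_exists[OF this] obtain v where
      v: "v \<noteq> 0" "\<And>y. y \<in> span ?S \<Longrightarrow> orthogonal v y" by blast
    have vE: "gform M c x v (E i) = 0" if "i \<in> I" for i
    proof -
      have "gram M c x *v E i \<in> span ?S" using that by (intro span_base) auto
      then show ?thesis using v(2) by (simp add: gform_inner[OF c] orthogonal_def)
    qed
    have pos: "gform M c x v v > 0" using gform_pos[OF c] v by blast
    define w where "w = (1 / sqrt (gform M c x v v)) *\<^sub>R v"
    have scale: "gform M c x (r *\<^sub>R v) u = r * gform M c x v u" "gform M c x u (r *\<^sub>R v) = r * gform M c x u v" for r u
      using linear_scale[OF linear_gform_left[OF c]] linear_scale[OF linear_gform_right[OF c]] by auto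
    have ww: "gform M c x w w = 1"
      unfolding w_def scale using pos by simp
    have wE: "gform M c x w (E i) = 0" "gform M c x (E i) w = 0" if "i \<in> I" for i
      using vE[OF that] gform_sym[OF c, of v "E i"] by (simp_all add: w_def scale)
    have "gform M c x ((E(k := w)) i) ((E(k := w)) j) = (if i = j then 1 else 0)"
      if "i \<in> insert k I" "j \<in> insert k I" for i j
      using that E ww wE insert.hyps(2) by auto
    then show ?case by blast
  qed simp
  from this[of UNIV] show ?thesis by simp
qed

lemma det_gram_pos: "c \<in> atlas M \<Longrightarrow> x \<in> chart_img c \<Longrightarrow> det (gram M c x) > 0"
  using ex_gform_orthonormal[of c x] axis_frame_matrix(2)[of _ "gram M c x"] by (auto simp: gform_inner)

lemma det_gram_nz: "c \<in> atlas M \<Longrightarrow> x \<in> chart_img c \<Longrightarrow> det (gram M c x) \<noteq> 0"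
  using det_gram_pos by fastforce

text \<open>Existence of a frame, which gives the choice in \<open>frame_at\<close> its
  meaning.\<close>

lemma orthonormal_frame_at: "orthonormal_frame M p (frame_at M p)"
proof -
  obtain c where c: "c \<in> charts_at M p" using chart_at_in by blast
  then have c': "c \<in> atlas M" "coord c p \<in> chart_img c" by (simp_all add: charts_at_iff)
  obtain E where E: "gform M c (coord c p) (E i) (E j) = (if i = j then 1 else 0)" for i j :: 'm
    using ex_gform_orthonormal[OF c'] by blast
  have "orthonormal_frame M p (\<lambda>i. coord_vec M c (E i) p)"
    using c by (simp add: orthonormal_frame_def coord_vec_tangent metric_eq_gform[OF _ _ c] coord_vec_self E)
  then show ?thesis unfolding frame_at_def by (rule someI[where P="orthonormal_frame M p"])
qed

lemma frame_at_tangent: "frame_at M p i \<in> tangent_space M p"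
  using orthonormal_frame_at by (auto simp: orthonormal_frame_def)

lemma frame_at_ginv:
  assumes c: "c \<in> charts_at M p"
  shows "(\<Sum>i\<in>UNIV. frame_at M p i c $ k * frame_at M p i c $ l) = matrix_inv (gram M c (coord c p)) $ k $ l"
proof (rule axis_frame_matrix(1))
  fix i j
  have "gform M c (coord c p) (frame_at M p i c) (frame_at M p j c) = (if i = j then 1 else 0)"
    using orthonormal_frame_at metric_eq_gform[OF frame_at_tangent frame_at_tangent c]
    by (simp add: orthonormal_frame_def)
  then show "frame_at M p i c \<bullet> (gram M c (coord c p) *v frame_at M p j c) = (if i = j then 1 else 0)"
    using c by (simp add: gform_inner charts_at_iff)
qed

section \<open>Smooth dependence on the point, and compatibility of the connection with the
  metric\<close>

lemma smooth_gram: "c \<in> atlas M \<Longrightarrow> smooth_on (chart_img c) (\<lambda>x. gram M c x $ i $ j)"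
  using riemannian unfolding riemannian_manifold_def riemannian_metric_def gram_def by simp

lemma smooth_gform [smooth_intros]:
  fixes Y W Z :: "'u::real_normed_vector \<Rightarrow> real^'m"
  assumes c: "c \<in> atlas M" and S: "open S" and Y: "\<And>z. z \<in> S \<Longrightarrow> Y z \<in> chart_img c"
    and sm: "smooth_on S Y" "smooth_on S W" "smooth_on S Z"
  shows "smooth_on S (\<lambda>z. gform M c (Y z) (W z) (Z z))"
proof -
  have "smooth_on S (\<lambda>z. \<Sum>i\<in>UNIV. \<Sum>j\<in>UNIV. gram M c (Y z) $ i $ j * W z $ i * Z z $ j)"
    by (intro smooth_intros S sm smooth_on_compose[OF S open_chart_img[OF c] smooth_gram[OF c] sm(1) Y])
  then show ?thesis
    by (subst smooth_on_cong[OF S]) (use Y gform_expand[OF c] in auto)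
qed

lemma smooth_ginv: "c \<in> atlas M \<Longrightarrow> smooth_on (chart_img c) (\<lambda>x. matrix_inv (gram M c x) $ i $ j)"
  by (intro smooth_on_matrix_inv open_chart_img smooth_gram det_gram_nz)

lemma smooth_sqrt_det_gram: "c \<in> atlas M \<Longrightarrow> smooth_on (chart_img c) (\<lambda>x. sqrt (det (gram M c x)))"
  by (intro smooth_intros open_chart_img smooth_gram det_gram_pos)

lemma smooth_christoffel_symbol: "c \<in> atlas M \<Longrightarrow> smooth_on (chart_img c) (\<lambda>x. christoffel_symbol M c x k i j)"
  unfolding christoffel_symbol_def gram_deriv_def
  by (intro smooth_intros open_chart_img smooth_gram smooth_ginv)

lemma smooth_christoffel [smooth_intros]:
  fixes Y W Z :: "'u::real_normed_vector \<Rightarrow> real^'m"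
  assumes c: "c \<in> atlas M" and S: "open S" and Y: "\<And>z. z \<in> S \<Longrightarrow> Y z \<in> chart_img c"
    and sm: "smooth_on S Y" "smooth_on S W" "smooth_on S Z"
  shows "smooth_on S (\<lambda>z. christoffel M c (Y z) (W z) (Z z))"
  unfolding christoffel_def
  by (intro smooth_intros S sm smooth_on_compose[OF S open_chart_img[OF c] smooth_christoffel_symbol[OF c] sm(1) Y])

context
  fixes c :: "('a, 'm) chart" and x :: "real^'m"
  assumes c: "c \<in> atlas M" and x: "x \<in> chart_img c"
begin

lemma gram_deriv_sym: "gram_deriv M c x k i j = gram_deriv M c x k j i"
  unfolding gram_deriv_def
  by (rule fun_cong[where x="axis k 1"], rule frechet_derivative_cong_open[OF open_chart_img[OF c] x])
    (rule gram_sym[OF c])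

lemma christoffel_symbol_sym: "christoffel_symbol M c x k i j = christoffel_symbol M c x k j i"
  unfolding christoffel_symbol_def using gram_deriv_sym by (simp add: algebra_simps)

lemma christoffel_sym: "christoffel M c x u v = christoffel M c x v u"
  unfolding christoffel_def vec_eq_iff
  by (subst sum.swap) (simp add: christoffel_symbol_sym[of _ _ _] mult_ac)

text \<open>Lowering the index cancels the inverse Gram matrix in the Christoffel symbol and leaves
  the symbol of the first kind.\<close>

lemma gform_christoffel_axis:
  "gform M c x (axis e 1) (christoffel M c x (axis a 1) (axis b 1)) =
    1 / 2 * (gram_deriv M c x a b e + gram_deriv M c x b a e - gram_deriv M c x e a b)"
proof -
  define w where "w = (\<chi> e. gram_deriv M c x a b e + gram_deriv M c x b a e - gram_deriv M c x e a b)"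
  have "christoffel M c x (axis a 1) (axis b 1) = (\<chi> l. christoffel_symbol M c x l a b)"
    by (simp add: christoffel_def sum_axis)
  also have "\<dots> = (1 / 2) *\<^sub>R (matrix_inv (gram M c x) *v w)"
    by (simp add: vec_eq_iff christoffel_symbol_def matrix_vector_mult_def w_def)
  finally have "gram M c x *v christoffel M c x (axis a 1) (axis b 1) =
      (1 / 2) *\<^sub>R (gram M c x *v (matrix_inv (gram M c x) *v w))"
    by (simp add: matrix_vector_mult_scaleR)
  also have "\<dots> = (1 / 2) *\<^sub>R w"
    by (simp add: matrix_vector_mul_assoc matrix_inv_mult(1)[OF invertible_gram[OF c x]])
  finally show ?thesis
    by (simp add: gform_inner[OF c x] inner_axis' w_def)
qed

text \<open>Metric compatibility. Both sides are linear in each of w, u and v, so they are compared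
  on basis vectors, where two symbols of the first kind add up to one derivative of the Gram
  matrix.\<close>

lemma gram_derivative:
  "(\<Sum>i\<in>UNIV. \<Sum>j\<in>UNIV. frechet_derivative (\<lambda>y. gram M c y $ i $ j) (at x) w * u $ i * v $ j) =
    gform M c x (christoffel M c x w u) v + gform M c x u (christoffel M c x w v)" (is "?L w u v = ?R w u v")
proof -
  let ?D = "\<lambda>i j. frechet_derivative (\<lambda>y. gram M c y $ i $ j) (at x)"
  have D: "linear (?D i j)" for i j
    by (rule linear_frechet_derivative[OF smooth_on_differentiable[OF smooth_gram[OF c] x]])
  note lin = linear_gform_left[OF c x] linear_gform_right[OF c x] linear_christoffel_left linear_christoffel_right
  have L: "linear (\<lambda>w. ?L w u v)" "linear (\<lambda>u. ?L w u v)" "linear (\<lambda>v. ?L w u v)" for w u v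
    by (rule linearI; simp add: linear_add[OF D] linear_scale[OF D] sum.distrib sum_distrib_left algebra_simps)+
  have R: "linear (\<lambda>w. ?R w u v)" "linear (\<lambda>u. ?R w u v)" "linear (\<lambda>v. ?R w u v)" for w u v
    by (rule linearI; simp add: linear_add[OF lin(1)] linear_add[OF lin(2)] linear_scale[OF lin(1)]
        linear_scale[OF lin(2)] christoffel_add_left christoffel_add_right christoffel_scaleR_left
        christoffel_scaleR_right algebra_simps)+
  have "?L (axis k 1) (axis i 1) (axis j 1) = ?R (axis k 1) (axis i 1) (axis j 1)" for i j k
  proof -
    have "?L (axis k 1) (axis i 1) (axis j 1) = gram_deriv M c x k i j"
      by (simp add: gram_deriv_def sum_axis)
    also have "\<dots> = ?R (axis k 1) (axis i 1) (axis j 1)"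
      unfolding gform_sym[OF c x, of "christoffel M c x (axis k 1) (axis i 1)"] gform_christoffel_axis
      using gram_deriv_sym[of k i j] gram_deriv_sym[of i k j] gram_deriv_sym[of j k i] by (simp add: field_simps)
    finally show ?thesis .
  qed
  then have "?L (axis k 1) (axis i 1) v = ?R (axis k 1) (axis i 1) v" for i k
    by (rule linear_eq_axis[OF L(3) R(3)])
  then have "?L (axis k 1) u v = ?R (axis k 1) u v" for k
    by (rule linear_eq_axis[OF L(2) R(2)])
  then show ?thesis
    by (rule linear_eq_axis[OF L(1) R(1)])
qed

end

text \<open>The derivative through the base point Y is absorbed by metric compatibility, which
  completes the derivatives of W and Z to covariant ones. Since the source is any normed space, the
  rule serves for points of M and for parameters alike.\<close>

lemma gform_has_derivative:
  fixes Y W Z :: "'u::real_normed_vector \<Rightarrow> real^'m"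
  assumes c: "c \<in> atlas M" and Y: "Y z \<in> chart_img c"
    and d: "(Y has_derivative Y') (at z)" "(W has_derivative W') (at z)" "(Z has_derivative Z') (at z)"
    and S: "open S" "z \<in> S" "\<And>z. z \<in> S \<Longrightarrow> Y z \<in> chart_img c"
  shows "((\<lambda>z. gform M c (Y z) (W z) (Z z)) has_derivative (\<lambda>a.
     gform M c (Y z) (W' a + christoffel M c (Y z) (Y' a) (W z)) (Z z) +
     gform M c (Y z) (W z) (Z' a + christoffel M c (Y z) (Y' a) (Z z)))) (at z)"
proof -
  let ?D = "\<lambda>i j. frechet_derivative (\<lambda>y. gram M c y $ i $ j) (at (Y z))"
  have g: "((\<lambda>z. gram M c (Y z) $ i $ j) has_derivative (\<lambda>a. ?D i j (Y' a))) (at z)" for i j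
    by (rule has_derivative_compose[OF d(1)]) (rule smooth_on_has_derivative[OF smooth_gram[OF c] Y])
  have nth: "((\<lambda>z. W z $ i) has_derivative (\<lambda>a. W' a $ i)) (at z)" "((\<lambda>z. Z z $ i) has_derivative (\<lambda>a. Z' a $ i)) (at z)" for i
    by (intro bounded_linear.has_derivative[OF bounded_linear_vec_nth] d)+
  have "((\<lambda>z. \<Sum>i\<in>UNIV. \<Sum>j\<in>UNIV. gram M c (Y z) $ i $ j * W z $ i * Z z $ j) has_derivative
     (\<lambda>a. \<Sum>i\<in>UNIV. \<Sum>j\<in>UNIV. gram M c (Y z) $ i $ j * W z $ i * Z' a $ j +
        (gram M c (Y z) $ i $ j * W' a $ i + ?D i j (Y' a) * W z $ i) * Z z $ j)) (at z)"
    by (intro has_derivative_sum has_derivative_mult g nth)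
  moreover have "(\<Sum>i\<in>UNIV. \<Sum>j\<in>UNIV. gram M c (Y z) $ i $ j * W z $ i * Z' a $ j +
        (gram M c (Y z) $ i $ j * W' a $ i + ?D i j (Y' a) * W z $ i) * Z z $ j) =
     gform M c (Y z) (W' a + christoffel M c (Y z) (Y' a) (W z)) (Z z) +
     gform M c (Y z) (W z) (Z' a + christoffel M c (Y z) (Y' a) (Z z))" for a
  proof -
    have "(\<Sum>i\<in>UNIV. \<Sum>j\<in>UNIV. gram M c (Y z) $ i $ j * W z $ i * Z' a $ j +
        (gram M c (Y z) $ i $ j * W' a $ i + ?D i j (Y' a) * W z $ i) * Z z $ j) =
      gform M c (Y z) (W z) (Z' a) + gform M c (Y z) (W' a) (Z z) +
      (\<Sum>i\<in>UNIV. \<Sum>j\<in>UNIV. ?D i j (Y' a) * W z $ i * Z z $ j)"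
      unfolding gform_expand[OF c Y] by (simp add: sum.distrib algebra_simps)
    then show ?thesis
      unfolding gram_derivative[OF c Y]
      by (simp add: linear_add[OF linear_gform_left[OF c Y]] linear_add[OF linear_gform_right[OF c Y]])
  qed
  ultimately have "((\<lambda>z. \<Sum>i\<in>UNIV. \<Sum>j\<in>UNIV. gram M c (Y z) $ i $ j * W z $ i * Z z $ j) has_derivative
     (\<lambda>a. gform M c (Y z) (W' a + christoffel M c (Y z) (Y' a) (W z)) (Z z) +
     gform M c (Y z) (W z) (Z' a + christoffel M c (Y z) (Y' a) (Z z)))) (at z)" by simp
  then show ?thesis
    by (rule has_derivative_transform_within_open[OF _ S(1,2)]) (simp add: gform_expand[OF c S(3)])
qed

end

section \<open>Covariant differentiation along maps into a chart\<close>

text \<open>A product rule for maps that are linear in the second argument only locally and whose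
  differentiability is known only for a fixed second argument. Expanding W in the basis reduces it
  to finitely many scalar multiples of the maps \<open>\<lambda>y. B y b\<close>.\<close>

lemma has_derivative_linear_family:
  fixes B :: "'y::real_normed_vector \<Rightarrow> 'w::euclidean_space \<Rightarrow> 'v::real_normed_vector"
  assumes T: "open T" "z \<in> T" and lin: "\<And>z. z \<in> T \<Longrightarrow> linear (B (Y z))"
    and diff: "\<And>w. (\<lambda>y. B y w) differentiable (at (Y z))"
    and S: "open S" "Y z \<in> S" and linS: "\<And>y. y \<in> S \<Longrightarrow> linear (B y)"
    and d: "(Y has_derivative Y') (at z)" "(W has_derivative W') (at z)"
  shows "((\<lambda>z. B (Y z) (W z)) has_derivative
    (\<lambda>a. frechet_derivative (\<lambda>y. B y (W z)) (at (Y z)) (Y' a) + B (Y z) (W' a))) (at z)"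
proof -
  have rep: "B y w = (\<Sum>b\<in>Basis. (w \<bullet> b) *\<^sub>R B y b)" if "linear (B y)" for y w
    by (subst euclidean_representation[of w, symmetric]) (simp only: linear_sum[OF that] linear_scale[OF that])
  have D: "((\<lambda>y. B y b) has_derivative frechet_derivative (\<lambda>y. B y b) (at (Y z))) (at (Y z))" for b
    by (rule has_derivative_frechet[OF diff])
  have "((\<lambda>y. \<Sum>b\<in>Basis. (W z \<bullet> b) *\<^sub>R B y b) has_derivative
      (\<lambda>a. \<Sum>b\<in>Basis. (W z \<bullet> b) *\<^sub>R frechet_derivative (\<lambda>y. B y b) (at (Y z)) a)) (at (Y z))"
    by (intro has_derivative_sum has_derivative_scaleR_right D)
  then have "((\<lambda>y. B y (W z)) has_derivative
      (\<lambda>a. \<Sum>b\<in>Basis. (W z \<bullet> b) *\<^sub>R frechet_derivative (\<lambda>y. B y b) (at (Y z)) a)) (at (Y z))"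
    by (rule has_derivative_transform_within_open[OF _ S]) (rule rep[symmetric, OF linS])
  then have 1: "frechet_derivative (\<lambda>y. B y (W z)) (at (Y z)) a =
      (\<Sum>b\<in>Basis. (W z \<bullet> b) *\<^sub>R frechet_derivative (\<lambda>y. B y b) (at (Y z)) a)" for a
    by (rule fun_cong[OF frechet_derivative_eqI])
  have "((\<lambda>z. \<Sum>b\<in>Basis. (W z \<bullet> b) *\<^sub>R B (Y z) b) has_derivative
    (\<lambda>a. \<Sum>b\<in>Basis. (W z \<bullet> b) *\<^sub>R frechet_derivative (\<lambda>y. B y b) (at (Y z)) (Y' a)
       + (W' a \<bullet> b) *\<^sub>R B (Y z) b)) (at z)"
    by (intro has_derivative_sum has_derivative_scaleR has_derivative_compose[OF d(1) D]
        bounded_linear.has_derivative[OF bounded_linear_inner_left] d(2))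
  then have "((\<lambda>z. \<Sum>b\<in>Basis. (W z \<bullet> b) *\<^sub>R B (Y z) b) has_derivative
    (\<lambda>a. frechet_derivative (\<lambda>y. B y (W z)) (at (Y z)) (Y' a) + B (Y z) (W' a))) (at z)"
    by (simp only: sum.distrib 1 rep[OF linS[OF S(2)], symmetric])
  then show ?thesis
    by (rule has_derivative_transform_within_open[OF _ T]) (rule rep[symmetric, OF lin])
qed

text \<open>The covariant derivative of W along Y in the direction a of the source. W is a field
  along Y rather than on the target, and the source may consist of coordinates of M, of parameters,
  or of both.\<close>

definition nab :: "('a, 'm::finite) riemannian \<Rightarrow> ('a, 'm) chart \<Rightarrow> ('u::real_normed_vector \<Rightarrow> real^'m) \<Rightarrow>
    ('u \<Rightarrow> real^'m) \<Rightarrow> 'u \<Rightarrow> 'u \<Rightarrow> real^'m" where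
  "nab M c Y W a z = frechet_derivative W (at z) a +
     christoffel M c (Y z) (frechet_derivative Y (at z) a) (W z)"

definition curv :: "('a, 'm::finite) riemannian \<Rightarrow> ('a, 'm) chart \<Rightarrow> real^'m \<Rightarrow>
    real^'m \<Rightarrow> real^'m \<Rightarrow> real^'m \<Rightarrow> real^'m" where
  "curv M c x u v w = cov_coord M c (\<lambda>_. u) (cov_coord M c (\<lambda>_. v) (\<lambda>_. w)) x
     - cov_coord M c (\<lambda>_. v) (cov_coord M c (\<lambda>_. u) (\<lambda>_. w)) x"

lemma curv_eq: "curv M c x u v w =
    frechet_derivative (\<lambda>y. christoffel M c y v w) (at x) u + christoffel M c x u (christoffel M c x v w)
  - (frechet_derivative (\<lambda>y. christoffel M c y u w) (at x) v + christoffel M c x v (christoffel M c x u w))"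
proof -
  have "cov_coord M c (\<lambda>_. v) (\<lambda>_. w) = (\<lambda>x. christoffel M c x v w)" for v w
    by (rule ext) (simp add: cov_coord_def)
  then show ?thesis by (simp add: curv_def) (simp add: cov_coord_def)
qed

context riem
begin

lemma gform_transform:
  assumes cd: "c \<in> atlas M" "d \<in> atlas M" and x: "x \<in> overlap c d"
  shows "gform M c x u v = gform M d (transition c d x) (dtrans c d x u) (dtrans c d x v)"
proof -
  let ?p = "param c x"
  have x': "x \<in> chart_img c" "?p \<in> chart_dom d" using x by (auto simp: overlap_def)
  have p: "c \<in> charts_at M ?p" "d \<in> charts_at M ?p" using cd x' by (simp_all add: charts_at_iff)
  have "gform M c x u v = gform M d (coord d ?p) (coord_vec M c u ?p d) (coord_vec M c v ?p d)"
    unfolding gform_def[of M c] by (intro metric_eq_gform coord_vec_tangent p)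
  then show ?thesis using p cd x' by (simp add: coord_vec_alt transition_def)
qed

lemma smooth_dtrans [smooth_intros]:
  fixes Y W :: "'u::real_normed_vector \<Rightarrow> real^'m"
  assumes cd: "c \<in> atlas M" "d \<in> atlas M" and S: "open S" and Y: "\<And>z. z \<in> S \<Longrightarrow> Y z \<in> overlap c d"
    and sm: "smooth_on S Y" "smooth_on S W"
  shows "smooth_on S (\<lambda>z. dtrans c d (Y z) (W z))"
proof -
  have "smooth_on S (\<lambda>z. \<Sum>b\<in>Basis. (W z \<bullet> b) *\<^sub>R dtrans c d (Y z) b)"
    unfolding dtrans_def
    by (intro smooth_intros S sm smooth_on_compose[OF S open_overlap[OF cd] smooth_on_frechet_derivative[OF smooth_transition[OF cd]] sm(1) Y])
  then show ?thesis
    unfolding dtrans_def using smooth_on_differentiable[OF smooth_transition[OF cd]] Y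
    by (subst smooth_on_cong[OF S]) (auto intro!: frechet_derivative_basis)
qed

lemma dtrans_has_derivative:
  fixes Y W :: "'u::real_normed_vector \<Rightarrow> real^'m"
  assumes cd: "c \<in> atlas M" "d \<in> atlas M" and T: "open T" "z \<in> T" and Y: "\<And>z. z \<in> T \<Longrightarrow> Y z \<in> overlap c d"
    and d: "(Y has_derivative Y') (at z)" "(W has_derivative W') (at z)"
  shows "((\<lambda>z. dtrans c d (Y z) (W z)) has_derivative
    (\<lambda>a. frechet_derivative (\<lambda>y. dtrans c d y (W z)) (at (Y z)) (Y' a) + dtrans c d (Y z) (W' a))) (at z)"
proof (rule has_derivative_linear_family[OF T _ _ open_overlap[OF cd] Y[OF T(2)] _ d])
  show "(\<lambda>y. dtrans c d y w) differentiable at (Y z)" for w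
    by (rule smooth_on_differentiable[of "overlap c d"], unfold dtrans_def,
        rule smooth_on_frechet_derivative[OF smooth_transition[OF cd]], rule Y[OF T(2)])
qed (use linear_dtrans[OF cd] Y in auto)

lemma dtrans_derivative_sym:
  assumes cd: "c \<in> atlas M" "d \<in> atlas M" and x: "x \<in> overlap c d"
  shows "frechet_derivative (\<lambda>y. dtrans c d y v) (at x) u = frechet_derivative (\<lambda>y. dtrans c d y u) (at x) v"
  unfolding dtrans_def by (rule frechet_derivative_commute[OF open_overlap[OF cd] x smooth_transition[OF cd]])

text \<open>Uniqueness of the Levi-Civita connection, in coordinates. Pair the defect
  \<open>T u v\<close> of the law with a third vector w: the result is symmetric in u and v, because
  both connections are torsion-free and second derivatives commute, and skew in v and w, because
  both connections are metric. Such a trilinear form vanishes.\<close>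

lemma christoffel_transform:
  assumes cd: "c \<in> atlas M" "d \<in> atlas M" and x: "x \<in> overlap c d"
  shows "dtrans c d x (christoffel M c x u v) =
    christoffel M d (transition c d x) (dtrans c d x u) (dtrans c d x v) +
    frechet_derivative (\<lambda>y. dtrans c d y v) (at x) u"
proof -
  let ?\<phi> = "transition c d" and ?D = "dtrans c d x"
  define H where "H u v = frechet_derivative (\<lambda>y. dtrans c d y v) (at x) u" for u v
  define T where "T u v = ?D (christoffel M c x u v) - (H u v + christoffel M d (?\<phi> x) (?D u) (?D v))" for u v
  have xc: "x \<in> chart_img c" using x by (simp add: overlap_def)
  have fx: "?\<phi> x \<in> chart_img d" by (rule transition_in_img[OF cd x])
  note O = open_overlap[OF cd]
  have T_sym: "T u v = T v u" for u v
    using dtrans_derivative_sym[OF cd x] christoffel_sym[OF cd(1) xc] christoffel_sym[OF cd(2) fx]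
    unfolding T_def H_def by metis
  have lin: "linear (\<lambda>u. gform M d (?\<phi> x) u w)" "linear (\<lambda>u. gform M d (?\<phi> x) w u)" for w
    by (rule linear_gform_left[OF cd(2) fx] linear_gform_right[OF cd(2) fx])+
  have anti: "gform M d (?\<phi> x) (T u v) (?D w) = - gform M d (?\<phi> x) (T u w) (?D v)" for u v w
  proof -
    \<comment> \<open>The function g(v, w), with constant coefficient vectors in the chart c, is
      differentiated in two ways: directly in c, and through its expression in d.\<close>
    have "((\<lambda>z. gform M c z v w) has_derivative (\<lambda>a. gform M c x (0 + christoffel M c x a v) w +
        gform M c x v (0 + christoffel M c x a w))) (at x)"
      by (rule gform_has_derivative[where S="chart_img c" and Y="\<lambda>z. z"])
        (use cd xc open_chart_img in auto)
    moreover have "((\<lambda>z. gform M c z v w) has_derivative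
        (\<lambda>a. gform M d (?\<phi> x) ((H a v + ?D 0) + christoffel M d (?\<phi> x) (?D a) (?D v)) (?D w) +
        gform M d (?\<phi> x) (?D v) ((H a w + ?D 0) + christoffel M d (?\<phi> x) (?D a) (?D w)))) (at x)"
    proof (rule has_derivative_transform_within_open[OF _ O x])
      show "((\<lambda>z. gform M d (?\<phi> z) (dtrans c d z v) (dtrans c d z w)) has_derivative
        (\<lambda>a. gform M d (?\<phi> x) ((H a v + ?D 0) + christoffel M d (?\<phi> x) (?D a) (?D v)) (?D w) +
        gform M d (?\<phi> x) (?D v) ((H a w + ?D 0) + christoffel M d (?\<phi> x) (?D a) (?D w)))) (at x)"
        unfolding H_def
        by (rule gform_has_derivative[OF cd(2) fx transition_has_derivative[OF cd x] _ _ O x])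
          (rule dtrans_has_derivative[OF cd O x] transition_in_img[OF cd] has_derivative_ident has_derivative_const | assumption)+
      show "gform M d (?\<phi> z) (dtrans c d z v) (dtrans c d z w) = gform M c z v w" if "z \<in> overlap c d" for z
        using gform_transform[OF cd that] by simp
    qed
    ultimately have "(\<lambda>a. gform M c x (0 + christoffel M c x a v) w + gform M c x v (0 + christoffel M c x a w)) =
        (\<lambda>a. gform M d (?\<phi> x) ((H a v + ?D 0) + christoffel M d (?\<phi> x) (?D a) (?D v)) (?D w) +
        gform M d (?\<phi> x) (?D v) ((H a w + ?D 0) + christoffel M d (?\<phi> x) (?D a) (?D w)))"
      by (rule has_derivative_unique)
    from fun_cong[OF this, of u]
    have "gform M d (?\<phi> x) (?D (christoffel M c x u v)) (?D w) + gform M d (?\<phi> x) (?D v) (?D (christoffel M c x u w)) =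
        gform M d (?\<phi> x) (H u v + christoffel M d (?\<phi> x) (?D u) (?D v)) (?D w) +
        gform M d (?\<phi> x) (?D v) (H u w + christoffel M d (?\<phi> x) (?D u) (?D w))"
      using linear_0[OF linear_dtrans[OF cd x]] by (simp add: gform_transform[OF cd x])
    then have "gform M d (?\<phi> x) (T u v) (?D w) + gform M d (?\<phi> x) (?D v) (T u w) = 0"
      unfolding T_def linear_diff[OF lin(1)] linear_diff[OF lin(2)] by linarith
    then show ?thesis using gform_sym[OF cd(2) fx, of "?D v"] by simp
  qed
  \<comment> \<open>Alternating the two symmetries through the six orders of u, v, w returns the
    form to its own negative.\<close>
  have "gform M d (?\<phi> x) (T u v) (?D w) = 0" for u v w
    using anti[of u v w] anti[of w u v] anti[of v w u] T_sym[of u w] T_sym[of w v] T_sym[of v u] by simp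
  then have "gform M d (?\<phi> x) (T u v) w = 0" for w
    using dtrans_surj[OF cd x, of w] by metis
  then have "T u v = 0" by (rule gform_nondegenerate[OF cd(2) fx])
  then show ?thesis by (simp add: T_def H_def)
qed

lemma christoffel_differentiable:
  "c \<in> atlas M \<Longrightarrow> x \<in> chart_img c \<Longrightarrow> (\<lambda>y. christoffel M c y u v) differentiable (at x)"
  by (rule smooth_on_differentiable[of "chart_img c"]) (auto intro!: smooth_intros open_chart_img)

lemma christoffel_has_derivative:
  fixes Y U W :: "'u::real_normed_vector \<Rightarrow> real^'m"
  assumes c: "c \<in> atlas M" and Y: "Y z \<in> chart_img c"
    and d: "(Y has_derivative Y') (at z)" "(U has_derivative U') (at z)" "(W has_derivative W') (at z)"
  shows "((\<lambda>z. christoffel M c (Y z) (U z) (W z)) has_derivative (\<lambda>a.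
    frechet_derivative (\<lambda>y. christoffel M c y (U z) (W z)) (at (Y z)) (Y' a) +
    christoffel M c (Y z) (U' a) (W z) + christoffel M c (Y z) (U z) (W' a))) (at z)"
proof -
  have 1: "((\<lambda>z. christoffel M c (Y z) (U z) w) has_derivative (\<lambda>a.
    frechet_derivative (\<lambda>y. christoffel M c y (U z) w) (at (Y z)) (Y' a) +
    christoffel M c (Y z) (U' a) w)) (at z)" for w
    by (rule has_derivative_linear_family[where B="\<lambda>y u. christoffel M c y u w" and T=UNIV and S=UNIV, OF _ _ _ _ _ _ _ d(1,2)])
      (auto intro: linear_christoffel_left christoffel_differentiable[OF c Y])
  then have 2: "(\<lambda>z. christoffel M c (Y z) (U z) w) differentiable (at z)" for w
    unfolding differentiable_def by blast
  \<comment> \<open>In this second use the base variable of the linear family is z itself, with the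
    first two arguments already inserted.\<close>
  have "((\<lambda>z. christoffel M c (Y z) (U z) (W z)) has_derivative
    (\<lambda>a. frechet_derivative (\<lambda>z'. christoffel M c (Y z') (U z') (W z)) (at z) a + christoffel M c (Y z) (U z) (W' a))) (at z)"
    by (rule has_derivative_linear_family[where B="\<lambda>z w. christoffel M c (Y z) (U z) w" and Y="\<lambda>z. z" and T=UNIV and S=UNIV,
          OF _ _ _ _ _ _ _ has_derivative_ident d(3)])
      (auto intro: linear_christoffel_right 2)
  then show ?thesis
    unfolding frechet_derivative_eqI[OF 1] .
qed

lemma curvature_eq_curv:
  "c \<in> charts_at M p \<Longrightarrow> curvature M p X Y Z c = curv M c (coord c p) (X c) (Y c) (Z c)"
  by (simp add: curvature_def curv_def)

text \<open>A local expression \<open>Y\<close>, in the chart \<open>c\<close>, of a smooth map defined on the open set \<open>S\<close>.\<close>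

context
  fixes c :: "('a, 'm) chart" and Y :: "'u::euclidean_space \<Rightarrow> real^'m" and S :: "'u set"
  assumes c: "c \<in> atlas M" and S: "open S" and Y: "smooth_on S Y" and YS: "\<And>z. z \<in> S \<Longrightarrow> Y z \<in> chart_img c"
begin

lemma smooth_nab [smooth_intros]:
  "smooth_on S W \<Longrightarrow> smooth_on S (\<lambda>z. nab M c Y W a z)"
  unfolding nab_def by (intro smooth_intros c S Y YS)

lemma nab_metric:
  assumes W: "smooth_on S W" and Z: "smooth_on S Z" and z: "z \<in> S"
  shows "((\<lambda>z. gform M c (Y z) (W z) (Z z)) has_derivative (\<lambda>a.
    gform M c (Y z) (nab M c Y W a z) (Z z) + gform M c (Y z) (W z) (nab M c Y Z a z))) (at z)"
  unfolding nab_def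
  by (rule gform_has_derivative[where Y=Y and S=S])
    (use c z S YS smooth_on_has_derivative[OF Y z] smooth_on_has_derivative[OF W z] smooth_on_has_derivative[OF Z z] in auto)

text \<open>Torsion-freeness along a map: mixed second derivatives commute, and the Christoffel term
  is symmetric.\<close>

lemma nab_sym:
  assumes z: "z \<in> S"
  shows "nab M c Y (\<lambda>z. frechet_derivative Y (at z) b) a z = nab M c Y (\<lambda>z. frechet_derivative Y (at z) a) b z"
  unfolding nab_def frechet_derivative_commute[OF S z Y, of a b] christoffel_sym[OF c YS[OF z], of _ "frechet_derivative Y (at z) a"] ..

text \<open>The directions a and b are constant, so no bracket term occurs. Second derivatives
  cancel by their symmetry, the terms with first derivatives of W are together symmetric in a and b,
  and what remains is the coordinate form of the curvature.\<close>

lemma nab_commute: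
  assumes W: "smooth_on S W" and z: "z \<in> S"
  shows "nab M c Y (nab M c Y W b) a z - nab M c Y (nab M c Y W a) b z =
    curv M c (Y z) (frechet_derivative Y (at z) a) (frechet_derivative Y (at z) b) (W z)"
proof -
  let ?Y = "frechet_derivative Y (at z)" and ?W = "frechet_derivative W (at z)" and ?G = "christoffel M c (Y z)"
  let ?DY = "\<lambda>b. frechet_derivative (\<lambda>z. frechet_derivative Y (at z) b) (at z)"
  let ?DW = "\<lambda>b. frechet_derivative (\<lambda>z. frechet_derivative W (at z) b) (at z)"
  have *: "nab M c Y (nab M c Y W b) a z = ?DW b a +
     (frechet_derivative (\<lambda>y. christoffel M c y (?Y b) (W z)) (at (Y z)) (?Y a) +
       ?G (?DY b a) (W z) + ?G (?Y b) (?W a)) + ?G (?Y a) (?W b + ?G (?Y b) (W z))" for a b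
  proof -
    have "(nab M c Y W b has_derivative (\<lambda>a. ?DW b a +
     (frechet_derivative (\<lambda>y. christoffel M c y (?Y b) (W z)) (at (Y z)) (?Y a) +
       ?G (?DY b a) (W z) + ?G (?Y b) (?W a)))) (at z)"
      unfolding nab_def[abs_def]
      by (intro has_derivative_add christoffel_has_derivative c YS z smooth_on_has_derivative[of S] smooth_intros W Y)
    from frechet_derivative_eqI[OF this] show ?thesis
      by (simp only: nab_def[of M c Y "nab M c Y W b"]) (simp add: nab_def)
  qed
  have "?DW b a = ?DW a b" "?DY b a = ?DY a b"
    by (rule frechet_derivative_commute[OF S z W] frechet_derivative_commute[OF S z Y])+
  then show ?thesis
    unfolding * curv_eq by (simp add: christoffel_add_right algebra_simps)
qed

text \<open>The second derivatives of the transition map that the product rule produces are exactly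
  the inhomogeneous term in \<open>christoffel_transform\<close>.\<close>

lemma nab_transform:
  assumes d: "d \<in> atlas M" and Yd: "\<And>z. z \<in> S \<Longrightarrow> Y z \<in> overlap c d" and W: "smooth_on S W" and z: "z \<in> S"
  shows "nab M d (\<lambda>z. transition c d (Y z)) (\<lambda>z. dtrans c d (Y z) (W z)) a z = dtrans c d (Y z) (nab M c Y W a z)"
proof -
  have Y': "(Y has_derivative frechet_derivative Y (at z)) (at z)" by (rule smooth_on_has_derivative[OF Y z])
  have 1: "frechet_derivative (\<lambda>z. transition c d (Y z)) (at z) = (\<lambda>a. dtrans c d (Y z) (frechet_derivative Y (at z) a))"
    by (rule frechet_derivative_eqI, rule has_derivative_compose[OF Y' transition_has_derivative[OF c d Yd[OF z]]])
  have 2: "frechet_derivative (\<lambda>z. dtrans c d (Y z) (W z)) (at z) =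
    (\<lambda>a. frechet_derivative (\<lambda>y. dtrans c d y (W z)) (at (Y z)) (frechet_derivative Y (at z) a)
       + dtrans c d (Y z) (frechet_derivative W (at z) a))"
    by (rule frechet_derivative_eqI, rule dtrans_has_derivative[OF c d S z Yd Y' smooth_on_has_derivative[OF W z]])
  show ?thesis
    unfolding nab_def 1 2 linear_add[OF linear_dtrans[OF c d Yd[OF z]]] christoffel_transform[OF c d Yd[OF z]]
    by simp
qed

end

end

lemma nab_cong:
  assumes "open S" "z \<in> S" "\<And>y. y \<in> S \<Longrightarrow> Y y = Y' y" "\<And>y. y \<in> S \<Longrightarrow> W y = W' y"
  shows "nab M c Y W a z = nab M c Y' W' a z"
proof -
  have "frechet_derivative Y (at z) = frechet_derivative Y' (at z)"
    by (rule frechet_derivative_cong_open[OF assms(1,2)]) (rule assms(3))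
  moreover have "frechet_derivative W (at z) = frechet_derivative W' (at z)"
    by (rule frechet_derivative_cong_open[OF assms(1,2)]) (rule assms(4))
  ultimately show ?thesis using assms(3,4)[OF assms(2)] by (simp add: nab_def)
qed

section \<open>Tensor properties of the curvature\<close>

context riem
begin

text \<open>Curvature is the commutator of covariant derivatives along any map. Taking the plane
  through x in the directions u and v, with the constant field w, and transporting the commutator by
  \<open>nab_transform\<close> avoids third derivatives of the transition map.\<close>

lemma curv_transform:
  assumes cd: "c \<in> atlas M" "d \<in> atlas M" and x: "x \<in> overlap c d"
  shows "curv M d (transition c d x) (dtrans c d x u) (dtrans c d x v) (dtrans c d x w) =
    dtrans c d x (curv M c x u v w)"
proof -
  define Y where "Y z = x + fst z *\<^sub>R u + snd z *\<^sub>R v" for z :: "real \<times> real"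
  define W where "W z = w" for z :: "real \<times> real"
  define a b z0 :: "real \<times> real" where "a = (1, 0)" and "b = (0, 1)" and "z0 = (0, 0)"
  define S where "S = Y -` overlap c d"
  note O = open_overlap[OF cd]
  have Ysm: "smooth_on U Y" if "open U" for U unfolding Y_def by (intro smooth_intros that)
  have Wsm: "smooth_on U W" if "open U" for U unfolding W_def by (intro smooth_intros that)
  have S: "open S"
    unfolding S_def by (rule open_vimage[OF O smooth_on_imp_continuous[OF Ysm[OF open_UNIV]]])
  have YS: "\<And>z. z \<in> S \<Longrightarrow> Y z \<in> overlap c d" by (simp add: S_def)
  then have YS': "\<And>z. z \<in> S \<Longrightarrow> Y z \<in> chart_img c" by (simp add: overlap_def)
  have z0: "z0 \<in> S" "Y z0 = x" using x by (auto simp: S_def Y_def z0_def)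
  have "(Y has_derivative (\<lambda>a. fst a *\<^sub>R u + snd a *\<^sub>R v)) (at z0)"
    unfolding Y_def by (auto intro!: derivative_eq_intros)
  then have DY: "frechet_derivative Y (at z0) = (\<lambda>a. fst a *\<^sub>R u + snd a *\<^sub>R v)"
    by (rule frechet_derivative_eqI)
  let ?Y = "\<lambda>z. transition c d (Y z)"
  have DY': "frechet_derivative ?Y (at z0) = (\<lambda>a. dtrans c d x (frechet_derivative Y (at z0) a))"
    using transition_has_derivative[OF cd x] unfolding z0(2)[symmetric]
    by (intro frechet_derivative_eqI has_derivative_compose[OF smooth_on_has_derivative[OF Ysm[OF S] z0(1)]])
  let ?W = "\<lambda>z. dtrans c d (Y z) (W z)"
  have Y'sm: "smooth_on S ?Y"
    by (rule smooth_on_compose[OF S O smooth_transition[OF cd] Ysm[OF S] YS])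
  have Y'S: "\<And>z. z \<in> S \<Longrightarrow> ?Y z \<in> chart_img d" using transition_in_img[OF cd] YS by blast
  have W'sm: "smooth_on S ?W" by (intro smooth_intros cd S YS Ysm Wsm)
  note N = smooth_nab[OF cd(1) S Ysm[OF S] YS' Wsm[OF S]]
  have nab2: "nab M d ?Y (nab M d ?Y ?W b) a z0 = dtrans c d x (nab M c Y (nab M c Y W b) a z0)" for a b
  proof -
    have "nab M d ?Y (nab M d ?Y ?W b) a z0 = nab M d ?Y (\<lambda>z. dtrans c d (Y z) (nab M c Y W b z)) a z0"
      by (rule nab_cong[OF S z0(1) refl]) (rule nab_transform[OF cd(1) S Ysm[OF S] YS' cd(2) YS Wsm[OF S]])
    also have "\<dots> = dtrans c d x (nab M c Y (nab M c Y W b) a z0)"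
      using nab_transform[OF cd(1) S Ysm[OF S] YS' cd(2) YS N z0(1)] by (simp add: z0(2))
    finally show ?thesis .
  qed
  have "curv M d (?Y z0) (frechet_derivative ?Y (at z0) a) (frechet_derivative ?Y (at z0) b) (?W z0) =
      nab M d ?Y (nab M d ?Y ?W b) a z0 - nab M d ?Y (nab M d ?Y ?W a) b z0"
    by (rule nab_commute[OF cd(2) S Y'sm Y'S W'sm z0(1), symmetric])
  also have "\<dots> = dtrans c d x (nab M c Y (nab M c Y W b) a z0 - nab M c Y (nab M c Y W a) b z0)"
    by (simp only: nab2 linear_diff[OF linear_dtrans[OF cd x]])
  also have "\<dots> = dtrans c d x (curv M c (Y z0) (frechet_derivative Y (at z0) a) (frechet_derivative Y (at z0) b) (W z0))"
    by (simp only: nab_commute[OF cd(1) S Ysm[OF S] YS' Wsm[OF S] z0(1)])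
  finally have "curv M d (?Y z0) (frechet_derivative ?Y (at z0) a) (frechet_derivative ?Y (at z0) b) (?W z0) =
    dtrans c d x (curv M c (Y z0) (frechet_derivative Y (at z0) a) (frechet_derivative Y (at z0) b) (W z0))" .
  then show ?thesis by (simp add: DY DY' z0(2) W_def a_def b_def)
qed

lemma curvature_tangent:
  assumes "X \<in> tangent_space M p" "Y \<in> tangent_space M p" "Z \<in> tangent_space M p"
  shows "curvature M p X Y Z \<in> tangent_space M p"
proof (rule tangent_spaceI[OF chart_at_in])
  fix d assume d: "d \<in> charts_at M p"
  let ?c = "chart_at M p"
  have cd: "?c \<in> atlas M" "d \<in> atlas M" using chart_at_in d by (auto simp: charts_at_iff)
  note tr = tangent_transform[OF _ chart_at_in d]
  show "curvature M p X Y Z d = dtrans ?c d (coord ?c p) (curvature M p X Y Z ?c)"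
    using curv_transform[OF cd overlap_charts_at[OF chart_at_in d]]
    by (simp add: curvature_eq_curv[OF d] curvature_eq_curv[OF chart_at_in] tr[OF assms(1)] tr[OF assms(2)] tr[OF assms(3)]
        transition_coord[OF chart_at_in])
qed (simp add: curvature_def)

lemma frechet_christoffel_linear:
  assumes c: "c \<in> atlas M" and x: "x \<in> chart_img c"
  defines "D \<equiv> \<lambda>v w. frechet_derivative (\<lambda>y. christoffel M c y v w) (at x)"
  shows "D (v + v') w u = D v w u + D v' w u" "D (r *\<^sub>R v) w u = r *\<^sub>R D v w u"
    "D v (w + w') u = D v w u + D v w' u" "D v (r *\<^sub>R w) u = r *\<^sub>R D v w u"
    "D v w (u + u') = D v w u + D v w u'" "D v w (r *\<^sub>R u) = r *\<^sub>R D v w u"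
proof -
  note d = has_derivative_frechet[OF christoffel_differentiable[OF c x]]
  note e = frechet_derivative_eqI[THEN fun_cong, of _ _ x u]
  show "D (v + v') w u = D v w u + D v' w u" "D (r *\<^sub>R v) w u = r *\<^sub>R D v w u"
    "D v (w + w') u = D v w u + D v w' u" "D v (r *\<^sub>R w) u = r *\<^sub>R D v w u"
    unfolding D_def christoffel_add_left christoffel_add_right christoffel_scaleR_left christoffel_scaleR_right
    by (rule e; intro has_derivative_add has_derivative_scaleR_right d)+
  have "linear (D v w)" unfolding D_def by (rule has_derivative_linear[OF d])
  then show "D v w (u + u') = D v w u + D v w u'" "D v w (r *\<^sub>R u) = r *\<^sub>R D v w u"
    by (simp_all add: linear_add linear_scale)
qed

lemma linear_curv:
  assumes "c \<in> atlas M" "x \<in> chart_img c"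
  shows "linear (\<lambda>u. curv M c x u v w)" "linear (\<lambda>v. curv M c x u v w)" "linear (\<lambda>w. curv M c x u v w)"
  by (rule linearI; simp only: curv_eq frechet_christoffel_linear[OF assms]; simp add: christoffel_add_left
      christoffel_add_right christoffel_scaleR_left christoffel_scaleR_right algebra_simps)+

lemma smooth_curv [smooth_intros]:
  fixes Y U V W :: "'u::real_normed_vector \<Rightarrow> real^'m"
  assumes c: "c \<in> atlas M" and S: "open S" and Y: "\<And>z. z \<in> S \<Longrightarrow> Y z \<in> chart_img c"
    and sm: "smooth_on S Y" "smooth_on S U" "smooth_on S V" "smooth_on S W"
  shows "smooth_on S (\<lambda>z. curv M c (Y z) (U z) (V z) (W z))"
proof -
  have "smooth_on (chart_img c) (\<lambda>x. curv M c x u v w)" for u v w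
    unfolding curv_eq by (intro smooth_intros open_chart_img c)
  then have *: "smooth_on S (\<lambda>z. curv M c (Y z) u v w)" for u v w
    by (rule smooth_on_compose[OF S open_chart_img[OF c] _ sm(1) Y])
  have "smooth_on S (\<lambda>z. \<Sum>k\<in>UNIV. W z $ k *\<^sub>R (\<Sum>i\<in>UNIV. \<Sum>j\<in>UNIV. (U z $ i * V z $ j) *\<^sub>R
      curv M c (Y z) (axis i 1) (axis j 1) (axis k 1)))"
    by (intro smooth_intros S sm *)
  moreover have "(\<Sum>k\<in>UNIV. W z $ k *\<^sub>R (\<Sum>i\<in>UNIV. \<Sum>j\<in>UNIV. (U z $ i * V z $ j) *\<^sub>R
      curv M c (Y z) (axis i 1) (axis j 1) (axis k 1))) = curv M c (Y z) (U z) (V z) (W z)" if "z \<in> S" for z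
  proof -
    note L = linear_curv[OF c Y[OF that]]
    have "curv M c (Y z) (U z) (V z) (W z) = curv M c (Y z) (U z) (V z) (\<Sum>k\<in>UNIV. W z $ k *\<^sub>R axis k 1)"
      by (simp only: vec_basis_expansion[symmetric])
    also have "\<dots> = (\<Sum>k\<in>UNIV. W z $ k *\<^sub>R curv M c (Y z) (U z) (V z) (axis k 1))"
      by (simp only: linear_sum[OF L(3)] linear_scale[OF L(3)])
    finally show ?thesis
      by (simp only: bilinear_expand_axis[OF L(1,2), where u="U z" and v="V z", symmetric])
  qed
  ultimately show ?thesis by (subst smooth_on_cong[OF S, symmetric]) auto
qed

context
  fixes c :: "('a, 'm) chart" and Y :: "'u::euclidean_space \<Rightarrow> real^'m" and S :: "'u set"
  assumes c: "c \<in> atlas M" and S: "open S" and Y: "smooth_on S Y" and YS: "\<And>z. z \<in> S \<Longrightarrow> Y z \<in> chart_img c"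
begin

text \<open>The mixed second derivatives of \<open>gform (W, Z)\<close> are symmetric.\<close>

lemma gform_curv_skew:
  fixes a b :: 'u
  assumes W: "smooth_on S W" and Z: "smooth_on S Z" and z: "z \<in> S"
  defines "R \<equiv> curv M c (Y z) (frechet_derivative Y (at z) a) (frechet_derivative Y (at z) b)"
  shows "gform M c (Y z) (R (W z)) (Z z) = - gform M c (Y z) (W z) (R (Z z))"
proof -
  let ?f = "\<lambda>z. gform M c (Y z) (W z) (Z z)" and ?g = "gform M c (Y z)"
  let ?n = "nab M c Y"
  have f: "smooth_on S ?f" by (intro smooth_intros c S YS Y W Z)
  have D2: "frechet_derivative (\<lambda>z. frechet_derivative ?f (at z) b) (at z) a =
     ?g (?n (?n W b) a z) (Z z) + ?g (?n W b z) (?n Z a z) + (?g (?n W a z) (?n Z b z) + ?g (W z) (?n (?n Z b) a z))" for a b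
  proof -
    have "frechet_derivative (\<lambda>z. frechet_derivative ?f (at z) b) (at z) =
      frechet_derivative (\<lambda>z. gform M c (Y z) (?n W b z) (Z z) + gform M c (Y z) (W z) (?n Z b z)) (at z)"
      by (rule frechet_derivative_cong_open[OF S z], rule fun_cong[where x=b], rule frechet_derivative_eqI,
          rule nab_metric[OF c S Y YS W Z])
    also have "\<dots> = (\<lambda>a. ?g (?n (?n W b) a z) (Z z) + ?g (?n W b z) (?n Z a z)
        + (?g (?n W a z) (?n Z b z) + ?g (W z) (?n (?n Z b) a z)))"
      by (rule frechet_derivative_eqI)
        (intro has_derivative_add nab_metric[OF c S Y YS] smooth_nab[OF c S Y YS] W Z z)
    finally show ?thesis by simp
  qed
  have "?g (?n (?n W b) a z - ?n (?n W a) b z) (Z z) + ?g (W z) (?n (?n Z b) a z - ?n (?n Z a) b z) = 0"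
    using frechet_derivative_commute[OF S z f, of a b]
    unfolding D2 linear_diff[OF linear_gform_left[OF c YS[OF z]]] linear_diff[OF linear_gform_right[OF c YS[OF z]]]
    by linarith
  then have "?g (R (W z)) (Z z) + ?g (W z) (R (Z z)) = 0"
    by (simp only: nab_commute[OF c S Y YS W z] nab_commute[OF c S Y YS Z z] R_def)
  then show ?thesis by simp
qed

end

end

section \<open>Sections and forms along a map\<close>

definition ldom :: "('a \<Rightarrow> 'b) \<Rightarrow> ('a, 'm::finite) chart \<Rightarrow> ('b, 'n::finite) chart \<Rightarrow> (real^'m) set" where
  "ldom \<psi> c d = {x \<in> chart_img c. \<psi> (param c x) \<in> chart_dom d}"

definition loc :: "('a \<Rightarrow> 'b) \<Rightarrow> ('a, 'm::finite) chart \<Rightarrow> ('b, 'n::finite) chart \<Rightarrow> real^'m \<Rightarrow> real^'n" where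
  "loc \<psi> c d x = coord d (\<psi> (param c x))"

definition floc :: "('a, 'm::finite) riemannian \<Rightarrow> ('a \<Rightarrow> ('a, 'm) tvec \<Rightarrow> ('b, 'n::finite) tvec) \<Rightarrow>
    ('a, 'm) chart \<Rightarrow> ('b, 'n) chart \<Rightarrow> real^'m \<Rightarrow> real^'m \<Rightarrow> real^'n" where
  "floc M \<theta> c d x u = \<theta> (param c x) (coord_vec M c u (param c x)) d"

definition smooth_fun :: "('a, 'm::finite) riemannian \<Rightarrow> ('a \<Rightarrow> real) \<Rightarrow> bool" where
  "smooth_fun M f \<longleftrightarrow> (\<forall>c\<in>atlas M. smooth_on (chart_img c) (\<lambda>x. f (param c x)))"

text \<open>Smooth \<open>\<psi>\<^sup>-\<^sup>1TN\<close>-valued 1-forms; the value may depend only on the component of the tangent vector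
  in the chart chosen by \<^const>\<open>chart_at\<close>, since \<^const>\<open>cov_form\<close> is also applied to vectors
  not known to be tangent.\<close>

definition form_along ::
  "('a, 'm::finite) riemannian \<Rightarrow> ('b, 'n::finite) riemannian \<Rightarrow> ('a \<Rightarrow> 'b) \<Rightarrow>
    ('a \<Rightarrow> ('a, 'm) tvec \<Rightarrow> ('b, 'n) tvec) \<Rightarrow> bool" where
  "form_along M N \<psi> \<theta> \<longleftrightarrow>
    (\<forall>p. \<forall>v\<in>tangent_space M p. \<theta> p v \<in> tangent_space N (\<psi> p)) \<and>
    (\<forall>p v w. v (chart_at M p) = w (chart_at M p) \<longrightarrow> \<theta> p v = \<theta> p w) \<and>
    (\<forall>p d u v a b. u \<in> tangent_space M p \<longrightarrow> v \<in> tangent_space M p \<longrightarrow>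
       \<theta> p (\<lambda>c. a *\<^sub>R u c + b *\<^sub>R v c) d = a *\<^sub>R \<theta> p u d + b *\<^sub>R \<theta> p v d) \<and>
    (\<forall>c\<in>atlas M. \<forall>d\<in>atlas N. \<forall>u. smooth_on (ldom \<psi> c d) (\<lambda>x. floc M \<theta> c d x u))"

context riem
begin

text \<open>\<open>dir_deriv\<close> is computed in the one chart picked by \<open>chart_at\<close>;
  the chain rule through the transition map carries it to every chart c around p.\<close>

lemma dir_deriv_eq:
  assumes c: "c \<in> charts_at M p" and v: "v \<in> tangent_space M p"
    and f: "(\<lambda>x. f (param c x)) differentiable (at (coord c p))"
  shows "dir_deriv M p v f = frechet_derivative (\<lambda>x. f (param c x)) (at (coord c p)) (v c)"
proof -
  let ?c = "chart_at M p"
  note c0 = chart_at_in[of p]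
  have at: "?c \<in> atlas M" "c \<in> atlas M" using c c0 by (auto simp: charts_at_iff)
  note O = open_overlap[OF at] and x = overlap_charts_at[OF c0 c]
  have "((\<lambda>x. f (param c (transition ?c c x))) has_derivative
      (\<lambda>a. frechet_derivative (\<lambda>x. f (param c x)) (at (coord c p)) (dtrans ?c c (coord ?c p) a))) (at (coord ?c p))"
    using has_derivative_frechet[OF f] unfolding transition_coord[OF c0, of c, symmetric]
    by (rule has_derivative_compose[OF transition_has_derivative[OF at x]])
  then have "((f \<circ> param ?c) has_derivative
      (\<lambda>a. frechet_derivative (\<lambda>x. f (param c x)) (at (coord c p)) (dtrans ?c c (coord ?c p) a))) (at (coord ?c p))"
    by (rule has_derivative_transform_within_open[OF _ O x])
      (use at in \<open>auto simp: overlap_def transition_def\<close>)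
  from fun_cong[OF frechet_derivative_eqI[OF this], of "v ?c"] show ?thesis
    by (simp add: dir_deriv_def Let_def tangent_transform[OF v c0 c, symmetric])
qed

lemma coord_vec_change:
  assumes "c \<in> atlas M" "c' \<in> atlas M" "x \<in> overlap c c'"
  shows "coord_vec M c u (param c x) = coord_vec M c' (dtrans c c' x u) (param c' (transition c c' x))"
    and "param c' (transition c c' x) = param c x"
proof -
  have x: "x \<in> chart_img c" "param c x \<in> chart_dom c'" using assms(3) by (auto simp: overlap_def)
  then have p: "c \<in> charts_at M (param c x)" "c' \<in> charts_at M (param c x)" using assms by (simp_all add: charts_at_iff)
  show eq: "param c' (transition c c' x) = param c x" using assms x by (simp add: transition_def)
  have "coord_vec M c u (param c x) c' = dtrans c c' x u"
    using p x assms(1) by (simp add: coord_vec_alt)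
  then show "coord_vec M c u (param c x) = coord_vec M c' (dtrans c c' x u) (param c' (transition c c' x))"
    unfolding eq using tangent_eq_coord_vec[OF coord_vec_tangent[OF p(1)] p(2)] by metis
qed

end

locale riem_map = M: riem M + N: riem N
  for M :: "('a::{t2_space,second_countable_topology}, 'm::finite) riemannian"
    and N :: "('b::{t2_space,second_countable_topology}, 'n::finite) riemannian" +
  fixes \<psi> :: "'a \<Rightarrow> 'b"
  assumes smooth_map: "smooth_map M N \<psi>"
begin

lemma continuous_psi: "continuous_on UNIV \<psi>"
  using smooth_map by (simp add: smooth_map_def)

lemma open_psi_vimage: "open U \<Longrightarrow> open (\<psi> -` U)"
  using open_vimage[OF _ continuous_psi] .

lemma open_ldom: "c \<in> atlas M \<Longrightarrow> d \<in> atlas N \<Longrightarrow> open (ldom \<psi> c d)"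
  using M.open_param_preimage[OF _ open_psi_vimage[OF N.open_chart_dom]] by (simp add: ldom_def)

lemma smooth_loc: "c \<in> atlas M \<Longrightarrow> d \<in> atlas N \<Longrightarrow> smooth_on (ldom \<psi> c d) (loc \<psi> c d)"
proof -
  have "loc \<psi> c d = coord d \<circ> \<psi> \<circ> param c" by (simp add: fun_eq_iff loc_def)
  then show "c \<in> atlas M \<Longrightarrow> d \<in> atlas N \<Longrightarrow> smooth_on (ldom \<psi> c d) (loc \<psi> c d)"
    using smooth_map by (simp add: smooth_map_def ldom_def)
qed

lemma loc_in: "x \<in> ldom \<psi> c d \<Longrightarrow> loc \<psi> c d x \<in> chart_img d"
  by (simp add: ldom_def loc_def)

lemma ldom_img: "x \<in> ldom \<psi> c d \<Longrightarrow> x \<in> chart_img c"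
  by (simp add: ldom_def)

lemma ldom_charts:
  "c \<in> atlas M \<Longrightarrow> d \<in> atlas N \<Longrightarrow> x \<in> ldom \<psi> c d \<Longrightarrow> c \<in> charts_at M (param c x)"
  "c \<in> atlas M \<Longrightarrow> d \<in> atlas N \<Longrightarrow> x \<in> ldom \<psi> c d \<Longrightarrow> d \<in> charts_at N (\<psi> (param c x))"
  by (simp_all add: ldom_def M.charts_at_iff N.charts_at_iff)

lemma coord_in_ldom:
  "c \<in> charts_at M p \<Longrightarrow> d \<in> charts_at N (\<psi> p) \<Longrightarrow> coord c p \<in> ldom \<psi> c d"
  by (simp add: ldom_def M.charts_at_iff N.charts_at_iff)

lemma loc_coord: "c \<in> charts_at M p \<Longrightarrow> loc \<psi> c d (coord c p) = coord d (\<psi> p)"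
  by (simp add: loc_def M.charts_at_iff)

lemma loc_change_dom:
  "c \<in> atlas M \<Longrightarrow> c' \<in> atlas M \<Longrightarrow> x \<in> overlap c c' \<Longrightarrow> loc \<psi> c' d (transition c c' x) = loc \<psi> c d x"
  by (simp add: loc_def M.coord_vec_change(2))

lemma loc_change_cod:
  "d \<in> atlas N \<Longrightarrow> x \<in> ldom \<psi> c d \<Longrightarrow> loc \<psi> c d' x = transition d d' (loc \<psi> c d x)"
  by (simp add: loc_def ldom_def transition_def)

lemma loc_in_overlap:
  "d \<in> atlas N \<Longrightarrow> x \<in> ldom \<psi> c d \<Longrightarrow> x \<in> ldom \<psi> c d' \<Longrightarrow> loc \<psi> c d x \<in> overlap d d'"
  by (simp add: loc_def ldom_def overlap_def)

lemma section_tangent: "\<sigma> \<in> sections_along M N \<psi> \<Longrightarrow> \<sigma> p \<in> tangent_space N (\<psi> p)"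
  by (simp add: sections_along_def)

lemma section_smooth: "\<sigma> \<in> sections_along M N \<psi> \<Longrightarrow> c \<in> atlas M \<Longrightarrow> d \<in> atlas N \<Longrightarrow>
    smooth_on (ldom \<psi> c d) (\<lambda>x. \<sigma> (param c x) d)"
  by (simp add: sections_along_def ldom_def)

lemma sectionI:
  assumes "\<And>p. \<sigma> p \<in> tangent_space N (\<psi> p)"
    "\<And>c d. c \<in> atlas M \<Longrightarrow> d \<in> atlas N \<Longrightarrow> smooth_on (ldom \<psi> c d) (\<lambda>x. \<sigma> (param c x) d)"
  shows "\<sigma> \<in> sections_along M N \<psi>"
  using assms unfolding sections_along_def ldom_def by blast

lemma differential_loc:
  assumes "c \<in> charts_at M p" "d \<in> charts_at N (\<psi> p)" "v \<in> tangent_space M p"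
  shows "differential M N \<psi> p v d = frechet_derivative (loc \<psi> c d) (at (coord c p)) (v c)"
proof -
  have "(\<lambda>x. (coord d \<circ> \<psi>) (param c x)) = loc \<psi> c d" by (simp add: fun_eq_iff loc_def)
  moreover have "loc \<psi> c d differentiable (at (coord c p))"
    using assms(1,2) by (intro smooth_on_differentiable[OF smooth_loc coord_in_ldom])
      (simp_all add: M.charts_at_iff N.charts_at_iff)
  ultimately show ?thesis
    using M.dir_deriv_eq[OF assms(1,3), of "coord d \<circ> \<psi>"] assms(2) by (simp add: differential_def)
qed

lemma loc_has_derivative:
  assumes "c \<in> atlas M" "d \<in> atlas N" "x \<in> ldom \<psi> c d"
  shows "(loc \<psi> c d has_derivative frechet_derivative (loc \<psi> c d) (at x)) (at x)"
  by (rule smooth_on_has_derivative[OF smooth_loc assms(3)]) (rule assms)+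

lemma differential_tangent:
  assumes v: "v \<in> tangent_space M p"
  shows "differential M N \<psi> p v \<in> tangent_space N (\<psi> p)"
proof (rule N.tangent_spaceI[OF N.chart_at_in])
  fix e assume e: "e \<in> charts_at N (\<psi> p)"
  let ?c = "chart_at M p" and ?d = "chart_at N (\<psi> p)"
  note c = M.chart_at_in[of p] and d = N.chart_at_in[of "\<psi> p"]
  have at: "?c \<in> atlas M" "?d \<in> atlas N" "e \<in> atlas N" using c d e by (auto simp: M.charts_at_iff N.charts_at_iff)
  let ?x = "coord ?c p"
  have x: "?x \<in> ldom \<psi> ?c ?d" "?x \<in> ldom \<psi> ?c e" using c d e by (auto intro: coord_in_ldom)
  have "((\<lambda>x. transition ?d e (loc \<psi> ?c ?d x)) has_derivative
     (\<lambda>a. dtrans ?d e (loc \<psi> ?c ?d ?x) (frechet_derivative (loc \<psi> ?c ?d) (at ?x) a))) (at ?x)"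
    by (rule has_derivative_compose[OF loc_has_derivative[OF at(1,2) x(1)]
          N.transition_has_derivative[OF at(2,3) loc_in_overlap[OF at(2) x]]])
  then have "(loc \<psi> ?c e has_derivative
     (\<lambda>a. dtrans ?d e (loc \<psi> ?c ?d ?x) (frechet_derivative (loc \<psi> ?c ?d) (at ?x) a))) (at ?x)"
    by (rule has_derivative_transform_within_open[OF _ open_ldom[OF at(1,2)] x(1)])
      (rule loc_change_cod[OF at(2), symmetric])
  from frechet_derivative_eqI[OF this]
  show "differential M N \<psi> p v e = dtrans ?d e (coord ?d (\<psi> p)) (differential M N \<psi> p v ?d)"
    by (simp add: differential_loc[OF c d v] differential_loc[OF c e v] loc_coord[OF c])
qed (simp add: differential_def)

lemma cov_along_nab:
  assumes "c \<in> charts_at M p" "d \<in> charts_at N (\<psi> p)" "v \<in> tangent_space M p"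
    and "(\<lambda>x. \<sigma> (param c x) d) differentiable (at (coord c p))"
  shows "cov_along M N \<psi> \<sigma> p v d = nab N d (loc \<psi> c d) (\<lambda>x. \<sigma> (param c x) d) (v c) (coord c p)"
  using assms(1,2) M.dir_deriv_eq[OF assms(1,3), of "\<lambda>q. \<sigma> q d", OF assms(4)]
  by (simp add: cov_along_def nab_def differential_loc[OF assms(1-3)] loc_coord M.charts_at_iff)

text \<open>\<open>nab_transform\<close> for the local expression of \<psi>: only the chart of N
  changes, and the two fields need to match only where both local expressions exist.\<close>

lemma nab_loc_change:
  assumes at: "c \<in> atlas M" "d \<in> atlas N" "e \<in> atlas N" and x: "x \<in> ldom \<psi> c d" "x \<in> ldom \<psi> c e"
    and W: "smooth_on (ldom \<psi> c d) W"
    and W': "\<And>x. x \<in> ldom \<psi> c d \<Longrightarrow> x \<in> ldom \<psi> c e \<Longrightarrow> W' x = dtrans d e (loc \<psi> c d x) (W x)"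
  shows "nab N e (loc \<psi> c e) W' a x = dtrans d e (loc \<psi> c d x) (nab N d (loc \<psi> c d) W a x)"
proof -
  let ?S = "ldom \<psi> c d \<inter> ldom \<psi> c e"
  have S: "open ?S" by (intro open_Int open_ldom at)
  have "nab N e (loc \<psi> c e) W' a x = nab N e (\<lambda>x. transition d e (loc \<psi> c d x)) (\<lambda>x. dtrans d e (loc \<psi> c d x) (W x)) a x"
    by (rule nab_cong[OF S]) (simp_all add: x W' loc_change_cod[OF at(2), of _ c e])
  also have "\<dots> = dtrans d e (loc \<psi> c d x) (nab N d (loc \<psi> c d) W a x)"
    by (rule N.nab_transform[OF at(2) S _ _ at(3)])
      (simp_all add: x smooth_on_subset[OF W] smooth_on_subset[OF smooth_loc[OF at(1,2)]] loc_in
        loc_in_overlap[OF at(2), of _ c e])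
  finally show ?thesis .
qed

lemma section_change:
  assumes "\<sigma> \<in> sections_along M N \<psi>" "c \<in> atlas M" "d \<in> atlas N" "e \<in> atlas N" "x \<in> ldom \<psi> c d" "x \<in> ldom \<psi> c e"
  shows "\<sigma> (param c x) e = dtrans d e (loc \<psi> c d x) (\<sigma> (param c x) d)"
  using N.tangent_transform[OF section_tangent[OF assms(1)] ldom_charts(2)[OF assms(2,3,5)] ldom_charts(2)[OF assms(2,4,6)]]
  by (simp add: loc_def)

lemma section_differentiable:
  assumes "\<sigma> \<in> sections_along M N \<psi>" "c \<in> charts_at M p" "d \<in> charts_at N (\<psi> p)"
  shows "(\<lambda>x. \<sigma> (param c x) d) differentiable (at (coord c p))"
  by (rule smooth_on_differentiable[OF section_smooth[OF assms(1)] coord_in_ldom[OF assms(2,3)]])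
    (use assms in \<open>simp_all add: M.charts_at_iff N.charts_at_iff\<close>)

lemma section_cov_along:
  assumes "\<sigma> \<in> sections_along M N \<psi>" "c \<in> charts_at M p" "d \<in> charts_at N (\<psi> p)" "v \<in> tangent_space M p"
  shows "cov_along M N \<psi> \<sigma> p v d = nab N d (loc \<psi> c d) (\<lambda>x. \<sigma> (param c x) d) (v c) (coord c p)"
  by (intro cov_along_nab section_differentiable assms)

lemma cov_along_tangent:
  assumes \<sigma>: "\<sigma> \<in> sections_along M N \<psi>" and v: "v \<in> tangent_space M p"
  shows "cov_along M N \<psi> \<sigma> p v \<in> tangent_space N (\<psi> p)"
proof (rule N.tangent_spaceI[OF N.chart_at_in])
  fix e assume e: "e \<in> charts_at N (\<psi> p)"
  let ?c = "chart_at M p" and ?d = "chart_at N (\<psi> p)"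
  note c = M.chart_at_in[of p] and d = N.chart_at_in[of "\<psi> p"]
  have at: "?c \<in> atlas M" "?d \<in> atlas N" "e \<in> atlas N" using c d e by (auto simp: M.charts_at_iff N.charts_at_iff)
  show "cov_along M N \<psi> \<sigma> p v e = dtrans ?d e (coord ?d (\<psi> p)) (cov_along M N \<psi> \<sigma> p v ?d)"
    unfolding section_cov_along[OF \<sigma> c e v] section_cov_along[OF \<sigma> c d v] loc_coord[OF c, symmetric]
    by (rule nab_loc_change[OF at coord_in_ldom[OF c d] coord_in_ldom[OF c e] section_smooth[OF \<sigma> at(1,2)]
          section_change[OF \<sigma> at]])
qed (simp add: cov_along_def)

lemma formD:
  assumes "form_along M N \<psi> \<theta>"
  shows "v \<in> tangent_space M p \<Longrightarrow> \<theta> p v \<in> tangent_space N (\<psi> p)"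
    and "v (chart_at M p) = w (chart_at M p) \<Longrightarrow> \<theta> p v = \<theta> p w"
    and "u \<in> tangent_space M p \<Longrightarrow> v \<in> tangent_space M p \<Longrightarrow>
       \<theta> p (\<lambda>c. a *\<^sub>R u c + b *\<^sub>R v c) e = a *\<^sub>R \<theta> p u e + b *\<^sub>R \<theta> p v e"
    and "c \<in> atlas M \<Longrightarrow> d \<in> atlas N \<Longrightarrow> smooth_on (ldom \<psi> c d) (\<lambda>x. floc M \<theta> c d x w')"
  using assms unfolding form_along_def by blast+

lemma floc_linear:
  assumes \<theta>: "form_along M N \<psi> \<theta>" and c: "c \<in> atlas M" and x: "x \<in> chart_img c"
  shows "linear (floc M \<theta> c d x)"
proof -
  have *: "floc M \<theta> c d x (a *\<^sub>R u + b *\<^sub>R v) = a *\<^sub>R floc M \<theta> c d x u + b *\<^sub>R floc M \<theta> c d x v" for a b u v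
    unfolding floc_def M.coord_vec_lincomb[OF c x]
    by (intro formD(3)[OF \<theta>] M.coord_vec_tangent M.chart_at_param[OF c x])
  show ?thesis
    using *[of 1 _ 1] *[of _ _ 0 0] by (intro linearI) (metis scaleR_one, metis add.right_neutral scaleR_zero_left)
qed

lemma form_floc:
  assumes "form_along M N \<psi> \<theta>" "c \<in> charts_at M p" "v \<in> tangent_space M p"
  shows "\<theta> p v d = floc M \<theta> c d (coord c p) (v c)"
  using assms(2) M.tangent_eq_coord_vec[OF assms(3,2), symmetric] by (simp add: floc_def M.charts_at_iff)

lemma smooth_floc [smooth_intros]:
  assumes \<theta>: "form_along M N \<psi> \<theta>" and at: "c \<in> atlas M" "d \<in> atlas N" and U: "smooth_on (ldom \<psi> c d) U"
  shows "smooth_on (ldom \<psi> c d) (\<lambda>x. floc M \<theta> c d x (U x))"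
proof -
  have "smooth_on (ldom \<psi> c d) (\<lambda>x. \<Sum>i\<in>UNIV. U x $ i *\<^sub>R floc M \<theta> c d x (axis i 1))"
    by (intro smooth_intros open_ldom at U formD(4)[OF \<theta>])
  moreover have "(\<Sum>i\<in>UNIV. U x $ i *\<^sub>R floc M \<theta> c d x (axis i 1)) = floc M \<theta> c d x (U x)"
    if "x \<in> ldom \<psi> c d" for x
    by (subst (3) vec_basis_expansion)
      (simp add: linear_sum[OF floc_linear[OF \<theta> at(1) ldom_img[OF that]]] linear_scale[OF floc_linear[OF \<theta> at(1) ldom_img[OF that]]])
  ultimately show ?thesis by (subst smooth_on_cong[OF open_ldom[OF at], symmetric]) auto
qed

lemma floc_differential:
  assumes at: "c \<in> atlas M" "d \<in> atlas N" and x: "x \<in> ldom \<psi> c d"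
  shows "floc M (differential M N \<psi>) c d x u = frechet_derivative (loc \<psi> c d) (at x) u"
  using ldom_charts[OF at x] ldom_img[OF x] at
  by (simp add: floc_def differential_loc M.coord_vec_tangent M.coord_vec_self)

lemma form_differential: "form_along M N \<psi> (differential M N \<psi>)"
  unfolding form_along_def
proof (intro conjI allI impI ballI)
  show "differential M N \<psi> p v \<in> tangent_space N (\<psi> p)" if "v \<in> tangent_space M p" for p v
    by (rule differential_tangent[OF that])
  show "differential M N \<psi> p v = differential M N \<psi> p w" if "v (chart_at M p) = w (chart_at M p)" for p v w
    using that by (simp add: differential_def dir_deriv_def Let_def fun_eq_iff)
  show "differential M N \<psi> p (\<lambda>c. a *\<^sub>R u c + b *\<^sub>R v c) d = a *\<^sub>R differential M N \<psi> p u d + b *\<^sub>R differential M N \<psi> p v d"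
    if uv: "u \<in> tangent_space M p" "v \<in> tangent_space M p" for p d u v a b
  proof (cases "d \<in> charts_at N (\<psi> p)")
    case True
    note c = M.chart_at_in[of p]
    have at: "chart_at M p \<in> atlas M" "d \<in> atlas N" using c True by (auto simp: M.charts_at_iff N.charts_at_iff)
    note L = has_derivative_linear[OF loc_has_derivative[OF at coord_in_ldom[OF c True]]]
    show ?thesis
      by (simp add: differential_loc[OF c True] uv M.tangent_lincomb linear_add[OF L] linear_scale[OF L])
  qed (simp add: differential_def)
  show "smooth_on (ldom \<psi> c d) (\<lambda>x. floc M (differential M N \<psi>) c d x u)" if at: "c \<in> atlas M" "d \<in> atlas N" for c d u
    by (subst smooth_on_cong[OF open_ldom[OF at] floc_differential[OF at]])
      (auto intro!: smooth_on_frechet_derivative smooth_loc open_ldom at)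
qed

lemma floc_cov_along:
  assumes \<sigma>: "\<sigma> \<in> sections_along M N \<psi>" and at: "c \<in> atlas M" "d \<in> atlas N" and x: "x \<in> ldom \<psi> c d"
  shows "floc M (cov_along M N \<psi> \<sigma>) c d x u = nab N d (loc \<psi> c d) (\<lambda>x. \<sigma> (param c x) d) u x"
  using section_cov_along[OF \<sigma> ldom_charts[OF at x] M.coord_vec_tangent[OF ldom_charts(1)[OF at x]]] ldom_charts[OF at x] ldom_img[OF x] at
  by (simp add: floc_def M.coord_vec_self)

lemma form_cov_along:
  assumes \<sigma>: "\<sigma> \<in> sections_along M N \<psi>"
  shows "form_along M N \<psi> (cov_along M N \<psi> \<sigma>)"
  unfolding form_along_def
proof (intro conjI allI impI ballI)
  show "cov_along M N \<psi> \<sigma> p v \<in> tangent_space N (\<psi> p)" if "v \<in> tangent_space M p" for p v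
    by (rule cov_along_tangent[OF \<sigma> that])
  show "cov_along M N \<psi> \<sigma> p v = cov_along M N \<psi> \<sigma> p w" if "v (chart_at M p) = w (chart_at M p)" for p v w
    using that by (simp add: cov_along_def differential_def dir_deriv_def Let_def fun_eq_iff)
  show "cov_along M N \<psi> \<sigma> p (\<lambda>c. a *\<^sub>R u c + b *\<^sub>R v c) d = a *\<^sub>R cov_along M N \<psi> \<sigma> p u d + b *\<^sub>R cov_along M N \<psi> \<sigma> p v d"
    if uv: "u \<in> tangent_space M p" "v \<in> tangent_space M p" for p d u v a b
  proof (cases "d \<in> charts_at N (\<psi> p)")
    case True
    note c = M.chart_at_in[of p]
    have at: "chart_at M p \<in> atlas M" "d \<in> atlas N" using c True by (auto simp: M.charts_at_iff N.charts_at_iff)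
    note L = has_derivative_linear[OF loc_has_derivative[OF at coord_in_ldom[OF c True]]]
    note L2 = linear_frechet_derivative[OF section_differentiable[OF \<sigma> c True]]
    show ?thesis
      by (simp add: section_cov_along[OF \<sigma> c True] uv M.tangent_lincomb nab_def
          linear_add[OF L] linear_scale[OF L] linear_add[OF L2] linear_scale[OF L2]
          christoffel_add_left christoffel_scaleR_left algebra_simps)
  qed (simp add: cov_along_def)
  show "smooth_on (ldom \<psi> c d) (\<lambda>x. floc M (cov_along M N \<psi> \<sigma>) c d x u)" if at: "c \<in> atlas M" "d \<in> atlas N" for c d u
    by (subst smooth_on_cong[OF open_ldom[OF at] floc_cov_along[OF \<sigma> at]])
      (auto intro!: N.smooth_nab[OF at(2) open_ldom[OF at] smooth_loc[OF at]] section_smooth[OF \<sigma> at] loc_in)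
qed

end

text \<open>Coordinates of the covariant derivative of the form in the direction v, evaluated on u.
  The vector u is extended with constant coefficients, and the covariant derivative of this
  extension is the Christoffel term inside the subtracted value.\<close>

definition tloc :: "('a, 'm::finite) riemannian \<Rightarrow> ('b, 'n::finite) riemannian \<Rightarrow> ('a \<Rightarrow> 'b) \<Rightarrow>
    ('a \<Rightarrow> ('a, 'm) tvec \<Rightarrow> ('b, 'n) tvec) \<Rightarrow> ('a, 'm) chart \<Rightarrow> ('b, 'n) chart \<Rightarrow>
    real^'m \<Rightarrow> real^'m \<Rightarrow> real^'m \<Rightarrow> real^'n" where
  "tloc M N \<psi> \<theta> c d x u v = nab N d (loc \<psi> c d) (\<lambda>x. floc M \<theta> c d x u) v x
     - floc M \<theta> c d x (christoffel M c x v u)"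

lemma smooth_funD: "smooth_fun M f \<Longrightarrow> c \<in> atlas M \<Longrightarrow> smooth_on (chart_img c) (\<lambda>x. f (param c x))"
  by (simp add: smooth_fun_def)

section \<open>Smooth real functions on a manifold\<close>

context riem
begin

lemma smooth_fun_add: "smooth_fun M f \<Longrightarrow> smooth_fun M g \<Longrightarrow> smooth_fun M (\<lambda>p. f p + g p)"
  unfolding smooth_fun_def by (auto intro!: smooth_intros open_chart_img)

lemma smooth_fun_mult: "smooth_fun M f \<Longrightarrow> smooth_fun M g \<Longrightarrow> smooth_fun M (\<lambda>p. f p * g p)"
  unfolding smooth_fun_def by (auto intro!: smooth_intros open_chart_img)

lemma smooth_fun_const: "smooth_fun M (\<lambda>p. r)"
  unfolding smooth_fun_def by (auto intro!: smooth_intros open_chart_img)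

lemma smooth_fun_powr: "smooth_fun M f \<Longrightarrow> (\<And>p. f p > 0) \<Longrightarrow> smooth_fun M (\<lambda>p. f p powr a)"
  unfolding smooth_fun_def by (auto intro!: smooth_intros open_chart_img)

lemma smooth_fun_continuous:
  assumes "smooth_fun M f"
  shows "continuous_on UNIV f"
proof -
  have "continuous_on (chart_dom c) f" if c: "c \<in> atlas M" for c
  proof -
    have "continuous_on (chart_img c) (\<lambda>x. f (param c x))"
      by (rule smooth_on_imp_continuous[OF smooth_funD[OF assms c]])
    then have "continuous_on (chart_dom c) (\<lambda>p. f (param c (coord c p)))"
      by (rule continuous_on_compose2[OF _ continuous_coord[OF c]]) (simp add: image_subset_iff)
    then show ?thesis
      by (rule continuous_on_eq) (simp add: c)
  qed
  then have "continuous_on (\<Union>(chart_dom ` atlas M)) f"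
    by (intro continuous_on_open_Union) (auto intro: open_chart_dom)
  moreover have "\<Union>(chart_dom ` atlas M) = UNIV" using ex_chart by blast
  ultimately show ?thesis by simp
qed

end

context riem_map
begin

lemma form_scale:
  assumes \<theta>: "form_along M N \<psi> \<theta>" and f: "smooth_fun M f"
  shows "form_along M N \<psi> (\<lambda>q v d. f q *\<^sub>R \<theta> q v d)"
  unfolding form_along_def
proof (intro conjI allI impI ballI)
  show "(\<lambda>d. f p *\<^sub>R \<theta> p v d) \<in> tangent_space N (\<psi> p)" if "v \<in> tangent_space M p" for p v
    by (intro N.tangent_scaleR formD(1)[OF \<theta>] that)
  show "(\<lambda>d. f p *\<^sub>R \<theta> p v d) = (\<lambda>d. f p *\<^sub>R \<theta> p w d)" if "v (chart_at M p) = w (chart_at M p)" for p v w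
    using formD(2)[OF \<theta>, of v p w, OF that] by simp
  show "f p *\<^sub>R \<theta> p (\<lambda>c. a *\<^sub>R u c + b *\<^sub>R v c) d = a *\<^sub>R f p *\<^sub>R \<theta> p u d + b *\<^sub>R f p *\<^sub>R \<theta> p v d"
    if "u \<in> tangent_space M p" "v \<in> tangent_space M p" for p d u v a b
    unfolding formD(3)[OF \<theta> that] by (simp add: algebra_simps)
  show "smooth_on (ldom \<psi> c d) (\<lambda>x. floc M (\<lambda>q v d. f q *\<^sub>R \<theta> q v d) c d x u)"
    if at: "c \<in> atlas M" "d \<in> atlas N" for c d u
  proof -
    have "smooth_on (ldom \<psi> c d) (\<lambda>x. f (param c x))"
      by (rule smooth_on_subset[OF smooth_funD[OF f at(1)]]) (auto simp: ldom_img)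
    then have "smooth_on (ldom \<psi> c d) (\<lambda>x. f (param c x) *\<^sub>R floc M \<theta> c d x u)"
      by (intro smooth_intros open_ldom at formD(4)[OF \<theta>])
    then show ?thesis by (simp add: floc_def)
  qed
qed

lemma section_scale:
  assumes \<sigma>: "\<sigma> \<in> sections_along M N \<psi>" and f: "smooth_fun M f"
  shows "(\<lambda>q d. f q *\<^sub>R \<sigma> q d) \<in> sections_along M N \<psi>"
proof (rule sectionI)
  show "smooth_on (ldom \<psi> c d) (\<lambda>x. f (param c x) *\<^sub>R \<sigma> (param c x) d)"
    if at: "c \<in> atlas M" "d \<in> atlas N" for c d
    by (intro smooth_intros open_ldom at section_smooth[OF \<sigma>]
        smooth_on_subset[OF smooth_funD[OF f at(1)]]) (auto simp: ldom_img)
qed (intro N.tangent_scaleR section_tangent[OF \<sigma>])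

lemma section_add:
  assumes "\<sigma> \<in> sections_along M N \<psi>" "\<tau> \<in> sections_along M N \<psi>"
  shows "(\<lambda>q d. \<sigma> q d + \<tau> q d) \<in> sections_along M N \<psi>"
  by (rule sectionI) (intro N.tangent_add section_tangent assms smooth_intros open_ldom section_smooth | assumption)+

lemma smooth_funI:
  assumes "\<And>c d. c \<in> atlas M \<Longrightarrow> d \<in> atlas N \<Longrightarrow> smooth_on (ldom \<psi> c d) (\<lambda>x. f (param c x))"
  shows "smooth_fun M f"
  unfolding smooth_fun_def
proof
  fix c assume c: "c \<in> atlas M"
  show "smooth_on (chart_img c) (\<lambda>x. f (param c x))"
  proof (rule smooth_on_locally)
    fix x assume x: "x \<in> chart_img c"
    obtain d where d: "d \<in> atlas N" "\<psi> (param c x) \<in> chart_dom d" using N.ex_chart by blast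
    then show "\<exists>T. open T \<and> x \<in> T \<and> smooth_on T (\<lambda>x. f (param c x))"
      using open_ldom[OF c d(1)] assms[OF c d(1)] x by (intro exI[of _ "ldom \<psi> c d"]) (simp add: ldom_def)
  qed
qed

lemma metric_loc:
  assumes "\<sigma> p \<in> tangent_space N (\<psi> p)" "\<tau> p \<in> tangent_space N (\<psi> p)" "c \<in> charts_at M p" "d \<in> charts_at N (\<psi> p)"
  shows "metric N (\<psi> p) (\<sigma> p) (\<tau> p) = gform N d (loc \<psi> c d (coord c p)) (\<sigma> p d) (\<tau> p d)"
  unfolding loc_coord[OF assms(3)] by (rule N.metric_eq_gform[OF assms(1,2,4)])

lemma smooth_fun_metric:
  assumes "\<sigma> \<in> sections_along M N \<psi>" "\<tau> \<in> sections_along M N \<psi>"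
  shows "smooth_fun M (\<lambda>p. metric N (\<psi> p) (\<sigma> p) (\<tau> p))"
proof (rule smooth_funI)
  fix c d assume at: "c \<in> atlas M" "d \<in> atlas N"
  have "smooth_on (ldom \<psi> c d) (\<lambda>x. gform N d (loc \<psi> c d x) (\<sigma> (param c x) d) (\<tau> (param c x) d))"
    by (intro smooth_intros at open_ldom loc_in smooth_loc section_smooth assms)
  moreover have "metric N (\<psi> (param c x)) (\<sigma> (param c x)) (\<tau> (param c x)) =
      gform N d (loc \<psi> c d x) (\<sigma> (param c x) d) (\<tau> (param c x) d)" if "x \<in> ldom \<psi> c d" for x
    using metric_loc[of \<sigma> "param c x" \<tau>, OF section_tangent[OF assms(1)] section_tangent[OF assms(2)] ldom_charts[OF at that]] ldom_img[OF that] at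
    by simp
  ultimately show "smooth_on (ldom \<psi> c d) (\<lambda>x. metric N (\<psi> (param c x)) (\<sigma> (param c x)) (\<tau> (param c x)))"
    by (subst smooth_on_cong[OF open_ldom[OF at]]) auto
qed

lemma hs_inner_frame:
  assumes \<theta>: "form_along M N \<psi> \<theta>" and \<eta>: "form_along M N \<psi> \<eta>"
    and c: "c \<in> charts_at M p" and d: "d \<in> charts_at N (\<psi> p)"
  defines "x \<equiv> coord c p"
  shows "hs_inner M N \<psi> p (\<theta> p) (\<eta> p) =
    (\<Sum>i\<in>UNIV. gform N d (loc \<psi> c d x) (floc M \<theta> c d x (frame_at M p i c)) (floc M \<eta> c d x (frame_at M p i c)))"
  unfolding hs_inner_def x_def
  by (simp add: N.metric_eq_gform[OF formD(1)[OF \<theta> M.frame_at_tangent] formD(1)[OF \<eta> M.frame_at_tangent] d]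
      form_floc[OF \<theta> c M.frame_at_tangent] form_floc[OF \<eta> c M.frame_at_tangent] loc_coord[OF c])

text \<open>The frame disappears in favour of the inverse Gram matrix; since frames need not vary
  smoothly, this is the version that shows \<open>hs_inner\<close> to be smooth.\<close>

lemma hs_inner_loc:
  assumes \<theta>: "form_along M N \<psi> \<theta>" and \<eta>: "form_along M N \<psi> \<eta>"
    and at: "c \<in> atlas M" "d \<in> atlas N" and x: "x \<in> ldom \<psi> c d"
  shows "hs_inner M N \<psi> (param c x) (\<theta> (param c x)) (\<eta> (param c x)) =
    (\<Sum>k\<in>UNIV. \<Sum>l\<in>UNIV. matrix_inv (gram M c x) $ k $ l *
      gform N d (loc \<psi> c d x) (floc M \<theta> c d x (axis k 1)) (floc M \<eta> c d x (axis l 1)))"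
proof -
  let ?B = "\<lambda>u v. gform N d (loc \<psi> c d x) (floc M \<theta> c d x u) (floc M \<eta> c d x v)"
  have L: "linear (\<lambda>u. ?B u v)" "linear (\<lambda>v. ?B u v)" for u v
    using linear_compose[OF floc_linear[OF \<theta> at(1) ldom_img[OF x]] N.linear_gform_left[OF at(2) loc_in[OF x]]]
      linear_compose[OF floc_linear[OF \<eta> at(1) ldom_img[OF x]] N.linear_gform_right[OF at(2) loc_in[OF x]]]
    by (simp_all add: o_def)
  note ch = ldom_charts[OF at x]
  have "hs_inner M N \<psi> (param c x) (\<theta> (param c x)) (\<eta> (param c x)) =
      (\<Sum>i\<in>UNIV. ?B (frame_at M (param c x) i c) (frame_at M (param c x) i c))"
    using hs_inner_frame[OF \<theta> \<eta> ch] at ldom_img[OF x] by simp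
  also have "\<dots> = (\<Sum>k\<in>UNIV. \<Sum>l\<in>UNIV. matrix_inv (gram M c x) $ k $ l *\<^sub>R ?B (axis k 1) (axis l 1))"
    by (rule sum_frame_bilinear[OF L]) (use M.frame_at_ginv[OF ch(1)] at ldom_img[OF x] in simp)
  finally show ?thesis by simp
qed

lemma smooth_fun_hs_inner:
  assumes \<theta>: "form_along M N \<psi> \<theta>" and \<eta>: "form_along M N \<psi> \<eta>"
  shows "smooth_fun M (\<lambda>p. hs_inner M N \<psi> p (\<theta> p) (\<eta> p))"
proof (rule smooth_funI)
  fix c d assume at: "c \<in> atlas M" "d \<in> atlas N"
  have "smooth_on (ldom \<psi> c d) (\<lambda>x. \<Sum>k\<in>UNIV. \<Sum>l\<in>UNIV. matrix_inv (gram M c x) $ k $ l *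
      gform N d (loc \<psi> c d x) (floc M \<theta> c d x (axis k 1)) (floc M \<eta> c d x (axis l 1)))"
    by (intro smooth_intros at open_ldom loc_in smooth_loc \<theta> \<eta> smooth_on_subset[OF M.smooth_ginv])
      (auto simp: ldom_img)
  then show "smooth_on (ldom \<psi> c d) (\<lambda>x. hs_inner M N \<psi> (param c x) (\<theta> (param c x)) (\<eta> (param c x)))"
    by (subst smooth_on_cong[OF open_ldom[OF at]]) (auto simp: hs_inner_loc[OF \<theta> \<eta> at])
qed

lemma hs_inner_nonneg:
  assumes "form_along M N \<psi> \<theta>"
  shows "hs_inner M N \<psi> p (\<theta> p) (\<theta> p) \<ge> 0"
  unfolding hs_inner_def
proof (rule sum_nonneg)
  fix i
  let ?v = "\<theta> p (frame_at M p i)"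
  have v: "?v \<in> tangent_space N (\<psi> p)" by (rule formD(1)[OF assms M.frame_at_tangent])
  show "metric N (\<psi> p) ?v ?v \<ge> 0"
  proof (cases "?v = (\<lambda>_. 0)")
    case True
    then show ?thesis using N.metric_lincomb_left[OF v v v, of 0 0] by simp
  next
    case False
    then show ?thesis using N.metric_pos[OF v] by simp
  qed
qed

lemma hs_norm_sq:
  assumes "form_along M N \<psi> \<theta>"
  shows "(hs_norm M N \<psi> p (\<theta> p))\<^sup>2 = hs_inner M N \<psi> p (\<theta> p) (\<theta> p)"
  using hs_inner_nonneg[OF assms] by (simp add: hs_norm_def)

lemma floc_change:
  assumes at: "c \<in> atlas M" "c' \<in> atlas M" and x: "x \<in> overlap c c'"
  shows "floc M \<theta> c d x u = floc M \<theta> c' d (transition c c' x) (dtrans c c' x u)"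
  unfolding floc_def M.coord_vec_change(1)[OF at x] M.coord_vec_change(2)[OF at x] ..

lemma floc_change_cod:
  assumes \<theta>: "form_along M N \<psi> \<theta>" and at: "c \<in> atlas M" "d \<in> atlas N" "e \<in> atlas N"
    and x: "x \<in> ldom \<psi> c d" "x \<in> ldom \<psi> c e"
  shows "floc M \<theta> c e x u = dtrans d e (loc \<psi> c d x) (floc M \<theta> c d x u)"
  using N.tangent_transform[OF formD(1)[OF \<theta> M.coord_vec_tangent[OF ldom_charts(1)[OF at(1,2) x(1)]]]
      ldom_charts(2)[OF at(1,2) x(1)] ldom_charts(2)[OF at(1,3) x(2)]]
  by (simp add: floc_def loc_def)

lemma tloc_change_cod:
  assumes \<theta>: "form_along M N \<psi> \<theta>" and at: "c \<in> atlas M" "d \<in> atlas N" "e \<in> atlas N"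
    and x: "x \<in> ldom \<psi> c d" "x \<in> ldom \<psi> c e"
  shows "tloc M N \<psi> \<theta> c e x u v = dtrans d e (loc \<psi> c d x) (tloc M N \<psi> \<theta> c d x u v)"
proof -
  have "nab N e (loc \<psi> c e) (\<lambda>x. floc M \<theta> c e x u) v x =
      dtrans d e (loc \<psi> c d x) (nab N d (loc \<psi> c d) (\<lambda>x. floc M \<theta> c d x u) v x)"
    by (rule nab_loc_change[OF at x formD(4)[OF \<theta> at(1,2)]]) (rule floc_change_cod[OF \<theta> at])
  then show ?thesis
    by (simp only: tloc_def floc_change_cod[OF \<theta> at x, of "christoffel M c x v u"]
        linear_diff[OF N.linear_dtrans[OF at(2,3) loc_in_overlap[OF at(2) x]]])
qed

text \<open>A change of chart in M produces a second derivative of the transition map in the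
  derivative of the coefficients, and another one through the Christoffel symbols of M; in
  \<open>tloc\<close> the two cancel.\<close>

lemma tloc_change_dom:
  assumes \<theta>: "form_along M N \<psi> \<theta>" and at: "c \<in> atlas M" "c' \<in> atlas M" "d \<in> atlas N"
    and x: "x \<in> overlap c c'" "x \<in> ldom \<psi> c d"
  defines "y \<equiv> transition c c' x" and "D \<equiv> dtrans c c' x"
  shows "tloc M N \<psi> \<theta> c d x u v = tloc M N \<psi> \<theta> c' d y (D u) (D v)"
proof -
  note O = M.open_overlap[OF at(1,2)]
  let ?S = "overlap c c' \<inter> ldom \<psi> c d"
  have S: "open ?S" "x \<in> ?S" using O open_ldom[OF at(1,3)] x by auto
  have y: "transition c c' z \<in> ldom \<psi> c' d" if "z \<in> ?S" for z
    using that M.transition_in_img[OF at(1,2)] M.coord_vec_change(2)[OF at(1,2)] by (auto simp: ldom_def)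
  note T = M.transition_has_derivative[OF at(1,2) x(1)]
  have "((\<lambda>x. loc \<psi> c' d (transition c c' x)) has_derivative (\<lambda>a. frechet_derivative (loc \<psi> c' d) (at y) (D a))) (at x)"
    unfolding y_def D_def
    by (rule has_derivative_compose[OF T loc_has_derivative[OF at(2,3) y[OF S(2)]]])
  then have "(loc \<psi> c d has_derivative (\<lambda>a. frechet_derivative (loc \<psi> c' d) (at y) (D a))) (at x)"
    by (rule has_derivative_transform_within_open[OF _ O x(1)]) (rule loc_change_dom[OF at(1,2)])
  then have 1: "frechet_derivative (loc \<psi> c d) (at x) = (\<lambda>a. frechet_derivative (loc \<psi> c' d) (at y) (D a))"
    by (rule frechet_derivative_eqI)
  have "((\<lambda>x. floc M \<theta> c' d (transition c c' x) (dtrans c c' x u)) has_derivative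
     (\<lambda>a. frechet_derivative (\<lambda>y. floc M \<theta> c' d y (D u)) (at y) (D a) +
        floc M \<theta> c' d y (frechet_derivative (\<lambda>y. dtrans c c' y u) (at x) a + D 0))) (at x)"
    unfolding y_def D_def
  proof (rule has_derivative_linear_family[OF S _ _ open_ldom[OF at(2,3)] y[OF S(2)] _ T])
    show "linear (floc M \<theta> c' d (transition c c' z))" if "z \<in> ?S" for z
      by (rule floc_linear[OF \<theta> at(2) ldom_img[OF y[OF that]]])
    show "linear (floc M \<theta> c' d z)" if "z \<in> ldom \<psi> c' d" for z
      by (rule floc_linear[OF \<theta> at(2) ldom_img[OF that]])
    show "(\<lambda>y. floc M \<theta> c' d y w) differentiable at (transition c c' x)" for w
      by (rule smooth_on_differentiable[OF formD(4)[OF \<theta> at(2,3)] y[OF S(2)]])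
    show "((\<lambda>x. dtrans c c' x u) has_derivative
        (\<lambda>a. frechet_derivative (\<lambda>y. dtrans c c' y u) (at x) a + dtrans c c' x 0)) (at x)"
      by (rule M.dtrans_has_derivative[OF at(1,2) O x(1)]) auto
  qed
  then have "((\<lambda>x. floc M \<theta> c d x u) has_derivative
     (\<lambda>a. frechet_derivative (\<lambda>y. floc M \<theta> c' d y (D u)) (at y) (D a) +
        floc M \<theta> c' d y (frechet_derivative (\<lambda>y. dtrans c c' y u) (at x) a + D 0))) (at x)"
    by (rule has_derivative_transform_within_open[OF _ O x(1)]) (rule floc_change[OF at(1,2), symmetric])
  then have 2: "frechet_derivative (\<lambda>x. floc M \<theta> c d x u) (at x) v =
     frechet_derivative (\<lambda>y. floc M \<theta> c' d y (D u)) (at y) (D v) +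
        floc M \<theta> c' d y (frechet_derivative (\<lambda>y. dtrans c c' y u) (at x) v)"
    using linear_0[OF M.linear_dtrans[OF at(1,2) x(1)]] by (simp add: frechet_derivative_eqI D_def)
  show ?thesis
    unfolding tloc_def nab_def 1 2 floc_change[OF at(1,2) x(1), folded y_def D_def]
      loc_change_dom[OF at(1,2) x(1), folded y_def, symmetric] D_def M.christoffel_transform[OF at(1,2) x(1)]
    unfolding D_def[symmetric] y_def[symmetric]
      linear_add[OF floc_linear[OF \<theta> at(2) ldom_img[OF y[OF S(2)]]], folded y_def]
    by (simp add: algebra_simps)
qed

section \<open>Traces of covariant derivatives of forms\<close>

lemma floc_frechet_linear:
  assumes \<theta>: "form_along M N \<psi> \<theta>" and at: "c \<in> atlas M" "d \<in> atlas N" and x: "x \<in> ldom \<psi> c d"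
  shows "linear (\<lambda>u. frechet_derivative (\<lambda>x. floc M \<theta> c d x u) (at x) v)"
proof -
  have d: "((\<lambda>x. floc M \<theta> c d x u) has_derivative frechet_derivative (\<lambda>x. floc M \<theta> c d x u) (at x)) (at x)" for u
    by (rule smooth_on_has_derivative[OF formD(4)[OF \<theta> at] x])
  note L = floc_linear[OF \<theta> at(1) ldom_img]
  show ?thesis
  proof (rule linearI)
    fix u w :: "real^'m" and r :: real
    have "((\<lambda>x. floc M \<theta> c d x (u + w)) has_derivative (\<lambda>a. frechet_derivative (\<lambda>x. floc M \<theta> c d x u) (at x) a
        + frechet_derivative (\<lambda>x. floc M \<theta> c d x w) (at x) a)) (at x)"
      by (rule has_derivative_transform_within_open[OF has_derivative_add[OF d d] open_ldom[OF at] x])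
        (simp add: linear_add[OF L])
    from fun_cong[OF frechet_derivative_eqI[OF this], of v]
    show "frechet_derivative (\<lambda>x. floc M \<theta> c d x (u + w)) (at x) v =
      frechet_derivative (\<lambda>x. floc M \<theta> c d x u) (at x) v + frechet_derivative (\<lambda>x. floc M \<theta> c d x w) (at x) v" .
    have "((\<lambda>x. floc M \<theta> c d x (r *\<^sub>R u)) has_derivative
        (\<lambda>a. r *\<^sub>R frechet_derivative (\<lambda>x. floc M \<theta> c d x u) (at x) a)) (at x)"
      by (rule has_derivative_transform_within_open[OF has_derivative_scaleR_right[OF d] open_ldom[OF at] x])
        (simp add: linear_scale[OF L])
    from fun_cong[OF frechet_derivative_eqI[OF this], of v]
    show "frechet_derivative (\<lambda>x. floc M \<theta> c d x (r *\<^sub>R u)) (at x) v =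
      r *\<^sub>R frechet_derivative (\<lambda>x. floc M \<theta> c d x u) (at x) v" .
  qed
qed

lemma tloc_bilinear:
  assumes \<theta>: "form_along M N \<psi> \<theta>" and at: "c \<in> atlas M" "d \<in> atlas N" and x: "x \<in> ldom \<psi> c d"
  shows "linear (\<lambda>u. tloc M N \<psi> \<theta> c d x u v)" and "linear (\<lambda>v. tloc M N \<psi> \<theta> c d x u v)"
proof -
  note L = floc_linear[OF \<theta> at(1) ldom_img[OF x], of d] floc_frechet_linear[OF \<theta> at x]
    has_derivative_linear[OF loc_has_derivative[OF at x]]
    has_derivative_linear[OF smooth_on_has_derivative[OF formD(4)[OF \<theta> at] x]]
  show "linear (\<lambda>u. tloc M N \<psi> \<theta> c d x u v)"
    by (rule linearI) (simp_all add: tloc_def nab_def linear_add[OF L(1)] linear_scale[OF L(1)] linear_add[OF L(2)]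
        linear_scale[OF L(2)] christoffel_add_right christoffel_scaleR_right algebra_simps)
  show "linear (\<lambda>v. tloc M N \<psi> \<theta> c d x u v)"
    by (rule linearI) (simp_all add: tloc_def nab_def linear_add[OF L(1)] linear_scale[OF L(1)] linear_add[OF L(3)]
        linear_scale[OF L(3)] linear_add[OF L(4)] linear_scale[OF L(4)] christoffel_add_left christoffel_scaleR_left algebra_simps)
qed

lemma smooth_tloc [smooth_intros]:
  assumes \<theta>: "form_along M N \<psi> \<theta>" and at: "c \<in> atlas M" "d \<in> atlas N"
  shows "smooth_on (ldom \<psi> c d) (\<lambda>x. tloc M N \<psi> \<theta> c d x u v)"
  unfolding tloc_def
  by (intro smooth_intros \<theta> at open_ldom N.smooth_nab[OF at(2) open_ldom[OF at] smooth_loc[OF at]] loc_in ldom_img)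

text \<open>The field Y with constant coefficients in \<open>chart_at\<close> has a covariant
  derivative whose component there is the Christoffel term. No other component matters, since a form
  in the sense of \<open>form_along\<close> sees only this one.\<close>

lemma cov_form_tloc:
  assumes \<theta>: "form_along M N \<psi> \<theta>" and v: "v \<in> tangent_space M p" and w: "w \<in> tangent_space M p"
    and d: "d \<in> charts_at N (\<psi> p)"
  defines "c \<equiv> chart_at M p"
  shows "cov_form M N \<psi> \<theta> p v w d = tloc M N \<psi> \<theta> c d (coord c p) (w c) (v c)"
proof -
  have c: "c \<in> charts_at M p" unfolding c_def by (rule M.chart_at_in)
  have at: "c \<in> atlas M" "d \<in> atlas N" using c d by (auto simp: M.charts_at_iff N.charts_at_iff)
  let ?x = "coord c p" and ?Y = "coord_vec M c (w c)"
  have x: "?x \<in> ldom \<psi> c d" by (rule coord_in_ldom[OF c d])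
  have xi: "?x \<in> chart_img c" by (rule ldom_img[OF x])
  let ?X = "cov_along M M id ?Y p v"
  have 1: "cov_along M N \<psi> (\<lambda>q. \<theta> q (?Y q)) p v d = nab N d (loc \<psi> c d) (\<lambda>x. floc M \<theta> c d x (w c)) (v c) ?x"
    unfolding floc_def
    by (rule cov_along_nab[OF c d v, where \<sigma>="\<lambda>q. \<theta> q (?Y q)"])
      (rule smooth_on_differentiable[OF formD(4)[OF \<theta> at, unfolded floc_def] x])
  have D1: "((\<lambda>x. ?Y (param c x) c) has_derivative (\<lambda>a. 0)) (at ?x)"
    by (rule has_derivative_transform_within_open[OF has_derivative_const[of "w c"] M.open_chart_img[OF at(1)] xi])
      (simp add: M.coord_vec_self M.charts_at_iff at)
  have D2: "((\<lambda>x. (coord c \<circ> id) (param c x)) has_derivative (\<lambda>a. a)) (at ?x)"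
    by (rule has_derivative_transform_within_open[OF has_derivative_ident M.open_chart_img[OF at(1)] xi])
      (simp add: at)
  have "dir_deriv M p v (\<lambda>q. ?Y q c) = 0"
    using M.dir_deriv_eq[OF c v, of "\<lambda>q. ?Y q c"] D1 frechet_derivative_eqI[OF D1] by (simp add: differentiable_def) blast
  moreover have "dir_deriv M p v (coord c \<circ> id) = v c"
    using M.dir_deriv_eq[OF c v, of "coord c \<circ> id"] D2 frechet_derivative_eqI[OF D2] unfolding differentiable_def by metis
  ultimately have X: "?X c = christoffel M c ?x (v c) (w c)"
    using c by (simp add: cov_along_def differential_def M.coord_vec_self)
  have "\<theta> p ?X = \<theta> p (coord_vec M c (?X c) p)"
    by (rule formD(2)[OF \<theta>]) (simp add: M.coord_vec_self[OF M.chart_at_in] c_def)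
  then have "\<theta> p ?X d = floc M \<theta> c d ?x (?X c)"
    using c by (simp add: floc_def M.charts_at_iff)
  then show ?thesis
    by (simp add: cov_form_def Let_def c_def[symmetric] 1 X tloc_def)
qed

text \<open>\<open>cov_form\<close> is tied to \<open>chart_at\<close>; the invariance of
  \<open>tloc\<close> and the transformation rule of the frame vectors free the trace from that
  chart.\<close>

lemma trace_cov_frame:
  assumes \<theta>: "form_along M N \<psi> \<theta>" and c: "c \<in> charts_at M p" and d: "d \<in> charts_at N (\<psi> p)"
  shows "trace_cov M N \<psi> \<theta> p d =
    (\<Sum>i\<in>UNIV. tloc M N \<psi> \<theta> c d (coord c p) (frame_at M p i c) (frame_at M p i c))"
proof -
  let ?c = "chart_at M p"
  note c0 = M.chart_at_in[of p]
  have at: "?c \<in> atlas M" "c \<in> atlas M" "d \<in> atlas N" using c0 c d by (auto simp: M.charts_at_iff N.charts_at_iff)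
  show ?thesis
    unfolding trace_cov_def cov_form_tloc[OF \<theta> M.frame_at_tangent M.frame_at_tangent d]
      tloc_change_dom[OF \<theta> at M.overlap_charts_at[OF c0 c] coord_in_ldom[OF c0 d]]
    by (simp add: M.tangent_transform[OF M.frame_at_tangent c0 c, symmetric] M.transition_coord[OF c0])
qed

lemma trace_cov_loc:
  assumes \<theta>: "form_along M N \<psi> \<theta>" and at: "c \<in> atlas M" "d \<in> atlas N" and x: "x \<in> ldom \<psi> c d"
  shows "trace_cov M N \<psi> \<theta> (param c x) d =
    (\<Sum>k\<in>UNIV. \<Sum>l\<in>UNIV. matrix_inv (gram M c x) $ k $ l *\<^sub>R tloc M N \<psi> \<theta> c d x (axis k 1) (axis l 1))"
proof -
  note ch = ldom_charts[OF at x]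
  have "trace_cov M N \<psi> \<theta> (param c x) d =
      (\<Sum>i\<in>UNIV. tloc M N \<psi> \<theta> c d x (frame_at M (param c x) i c) (frame_at M (param c x) i c))"
    using trace_cov_frame[OF \<theta> ch] at ldom_img[OF x] by simp
  also have "\<dots> = (\<Sum>k\<in>UNIV. \<Sum>l\<in>UNIV. matrix_inv (gram M c x) $ k $ l *\<^sub>R tloc M N \<psi> \<theta> c d x (axis k 1) (axis l 1))"
    by (rule sum_frame_bilinear[OF tloc_bilinear[OF \<theta> at x]]) (use M.frame_at_ginv[OF ch(1)] at ldom_img[OF x] in simp)
  finally show ?thesis .
qed

lemma trace_cov_tangent:
  assumes \<theta>: "form_along M N \<psi> \<theta>"
  shows "trace_cov M N \<psi> \<theta> p \<in> tangent_space N (\<psi> p)"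
proof (rule N.tangent_spaceI[OF N.chart_at_in])
  fix e assume e: "e \<in> charts_at N (\<psi> p)"
  let ?c = "chart_at M p" and ?d = "chart_at N (\<psi> p)"
  note c = M.chart_at_in[of p] and d = N.chart_at_in[of "\<psi> p"]
  have at: "?c \<in> atlas M" "?d \<in> atlas N" "e \<in> atlas N" using c d e by (auto simp: M.charts_at_iff N.charts_at_iff)
  let ?x = "coord ?c p"
  have x: "?x \<in> ldom \<psi> ?c ?d" "?x \<in> ldom \<psi> ?c e" using c d e by (auto intro: coord_in_ldom)
  show "trace_cov M N \<psi> \<theta> p e = dtrans ?d e (coord ?d (\<psi> p)) (trace_cov M N \<psi> \<theta> p ?d)"
    unfolding trace_cov_frame[OF \<theta> c d] trace_cov_frame[OF \<theta> c e] tloc_change_cod[OF \<theta> at x]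
      loc_coord[OF c, symmetric]
    by (rule linear_sum[OF N.linear_dtrans[OF at(2,3) loc_in_overlap[OF at(2) x]], symmetric])
next
  \<comment> \<open>Outside the charts around \<psi> p the value must be the padding 0, even for
    vectors to which \<open>cov_form\<close> applies \<theta> without a proof of tangency; these are
    replaced by tangent vectors with the same relevant component.\<close>
  fix d assume d: "d \<notin> charts_at N (\<psi> p)"
  let ?c = "chart_at M p"
  have "\<theta> p X d = 0" for X
  proof -
    have "\<theta> p X = \<theta> p (coord_vec M ?c (X ?c) p)"
      by (rule formD(2)[OF \<theta>]) (simp add: M.coord_vec_self[OF M.chart_at_in])
    then show ?thesis
      using N.tangent_zero[OF formD(1)[OF \<theta> M.coord_vec_tangent[OF M.chart_at_in]] d] by simp
  qed
  then show "trace_cov M N \<psi> \<theta> p d = 0"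
    using d by (simp add: trace_cov_def cov_form_def Let_def cov_along_def)
qed

lemma trace_cov_section:
  assumes \<theta>: "form_along M N \<psi> \<theta>"
  shows "trace_cov M N \<psi> \<theta> \<in> sections_along M N \<psi>"
proof (rule sectionI)
  fix c d assume at: "c \<in> atlas M" "d \<in> atlas N"
  have "smooth_on (ldom \<psi> c d) (\<lambda>x. \<Sum>k\<in>UNIV. \<Sum>l\<in>UNIV. matrix_inv (gram M c x) $ k $ l *\<^sub>R
      tloc M N \<psi> \<theta> c d x (axis k 1) (axis l 1))"
    by (intro smooth_intros at open_ldom \<theta> smooth_on_subset[OF M.smooth_ginv]) (auto simp: ldom_img)
  then show "smooth_on (ldom \<psi> c d) (\<lambda>x. trace_cov M N \<psi> \<theta> (param c x) d)"
    by (subst smooth_on_cong[OF open_ldom[OF at]]) (auto simp: trace_cov_loc[OF \<theta> at])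
qed (rule trace_cov_tangent[OF \<theta>])

section \<open>The terms of the Jacobi operator as smooth sections\<close>

lemma trace_curvature_section:
  assumes \<sigma>: "\<sigma> \<in> sections_along M N \<psi>"
  shows "trace_curvature M N \<psi> \<sigma> \<in> sections_along M N \<psi>"
proof (rule sectionI)
  show "trace_curvature M N \<psi> \<sigma> p \<in> tangent_space N (\<psi> p)" for p
    unfolding trace_curvature_def
    by (intro N.tangent_sum N.curvature_tangent section_tangent[OF \<sigma>] differential_tangent M.frame_at_tangent)
  fix c d assume at: "c \<in> atlas M" "d \<in> atlas N"
  let ?R = "\<lambda>x u v. curv N d (loc \<psi> c d x) (\<sigma> (param c x) d) (frechet_derivative (loc \<psi> c d) (at x) u)
    (frechet_derivative (loc \<psi> c d) (at x) v)"
  have "smooth_on (ldom \<psi> c d) (\<lambda>x. \<Sum>k\<in>UNIV. \<Sum>l\<in>UNIV. matrix_inv (gram M c x) $ k $ l *\<^sub>R ?R x (axis k 1) (axis l 1))"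
    by (intro smooth_intros at open_ldom smooth_on_subset[OF M.smooth_ginv] section_smooth[OF \<sigma>] smooth_loc loc_in)
      (auto simp: ldom_img)
  moreover have "trace_curvature M N \<psi> \<sigma> (param c x) d =
      (\<Sum>k\<in>UNIV. \<Sum>l\<in>UNIV. matrix_inv (gram M c x) $ k $ l *\<^sub>R ?R x (axis k 1) (axis l 1))" if x: "x \<in> ldom \<psi> c d" for x
  proof -
    note ch = ldom_charts[OF at x]
    have xi: "coord c (param c x) = x" using at ldom_img[OF x] by simp
    note R = N.linear_curv[OF at(2) loc_in[OF x]] and D = has_derivative_linear[OF loc_has_derivative[OF at x]]
    have L: "linear (\<lambda>u. ?R x u v)" "linear (\<lambda>v. ?R x u v)" for u v
      using linear_compose[OF D R(2)] linear_compose[OF D R(3)] by (simp_all add: o_def)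
    have "trace_curvature M N \<psi> \<sigma> (param c x) d = (\<Sum>i\<in>UNIV. ?R x (frame_at M (param c x) i c) (frame_at M (param c x) i c))"
      unfolding trace_curvature_def N.curvature_eq_curv[OF ch(2)] differential_loc[OF ch M.frame_at_tangent] xi
      by (simp add: loc_def)
    also have "\<dots> = (\<Sum>k\<in>UNIV. \<Sum>l\<in>UNIV. matrix_inv (gram M c x) $ k $ l *\<^sub>R ?R x (axis k 1) (axis l 1))"
      by (rule sum_frame_bilinear[OF L]) (use M.frame_at_ginv[OF ch(1)] xi in simp)
    finally show ?thesis .
  qed
  ultimately show "smooth_on (ldom \<psi> c d) (\<lambda>x. trace_curvature M N \<psi> \<sigma> (param c x) d)"
    by (subst smooth_on_cong[OF open_ldom[OF at]]) auto
qed

definition rho :: "'a \<Rightarrow> real" where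
  "rho p = 1 + (hs_norm M N \<psi> p (differential M N \<psi> p))\<^sup>2"

lemma rho_eq: "rho p = 1 + hs_inner M N \<psi> p (differential M N \<psi> p) (differential M N \<psi> p)"
  by (simp add: rho_def hs_norm_sq[OF form_differential])

lemma rho_pos: "rho p > 0"
  unfolding rho_def by (smt (verit) zero_le_power2)

lemma smooth_fun_rho: "smooth_fun M (\<lambda>p. rho p powr a)"
  unfolding rho_eq
  by (rule M.smooth_fun_powr[OF M.smooth_fun_add[OF M.smooth_fun_const smooth_fun_hs_inner[OF form_differential form_differential]]])
    (rule rho_pos[unfolded rho_eq])

text \<open>\<open>stress1\<close> and \<open>stress2\<close> are the forms whose traced covariant
  derivatives occur in \<open>alpha_jacobi\<close>; each of them will be the form in one integration
  by parts.\<close>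

definition stress1 :: "real \<Rightarrow> ('a \<Rightarrow> ('b, 'n) tvec) \<Rightarrow> 'a \<Rightarrow> ('a, 'm) tvec \<Rightarrow> ('b, 'n) tvec" where
  "stress1 \<alpha> \<upsilon> = (\<lambda>q v d. (hs_inner M N \<psi> q (cov_along M N \<psi> \<upsilon> q) (differential M N \<psi> q) * rho q powr (\<alpha> - 2)) *\<^sub>R
     differential M N \<psi> q v d)"

definition stress2 :: "real \<Rightarrow> ('a \<Rightarrow> ('b, 'n) tvec) \<Rightarrow> 'a \<Rightarrow> ('a, 'm) tvec \<Rightarrow> ('b, 'n) tvec" where
  "stress2 \<alpha> \<upsilon> = (\<lambda>q v d. (rho q powr (\<alpha> - 1)) *\<^sub>R cov_along M N \<psi> \<upsilon> q v d)"

lemma alpha_jacobi_eq: "alpha_jacobi \<alpha> M N \<psi> \<upsilon> p d =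
    (2 * \<alpha> * rho p powr (\<alpha> - 1)) *\<^sub>R trace_curvature M N \<psi> \<upsilon> p d
    + (4 * \<alpha> * (\<alpha> - 1)) *\<^sub>R trace_cov M N \<psi> (stress1 \<alpha> \<upsilon>) p d
    + (2 * \<alpha>) *\<^sub>R trace_cov M N \<psi> (stress2 \<alpha> \<upsilon>) p d"
  by (simp add: alpha_jacobi_def Let_def stress1_def stress2_def rho_def)

lemma form_stress:
  assumes "\<upsilon> \<in> sections_along M N \<psi>"
  shows "form_along M N \<psi> (stress1 \<alpha> \<upsilon>)" "form_along M N \<psi> (stress2 \<alpha> \<upsilon>)"
  unfolding stress1_def stress2_def
  by (intro form_scale form_differential form_cov_along assms M.smooth_fun_mult smooth_fun_rho smooth_fun_hs_inner)+

lemma alpha_jacobi_section: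
  assumes \<upsilon>: "\<upsilon> \<in> sections_along M N \<psi>"
  shows "alpha_jacobi \<alpha> M N \<psi> \<upsilon> \<in> sections_along M N \<psi>"
  unfolding alpha_jacobi_eq[abs_def]
  by (intro section_add section_scale trace_curvature_section trace_cov_section form_stress \<upsilon>
      M.smooth_fun_mult M.smooth_fun_const smooth_fun_rho)

end

section \<open>Change of variables\<close>

text \<open>The library states the change-of-variables theorem for well-ordered index types only; \<open>'m idx\<close> is a
  well-ordered copy of an arbitrary finite type.\<close>

typedef ('m::finite) idx = "{..<CARD('m)}"
  by (rule exI[of _ 0]) simp

lemma card_idx: "card (UNIV :: 'm::finite idx set) = CARD('m)"
  using type_definition.card[OF type_definition_idx[where 'm='m]] by simp

instance idx :: (finite) finite
  by standard (rule card_ge_0_finite, simp add: card_idx)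

instantiation idx :: (finite) wellorder
begin

definition less_eq_idx :: "'a idx \<Rightarrow> 'a idx \<Rightarrow> bool" where "less_eq_idx i j \<longleftrightarrow> Rep_idx i \<le> Rep_idx j"
definition less_idx :: "'a idx \<Rightarrow> 'a idx \<Rightarrow> bool" where "less_idx i j \<longleftrightarrow> Rep_idx i < Rep_idx j"

instance
proof
  fix P :: "'a idx \<Rightarrow> bool" and a
  assume *: "\<And>x. (\<And>y. y < x \<Longrightarrow> P y) \<Longrightarrow> P x"
  show "P a"
    by (induction "Rep_idx a" arbitrary: a rule: less_induct) (rule *, simp add: less_idx_def)
qed (auto simp: less_eq_idx_def less_idx_def Rep_idx_inject)

end

definition idx_of :: "'m::finite idx \<Rightarrow> 'm" where
  "idx_of = (SOME f. bij f)"

lemma bij_idx_of: "bij (idx_of :: 'm::finite idx \<Rightarrow> 'm)"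
proof -
  have "\<exists>f :: 'm idx \<Rightarrow> 'm. bij f"
    by (rule finite_same_card_bij) (simp_all add: card_idx)
  then show ?thesis unfolding idx_of_def by (rule someI_ex)
qed

definition to_idx :: "real^'m::finite \<Rightarrow> real^'m idx" where
  "to_idx x = (\<chi> i. x $ idx_of i)"

definition from_idx :: "real^'m idx \<Rightarrow> real^'m::finite" where
  "from_idx y = (\<chi> j. y $ inv idx_of j)"

lemma from_to_idx [simp]: "from_idx (to_idx x) = x"
  by (simp add: from_idx_def to_idx_def vec_eq_iff surj_f_inv_f[OF bij_is_surj[OF bij_idx_of]])

lemma to_from_idx [simp]: "to_idx (from_idx y) = y"
  by (simp add: from_idx_def to_idx_def vec_eq_iff inv_f_f[OF bij_is_inj[OF bij_idx_of]])

lemma bounded_linear_to_idx: "bounded_linear to_idx"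
  by (rule linear_conv_bounded_linear[THEN iffD1], rule linearI) (simp_all add: to_idx_def vec_eq_iff)

lemma bounded_linear_from_idx: "bounded_linear from_idx"
  by (rule linear_conv_bounded_linear[THEN iffD1], rule linearI) (simp_all add: from_idx_def vec_eq_iff)

lemma borel_to_idx [measurable]: "to_idx \<in> borel \<rightarrow>\<^sub>M borel"
  by (intro borel_measurable_continuous_onI bounded_linear.continuous_on[OF bounded_linear_to_idx] continuous_on_id)

lemma borel_from_idx [measurable]: "from_idx \<in> borel \<rightarrow>\<^sub>M borel"
  by (intro borel_measurable_continuous_onI bounded_linear.continuous_on[OF bounded_linear_from_idx] continuous_on_id)

lemma prod_Basis_vec:
  fixes f :: "real^'n \<Rightarrow> real"
  shows "(\<Prod>b\<in>Basis. f b) = (\<Prod>i\<in>UNIV. f (axis i (1::real)))"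
proof -
  have "(Basis :: (real^'n) set) = range (\<lambda>i. axis i 1)" by (auto simp: Basis_vec_def)
  then have "prod f Basis = prod f (range (\<lambda>i. axis i 1))" by (rule arg_cong)
  also have "\<dots> = (\<Prod>i\<in>UNIV. f (axis i 1))"
    by (subst prod.reindex) (auto simp: inj_on_def axis_eq_axis)
  finally show ?thesis .
qed

text \<open>Lebesgue measure is determined by its values on boxes, and relabelling the coordinates
  only permutes the side lengths.\<close>

lemma lborel_to_idx: "distr lborel borel to_idx = (lborel :: (real^'m::finite idx) measure)"
proof (rule lborel_eqI[symmetric])
  fix l u :: "real^'m idx"
  assume le: "\<And>b. b \<in> Basis \<Longrightarrow> l \<bullet> b \<le> u \<bullet> b"
  have le': "l $ i \<le> u $ i" for i
    using le[of "axis i 1"] by (simp add: inner_axis)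
  have "to_idx -` box l u = box (from_idx l) (from_idx u)"
  proof -
    have "(\<forall>i. l $ i < x $ idx_of i \<and> x $ idx_of i < u $ i) \<longleftrightarrow>
        (\<forall>j. l $ inv idx_of j < x $ j \<and> x $ j < u $ inv idx_of j)" for x :: "real^'m"
      by (metis bij_idx_of bij_inv_eq_iff)
    then show ?thesis by (auto simp: mem_box_cart to_idx_def from_idx_def)
  qed
  then have "emeasure (distr lborel borel to_idx) (box l u) = emeasure lborel (box (from_idx l) (from_idx u))"
    by (simp add: emeasure_distr)
  also have "\<dots> = (\<Prod>b\<in>Basis. (from_idx u - from_idx l) \<bullet> b)"
    by (rule emeasure_lborel_box) (auto simp: Basis_vec_def inner_axis from_idx_def le')
  also have "(\<Prod>b\<in>Basis. (from_idx u - from_idx l) \<bullet> b) = (\<Prod>j\<in>UNIV. (u - l) $ inv idx_of j)"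
    by (simp add: prod_Basis_vec inner_axis from_idx_def)
  also have "\<dots> = (\<Prod>i\<in>UNIV. (u - l) $ i)"
    by (rule prod.reindex_bij_betw[OF bij_imp_bij_inv[OF bij_idx_of]])
  also have "\<dots> = (\<Prod>b\<in>Basis. (u - l) \<bullet> b)"
    by (simp add: prod_Basis_vec inner_axis)
  finally show "emeasure (distr lborel borel to_idx) (box l u) = (\<Prod>b\<in>Basis. (u - l) \<bullet> b)" .
qed simp

lemma nn_integral_to_idx:
  assumes [measurable]: "h \<in> borel_measurable borel"
  shows "(\<integral>\<^sup>+y. h y \<partial>lborel) = (\<integral>\<^sup>+x. h (to_idx x) \<partial>lborel)"
  by (subst lborel_to_idx[symmetric]) (simp add: nn_integral_distr)

text \<open>Conjugation by b is a sign-preserving bijection between the permutations of the two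
  index types, so the Leibniz sums agree term by term.\<close>

lemma det_reindex:
  fixes A :: "real^'m::finite^'m"
  assumes b: "bij (b :: 'k::finite \<Rightarrow> 'm)"
  shows "det (\<chi> i j. A $ b i $ b j) = det A"
proof -
  have inj: "inj_on b UNIV" using b by (simp add: bij_def)
  have "det A = (\<Sum>p\<in>{p. p permutes (UNIV::'k set)}. of_int (sign (map_permutation UNIV b p)) *
      (\<Prod>i\<in>UNIV. A $ i $ map_permutation UNIV b p i))"
    unfolding det_def
  proof (rule sum.reindex_bij_betw[symmetric])
    have "map_permutation UNIV b = (\<lambda>p x. if x \<in> UNIV then b (p (inv_into UNIV b x)) else x)"
      using bij_is_surj[OF b] by (simp add: map_permutation_def restrict_id_def fun_eq_iff)
    then show "bij_betw (map_permutation UNIV b) {p. p permutes UNIV} {p. p permutes UNIV}"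
      using bij_betw_permutations[OF b] by (simp only:)
  qed
  also have "\<dots> = (\<Sum>p\<in>{p. p permutes (UNIV::'k set)}. of_int (sign p) * (\<Prod>i\<in>UNIV. A $ b i $ b (p i)))"
  proof (rule sum.cong[OF refl])
    fix p :: "'k \<Rightarrow> 'k" assume p: "p \<in> {p. p permutes UNIV}"
    have "(\<Prod>i\<in>UNIV. A $ i $ map_permutation UNIV b p i) = (\<Prod>i\<in>UNIV. A $ b i $ map_permutation UNIV b p (b i))"
      by (rule prod.reindex_bij_betw[OF b, symmetric])
    then show "of_int (sign (map_permutation UNIV b p)) * (\<Prod>i\<in>UNIV. A $ i $ map_permutation UNIV b p i) =
        of_int (sign p) * (\<Prod>i\<in>UNIV. A $ b i $ b (p i))"
      using p by (simp add: sign_map_permutation[OF inj] map_permutation_apply[OF inj])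
  qed
  finally show ?thesis by (simp add: det_def)
qed

text \<open>A finite value of either side makes its integrand integrable, and the change of
  variables then gives the other side the same value; hence the two sides are also infinite
  together.\<close>

lemma nn_integral_change_of_variables_wellorder:
  fixes g :: "real^'k::{finite,wellorder} \<Rightarrow> real^'k::_" and f :: "real^'k::_ \<Rightarrow> real"
  assumes S: "S \<in> sets borel"
    and der: "\<And>x. x \<in> S \<Longrightarrow> (g has_derivative g' x) (at x)" and inj: "inj_on g S"
    and f: "\<And>y. y \<in> g ` S \<Longrightarrow> f y \<ge> 0"
    and meas: "(\<lambda>y. indicator (g ` S) y * f y) \<in> borel_measurable borel"
      "(\<lambda>x. indicator S x * (\<bar>det (matrix (g' x))\<bar> * f (g x))) \<in> borel_measurable borel"
  shows "(\<integral>\<^sup>+y. ennreal (indicator (g ` S) y * f y) \<partial>lborel) =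
    (\<integral>\<^sup>+x. ennreal (indicator S x * (\<bar>det (matrix (g' x))\<bar> * f (g x))) \<partial>lborel)" (is "?B = ?A")
proof -
  let ?h = "\<lambda>x. \<bar>det (matrix (g' x))\<bar> * f (g x)"
  have hpos: "?h x \<ge> 0" if "x \<in> S" for x using f that by simp
  \<comment> \<open>The vector-valued change of variables is used with values in
    \<open>real^1\<close>; for nonnegative integrands absolute integrability is the same as
    integrability.\<close>
  have iff: "(?h has_integral r) S \<longleftrightarrow> (f has_integral r) (g ` S)" for r
  proof -
    have "(\<lambda>x. ?h x) absolutely_integrable_on S \<and> integral S ?h = r \<longleftrightarrow>
        f absolutely_integrable_on (g ` S) \<and> integral (g ` S) f = r"
      using has_absolute_integral_change_of_variables[of S g g' "\<lambda>x. vec (f x) :: real^1" "vec r"] S inj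
        has_derivative_at_withinI[OF der]
      by (simp add: absolutely_integrable_on_1_iff integral_on_1_eq)
    then show ?thesis
      using absolutely_integrable_on_iff_nonneg[of S ?h] absolutely_integrable_on_iff_nonneg[of "g ` S" f] hpos f
      by (auto simp: has_integral_iff)
  qed
  have ind: "((\<lambda>x. indicator U x * k x) has_integral r) UNIV \<longleftrightarrow> (k has_integral r) U" for k :: "real^'k::_ \<Rightarrow> real" and U r
    using has_integral_restrict_UNIV[of U k r] by (simp add: indicator_def of_bool_def if_distrib[of "\<lambda>x. x * k y" for y] cong: if_cong)
  have BA: "?B = ennreal r \<Longrightarrow> ?A = ennreal r" if "0 \<le> r" for r
  proof -
    assume "?B = ennreal r"
    then have "((\<lambda>y. indicator (g ` S) y * f y) has_integral r) UNIV"
      by (intro nn_integral_has_integral meas that) (auto simp: indicator_def f)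
    then have "(?h has_integral r) S" by (simp add: ind iff)
    then show "?A = ennreal r" by (intro nn_integral_has_integral_lebesgue hpos)
  qed
  have AB: "?A = ennreal r \<Longrightarrow> ?B = ennreal r" if "0 \<le> r" for r
  proof -
    assume "?A = ennreal r"
    then have "((\<lambda>x. indicator S x * ?h x) has_integral r) UNIV"
      by (intro nn_integral_has_integral meas that) (auto simp: indicator_def f)
    then have "(f has_integral r) (g ` S)" by (simp add: ind iff)
    then show "?B = ennreal r" by (intro nn_integral_has_integral_lebesgue f)
  qed
  show ?thesis
  proof (cases ?A)
    case (real r)
    then show ?thesis using AB[of r] by simp
  next
    case top
    then show ?thesis
    proof (cases ?B)
      case (real r)
      then show ?thesis using BA[of r] by simp
    qed simp
  qed
qed

lemma nn_integral_change_of_variables: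
  fixes g :: "real^'m::finite \<Rightarrow> real^'m" and f :: "real^'m \<Rightarrow> real"
  assumes S: "S \<in> sets borel"
    and der: "\<And>x. x \<in> S \<Longrightarrow> (g has_derivative g' x) (at x)" and inj: "inj_on g S"
    and f: "\<And>y. y \<in> g ` S \<Longrightarrow> f y \<ge> 0"
    and meas: "(\<lambda>y. indicator (g ` S) y * f y) \<in> borel_measurable borel"
      "(\<lambda>x. indicator S x * (\<bar>det (matrix (g' x))\<bar> * f (g x))) \<in> borel_measurable borel"
  shows "(\<integral>\<^sup>+y. ennreal (indicator (g ` S) y * f y) \<partial>lborel) =
    (\<integral>\<^sup>+x. ennreal (indicator S x * (\<bar>det (matrix (g' x))\<bar> * f (g x))) \<partial>lborel)"
proof -
  let ?g = "\<lambda>y. to_idx (g (from_idx y))" and ?g' = "\<lambda>y v. to_idx (g' (from_idx y) (from_idx v))"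
  let ?S = "to_idx ` S"
  have S': "?S = from_idx -` S" by (auto simp: image_iff) (metis to_from_idx)
  have gS: "?g ` ?S = from_idx -` (g ` S)" by (auto simp: image_iff) (metis to_from_idx)
  have det: "det (matrix (?g' y)) = det (matrix (g' (from_idx y)))" for y
  proof -
    have ax: "from_idx (axis j 1) = axis (idx_of j) 1" for j :: "'m idx"
      using bij_idx_of[where 'm='m] by (auto simp: from_idx_def axis_def vec_eq_iff) (metis bij_inv_eq_iff)+
    have "matrix (?g' y) = (\<chi> i j. matrix (g' (from_idx y)) $ idx_of i $ idx_of j)"
      by (simp add: matrix_def vec_eq_iff to_idx_def ax)
    then show ?thesis by (simp only: det_reindex[OF bij_idx_of])
  qed
  have indS: "indicator ?S y = (indicator S (from_idx y) :: real)" "indicator (?g ` ?S) y = (indicator (g ` S) (from_idx y) :: real)" for y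
    by (simp_all only: gS) (simp_all add: S' indicator_def)
  have "(\<integral>\<^sup>+y. ennreal (indicator (?g ` ?S) y * f (from_idx y)) \<partial>lborel) =
    (\<integral>\<^sup>+x. ennreal (indicator ?S x * (\<bar>det (matrix (?g' x))\<bar> * f (from_idx (?g x)))) \<partial>lborel)"
  proof (rule nn_integral_change_of_variables_wellorder)
    show "?S \<in> sets borel" unfolding S' using measurable_sets_borel[OF borel_from_idx S] by simp
    show "(?g has_derivative ?g' y) (at y)" if "y \<in> ?S" for y
      using that
      by (intro bounded_linear.has_derivative[OF bounded_linear_to_idx]
          has_derivative_compose[OF bounded_linear.has_derivative[OF bounded_linear_from_idx has_derivative_ident] der])
        (auto simp: S')
    show "inj_on ?g ?S"
      using inj by (auto simp: inj_on_def) (metis from_to_idx)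
    show "f (from_idx y) \<ge> 0" if "y \<in> ?g ` ?S" for y using that f by (auto simp: gS)
    show "(\<lambda>y. indicator (?g ` ?S) y * f (from_idx y)) \<in> borel_measurable borel"
      unfolding indS using measurable_compose[OF borel_from_idx meas(1)] .
    show "(\<lambda>x. indicator ?S x * (\<bar>det (matrix (?g' x))\<bar> * f (from_idx (?g x)))) \<in> borel_measurable borel"
      unfolding indS det using measurable_compose[OF borel_from_idx meas(2)] by simp
  qed
  moreover have "(\<lambda>y. ennreal (indicator (?g ` ?S) y * f (from_idx y))) \<in> borel_measurable borel"
    unfolding indS using measurable_compose[OF borel_from_idx meas(1)] by simp
  moreover have "(\<lambda>x. ennreal (indicator ?S x * (\<bar>det (matrix (?g' x))\<bar> * f (from_idx (?g x))))) \<in> borel_measurable borel"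
    unfolding indS det using measurable_compose[OF borel_from_idx meas(2)] by simp
  ultimately show ?thesis
    by (simp only: nn_integral_to_idx indS det from_to_idx)
qed

section \<open>The Riemannian volume\<close>

context riem
begin

text \<open>The volume density, cut off outside the chart image so that it is Borel measurable.\<close>

definition vden :: "('a, 'm) chart \<Rightarrow> real^'m \<Rightarrow> real" where
  "vden c x = (if x \<in> chart_img c then sqrt (det (gram M c x)) else 0)"

definition vol :: "('a, 'm) chart \<Rightarrow> (real^'m) measure" where
  "vol c = density lborel (\<lambda>x. ennreal (vden c x))"

lemma vden_nonneg: "c \<in> atlas M \<Longrightarrow> vden c x \<ge> 0"
  using det_gram_pos[of c x] by (auto simp: vden_def less_imp_le)

lemma vden_measurable [measurable]:
  assumes c: "c \<in> atlas M"
  shows "vden c \<in> borel_measurable borel"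
proof -
  have "continuous_on (chart_img c) (\<lambda>x. sqrt (det (gram M c x)))"
    by (rule smooth_on_imp_continuous[OF smooth_sqrt_det_gram[OF c]])
  then have "(\<lambda>x. indicator (chart_img c) x *\<^sub>R sqrt (det (gram M c x))) \<in> borel_measurable borel"
    using open_chart_img[OF c] by (intro borel_measurable_continuous_on_indicator) auto
  moreover have "vden c = (\<lambda>x. indicator (chart_img c) x *\<^sub>R sqrt (det (gram M c x)))"
    by (auto simp: vden_def fun_eq_iff)
  ultimately show ?thesis by simp
qed

lemma sets_vol [simp, measurable_cong]: "sets (vol c) = sets borel"
  by (simp add: vol_def)

lemma space_vol [simp]: "space (vol c) = UNIV"
  by (simp add: vol_def)

lemma coord_image_eq: "c \<in> atlas M \<Longrightarrow> X \<subseteq> chart_dom c \<Longrightarrow> coord c ` X = {x \<in> chart_img c. param c x \<in> X}"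
  by (force simp: chart_img_def)

lemma borel_param_vimage:
  assumes c: "c \<in> atlas M" and X: "X \<in> sets borel"
  shows "{x \<in> chart_img c. param c x \<in> X} \<in> sets borel"
proof -
  have "param c \<in> borel_measurable (restrict_space borel (chart_img c))"
    by (rule borel_measurable_continuous_on_restrict[OF continuous_param[OF c]])
  from measurable_sets[OF this X]
  have "param c -` X \<inter> chart_img c \<in> sets (restrict_space borel (chart_img c))"
    by (simp add: space_restrict_space)
  then have "param c -` X \<inter> chart_img c \<in> sets borel"
    using open_chart_img[OF c] by (subst (asm) sets_restrict_space_iff) auto
  moreover have "param c -` X \<inter> chart_img c = {x \<in> chart_img c. param c x \<in> X}" by auto
  ultimately show ?thesis by simp
qed

lemma borel_coord_image:
  assumes c: "c \<in> atlas M" and X: "X \<in> sets borel" "X \<subseteq> chart_dom c"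
  shows "coord c ` X \<in> sets borel"
  using borel_param_vimage[OF c X(1)] by (simp add: coord_image_eq[OF c X(2)])

lemma inj_on_coord: "c \<in> atlas M \<Longrightarrow> inj_on (coord c) (chart_dom c)"
  by (rule inj_on_inverseI[of _ "param c"]) simp

lemma emeasure_vol:
  assumes c: "c \<in> atlas M" and A: "A \<in> sets borel" "A \<subseteq> chart_img c"
  shows "emeasure (vol c) A = (\<integral>\<^sup>+x. ennreal (sqrt (det (gram M c x))) * indicator A x \<partial>lborel)"
proof -
  have "emeasure (vol c) A = (\<integral>\<^sup>+x. ennreal (vden c x) * indicator A x \<partial>lborel)"
    unfolding vol_def using A(1) vden_measurable[OF c] by (subst emeasure_density) auto
  also have "\<dots> = (\<integral>\<^sup>+x. ennreal (sqrt (det (gram M c x))) * indicator A x \<partial>lborel)"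
    by (rule nn_integral_cong) (use A(2) in \<open>auto simp: vden_def indicator_def\<close>)
  finally show ?thesis .
qed

text \<open>The Gram matrix in c is \<open>transpose P ** (G ** P)\<close>, with P the Jacobian of
  the transition and G the Gram matrix in d, so the determinants differ by the square of det
  P.\<close>

lemma det_gram_change:
  assumes cd: "c \<in> atlas M" "d \<in> atlas M" and x: "x \<in> overlap c d"
  shows "sqrt (det (gram M c x)) = \<bar>det (matrix (dtrans c d x))\<bar> * sqrt (det (gram M d (transition c d x)))"
proof -
  let ?P = "matrix (dtrans c d x)" and ?G = "gram M d (transition c d x)"
  have "gram M c x $ i $ j = (transpose ?P ** (?G ** ?P)) $ i $ j" for i j
  proof -
    have "gram M c x $ i $ j = gform M d (transition c d x) (dtrans c d x (axis i 1)) (dtrans c d x (axis j 1))"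
      unfolding gram_eq_gform by (rule gform_transform[OF cd x])
    also have "\<dots> = (transpose ?P ** (?G ** ?P)) $ i $ j"
      unfolding gform_inner[OF cd(2) transition_in_img[OF cd x]]
      by (simp add: matrix_matrix_mult_def matrix_vector_mult_def transpose_def inner_vec_def matrix_def)
    finally show ?thesis .
  qed
  then have "gram M c x = transpose ?P ** (?G ** ?P)" by (simp add: vec_eq_iff)
  then have "det (gram M c x) = (det ?P)\<^sup>2 * det ?G"
    by (simp add: det_mul power2_eq_square)
  then show ?thesis by (simp add: real_sqrt_mult)
qed

text \<open>The Jacobian factor of the transition is exactly the ratio of the two densities. This
  agreement on overlaps is what allows the local volumes to be glued.\<close>

lemma vol_change:
  assumes cd: "c \<in> atlas M" "d \<in> atlas M" and X: "X \<in> sets borel" "X \<subseteq> chart_dom c" "X \<subseteq> chart_dom d"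
  shows "emeasure (vol c) (coord c ` X) = emeasure (vol d) (coord d ` X)"
proof -
  let ?S = "coord c ` X" and ?g = "transition c d"
  have Xp: "p \<in> chart_dom c" "p \<in> chart_dom d" if "p \<in> X" for p using X that by blast+
  have S: "?S \<in> sets borel" "?S \<subseteq> chart_img c" "?S \<subseteq> overlap c d"
    using borel_coord_image[OF cd(1) X(1,2)] by (auto simp: overlap_def Xp cd)
  have gS: "?g ` ?S = coord d ` X"
    unfolding image_image by (rule image_cong) (simp_all add: transition_def Xp cd)
  have gS': "?g ` ?S \<in> sets borel" "?g ` ?S \<subseteq> chart_img d"
    unfolding gS using borel_coord_image[OF cd(2) X(1,3)] X(3) by auto
  have "(\<integral>\<^sup>+y. ennreal (indicator (?g ` ?S) y * vden d y) \<partial>lborel) =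
    (\<integral>\<^sup>+x. ennreal (indicator ?S x * (\<bar>det (matrix (dtrans c d x))\<bar> * vden d (?g x))) \<partial>lborel)"
  proof (rule nn_integral_change_of_variables[OF S(1)])
    show "(?g has_derivative dtrans c d x) (at x)" if "x \<in> ?S" for x
      using transition_has_derivative[OF cd] that S(3) by blast
    show "inj_on ?g ?S"
    proof (rule inj_onI)
      fix x y assume xy: "x \<in> ?S" "y \<in> ?S" "?g x = ?g y"
      then obtain p q where "p \<in> X" "q \<in> X" "x = coord c p" "y = coord c q" by blast
      then show "x = y"
        using xy(3) inj_onD[OF inj_on_coord[OF cd(2)], of p q] by (simp add: transition_def Xp cd)
    qed
    show "(\<lambda>y. indicator (?g ` ?S) y * vden d y) \<in> borel_measurable borel"
      using gS'(1) vden_measurable[OF cd(2)] by simp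
    \<comment> \<open>Measurability of the transformed integrand follows once it is recognised as
      the density in the chart c.\<close>
    have "(\<lambda>x. indicator ?S x * (\<bar>det (matrix (dtrans c d x))\<bar> * vden d (?g x))) = (\<lambda>x. indicator ?S x * vden c x)"
    proof
      fix x
      show "indicator ?S x * (\<bar>det (matrix (dtrans c d x))\<bar> * vden d (?g x)) = indicator ?S x * vden c x"
      proof (cases "x \<in> ?S")
        case True
        then have x: "x \<in> overlap c d" using S by blast
        then show ?thesis
          using det_gram_change[OF cd x] transition_in_img[OF cd x] by (simp add: vden_def overlap_def)
      qed simp
    qed
    then show "(\<lambda>x. indicator ?S x * (\<bar>det (matrix (dtrans c d x))\<bar> * vden d (?g x))) \<in> borel_measurable borel"
      using S(1) vden_measurable[OF cd(1)] by simp
  qed (rule vden_nonneg[OF cd(2)])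
  moreover have "(\<integral>\<^sup>+y. ennreal (indicator (?g ` ?S) y * vden d y) \<partial>lborel) = emeasure (vol d) (coord d ` X)"
    unfolding emeasure_vol[OF cd(2) gS'[unfolded gS]] gS
    by (rule nn_integral_cong) (use gS'(2) gS in \<open>auto simp: vden_def indicator_def\<close>)
  moreover have "(\<integral>\<^sup>+x. ennreal (indicator ?S x * (\<bar>det (matrix (dtrans c d x))\<bar> * vden d (?g x))) \<partial>lborel) =
      emeasure (vol c) ?S"
    unfolding emeasure_vol[OF cd(1) S(1,2)]
  proof (rule nn_integral_cong)
    fix x
    show "ennreal (indicator ?S x * (\<bar>det (matrix (dtrans c d x))\<bar> * vden d (?g x))) =
        ennreal (sqrt (det (gram M c x))) * indicator ?S x"
    proof (cases "x \<in> ?S")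
      case True
      then have x: "x \<in> overlap c d" using S by blast
      then show ?thesis
        using True det_gram_change[OF cd x] transition_in_img[OF cd x] by (simp add: vden_def)
    qed simp
  qed
  ultimately show ?thesis by simp
qed

end

section \<open>Volume and integration on a compact manifold\<close>

locale compact_riem = riem +
  assumes compact: "compact (UNIV :: 'a set)"
begin

text \<open>Finitely many charts cover by compactness, and making their domains disjoint gives
  pieces that each lie in one chart. Additivity over such pieces yields both the existence and the
  uniqueness of the volume.\<close>

lemma finite_borel_partition:
  "\<exists>(n::nat) cs B. (\<forall>k<n. cs k \<in> atlas M \<and> B k \<in> sets borel \<and> B k \<subseteq> chart_dom (cs k)) \<and>
     disjoint_family_on B {..<n} \<and> (\<Union>k<n. B k) = UNIV"
proof -
  obtain C where C: "C \<subseteq> atlas M" "finite C" "(UNIV :: 'a set) \<subseteq> (\<Union>c\<in>C. chart_dom c)"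
    by (rule compactE_image[OF compact, of "atlas M" chart_dom]) (use open_chart_dom ex_chart in blast)+
  obtain n :: nat and cs where cs: "C = cs ` {i. i < n}"
    using finite_imp_nat_seg_image_inj_on[OF C(2)] by metis
  \<comment> \<open>\<open>disjointed\<close> works on infinite sequences, so the finite list of
    chart domains is padded with empty sets.\<close>
  define A where "A k = (if k < n then chart_dom (cs k) else {})" for k
  have at: "cs k \<in> atlas M" if "k < n" for k using that C(1) unfolding cs by blast
  have A: "range A \<subseteq> sets borel"
    using open_chart_dom[OF at] by (auto simp: A_def)
  have B: "disjointed A k \<subseteq> A k" for k by (rule disjointed_subset)
  have "(\<Union>k<n. disjointed A k) = (\<Union>k. disjointed A k)"
  proof (intro set_eqI iffI)
    fix p assume "p \<in> (\<Union>k. disjointed A k)"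
    then obtain k where k: "p \<in> disjointed A k" by blast
    then have "k < n" using B[of k] by (auto simp: A_def split: if_splits)
    then show "p \<in> (\<Union>k<n. disjointed A k)" using k by blast
  qed blast
  also have "\<dots> = (\<Union>k. A k)" by (rule UN_disjointed_eq)
  also have "\<dots> = UNIV"
  proof (intro set_eqI iffI UNIV_I)
    fix p obtain c where "c \<in> C" "p \<in> chart_dom c" using C(3) by blast
    then obtain k where "k < n" "p \<in> chart_dom (cs k)" unfolding cs by blast
    then show "p \<in> (\<Union>k. A k)" by (intro UN_I[of k]) (simp_all add: A_def)
  qed
  finally have un: "(\<Union>k<n. disjointed A k) = UNIV" .
  have "disjointed A k \<in> sets borel" for k
    using sets.range_disjointed_sets[OF A] by blast
  moreover have "disjointed A k \<subseteq> chart_dom (cs k)" if "k < n" for k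
    using B[of k] that by (simp add: A_def)
  moreover have "disjoint_family_on (disjointed A) {..<n}"
    using disjoint_family_disjointed[of A] by (auto simp: disjoint_family_on_def)
  ultimately show ?thesis using un at by blast
qed

text \<open>The condition under the definite description in \<open>riemannian_volume\<close>,
  phrased with the measures \<open>vol c\<close>; \<open>volume_spec_iff\<close> is the bridge to
  the original wording.\<close>

definition volume_spec :: "'a measure \<Rightarrow> bool" where
  "volume_spec \<mu> \<longleftrightarrow> sets \<mu> = sets borel \<and>
     (\<forall>c\<in>atlas M. \<forall>X\<in>sets borel. X \<subseteq> chart_dom c \<longrightarrow> emeasure \<mu> X = emeasure (vol c) (coord c ` X))"

lemma volume_spec_iff: "volume_spec \<mu> \<longleftrightarrow> sets \<mu> = sets borel \<and>
     (\<forall>c\<in>atlas M. \<forall>X\<in>sets borel. X \<subseteq> chart_dom c \<longrightarrow>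
        emeasure \<mu> X = (\<integral>\<^sup>+x. ennreal (sqrt (det (gram M c x))) * indicator (coord c ` X) x \<partial>lborel))"
proof -
  have "emeasure (vol c) (coord c ` X) = (\<integral>\<^sup>+x. ennreal (sqrt (det (gram M c x))) * indicator (coord c ` X) x \<partial>lborel)"
    if "c \<in> atlas M" "X \<in> sets borel" "X \<subseteq> chart_dom c" for c X
    using that by (intro emeasure_vol borel_coord_image) auto
  then show ?thesis unfolding volume_spec_def by (metis (no_types, lifting))
qed

lemma volume_spec_unique:
  assumes "volume_spec \<mu>" "volume_spec \<nu>"
  shows "\<mu> = \<nu>"
proof (rule measure_eqI)
  show sets: "sets \<mu> = sets \<nu>" using assms by (simp add: volume_spec_def)
  fix X assume "X \<in> sets \<mu>"
  then have X: "X \<in> sets borel" using assms by (simp add: volume_spec_def)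
  obtain n cs D where D: "\<forall>k<n::nat. cs k \<in> atlas M \<and> D k \<in> sets borel \<and> D k \<subseteq> chart_dom (cs k)"
      "disjoint_family_on D {..<n}" "(\<Union>k<n. D k) = UNIV"
    using finite_borel_partition by blast
  define B where "B k = X \<inter> D k" for k
  have cs: "cs k \<in> atlas M" and B: "B k \<in> sets borel" "B k \<subseteq> chart_dom (cs k)" if "k < n" for k
    using that D(1) X by (auto simp: B_def)
  have dis: "disjoint_family_on B {..<n}"
    using D(2) unfolding disjoint_family_on_def B_def by blast
  have un: "(\<Union>k<n. B k) = X" using D(3) unfolding B_def by blast
  have "emeasure \<rho> X = (\<Sum>k<n. emeasure (vol (cs k)) (coord (cs k) ` B k))" if "volume_spec \<rho>" for \<rho>
  proof -
    have "(\<Sum>k<n. emeasure \<rho> (B k)) = emeasure \<rho> (\<Union>k<n. B k)"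
      using that B dis by (intro sum_emeasure) (auto simp: volume_spec_def)
    moreover have "emeasure \<rho> (B k) = emeasure (vol (cs k)) (coord (cs k) ` B k)" if "k < n" for k
      using \<open>volume_spec \<rho>\<close> cs[OF that] B[OF that] by (simp add: volume_spec_def)
    ultimately show ?thesis by (simp add: un)
  qed
  then show "emeasure \<mu> X = emeasure \<nu> X" using assms by simp
qed

text \<open>The candidate measures a set piece by piece, each piece in the chart attached to it.
  Countable additivity is inherited from the measures \<open>vol\<close>, and independence of the
  attached charts from \<open>vol_change\<close>.\<close>

lemma volume_spec_exists: "\<exists>\<mu>. volume_spec \<mu>"
proof -
  obtain n cs B where B: "\<forall>k<n::nat. cs k \<in> atlas M \<and> B k \<in> sets borel \<and> B k \<subseteq> chart_dom (cs k)"
      and dis: "disjoint_family_on B {..<n}" and un: "(\<Union>k<n. B k) = UNIV"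
    using finite_borel_partition by blast
  have cs: "cs k \<in> atlas M" and Bm: "B k \<in> sets borel" and Bd: "B k \<subseteq> chart_dom (cs k)" if "k < n" for k
    using that B by auto
  have im: "coord (cs k) ` (X \<inter> B k) \<in> sets borel" if "k < n" "X \<in> sets borel" for k X
    using that Bm Bd by (intro borel_coord_image cs) auto
  define m where "m X = (\<Sum>k<n. emeasure (vol (cs k)) (coord (cs k) ` (X \<inter> B k)))" for X
  define \<mu> where "\<mu> = measure_of UNIV (sets borel) m"
  have ca: "countably_additive (sets borel) m"
  proof (rule countably_additiveI)
    fix A :: "nat \<Rightarrow> 'a set" assume A: "range A \<subseteq> sets borel" "disjoint_family A" "(\<Union>i. A i) \<in> sets borel"
    have "(\<Sum>i. emeasure (vol (cs k)) (coord (cs k) ` (A i \<inter> B k))) =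
        emeasure (vol (cs k)) (coord (cs k) ` ((\<Union>i. A i) \<inter> B k))" if k: "k < n" for k
    proof -
      have "disjoint_family (\<lambda>i. coord (cs k) ` (A i \<inter> B k))"
        unfolding disjoint_family_on_def
      proof (intro ballI impI)
        fix i j :: nat assume "i \<noteq> j"
        then have "A i \<inter> A j = {}" using A(2) by (simp add: disjoint_family_on_def)
        then show "coord (cs k) ` (A i \<inter> B k) \<inter> coord (cs k) ` (A j \<inter> B k) = {}"
          using inj_on_image_Int[OF inj_on_coord[OF cs[OF k]], of "A i \<inter> B k" "A j \<inter> B k"] Bd[OF k] by auto
      qed
      moreover have "(\<Union>i. coord (cs k) ` (A i \<inter> B k)) = coord (cs k) ` ((\<Union>i. A i) \<inter> B k)" by blast
      moreover have "range (\<lambda>i. coord (cs k) ` (A i \<inter> B k)) \<subseteq> sets (vol (cs k))"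
        using im[OF k] A(1) by (simp add: image_subset_iff)
      ultimately show ?thesis
        using suminf_emeasure[of "\<lambda>i. coord (cs k) ` (A i \<inter> B k)" "vol (cs k)"] by simp
    qed
    then have "m (\<Union>i. A i) = (\<Sum>k<n. \<Sum>i. emeasure (vol (cs k)) (coord (cs k) ` (A i \<inter> B k)))"
      by (simp add: m_def)
    also have "\<dots> = (\<Sum>i. m (A i))"
      unfolding m_def by (rule suminf_sum[symmetric]) (rule summableI)
    finally show "(\<Sum>i. m (A i)) = m (\<Union>i. A i)" ..
  qed
  have sets: "sets \<mu> = sets borel"
    unfolding \<mu>_def using sets.sigma_sets_eq[of borel] by (subst sets_measure_of) auto
  have em: "emeasure \<mu> X = m X" if "X \<in> sets borel" for X
  proof (rule emeasure_measure_of_sigma[of UNIV "sets borel" m X, folded \<mu>_def])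
    show "sigma_algebra UNIV (sets borel :: 'a set set)"
      using sets.sigma_algebra_axioms[of "borel :: 'a measure"] by simp
    show "positive (sets borel) m" by (simp add: positive_def m_def)
  qed (use ca that in auto)
  have "emeasure \<mu> X = emeasure (vol c) (coord c ` X)" if c: "c \<in> atlas M" and X: "X \<in> sets borel" "X \<subseteq> chart_dom c" for c X
  proof -
    \<comment> \<open>A set inside the domain of c meets each piece in an overlap of two charts,
      where the chart of the piece may be replaced by c.\<close>
    have "emeasure \<mu> X = (\<Sum>k<n. emeasure (vol c) (coord c ` (X \<inter> B k)))"
      unfolding em[OF X(1)] m_def
      by (intro sum.cong refl vol_change cs c) (use X Bm Bd in auto)
    also have "\<dots> = emeasure (vol c) (\<Union>k<n. coord c ` (X \<inter> B k))"
    proof (rule sum_emeasure)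
      show "(\<lambda>k. coord c ` (X \<inter> B k)) ` {..<n} \<subseteq> sets (vol c)"
        using X Bm by (auto intro!: borel_coord_image[OF c] sets.Int)
      show "disjoint_family_on (\<lambda>k. coord c ` (X \<inter> B k)) {..<n}"
        unfolding disjoint_family_on_def
      proof (intro ballI impI)
        fix i j assume "i \<in> {..<n}" "j \<in> {..<n}" "i \<noteq> j"
        then have "B i \<inter> B j = {}" using dis by (simp add: disjoint_family_on_def)
        then show "coord c ` (X \<inter> B i) \<inter> coord c ` (X \<inter> B j) = {}"
          using inj_on_image_Int[OF inj_on_coord[OF c], of "X \<inter> B i" "X \<inter> B j"] X(2) by auto
      qed
    qed simp
    also have "(\<Union>k<n. coord c ` (X \<inter> B k)) = coord c ` X" using un by blast
    finally show ?thesis .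
  qed
  then show ?thesis using sets unfolding volume_spec_def by blast
qed

abbreviation "V \<equiv> riemannian_volume M"

lemma volume_spec: "volume_spec V"
proof -
  have "\<exists>!\<mu>. volume_spec \<mu>" using volume_spec_exists volume_spec_unique by blast
  from theI'[OF this] show ?thesis
    unfolding riemannian_volume_def volume_spec_iff[symmetric, abs_def] .
qed

lemma sets_V [simp, measurable_cong]: "sets V = sets borel"
  using volume_spec by (simp add: volume_spec_def)

lemma space_V [simp]: "space V = UNIV"
  using sets_eq_imp_space_eq[OF sets_V] by simp

lemma emeasure_V: "c \<in> atlas M \<Longrightarrow> X \<in> sets borel \<Longrightarrow> X \<subseteq> chart_dom c \<Longrightarrow> emeasure V X = emeasure (vol c) (coord c ` X)"
  using volume_spec by (simp add: volume_spec_def)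

lemma emeasure_vol_compact:
  assumes c: "c \<in> atlas M" and K: "compact K" "K \<subseteq> chart_img c"
  shows "emeasure (vol c) K < \<infinity>"
proof -
  have "continuous_on K (\<lambda>x. sqrt (det (gram M c x)))"
    by (rule continuous_on_subset[OF smooth_on_imp_continuous[OF smooth_sqrt_det_gram[OF c]] K(2)])
  then have "bounded ((\<lambda>x. sqrt (det (gram M c x))) ` K)"
    by (intro compact_imp_bounded compact_continuous_image K)
  then obtain b where b: "\<And>x. x \<in> K \<Longrightarrow> \<bar>sqrt (det (gram M c x))\<bar> \<le> b"
    unfolding bounded_iff by auto
  have Km: "K \<in> sets borel" using K(1) by (simp add: borel_compact)
  have "emeasure (vol c) K \<le> (\<integral>\<^sup>+x. ennreal b * indicator K x \<partial>lborel)"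
    unfolding emeasure_vol[OF c Km K(2)]
    by (intro nn_integral_mono) (use b in \<open>auto simp: indicator_def abs_le_iff intro!: ennreal_leI\<close>)
  also have "\<dots> = ennreal b * emeasure lborel K"
    using Km by (simp add: nn_integral_cmult_indicator)
  also have "\<dots> < \<infinity>"
    using emeasure_compact_finite[OF K(1)] by (simp add: ennreal_mult_less_top)
  finally show ?thesis .
qed

text \<open>Every point has a neighbourhood inside a compact coordinate ball, where the density is
  bounded; compactness leaves finitely many of these neighbourhoods.\<close>

lemma finite_measure_V: "finite_measure V"
proof (rule finite_measureI)
  have "\<exists>U. open U \<and> p \<in> U \<and> emeasure V U < \<infinity>" for p
  proof -
    obtain c where c: "c \<in> atlas M" "p \<in> chart_dom c" using ex_chart by blast
    have "coord c p \<in> chart_img c" using c(2) by simp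
    then obtain r where r: "r > 0" "cball (coord c p) r \<subseteq> chart_img c"
      using open_chart_img[OF c(1)] unfolding open_contains_cball by blast
    let ?U = "{q \<in> chart_dom c. coord c q \<in> ball (coord c p) r}"
    have U: "open ?U" by (rule open_coord_preimage[OF c(1)]) simp
    have "coord c ` ?U \<subseteq> cball (coord c p) r" by auto
    then have "emeasure (vol c) (coord c ` ?U) \<le> emeasure (vol c) (cball (coord c p) r)"
      by (intro emeasure_mono) auto
    also have "\<dots> < \<infinity>" by (rule emeasure_vol_compact[OF c(1) compact_cball r(2)])
    finally have "emeasure V ?U < \<infinity>" using U by (subst emeasure_V[OF c(1)]) auto
    then show ?thesis using U c(2) r(1) by (intro exI[of _ ?U]) auto
  qed
  then obtain U where U: "\<And>p. open (U p) \<and> p \<in> U p \<and> emeasure V (U p) < \<infinity>" by metis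
  obtain C where C: "finite C" "UNIV \<subseteq> (\<Union>p\<in>C. U p)"
    by (rule compactE_image[OF compact, of UNIV U]) (use U in auto)
  have "emeasure V UNIV \<le> emeasure V (\<Union>p\<in>C. U p)"
    using C U by (intro emeasure_mono) auto
  also have "\<dots> \<le> (\<Sum>p\<in>C. emeasure V (U p))"
    using C U by (intro emeasure_subadditive_finite) auto
  also have "\<dots> < \<infinity>" using U C(1) by simp
  finally show "emeasure V (space V) \<noteq> \<infinity>" by simp
qed

lemma integral_V_chart:
  fixes f :: "'a \<Rightarrow> real"
  assumes c: "c \<in> atlas M" and f: "f \<in> borel_measurable borel" and supp: "\<And>p. p \<notin> chart_dom c \<Longrightarrow> f p = 0"
  shows "(\<integral>p. f p \<partial>V) = (\<integral>x. vden c x * f (param c x) \<partial>lborel)"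
proof -
  obtain p0 :: 'a where True by blast
  \<comment> \<open>The value p0 outside the chart image only serves to make h a Borel map on the
    whole space; the density is 0 there.\<close>
  define h where "h x = (if x \<in> chart_img c then param c x else p0)" for x
  have dom: "chart_dom c \<in> sets borel" using open_chart_dom[OF c] by simp
  have img: "chart_img c \<in> sets borel" using open_chart_img[OF c] by simp
  have h: "h \<in> borel \<rightarrow>\<^sub>M borel"
  proof (rule measurableI)
    fix X :: "'a set" assume X: "X \<in> sets borel"
    have "h -` X \<inter> space borel = {x \<in> chart_img c. param c x \<in> X} \<union> (if p0 \<in> X then - chart_img c else {})"
      by (auto simp: h_def split: if_splits)
    also have "\<dots> \<in> sets borel" using borel_param_vimage[OF c X] img by (auto intro: sets.Un borel_comp)
    finally show "h -` X \<inter> space borel \<in> sets borel" .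
  qed simp
  have h': "h \<in> vol c \<rightarrow>\<^sub>M borel" using h by (simp add: measurable_def)
  \<comment> \<open>The push-forward of the coordinate volume is V restricted to the chart domain;
    the integral formula is then a change of measure.\<close>
  have eq: "distr (vol c) borel h = density V (indicator (chart_dom c))"
  proof (rule measure_eqI)
    fix X assume "X \<in> sets (distr (vol c) borel h)"
    then have X: "X \<in> sets borel" by simp
    have hX: "h -` X \<in> sets borel" using measurable_sets[OF h X] by simp
    have iX: "coord c ` (X \<inter> chart_dom c) = h -` X \<inter> chart_img c"
      using coord_image_eq[OF c, of "X \<inter> chart_dom c"] c by (auto simp: h_def)
    have "emeasure (distr (vol c) borel h) X = emeasure (vol c) (h -` X)"
      using X h' by (simp add: emeasure_distr)
    also have "\<dots> = (\<integral>\<^sup>+x. ennreal (vden c x) * indicator (h -` X) x \<partial>lborel)"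
      unfolding vol_def using hX vden_measurable[OF c] by (subst emeasure_density) auto
    also have "\<dots> = (\<integral>\<^sup>+x. ennreal (vden c x) * indicator (h -` X \<inter> chart_img c) x \<partial>lborel)"
      by (rule nn_integral_cong) (auto simp: indicator_def vden_def)
    also have "\<dots> = emeasure (vol c) (h -` X \<inter> chart_img c)"
      unfolding vol_def using hX img vden_measurable[OF c] by (subst emeasure_density) auto
    also have "\<dots> = emeasure V (X \<inter> chart_dom c)"
      unfolding iX[symmetric] using X dom by (intro emeasure_V[symmetric, OF c]) auto
    also have "\<dots> = (\<integral>\<^sup>+p. indicator (X \<inter> chart_dom c) p \<partial>V)"
      using X dom by (intro nn_integral_indicator[symmetric]) simp
    also have "\<dots> = emeasure (density V (indicator (chart_dom c))) X"
      using X dom by (subst emeasure_density) (auto intro!: nn_integral_cong simp del: nn_integral_indicator simp: indicator_def)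
    finally show "emeasure (distr (vol c) borel h) X = emeasure (density V (indicator (chart_dom c))) X" .
  qed simp
  have "(\<integral>p. f p \<partial>V) = (\<integral>p. indicator (chart_dom c) p *\<^sub>R f p \<partial>V)"
    by (rule Bochner_Integration.integral_cong) (use supp in \<open>auto simp: indicator_def\<close>)
  also have "\<dots> = (\<integral>p. f p \<partial>density V (\<lambda>p. ennreal (indicator (chart_dom c) p)))"
    using f dom by (intro integral_density[symmetric]) auto
  also have "\<dots> = (\<integral>p. f p \<partial>distr (vol c) borel h)"
  proof -
    have "(\<lambda>p. ennreal (indicator (chart_dom c) p)) = indicator (chart_dom c)"
      by (auto simp: fun_eq_iff indicator_def)
    then show ?thesis by (simp only: eq)
  qed
  also have "\<dots> = (\<integral>x. f (h x) \<partial>vol c)"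
    by (rule integral_distr[OF h' f])
  also have "\<dots> = (\<integral>x. vden c x *\<^sub>R f (h x) \<partial>lborel)"
    unfolding vol_def using f h vden_measurable[OF c] vden_nonneg[OF c]
    by (intro integral_density) (auto intro: measurable_compose)
  also have "\<dots> = (\<integral>x. vden c x * f (param c x) \<partial>lborel)"
    by (rule Bochner_Integration.integral_cong) (auto simp: h_def vden_def)
  finally show ?thesis .
qed

lemma continuous_integrable_V:
  fixes f :: "'a \<Rightarrow> real"
  assumes f: "continuous_on UNIV f"
  shows "integrable V f"
proof -
  have "bounded (range f)"
    by (intro compact_imp_bounded compact_continuous_image f compact)
  then obtain B where "\<And>p. norm (f p) \<le> B" unfolding bounded_iff by auto
  then show ?thesis
    using finite_measure_V borel_measurable_continuous_onI[OF f]
    by (intro finite_measure.integrable_const_bound[of V f B]) (auto simp: measurable_def)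
qed

end

section \<open>Differentiation under the integral and partitions of unity\<close>

text \<open>The bound g on the derivatives is also a bound on the difference quotients, by the mean
  value inequality; dominated convergence does the rest along every sequence tending to t0.\<close>

lemma has_real_derivative_integral:
  fixes f f' :: "real \<Rightarrow> 'x \<Rightarrow> real"
  assumes e: "e > 0"
    and int: "\<And>t. \<bar>t - t0\<bar> < e \<Longrightarrow> integrable \<mu> (f t)"
    and der: "\<And>t x. \<bar>t - t0\<bar> < e \<Longrightarrow> ((\<lambda>t. f t x) has_real_derivative f' t x) (at t)"
    and bound: "\<And>t x. \<bar>t - t0\<bar> < e \<Longrightarrow> \<bar>f' t x\<bar> \<le> g x"
    and g: "integrable \<mu> g" and meas: "f' t0 \<in> borel_measurable \<mu>"
  shows "((\<lambda>t. \<integral>x. f t x \<partial>\<mu>) has_real_derivative (\<integral>x. f' t0 x \<partial>\<mu>)) (at t0)"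
  unfolding has_field_derivative_iff tendsto_at_iff_sequentially comp_def
proof (intro allI impI)
  fix X :: "nat \<Rightarrow> real" assume X: "\<forall>i. X i \<in> UNIV - {t0}" "X \<longlonglongrightarrow> t0"
  \<comment> \<open>Discarding the first N terms keeps all points of the sequence in the interval
    where the hypotheses are available.\<close>
  obtain N where N: "\<And>n. n \<ge> N \<Longrightarrow> \<bar>X n - t0\<bar> < e"
    using X(2) e unfolding lim_sequentially dist_real_def by blast
  let ?q = "\<lambda>n x. (f (X (n + N)) x - f t0 x) / (X (n + N) - t0)"
  have t0: "\<bar>t0 - t0\<bar> < e" using e by simp
  have "(\<lambda>n. \<integral>x. ?q n x \<partial>\<mu>) \<longlonglongrightarrow> (\<integral>x. f' t0 x \<partial>\<mu>)"
  proof (rule integral_dominated_convergence[OF meas _ g])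
    show "?q n \<in> borel_measurable \<mu>" for n
      using int[OF N[of "n + N"]] int[OF t0] by (auto intro!: borel_measurable_divide)
    show "AE x in \<mu>. (\<lambda>n. ?q n x) \<longlonglongrightarrow> f' t0 x"
    proof (rule AE_I2)
      fix x
      have "((\<lambda>t. (f t x - f t0 x) / (t - t0)) \<longlongrightarrow> f' t0 x) (at t0)"
        using der[OF t0] by (simp add: has_field_derivative_iff)
      then have "(\<lambda>n. (f (X n) x - f t0 x) / (X n - t0)) \<longlonglongrightarrow> f' t0 x"
        using X unfolding tendsto_at_iff_sequentially comp_def by blast
      then show "(\<lambda>n. ?q n x) \<longlonglongrightarrow> f' t0 x" by (rule LIMSEQ_ignore_initial_segment)
    qed
    show "AE x in \<mu>. norm (?q n x) \<le> g x" for n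
    proof (rule AE_I2)
      fix x
      have "norm (f (X (n + N)) x - f t0 x) \<le> g x * norm (X (n + N) - t0)"
      proof (rule field_differentiable_bound[where S="{t0 - e<..<t0 + e}" and f="\<lambda>t. f t x" and f'="\<lambda>t. f' t x"])
        show "((\<lambda>t. f t x) has_field_derivative f' z x) (at z within {t0 - e<..<t0 + e})" if "z \<in> {t0 - e<..<t0 + e}" for z
          by (rule has_field_derivative_at_within, rule der) (use that in auto)
        show "norm (f' z x) \<le> g x" if "z \<in> {t0 - e<..<t0 + e}" for z
          using bound[of z x] that by auto
      qed (use N[of "n + N"] e in auto)
      moreover have "X (n + N) \<noteq> t0" using X(1) by auto
      ultimately show "norm (?q n x) \<le> g x" by (simp add: divide_le_eq)
    qed
  qed
  moreover have "(\<integral>x. ?q n x \<partial>\<mu>) =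
      ((\<integral>x. f (X (n + N)) x \<partial>\<mu>) - (\<integral>x. f t0 x \<partial>\<mu>)) / (X (n + N) - t0)" for n
    using int[OF N[of "n + N"]] int[OF t0] by simp
  ultimately have "(\<lambda>n. ((\<integral>x. f (X (n + N)) x \<partial>\<mu>) - (\<integral>x. f t0 x \<partial>\<mu>)) / (X (n + N) - t0)) \<longlonglongrightarrow> (\<integral>x. f' t0 x \<partial>\<mu>)"
    by (simp only:)
  then show "(\<lambda>n. ((\<integral>x. f (X n) x \<partial>\<mu>) - (\<integral>x. f t0 x \<partial>\<mu>)) / (X n - t0)) \<longlonglongrightarrow> (\<integral>x. f' t0 x \<partial>\<mu>)"
    by (rule LIMSEQ_offset)
qed

text \<open>The integral of \<open>Y (x + t v)\<close> does not depend on \<open>t\<close>.\<close>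

lemma integral_directional_derivative_zero:
  fixes Y :: "'v::euclidean_space \<Rightarrow> real"
  assumes Y: "smooth_on UNIV Y" and K: "compact K" "\<And>x. x \<notin> K \<Longrightarrow> Y x = 0"
  shows "(\<integral>x. frechet_derivative Y (at x) v \<partial>lborel) = 0" and "integrable lborel (\<lambda>x. frechet_derivative Y (at x) v)"
proof -
  let ?D = "\<lambda>x. frechet_derivative Y (at x) v"
  have DK: "?D x = 0" if "x \<notin> K" for x
  proof -
    have "(Y has_derivative (\<lambda>_. 0)) (at x)"
      by (rule has_derivative_transform_within_open[OF has_derivative_const[of 0] _ , of "- K"])
        (use that K compact_imp_closed in auto)
    then show ?thesis by (simp add: frechet_derivative_eqI)
  qed
  have cont: "continuous_on UNIV Y" "continuous_on UNIV ?D"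
    by (intro smooth_on_imp_continuous smooth_on_frechet_derivative Y)+
  have ci: "integrable lborel h" if h: "continuous_on UNIV h" "\<And>x. x \<notin> K \<Longrightarrow> h x = 0" for h :: "'v \<Rightarrow> real"
  proof -
    have "integrable lborel (\<lambda>x. indicator K x *\<^sub>R h x)"
      by (rule borel_integrable_compact[OF K(1) continuous_on_subset[OF h(1)]]) simp
    moreover have "(\<lambda>x. indicator K x *\<^sub>R h x) = h" using h(2) by (auto simp: fun_eq_iff indicator_def)
    ultimately show ?thesis by simp
  qed
  have intD: "integrable lborel ?D" by (rule ci[OF cont(2) DK])
  then show "integrable lborel (\<lambda>x. frechet_derivative Y (at x) v)" .
  obtain R where R: "\<And>x. x \<in> K \<Longrightarrow> norm x \<le> R" using compact_imp_bounded[OF K(1)] unfolding bounded_iff by blast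
  obtain B where B: "\<And>x. x \<in> K \<Longrightarrow> \<bar>?D x\<bar> \<le> B"
    using compact_imp_bounded[OF compact_continuous_image[OF continuous_on_subset[OF cont(2)] K(1)]]
    unfolding bounded_iff by auto
  let ?f = "\<lambda>t x. Y (x + t *\<^sub>R v)" and ?f' = "\<lambda>t x. ?D (x + t *\<^sub>R v)"
  have shift: "integrable lborel (\<lambda>x. h (x + a)) \<and> (\<integral>x. h (x + a) \<partial>lborel) = (\<integral>x. h x \<partial>lborel)"
    if "integrable lborel h" for h :: "'v \<Rightarrow> real" and a
  proof -
    have m: "(+) a \<in> lborel \<rightarrow>\<^sub>M borel" by simp
    have h: "h \<in> borel_measurable borel" using borel_measurable_integrable[OF that] by simp
    have "integrable (distr lborel borel ((+) a)) h" using that by (simp add: lborel_distr_plus)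
    then have "integrable lborel (\<lambda>x. h (a + x))" by (simp add: integrable_distr_eq[OF m h])
    moreover have "(\<integral>x. h x \<partial>distr lborel borel ((+) a)) = (\<integral>x. h (a + x) \<partial>lborel)" by (rule integral_distr[OF m h])
    ultimately show ?thesis by (simp add: lborel_distr_plus add.commute)
  qed
  note intY = ci[OF cont(1) K(2)]
  have "((\<lambda>t. \<integral>x. ?f t x \<partial>lborel) has_real_derivative (\<integral>x. ?f' 0 x \<partial>lborel)) (at 0)"
  \<comment> \<open>For |t| < 1 the translated support stays in the ball of radius R + norm v, so
    one multiple of an indicator dominates all the derivatives. The absolute value covers a negative
    B, which is possible when K is empty.\<close>
  proof (rule has_real_derivative_integral[where e=1 and g="\<lambda>x. \<bar>B\<bar> * indicator (cball 0 (R + norm v)) x"])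
    show "integrable lborel (?f t)" for t using shift[OF intY] by blast
    show "((\<lambda>t. ?f t x) has_real_derivative ?f' t x) (at t)" for t x
      by (rule has_derivative_line[OF smooth_on_differentiable[OF Y]]) simp
    show "\<bar>?f' t x\<bar> \<le> \<bar>B\<bar> * indicator (cball 0 (R + norm v)) x" if t: "\<bar>t - 0\<bar> < 1" for t x
    proof (cases "x + t *\<^sub>R v \<in> K")
      case True
      have "norm x \<le> norm (x + t *\<^sub>R v) + norm (t *\<^sub>R v)"
        using norm_triangle_ineq4[of "x + t *\<^sub>R v" "t *\<^sub>R v"] by simp
      also have "\<dots> \<le> R + norm v" using R[OF True] t by (intro add_mono) (auto simp: mult_left_le_one_le)
      finally show ?thesis using B[OF True] by simp
    qed (simp add: DK)
    show "?f' 0 \<in> borel_measurable lborel" using borel_measurable_integrable[OF intD] by simp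
    have "integrable lborel (indicator (cball 0 (R + norm v)) :: 'v \<Rightarrow> real)"
      using emeasure_lborel_cball_finite by (intro integrable_real_indicator) auto
    then show "integrable lborel (\<lambda>x::'v. \<bar>B\<bar> * indicator (cball 0 (R + norm v)) x)" by simp
  qed simp
  moreover have "(\<lambda>t. \<integral>x. ?f t x \<partial>lborel) = (\<lambda>t. \<integral>x. Y x \<partial>lborel)" using shift[OF intY] by blast
  ultimately have "((\<lambda>t. \<integral>x. Y x \<partial>lborel) has_real_derivative (\<integral>x. ?D x \<partial>lborel)) (at 0)" by simp
  then show "(\<integral>x. ?D x \<partial>lborel) = 0" by (rule DERIV_unique) simp
qed

section \<open>Bump functions on a manifold and partitions of unity\<close>

context riem
begin

lemma smooth_fun_sum: "(\<And>i. i \<in> I \<Longrightarrow> smooth_fun M (f i)) \<Longrightarrow> smooth_fun M (\<lambda>p. \<Sum>i\<in>I. f i p)"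
  unfolding smooth_fun_def by (auto intro!: smooth_intros open_chart_img)

lemma smooth_fun_divide: "smooth_fun M f \<Longrightarrow> smooth_fun M g \<Longrightarrow> (\<And>p. g p \<noteq> 0) \<Longrightarrow> smooth_fun M (\<lambda>p. f p / g p)"
  unfolding smooth_fun_def by (auto intro!: smooth_intros open_chart_img)

lemma compact_param_image: "c \<in> atlas M \<Longrightarrow> compact K \<Longrightarrow> K \<subseteq> chart_img c \<Longrightarrow> compact (param c ` K)"
  by (rule compact_continuous_image[OF continuous_on_subset[OF continuous_param]])

definition chart_bump :: "('a, 'm) chart \<Rightarrow> real^'m \<Rightarrow> real \<Rightarrow> 'a \<Rightarrow> real" where
  "chart_bump c a r p = (if p \<in> chart_dom c then bump a r (coord c p) else 0)"

lemma chart_bump_support: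
  assumes c: "c \<in> atlas M" and r: "r > 0" and p: "p \<notin> param c ` cball a r"
  shows "chart_bump c a r p = 0"
proof (cases "p \<in> chart_dom c")
  case True
  then have "p = param c (coord c p)" using c by simp
  then have "\<not> dist a (coord c p) < r" using p by (metis image_eqI less_imp_le mem_cball)
  then have "\<not> bump a r (coord c p) > 0" using bump_pos[OF r] by metis
  then show ?thesis using bump_nonneg[of a r "coord c p"] by (simp add: chart_bump_def)
qed (simp add: chart_bump_def)

text \<open>The image of the closed coordinate ball is compact, hence closed, so every point outside
  the chart domain has a neighbourhood on which the extension by 0 vanishes identically.\<close>

lemma smooth_fun_chart_bump:
  assumes c: "c \<in> atlas M" and r: "r > 0" and K: "cball a r \<subseteq> chart_img c"
  shows "smooth_fun M (chart_bump c a r)"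
  unfolding smooth_fun_def
proof
  fix c' assume c': "c' \<in> atlas M"
  let ?K = "param c ` cball a r"
  have Kc: "closed ?K" by (rule compact_imp_closed[OF compact_param_image[OF c compact_cball K]])
  let ?T = "{x \<in> chart_img c'. param c' x \<in> - ?K}"
  have T: "open ?T" by (rule open_param_preimage[OF c']) (use Kc in auto)
  show "smooth_on (chart_img c') (\<lambda>x. chart_bump c a r (param c' x))"
  proof (rule smooth_on_locally)
    fix x assume x: "x \<in> chart_img c'"
    show "\<exists>T. open T \<and> x \<in> T \<and> smooth_on T (\<lambda>x. chart_bump c a r (param c' x))"
    proof (cases "param c' x \<in> chart_dom c")
      case True
      note O = open_overlap[OF c' c]
      have "smooth_on (overlap c' c) (\<lambda>x. bump a r (transition c' c x))"
        by (rule smooth_on_compose[OF O open_UNIV smooth_on_bump smooth_transition[OF c' c]]) simp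
      then have "smooth_on (overlap c' c) (\<lambda>x. chart_bump c a r (param c' x))"
        by (rule smooth_on_cong[OF O, THEN iffD1, rotated]) (simp add: overlap_def chart_bump_def transition_def)
      then show ?thesis using O True x by (intro exI[of _ "overlap c' c"]) (simp add: overlap_def)
    next
      case False
      have "?K \<subseteq> chart_dom c" using K c by auto
      then have "x \<in> ?T" using False x by blast
      moreover have "smooth_on ?T (\<lambda>x. chart_bump c a r (param c' x))"
        by (rule smooth_on_cong[OF T, THEN iffD1, OF _ smooth_on_const[OF T, of 0]])
          (use chart_bump_support[OF c r] in auto)
      ultimately show ?thesis using T by blast
    qed
  qed
qed

end

context compact_riem
begin

text \<open>Each point q is the centre of a coordinate ball inside some W i, with a bump function
  positive at q; finitely many of these cover and are divided by their sum. The index set C consists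
  of the centres. The sets W i let a second open cover be respected, in use the preimages of the
  charts of N.\<close>

lemma partition_of_unity:
  assumes W: "\<And>p. \<exists>c\<in>atlas M. \<exists>i\<in>I. p \<in> chart_dom c \<inter> W i" "\<And>i. i \<in> I \<Longrightarrow> open (W i)"
  shows "\<exists>C cs js f K. finite (C :: 'a set) \<and> (\<forall>q\<in>C. cs q \<in> atlas M \<and> js q \<in> I \<and> compact (K q) \<and>
      K q \<subseteq> chart_dom (cs q) \<inter> W (js q) \<and> smooth_fun M (f q) \<and> (\<forall>p. p \<notin> K q \<longrightarrow> f q p = 0)) \<and>
    (\<forall>p. (\<Sum>q\<in>C. f q p) = 1)"
proof -
  have "\<exists>c i r. c \<in> atlas M \<and> i \<in> I \<and> r > 0 \<and> q \<in> chart_dom c \<and> cball (coord c q) r \<subseteq> chart_img c \<and>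
      param c ` cball (coord c q) r \<subseteq> W i" for q
  proof -
    obtain c i where c: "c \<in> atlas M" "i \<in> I" "q \<in> chart_dom c" "q \<in> W i" using W(1)[of q] by blast
    have "open {x \<in> chart_img c. param c x \<in> W i}" by (rule open_param_preimage[OF c(1) W(2)[OF c(2)]])
    moreover have "coord c q \<in> {x \<in> chart_img c. param c x \<in> W i}" using c by simp
    ultimately obtain r where "r > 0" "cball (coord c q) r \<subseteq> {x \<in> chart_img c. param c x \<in> W i}"
      unfolding open_contains_cball by blast
    then show ?thesis using c by blast
  qed
  then obtain cs js r where s: "\<And>q. cs q \<in> atlas M" "\<And>q. js q \<in> I" "\<And>q. r q > 0" "\<And>q. q \<in> chart_dom (cs q)"
    "\<And>q. cball (coord (cs q) q) (r q) \<subseteq> chart_img (cs q)" "\<And>q. param (cs q) ` cball (coord (cs q) q) (r q) \<subseteq> W (js q)"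
    by metis
  define b where "b q = chart_bump (cs q) (coord (cs q) q) (r q)" for q
  define K where "K q = param (cs q) ` cball (coord (cs q) q) (r q)" for q
  have b: "smooth_fun M (b q)" "b q p \<ge> 0" "p \<notin> K q \<Longrightarrow> b q p = 0" for q p
    using smooth_fun_chart_bump[OF s(1,3,5)] chart_bump_support[OF s(1,3)] bump_nonneg
    by (auto simp: b_def K_def chart_bump_def)
  have Kq: "compact (K q)" "K q \<subseteq> chart_dom (cs q) \<inter> W (js q)" for q
    using compact_param_image[OF s(1) compact_cball s(5)] s(6)[of q] param_in[OF s(1)] s(5)[of q] by (auto simp: K_def)
  have bo: "open {p. b q p > 0}" for q
    using open_Collect_less[OF continuous_on_const smooth_fun_continuous[OF b(1)]] by auto
  have bq: "b q q > 0" for q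
    using bump_pos[of "r q" "coord (cs q) q" "coord (cs q) q"] s(3)[of q] s(4)[of q] by (simp add: b_def chart_bump_def)
  obtain C where C: "finite C" "(UNIV :: 'a set) \<subseteq> (\<Union>q\<in>C. {p. b q p > 0})"
    by (rule compactE_image[OF compact, of UNIV "\<lambda>q. {p. b q p > 0}"]) (use bo bq in auto)
  have pos: "(\<Sum>q\<in>C. b q p) > 0" for p
  proof -
    obtain q where "q \<in> C" "b q p > 0" using C(2) by blast
    then show ?thesis using C(1) b(2) by (intro sum_pos2[of C q]) auto
  qed
  define f where "f q p = b q p / (\<Sum>q\<in>C. b q p)" for q p
  have "smooth_fun M (f q)" for q
    unfolding f_def by (intro smooth_fun_divide smooth_fun_sum b(1)) (use pos in \<open>metis less_irrefl\<close>)
  moreover have "f q p = 0" if "p \<notin> K q" for q p using b(3)[OF that] by (simp add: f_def)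
  moreover have "(\<Sum>q\<in>C. f q p) = 1" for p
    using pos[of p] by (simp add: f_def sum_divide_distrib[symmetric])
  ultimately show ?thesis
    using C(1) s(1,2) Kq by (intro exI[of _ C] exI[of _ cs] exI[of _ js] exI[of _ f] exI[of _ K]) simp
qed

text \<open>On the compact product of a closed time interval with the manifold the derivative is
  bounded, and a constant is an integrable majorant because the volume is finite.\<close>

lemma has_real_derivative_integral_V:
  fixes f f' :: "real \<Rightarrow> 'a \<Rightarrow> real"
  assumes e: "e > 0"
    and f: "\<And>t. \<bar>t - t0\<bar> < e \<Longrightarrow> continuous_on UNIV (f t)"
    and der: "\<And>t p. \<bar>t - t0\<bar> < e \<Longrightarrow> ((\<lambda>t. f t p) has_real_derivative f' t p) (at t)"
    and f': "continuous_on ({t. \<bar>t - t0\<bar> < e} \<times> UNIV) (\<lambda>(t, p). f' t p)"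
  shows "((\<lambda>t. \<integral>p. f t p \<partial>V) has_real_derivative (\<integral>p. f' t0 p \<partial>V)) (at t0)"
proof -
  let ?K = "{t0 - e/2..t0 + e/2} \<times> (UNIV :: 'a set)"
  have "?K \<subseteq> {t. \<bar>t - t0\<bar> < e} \<times> UNIV" using e by (auto simp: abs_less_iff)
  then have "bounded ((\<lambda>(t, p). f' t p) ` ?K)"
    using compact by (intro compact_imp_bounded compact_continuous_image continuous_on_subset[OF f'] compact_Times) auto
  then obtain B where B: "\<And>t p. t \<in> {t0 - e/2..t0 + e/2} \<Longrightarrow> \<bar>f' t p\<bar> \<le> B"
    unfolding bounded_iff by force
  have "continuous_on UNIV (\<lambda>p. (\<lambda>(t, p). f' t p) (t0, p))"
    by (rule continuous_on_compose2[OF f']) (use e in \<open>auto intro!: continuous_intros\<close>)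
  then have m: "f' t0 \<in> borel_measurable V"
    using borel_measurable_continuous_onI[of "f' t0"] by (simp add: measurable_def)
  show ?thesis
  proof (rule has_real_derivative_integral[where e="e/2" and g="\<lambda>_. B"])
    show "integrable V (\<lambda>_. B)" using finite_measure_V by (simp add: finite_measure.integrable_const)
    show "\<bar>f' t x\<bar> \<le> B" if "\<bar>t - t0\<bar> < e / 2" for t x
      by (rule B) (use that in \<open>auto simp: abs_if split: if_splits\<close>)
  qed (use e m der continuous_integrable_V[OF f] in auto)
qed

end

section \<open>Divergence\<close>

lemma sum_product_trace: "(\<Sum>i\<in>UNIV. \<Sum>k\<in>UNIV. A $ i $ k * B $ k $ i) = trace (A ** B)"
  for A B :: "real^'i^'i"
  by (simp add: trace_def matrix_matrix_mult_def)

lemma matrix_add_rdistrib: "(A + B) ** C = A ** C + B ** C" for A B :: "real^'i^'k" and C :: "real^'j^'i"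
  by (simp add: matrix_matrix_mult_def vec_eq_iff sum.distrib distrib_right)

lemma matrix_neg_mult: "(- A) ** C = - (A ** C)" for A :: "real^'i^'k" and C :: "real^'j^'i"
  by (simp add: matrix_matrix_mult_def vec_eq_iff sum_negf)

context riem
begin

context
  fixes c :: "('a, 'm) chart" and x :: "real^'m"
  assumes c: "c \<in> atlas M" and x: "x \<in> chart_img c"
begin

lemma gram_deriv_christoffel:
  "gram_deriv M c x k i j = (\<Sum>l\<in>UNIV. gram M c x $ j $ l * christoffel_symbol M c x l k i) +
    (\<Sum>l\<in>UNIV. gram M c x $ i $ l * christoffel_symbol M c x l k j)"
proof -
  have "gform M c x v (axis j 1) = (\<Sum>l\<in>UNIV. gram M c x $ j $ l * v $ l)" for v j
    by (simp add: gform_expand[OF c x] sum_axis gram_sym[OF c x, of _ j])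
  moreover have "gform M c x (axis i 1) v = (\<Sum>l\<in>UNIV. gram M c x $ i $ l * v $ l)" for v i
    by (simp add: gform_inner[OF c x] inner_axis' matrix_vector_mult_def)
  moreover have "christoffel M c x (axis k 1) (axis i 1) $ l = christoffel_symbol M c x l k i" for k i l
    by (simp add: christoffel_def sum_axis)
  ultimately show ?thesis
    using gram_derivative[OF c x, of "axis k 1" "axis i 1" "axis j 1"]
    by (simp add: sum_axis gram_deriv_def)
qed

text \<open>Let G be the Gram matrix, I its inverse and \<open>C k\<close> the matrix of the symbols
  with first lower index k. By metric compatibility the k-th derivative of G is
  \<open>transpose (G ** C k) + G ** C k\<close>. Hence that of I is
  \<open>- (I ** transpose (C k) + C k ** I)\<close>, and that of sqrt (det G) is sqrt (det G) times
  the trace of \<open>C k\<close>. After summation over k the trace terms cancel.\<close>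

lemma divergence_ginv:
  "(\<Sum>k\<in>UNIV. frechet_derivative (\<lambda>x. sqrt (det (gram M c x)) * matrix_inv (gram M c x) $ k $ l) (at x) (axis k 1)) =
   - sqrt (det (gram M c x)) * (\<Sum>k\<in>UNIV. \<Sum>b\<in>UNIV. matrix_inv (gram M c x) $ k $ b * christoffel_symbol M c x l k b)"
proof -
  let ?G = "gram M c x" and ?I = "matrix_inv (gram M c x)" and ?s = "\<lambda>x. sqrt (det (gram M c x))"
  define C where "C k = (\<chi> l b. christoffel_symbol M c x l k b)" for k
  define E where "E v = (\<chi> b e. frechet_derivative (\<lambda>x. gram M c x $ b $ e) (at x) v)" for v
  define D where "D v = (\<chi> k b. frechet_derivative (\<lambda>x. matrix_inv (gram M c x) $ k $ b) (at x) v)" for v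
  note inv = matrix_inv_mult[OF invertible_gram[OF c x]]
  have GT: "transpose ?G = ?G" by (simp add: transpose_def vec_eq_iff gram_sym[OF c x, of _ _])
  have E: "E (axis k 1) = transpose (?G ** C k) + ?G ** C k" for k
    by (simp add: vec_eq_iff E_def gram_deriv_def[symmetric] gram_deriv_christoffel transpose_def matrix_matrix_mult_def C_def)
  have dG: "((\<lambda>x. gram M c x $ b $ e) has_derivative (\<lambda>v. E v $ b $ e)) (at x)" for b e
    using smooth_on_has_derivative[OF smooth_gram[OF c] x] by (simp add: E_def)
  have dI: "((\<lambda>x. matrix_inv (gram M c x) $ k $ b) has_derivative (\<lambda>v. D v $ k $ b)) (at x)" for k b
    using smooth_on_has_derivative[OF smooth_ginv[OF c] x] by (simp add: D_def)
  have ds: "(?s has_derivative frechet_derivative ?s (at x)) (at x)"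
    by (rule smooth_on_has_derivative[OF smooth_sqrt_det_gram[OF c] x])
  have s: "?s x > 0" using det_gram_pos[OF c x] by simp
  \<comment> \<open>The identity that inverse times G is 1, differentiated.\<close>
  have DG: "D v ** ?G + ?I ** E v = 0" for v
  proof -
    have "(D v ** ?G + ?I ** E v) $ k $ e = 0" for k e
    proof -
      have "((\<lambda>x. \<Sum>b\<in>UNIV. matrix_inv (gram M c x) $ k $ b * gram M c x $ b $ e) has_derivative
          (\<lambda>v. \<Sum>b\<in>UNIV. ?I $ k $ b * E v $ b $ e + D v $ k $ b * ?G $ b $ e)) (at x)"
        by (intro has_derivative_sum has_derivative_mult dG dI)
      moreover have "((\<lambda>x. \<Sum>b\<in>UNIV. matrix_inv (gram M c x) $ k $ b * gram M c x $ b $ e) has_derivative (\<lambda>v. 0)) (at x)"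
      proof (rule has_derivative_transform_within_open[OF has_derivative_const open_chart_img[OF c] x])
        fix y assume "y \<in> chart_img c"
        then have "(matrix_inv (gram M c y) ** gram M c y) $ k $ e = (mat 1 :: real^'m^'m) $ k $ e"
          using matrix_inv_mult(2)[OF invertible_gram[OF c]] by simp
        then show "(mat 1 :: real^'m^'m) $ k $ e = (\<Sum>b\<in>UNIV. matrix_inv (gram M c y) $ k $ b * gram M c y $ b $ e)"
          by (simp add: matrix_matrix_mult_def)
      qed
      ultimately have "(\<lambda>v. \<Sum>b\<in>UNIV. ?I $ k $ b * E v $ b $ e + D v $ k $ b * ?G $ b $ e) = (\<lambda>v. 0)"
        by (rule has_derivative_unique)
      from fun_cong[OF this, of v] show ?thesis
        by (simp add: matrix_matrix_mult_def sum.distrib add.commute)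
    qed
    then show ?thesis by (simp add: vec_eq_iff)
  qed
  have D: "D (axis k 1) = - (?I ** transpose (C k) + C k ** ?I)" for k
  proof -
    have "D (axis k 1) = (D (axis k 1) ** ?G) ** ?I"
      by (simp add: matrix_mul_assoc[symmetric] inv)
    also have "D (axis k 1) ** ?G = - (?I ** E (axis k 1))" using DG[of "axis k 1"] by (simp add: eq_neg_iff_add_eq_0)
    also have "?I ** E (axis k 1) = (?I ** transpose (C k)) ** ?G + C k"
      by (simp add: E matrix_add_ldistrib matrix_transpose_mul GT matrix_mul_assoc inv)
    finally show ?thesis
      by (simp only: matrix_neg_mult matrix_add_rdistrib matrix_mul_assoc[symmetric] inv matrix_mul_rid)
  qed
  have trE: "trace (E (axis k 1) ** ?I) = 2 * trace (C k)" for k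
  proof -
    have "trace (E (axis k 1) ** ?I) = trace ((transpose (C k) ** ?G) ** ?I) + trace (?I ** (?G ** C k))"
      by (simp add: E matrix_transpose_mul GT matrix_add_rdistrib trace_add trace_mul_sym[of "?G ** C k" ?I])
    also have "\<dots> = trace (transpose (C k)) + trace (C k)"
      by (simp add: matrix_mul_assoc[symmetric] inv) (simp add: matrix_mul_assoc inv)
    finally show ?thesis by (simp add: trace_def transpose_def)
  qed
  \<comment> \<open>The derivative of det G is computed by Jacobi's formula, and once more as that
    of the square of its root.\<close>
  have Ds: "frechet_derivative ?s (at x) (axis k 1) = ?s x * trace (C k)" for k
  proof -
    have "((\<lambda>x. det (gram M c x)) has_derivative (\<lambda>v. det ?G * trace (E v ** ?I))) (at x)"
      using has_derivative_det[OF dG invertible_gram[OF c x]] by (simp add: sum_product_trace)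
    moreover have "((\<lambda>x. det (gram M c x)) has_derivative
        (\<lambda>v. ?s x * frechet_derivative ?s (at x) v + frechet_derivative ?s (at x) v * ?s x)) (at x)"
      by (rule has_derivative_transform_within_open[OF has_derivative_mult[OF ds ds] open_chart_img[OF c] x])
        (use det_gram_pos[OF c] in \<open>simp add: less_imp_le\<close>)
    ultimately have "(\<lambda>v. det ?G * trace (E v ** ?I)) =
        (\<lambda>v. ?s x * frechet_derivative ?s (at x) v + frechet_derivative ?s (at x) v * ?s x)"
      by (rule has_derivative_unique)
    from fun_cong[OF this, of "axis k 1"]
    have "?s x * ?s x * (2 * trace (C k)) = 2 * ?s x * frechet_derivative ?s (at x) (axis k 1)"
      using det_gram_pos[OF c x] by (simp add: trE less_imp_le)
    then have "?s x * frechet_derivative ?s (at x) (axis k 1) = ?s x * (?s x * trace (C k))"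
      by algebra
    then show ?thesis using s by (metis mult_cancel_left less_irrefl)
  qed
  have "frechet_derivative (\<lambda>x. ?s x * matrix_inv (gram M c x) $ k $ l) (at x) =
      (\<lambda>v. ?s x * D v $ k $ l + frechet_derivative ?s (at x) v * ?I $ k $ l)" for k
    by (rule frechet_derivative_eqI[OF has_derivative_mult[OF ds dI]])
  then have "(\<Sum>k\<in>UNIV. frechet_derivative (\<lambda>x. ?s x * matrix_inv (gram M c x) $ k $ l) (at x) (axis k 1)) =
      (\<Sum>k\<in>UNIV. ?s x * (trace (C k) * ?I $ k $ l - (\<Sum>b\<in>UNIV. ?I $ k $ b * C k $ l $ b) - (\<Sum>b\<in>UNIV. C k $ k $ b * ?I $ b $ l)))"
    by (simp add: Ds D matrix_matrix_mult_def transpose_def algebra_simps)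
  also have "\<dots> = ?s x * ((\<Sum>k\<in>UNIV. trace (C k) * ?I $ k $ l) - (\<Sum>k\<in>UNIV. \<Sum>b\<in>UNIV. ?I $ k $ b * C k $ l $ b)
      - (\<Sum>k\<in>UNIV. \<Sum>b\<in>UNIV. C k $ k $ b * ?I $ b $ l))"
    by (simp add: sum_distrib_left[symmetric] sum_subtractf)
  \<comment> \<open>By the symmetry of the symbols in their lower indices this is the trace sum in
    another order, and the two cancel.\<close>
  also have "(\<Sum>k\<in>UNIV. \<Sum>b\<in>UNIV. C k $ k $ b * ?I $ b $ l) = (\<Sum>b\<in>UNIV. \<Sum>k\<in>UNIV. C k $ k $ b * ?I $ b $ l)"
    by (rule sum.swap)
  also have "\<dots> = (\<Sum>b\<in>UNIV. trace (C b) * ?I $ b $ l)"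
    by (simp add: trace_def C_def sum_distrib_right christoffel_symbol_sym[OF c x, of k k b for k b])
  finally show ?thesis by (simp add: C_def)
qed

end

end

section \<open>The divergence of a form paired with a section\<close>

context riem_map
begin

lemma cov_along_sum:
  assumes \<sigma>: "\<And>q. q \<in> C \<Longrightarrow> \<sigma> q \<in> sections_along M N \<psi>" and v: "v \<in> tangent_space M p"
  shows "cov_along M N \<psi> (\<lambda>p d. \<Sum>q\<in>C. \<sigma> q p d) p v = (\<lambda>d. \<Sum>q\<in>C. cov_along M N \<psi> (\<sigma> q) p v d)"
proof
  fix d
  show "cov_along M N \<psi> (\<lambda>p d. \<Sum>q\<in>C. \<sigma> q p d) p v d = (\<Sum>q\<in>C. cov_along M N \<psi> (\<sigma> q) p v d)"
  proof (cases "d \<in> charts_at N (\<psi> p)")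
    case True
    note c = M.chart_at_in[of p]
    let ?c = "chart_at M p"
    have D: "((\<lambda>x. \<Sum>q\<in>C. \<sigma> q (param ?c x) d) has_derivative
       (\<lambda>a. \<Sum>q\<in>C. frechet_derivative (\<lambda>x. \<sigma> q (param ?c x) d) (at (coord ?c p)) a)) (at (coord ?c p))"
      by (intro has_derivative_sum has_derivative_frechet section_differentiable[OF \<sigma> c True])
    then have "cov_along M N \<psi> (\<lambda>p d. \<Sum>q\<in>C. \<sigma> q p d) p v d =
      nab N d (loc \<psi> ?c d) (\<lambda>x. \<Sum>q\<in>C. \<sigma> q (param ?c x) d) (v ?c) (coord ?c p)"
      by (intro cov_along_nab[OF c True v, where \<sigma>="\<lambda>p d. \<Sum>q\<in>C. \<sigma> q p d"]) (auto simp: differentiable_def)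
    also have "\<dots> = (\<Sum>q\<in>C. nab N d (loc \<psi> ?c d) (\<lambda>x. \<sigma> q (param ?c x) d) (v ?c) (coord ?c p))"
      unfolding nab_def frechet_derivative_eqI[OF D] by (simp add: linear_sum[OF linear_christoffel_right] sum.distrib)
    also have "\<dots> = (\<Sum>q\<in>C. cov_along M N \<psi> (\<sigma> q) p v d)"
      by (intro sum.cong refl section_cov_along[symmetric] \<sigma> c True v)
    finally show ?thesis .
  qed (simp add: cov_along_def)
qed

lemma metric_sum:
  assumes u: "\<And>q. q \<in> C \<Longrightarrow> u q \<in> tangent_space N y" and w: "w \<in> tangent_space N y"
  shows "metric N y (\<lambda>d. \<Sum>q\<in>C. u q d) w = (\<Sum>q\<in>C. metric N y (u q) w)"
    and "metric N y w (\<lambda>d. \<Sum>q\<in>C. u q d) = (\<Sum>q\<in>C. metric N y w (u q))"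
proof -
  note d = N.chart_at_in[of y]
  let ?d = "chart_at N y"
  have d': "?d \<in> atlas N" "coord ?d y \<in> chart_img ?d" using d by (simp_all add: N.charts_at_iff)
  note L = N.linear_gform_left[OF d'] N.linear_gform_right[OF d']
  note s = N.tangent_sum[of C u y, OF u]
  show "metric N y (\<lambda>d. \<Sum>q\<in>C. u q d) w = (\<Sum>q\<in>C. metric N y (u q) w)"
    "metric N y w (\<lambda>d. \<Sum>q\<in>C. u q d) = (\<Sum>q\<in>C. metric N y w (u q))"
    by (simp_all add: N.metric_eq_gform[OF s w d] N.metric_eq_gform[OF w s d] linear_sum[OF L(1)] linear_sum[OF L(2)]
      N.metric_eq_gform[OF u w d] N.metric_eq_gform[OF w u d])
qed

lemma hs_inner_cov_sum:
  assumes \<theta>: "form_along M N \<psi> \<theta>" and \<sigma>: "\<And>q. q \<in> C \<Longrightarrow> \<sigma> q \<in> sections_along M N \<psi>"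
  shows "hs_inner M N \<psi> p (cov_along M N \<psi> (\<lambda>p d. \<Sum>q\<in>C. \<sigma> q p d) p) (\<theta> p) =
    (\<Sum>q\<in>C. hs_inner M N \<psi> p (cov_along M N \<psi> (\<sigma> q) p) (\<theta> p))"
proof -
  have cov: "cov_along M N \<psi> (\<lambda>p d. \<Sum>q\<in>C. \<sigma> q p d) p (frame_at M p i) =
      (\<lambda>d. \<Sum>q\<in>C. cov_along M N \<psi> (\<sigma> q) p (frame_at M p i) d)" for i
    by (rule cov_along_sum[OF \<sigma> M.frame_at_tangent])
  have "hs_inner M N \<psi> p (cov_along M N \<psi> (\<lambda>p d. \<Sum>q\<in>C. \<sigma> q p d) p) (\<theta> p) =
      (\<Sum>i\<in>UNIV. \<Sum>q\<in>C. metric N (\<psi> p) (cov_along M N \<psi> (\<sigma> q) p (frame_at M p i)) (\<theta> p (frame_at M p i)))"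
    unfolding hs_inner_def cov
    by (intro sum.cong refl metric_sum cov_along_tangent \<sigma> formD(1)[OF \<theta>] M.frame_at_tangent)
  also have "\<dots> = (\<Sum>q\<in>C. hs_inner M N \<psi> p (cov_along M N \<psi> (\<sigma> q) p) (\<theta> p))"
    unfolding hs_inner_def by (rule sum.swap)
  finally show ?thesis .
qed

text \<open>By the product rule this is the divergence of the vector field dual to the 1-form v ->
  h(\<theta> v, \<sigma>). That its integral vanishes is integration by parts between
  \<open>cov_along\<close> and \<open>trace_cov\<close>.\<close>

definition divf :: "('a \<Rightarrow> ('a, 'm) tvec \<Rightarrow> ('b, 'n) tvec) \<Rightarrow> ('a \<Rightarrow> ('b, 'n) tvec) \<Rightarrow> 'a \<Rightarrow> real" where
  "divf \<theta> \<sigma> p = hs_inner M N \<psi> p (cov_along M N \<psi> \<sigma> p) (\<theta> p) + metric N (\<psi> p) (trace_cov M N \<psi> \<theta> p) (\<sigma> p)"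

lemma divf_sum:
  assumes \<theta>: "form_along M N \<psi> \<theta>" and \<sigma>: "\<And>q. q \<in> C \<Longrightarrow> \<sigma> q \<in> sections_along M N \<psi>"
  shows "divf \<theta> (\<lambda>p d. \<Sum>q\<in>C. \<sigma> q p d) p = (\<Sum>q\<in>C. divf \<theta> (\<sigma> q) p)"
  using metric_sum(2)[of C "\<lambda>q. \<sigma> q p" "\<psi> p", OF section_tangent[OF \<sigma>] trace_cov_tangent[OF \<theta>]]
  by (simp add: divf_def hs_inner_cov_sum[OF \<theta> \<sigma>] sum.distrib)

lemma smooth_fun_divf:
  assumes "form_along M N \<psi> \<theta>" "\<sigma> \<in> sections_along M N \<psi>"
  shows "smooth_fun M (divf \<theta> \<sigma>)"
  unfolding divf_def[abs_def]
  by (intro M.smooth_fun_add smooth_fun_hs_inner smooth_fun_metric form_cov_along trace_cov_section assms)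

text \<open>Since K is closed, the section is identically 0 near p, and covariant derivatives see
  only a neighbourhood.\<close>

lemma divf_local_zero:
  assumes \<theta>: "form_along M N \<psi> \<theta>" and \<sigma>: "\<sigma> \<in> sections_along M N \<psi>"
    and K: "closed K" "\<And>p. p \<notin> K \<Longrightarrow> \<sigma> p = (\<lambda>_. 0)" and p: "p \<notin> K"
  shows "divf \<theta> \<sigma> p = 0"
proof -
  have 0: "metric N (\<psi> p) (\<lambda>_. 0) w = 0" "metric N (\<psi> p) w (\<lambda>_. 0) = 0" if "w \<in> tangent_space N (\<psi> p)" for w
    using metric_sum[of "{}" undefined "\<psi> p" w] that by simp_all
  have "cov_along M N \<psi> \<sigma> p v = (\<lambda>_. 0)" if v: "v \<in> tangent_space M p" for v
  proof
    fix d
    show "cov_along M N \<psi> \<sigma> p v d = 0"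
    proof (cases "d \<in> charts_at N (\<psi> p)")
      case True
      note c = M.chart_at_in[of p]
      let ?c = "chart_at M p"
      have c': "?c \<in> atlas M" "coord ?c p \<in> chart_img ?c" using c by (simp_all add: M.charts_at_iff)
      have T: "open {x \<in> chart_img ?c. param ?c x \<in> - K}" using K(1) by (intro M.open_param_preimage c') auto
      have "((\<lambda>x. \<sigma> (param ?c x) d) has_derivative (\<lambda>_. 0)) (at (coord ?c p))"
        by (rule has_derivative_transform_within_open[OF has_derivative_const T])
          (use c' c p K(2) in \<open>auto simp: M.charts_at_iff\<close>)
      then show ?thesis
        using K(2)[OF p] c
        by (simp add: section_cov_along[OF \<sigma> c True v] nab_def frechet_derivative_eqI M.charts_at_iff
            linear_0[OF linear_christoffel_right])
    qed (simp add: cov_along_def)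
  qed
  then show ?thesis
    using 0 formD(1)[OF \<theta> M.frame_at_tangent] trace_cov_tangent[OF \<theta>] K(2)[OF p]
    by (simp add: divf_def hs_inner_def M.frame_at_tangent)
qed

text \<open>In coordinates the integrand is the divergence of \<open>Z\<^sup>k = sqrt g g\<^sup>k\<^sup>l h(\<theta>\<^sub>l, \<sigma>)\<close>.\<close>

definition flux :: "('a \<Rightarrow> ('a, 'm) tvec \<Rightarrow> ('b, 'n) tvec) \<Rightarrow> ('a \<Rightarrow> ('b, 'n) tvec) \<Rightarrow>
    ('a, 'm) chart \<Rightarrow> ('b, 'n) chart \<Rightarrow> 'm \<Rightarrow> real^'m \<Rightarrow> real" where
  "flux \<theta> \<sigma> c d k x = (\<Sum>l\<in>UNIV. (sqrt (det (gram M c x)) * matrix_inv (gram M c x) $ k $ l) *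
     gform N d (loc \<psi> c d x) (floc M \<theta> c d x (axis l 1)) (\<sigma> (param c x) d))"

lemma smooth_flux:
  assumes \<theta>: "form_along M N \<psi> \<theta>" and \<sigma>: "\<sigma> \<in> sections_along M N \<psi>" and at: "c \<in> atlas M" "d \<in> atlas N"
  shows "smooth_on (ldom \<psi> c d) (flux \<theta> \<sigma> c d k)"
  unfolding flux_def
  by (intro smooth_intros open_ldom at loc_in smooth_loc \<theta> section_smooth[OF \<sigma>]
      smooth_on_subset[OF M.smooth_ginv] smooth_on_subset[OF M.smooth_sqrt_det_gram]) (auto simp: ldom_img)

text \<open>The derivative of the weights, given by \<open>divergence_ginv\<close>, contributes the
  Christoffel term that completes the derivative of the coefficients of \<theta> to
  \<open>tloc\<close>; the derivative of the pairing itself splits by metric compatibility in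
  N.\<close>

lemma divf_flux:
  assumes \<theta>: "form_along M N \<psi> \<theta>" and \<sigma>: "\<sigma> \<in> sections_along M N \<psi>"
    and at: "c \<in> atlas M" "d \<in> atlas N" and x: "x \<in> ldom \<psi> c d"
  shows "sqrt (det (gram M c x)) * divf \<theta> \<sigma> (param c x) =
    (\<Sum>k\<in>UNIV. frechet_derivative (flux \<theta> \<sigma> c d k) (at x) (axis k 1))"
proof -
  let ?I = "matrix_inv (gram M c x)" and ?s = "\<lambda>x. sqrt (det (gram M c x))"
  let ?h = "gform N d (loc \<psi> c d x)" and ?\<Theta> = "\<lambda>l x. floc M \<theta> c d x (axis l 1)" and ?S = "\<lambda>x. \<sigma> (param c x) d"
  let ?n = "nab N d (loc \<psi> c d)"
  let ?a = "\<lambda>l x. gform N d (loc \<psi> c d x) (?\<Theta> l x) (?S x)"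
  let ?w = "\<lambda>k l x. ?s x * matrix_inv (gram M c x) $ k $ l"
  note xi = ldom_img[OF x] and li = loc_in[OF x] and ch = ldom_charts[OF at x]
  note L = N.linear_gform_left[OF at(2) li]
  have Isym: "?I $ k $ l = ?I $ l $ k" for k l
    unfolding M.frame_at_ginv[OF ch(1), unfolded M.coord_param[OF at(1) xi], symmetric] by (simp add: mult.commute)
  have da: "(?a l has_derivative (\<lambda>v. ?h (?n (?\<Theta> l) v x) (?S x) + ?h (?\<Theta> l x) (?n ?S v x))) (at x)" for l
    by (rule N.nab_metric[OF at(2) open_ldom[OF at] smooth_loc[OF at] loc_in formD(4)[OF \<theta> at] section_smooth[OF \<sigma> at] x])
  have dw: "(?w k l has_derivative frechet_derivative (?w k l) (at x)) (at x)" for k l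
    by (rule smooth_on_has_derivative[OF _ xi])
      (intro smooth_intros M.open_chart_img M.smooth_sqrt_det_gram M.smooth_ginv at)
  have "frechet_derivative (flux \<theta> \<sigma> c d k) (at x) = (\<lambda>v. \<Sum>l\<in>UNIV.
      ?w k l x * (?h (?n (?\<Theta> l) v x) (?S x) + ?h (?\<Theta> l x) (?n ?S v x)) + frechet_derivative (?w k l) (at x) v * ?a l x)" for k
    unfolding flux_def by (rule frechet_derivative_eqI) (intro has_derivative_sum has_derivative_mult dw da)
  then have "(\<Sum>k\<in>UNIV. frechet_derivative (flux \<theta> \<sigma> c d k) (at x) (axis k 1)) =
      (\<Sum>k\<in>UNIV. \<Sum>l\<in>UNIV. ?w k l x * (?h (?n (?\<Theta> l) (axis k 1) x) (?S x) + ?h (?\<Theta> l x) (?n ?S (axis k 1) x)))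
      + (\<Sum>k\<in>UNIV. \<Sum>l\<in>UNIV. frechet_derivative (?w k l) (at x) (axis k 1) * ?a l x)"
    by (simp add: sum.distrib)
  also have "(\<Sum>k\<in>UNIV. \<Sum>l\<in>UNIV. frechet_derivative (?w k l) (at x) (axis k 1) * ?a l x) =
      (\<Sum>l\<in>UNIV. (\<Sum>k\<in>UNIV. frechet_derivative (?w k l) (at x) (axis k 1)) * ?a l x)"
    by (subst sum.swap) (simp add: sum_distrib_right)
  also have "\<dots> = - ?s x * (\<Sum>l\<in>UNIV. \<Sum>k\<in>UNIV. \<Sum>b\<in>UNIV. ?I $ k $ b * christoffel_symbol M c x l k b * ?a l x)"
    unfolding M.divergence_ginv[OF at(1) xi] by (simp add: sum_distrib_left sum_distrib_right mult.assoc sum_negf)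
  \<comment> \<open>Summation over the upper index l puts the Christoffel symbols inside \<theta>,
    as its value on \<open>christoffel M c x (axis k 1) (axis b 1)\<close>.\<close>
  also have "(\<Sum>l\<in>UNIV. \<Sum>k\<in>UNIV. \<Sum>b\<in>UNIV. ?I $ k $ b * christoffel_symbol M c x l k b * ?a l x) =
      (\<Sum>k\<in>UNIV. \<Sum>b\<in>UNIV. ?I $ k $ b * ?h (floc M \<theta> c d x (christoffel M c x (axis k 1) (axis b 1))) (?S x))"
  proof -
    have "floc M \<theta> c d x (christoffel M c x (axis k 1) (axis b 1)) = (\<Sum>l\<in>UNIV. christoffel_symbol M c x l k b *\<^sub>R ?\<Theta> l x)" for k b
      by (subst vec_basis_expansion)
        (simp add: linear_sum[OF floc_linear[OF \<theta> at(1) xi]] linear_scale[OF floc_linear[OF \<theta> at(1) xi]] christoffel_def sum_axis)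
    then have "?h (floc M \<theta> c d x (christoffel M c x (axis k 1) (axis b 1))) (?S x) =
        (\<Sum>l\<in>UNIV. christoffel_symbol M c x l k b * ?a l x)" for k b
      by (simp add: linear_sum[OF L] linear_scale[OF L])
    then have "(\<Sum>k\<in>UNIV. \<Sum>b\<in>UNIV. ?I $ k $ b * ?h (floc M \<theta> c d x (christoffel M c x (axis k 1) (axis b 1))) (?S x)) =
        (\<Sum>k\<in>UNIV. \<Sum>b\<in>UNIV. \<Sum>l\<in>UNIV. ?I $ k $ b * christoffel_symbol M c x l k b * ?a l x)"
      by (simp add: sum_distrib_left mult.assoc)
    also have "\<dots> = (\<Sum>k\<in>UNIV. \<Sum>l\<in>UNIV. \<Sum>b\<in>UNIV. ?I $ k $ b * christoffel_symbol M c x l k b * ?a l x)"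
      by (intro sum.cong refl sum.swap)
    also have "\<dots> = (\<Sum>l\<in>UNIV. \<Sum>k\<in>UNIV. \<Sum>b\<in>UNIV. ?I $ k $ b * christoffel_symbol M c x l k b * ?a l x)"
      by (rule sum.swap)
    finally show ?thesis by simp
  qed
  finally have *: "(\<Sum>k\<in>UNIV. frechet_derivative (flux \<theta> \<sigma> c d k) (at x) (axis k 1)) =
      ?s x * (\<Sum>k\<in>UNIV. \<Sum>l\<in>UNIV. ?I $ k $ l * (?h (tloc M N \<psi> \<theta> c d x (axis l 1) (axis k 1)) (?S x) + ?h (?\<Theta> l x) (?n ?S (axis k 1) x)))"
    by (simp add: tloc_def linear_diff[OF L] sum_distrib_left sum.distrib sum_subtractf sum_negf algebra_simps)
  have "hs_inner M N \<psi> (param c x) (cov_along M N \<psi> \<sigma> (param c x)) (\<theta> (param c x)) =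
      (\<Sum>k\<in>UNIV. \<Sum>l\<in>UNIV. ?I $ k $ l * ?h (?\<Theta> l x) (?n ?S (axis k 1) x))"
    unfolding hs_inner_loc[OF form_cov_along[OF \<sigma>] \<theta> at x] floc_cov_along[OF \<sigma> at x]
    by (simp add: N.gform_sym[OF at(2) li])
  moreover have "metric N (\<psi> (param c x)) (trace_cov M N \<psi> \<theta> (param c x)) (\<sigma> (param c x)) =
      (\<Sum>k\<in>UNIV. \<Sum>l\<in>UNIV. ?I $ k $ l * ?h (tloc M N \<psi> \<theta> c d x (axis l 1) (axis k 1)) (?S x))"
  proof -
    have "metric N (\<psi> (param c x)) (trace_cov M N \<psi> \<theta> (param c x)) (\<sigma> (param c x)) =
      ?h (trace_cov M N \<psi> \<theta> (param c x) d) (?S x)"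
      using metric_loc[of "trace_cov M N \<psi> \<theta>" "param c x" \<sigma>, OF trace_cov_tangent[OF \<theta>] section_tangent[OF \<sigma>] ch] xi at by simp
    also have "\<dots> = (\<Sum>k\<in>UNIV. \<Sum>l\<in>UNIV. ?I $ k $ l * ?h (tloc M N \<psi> \<theta> c d x (axis k 1) (axis l 1)) (?S x))"
      unfolding trace_cov_loc[OF \<theta> at x] by (simp add: linear_sum[OF L] linear_scale[OF L])
    also have "\<dots> = (\<Sum>l\<in>UNIV. \<Sum>k\<in>UNIV. ?I $ l $ k * ?h (tloc M N \<psi> \<theta> c d x (axis k 1) (axis l 1)) (?S x))"
      by (subst sum.swap) (simp add: Isym)
    finally show ?thesis .
  qed
  ultimately show ?thesis
    unfolding * divf_def by (simp add: sum.distrib algebra_simps)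
qed

end

section \<open>The divergence theorem on a compact manifold\<close>

locale compact_riem_map = riem_map M N \<psi> + M: compact_riem M
  for M :: "('a::{t2_space,second_countable_topology}, 'm::finite) riemannian"
    and N :: "('b::{t2_space,second_countable_topology}, 'n::finite) riemannian" and \<psi>
begin

text \<open>The partition of unity respects the charts of M and the preimages of the charts of N at
  once, so each piece lives where \<psi> has a single local expression. Both the divergence theorem
  and the first variation are proved for such pieces and then summed.\<close>

lemma section_decomposition:
  assumes \<sigma>: "\<sigma> \<in> sections_along M N \<psi>"
  obtains C :: "'a set" and \<tau> where "finite C" "\<sigma> = (\<lambda>p d. \<Sum>q\<in>C. \<tau> q p d)"
    "\<And>q. q \<in> C \<Longrightarrow> \<tau> q \<in> sections_along M N \<psi>"
    "\<And>q. q \<in> C \<Longrightarrow> \<exists>c\<in>atlas M. \<exists>d\<in>atlas N. \<exists>K. compact K \<and> K \<subseteq> chart_dom c \<inter> \<psi> -` chart_dom d \<and>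
       (\<forall>p. p \<notin> K \<longrightarrow> \<tau> q p = (\<lambda>_. 0))"
proof -
  have "\<exists>C cs ds f K. finite (C :: 'a set) \<and> (\<forall>q\<in>C. cs q \<in> atlas M \<and> ds q \<in> atlas N \<and> compact (K q) \<and>
      K q \<subseteq> chart_dom (cs q) \<inter> \<psi> -` chart_dom (ds q) \<and> smooth_fun M (f q) \<and> (\<forall>p. p \<notin> K q \<longrightarrow> f q p = 0)) \<and>
    (\<forall>p. (\<Sum>q\<in>C. f q p) = 1)"
  proof (rule M.partition_of_unity)
    show "\<exists>c\<in>atlas M. \<exists>d\<in>atlas N. p \<in> chart_dom c \<inter> \<psi> -` chart_dom d" for p
      using M.ex_chart[of p] N.ex_chart[of "\<psi> p"] by blast
    show "open (\<psi> -` chart_dom d)" if "d \<in> atlas N" for d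
      by (rule open_psi_vimage[OF N.open_chart_dom[OF that]])
  qed
  then obtain C :: "'a set" and cs ds f K where fin: "finite C" and
      C: "\<forall>q\<in>C. cs q \<in> atlas M \<and> ds q \<in> atlas N \<and> compact (K q) \<and>
      K q \<subseteq> chart_dom (cs q) \<inter> \<psi> -` chart_dom (ds q) \<and> smooth_fun M (f q) \<and> (\<forall>p. p \<notin> K q \<longrightarrow> f q p = 0)"
      and one: "\<And>p. (\<Sum>q\<in>C. f q p) = 1"
    by (elim exE conjE) metis
  show ?thesis
  proof (rule that[of C "\<lambda>q p d. f q p *\<^sub>R \<sigma> p d"])
    show "\<sigma> = (\<lambda>p d. \<Sum>q\<in>C. f q p *\<^sub>R \<sigma> p d)"
      by (simp add: scaleR_sum_left[symmetric] one)
    show "(\<lambda>p d. f q p *\<^sub>R \<sigma> p d) \<in> sections_along M N \<psi>" if "q \<in> C" for q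
      by (rule section_scale[OF \<sigma>]) (use C that in blast)
    show "\<exists>c\<in>atlas M. \<exists>d\<in>atlas N. \<exists>K. compact K \<and> K \<subseteq> chart_dom c \<inter> \<psi> -` chart_dom d \<and>
       (\<forall>p. p \<notin> K \<longrightarrow> (\<lambda>d. f q p *\<^sub>R \<sigma> p d) = (\<lambda>_. 0))" if "q \<in> C" for q
      using bspec[OF C that]
      by (intro bexI[of _ "cs q"] bexI[of _ "ds q"] exI[of _ "K q"]) auto
  qed (rule fin)
qed

lemma integral_divf_local:
  assumes \<theta>: "form_along M N \<psi> \<theta>" and \<sigma>: "\<sigma> \<in> sections_along M N \<psi>"
    and at: "c \<in> atlas M" "d \<in> atlas N"
    and K: "compact K" "K \<subseteq> chart_dom c \<inter> \<psi> -` chart_dom d" "\<And>p. p \<notin> K \<Longrightarrow> \<sigma> p = (\<lambda>_. 0)"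
  shows "(\<integral>p. divf \<theta> \<sigma> p \<partial>M.V) = 0"
proof -
  let ?K = "coord c ` K"
  have zero: "divf \<theta> \<sigma> p = 0" if "p \<notin> K" for p
    by (rule divf_local_zero[OF \<theta> \<sigma> compact_imp_closed[OF K(1)] K(3) that])
  have K': "compact ?K"
    by (rule compact_continuous_image[OF continuous_on_subset[OF M.continuous_coord[OF at(1)]] K(1)]) (use K(2) in blast)
  have notK: "param c x \<notin> K" if "x \<in> chart_img c" "x \<notin> ?K" for x
    using that at(1) by (metis M.coord_param imageI)
  have KL: "?K \<subseteq> ldom \<psi> c d"
  proof
    fix x assume "x \<in> ?K"
    then obtain p where "p \<in> K" "x = coord c p" by blast
    then show "x \<in> ldom \<psi> c d" using K(2) at(1) by (simp add: ldom_def subset_iff)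
  qed
  \<comment> \<open>The flux vanishes off the compact image of K, so its extension by 0 from the
    open set \<open>ldom \<psi> c d\<close> is smooth on the whole coordinate space.\<close>
  define Z where "Z k x = (if x \<in> ldom \<psi> c d then flux \<theta> \<sigma> c d k x else 0)" for k x
  have Z0: "Z k x = 0" if "x \<notin> ?K" for k x
  proof (cases "x \<in> ldom \<psi> c d")
    case True
    have "\<sigma> (param c x) = (\<lambda>_. 0)" by (rule K(3)[OF notK[OF ldom_img[OF True] that]])
    then show ?thesis
      by (simp add: Z_def flux_def linear_0[OF N.linear_gform_right[OF at(2) loc_in[OF True]]])
  qed (simp add: Z_def)
  have oK: "open (- ?K)" using compact_imp_closed[OF K'] by auto
  have "\<exists>T. open T \<and> x \<in> T \<and> smooth_on T (Z k)" for k x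
  proof (cases "x \<in> ldom \<psi> c d")
    case True
    have "smooth_on (ldom \<psi> c d) (Z k)"
      by (subst smooth_on_cong[OF open_ldom[OF at], where g="flux \<theta> \<sigma> c d k"])
        (simp_all add: Z_def smooth_flux[OF \<theta> \<sigma> at])
    then show ?thesis using True open_ldom[OF at] by blast
  next
    case False
    then have "x \<in> - ?K" using KL by blast
    moreover have "smooth_on (- ?K) (Z k)"
      by (subst smooth_on_cong[OF oK, where g="\<lambda>_. 0"]) (simp_all add: Z0 smooth_on_const[OF oK])
    ultimately show ?thesis using oK by blast
  qed
  then have Zs: "smooth_on UNIV (Z k)" for k by (rule smooth_on_locally)
  have eq: "M.vden c x * divf \<theta> \<sigma> (param c x) = (\<Sum>k\<in>UNIV. frechet_derivative (Z k) (at x) (axis k 1))" for x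
  proof (cases "x \<in> ldom \<psi> c d")
    case True
    have "frechet_derivative (Z k) (at x) = frechet_derivative (flux \<theta> \<sigma> c d k) (at x)" for k
      by (rule frechet_derivative_cong_open[OF open_ldom[OF at] True]) (simp add: Z_def)
    then show ?thesis
      using divf_flux[OF \<theta> \<sigma> at True] ldom_img[OF True] by (simp add: M.vden_def)
  next
    case False
    then have x: "x \<in> - ?K" using KL by blast
    have "frechet_derivative (Z k) (at x) = frechet_derivative (\<lambda>_. 0) (at x)" for k
      by (rule frechet_derivative_cong_open[OF oK x]) (simp add: Z0)
    moreover have "M.vden c x * divf \<theta> \<sigma> (param c x) = 0"
      using zero[OF notK] x by (auto simp: M.vden_def)
    ultimately show ?thesis by simp
  qed
  have "(\<integral>p. divf \<theta> \<sigma> p \<partial>M.V) = (\<integral>x. M.vden c x * divf \<theta> \<sigma> (param c x) \<partial>lborel)"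
    by (rule M.integral_V_chart[OF at(1) borel_measurable_continuous_onI[OF M.smooth_fun_continuous[OF smooth_fun_divf[OF \<theta> \<sigma>]]] zero])
      (use K(2) in blast)
  also have "\<dots> = (\<Sum>k\<in>UNIV. \<integral>x. frechet_derivative (Z k) (at x) (axis k 1) \<partial>lborel)"
    unfolding eq by (intro Bochner_Integration.integral_sum integral_directional_derivative_zero(2)[OF Zs K' Z0])
  also have "\<dots> = 0"
    by (simp add: integral_directional_derivative_zero(1)[OF Zs K' Z0])
  finally show ?thesis .
qed

lemma integral_divf:
  assumes \<theta>: "form_along M N \<psi> \<theta>" and \<sigma>: "\<sigma> \<in> sections_along M N \<psi>"
  shows "(\<integral>p. divf \<theta> \<sigma> p \<partial>M.V) = 0"
proof -
  obtain C :: "'a set" and \<tau> where C: "finite C" "\<sigma> = (\<lambda>p d. \<Sum>q\<in>C. \<tau> q p d)"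
    "\<And>q. q \<in> C \<Longrightarrow> \<tau> q \<in> sections_along M N \<psi>"
    "\<And>q. q \<in> C \<Longrightarrow> \<exists>c\<in>atlas M. \<exists>d\<in>atlas N. \<exists>K. compact K \<and> K \<subseteq> chart_dom c \<inter> \<psi> -` chart_dom d \<and>
       (\<forall>p. p \<notin> K \<longrightarrow> \<tau> q p = (\<lambda>_. 0))"
    by (rule section_decomposition[OF \<sigma>]) (rule that; assumption)
  have "(\<integral>p. divf \<theta> \<sigma> p \<partial>M.V) = (\<integral>p. (\<Sum>q\<in>C. divf \<theta> (\<tau> q) p) \<partial>M.V)"
    unfolding C(2) by (intro Bochner_Integration.integral_cong refl divf_sum[OF \<theta> C(3)])
  also have "\<dots> = (\<Sum>q\<in>C. \<integral>p. divf \<theta> (\<tau> q) p \<partial>M.V)"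
    by (intro Bochner_Integration.integral_sum M.continuous_integrable_V M.smooth_fun_continuous smooth_fun_divf \<theta> C(3))
  also have "\<dots> = 0"
    using C(4) integral_divf_local[OF \<theta> C(3)] by (intro sum.neutral ballI) metis
  finally show ?thesis .
qed

lemma integral_hs_inner_cov:
  assumes \<theta>: "form_along M N \<psi> \<theta>" and \<sigma>: "\<sigma> \<in> sections_along M N \<psi>"
  shows "(\<integral>p. hs_inner M N \<psi> p (cov_along M N \<psi> \<sigma> p) (\<theta> p) \<partial>M.V) =
    - (\<integral>p. metric N (\<psi> p) (trace_cov M N \<psi> \<theta> p) (\<sigma> p) \<partial>M.V)"
proof -
  have "integrable M.V (\<lambda>p. hs_inner M N \<psi> p (cov_along M N \<psi> \<sigma> p) (\<theta> p))"
    "integrable M.V (\<lambda>p. metric N (\<psi> p) (trace_cov M N \<psi> \<theta> p) (\<sigma> p))"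
    by (intro M.continuous_integrable_V M.smooth_fun_continuous smooth_fun_hs_inner smooth_fun_metric
        form_cov_along trace_cov_section assms)+
  then show ?thesis using integral_divf[OF assms] by (simp add: divf_def)
qed

end

section \<open>Smooth families of maps\<close>

lemma frechet_derivative_slice:
  fixes g :: "'p::real_normed_vector \<times> 'v::real_normed_vector \<Rightarrow> 'w::real_normed_vector"
  assumes "g differentiable (at (r, x))"
  shows "frechet_derivative (\<lambda>x. g (r, x)) (at x) u = frechet_derivative g (at (r, x)) (0, u)"
    and "frechet_derivative (\<lambda>r. g (r, x)) (at r) a = frechet_derivative g (at (r, x)) (a, 0)"
    and "(\<lambda>x. g (r, x)) differentiable (at x)" and "(\<lambda>r. g (r, x)) differentiable (at r)"
proof -
  note g = has_derivative_frechet[OF assms]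
  have "((\<lambda>x. (r, x)) has_derivative (\<lambda>u. (0, u))) (at x)" "((\<lambda>r. (r, x)) has_derivative (\<lambda>a. (a, 0))) (at r)"
    by (auto intro!: derivative_eq_intros)
  note * = has_derivative_compose[OF this(1) g] has_derivative_compose[OF this(2) g]
  from fun_cong[OF frechet_derivative_eqI[OF *(1)], of u] fun_cong[OF frechet_derivative_eqI[OF *(2)], of a]
  show "frechet_derivative (\<lambda>x. g (r, x)) (at x) u = frechet_derivative g (at (r, x)) (0, u)"
    "frechet_derivative (\<lambda>r. g (r, x)) (at r) a = frechet_derivative g (at (r, x)) (a, 0)" .
  show "(\<lambda>x. g (r, x)) differentiable (at x)" "(\<lambda>r. g (r, x)) differentiable (at r)"
    using * unfolding differentiable_def by blast+
qed

text \<open>Derivatives along M and along the parameters become values of one operator on the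
  product, in the directions (0, u) and (a, 0), so that the commutation rules can mix the
  two.\<close>

lemma nab_slice:
  fixes Y W :: "'p::real_normed_vector \<times> 'v::real_normed_vector \<Rightarrow> real^'n"
  assumes "Y differentiable (at (r, x))" "W differentiable (at (r, x))"
  shows "nab N d (\<lambda>x. Y (r, x)) (\<lambda>x. W (r, x)) u x = nab N d Y W (0, u) (r, x)"
    and "nab N d (\<lambda>r. Y (r, x)) (\<lambda>r. W (r, x)) a r = nab N d Y W (a, 0) (r, x)"
  using assms by (simp_all add: nab_def frechet_derivative_slice)

lemma smooth_on_slice:
  fixes g :: "'p::euclidean_space \<times> 'v::euclidean_space \<Rightarrow> 'w::real_normed_vector"
  assumes "open S" "smooth_on S g"
  shows "smooth_on {x. (r, x) \<in> S} (\<lambda>x. g (r, x))" "open {x. (r, x) \<in> S}" "open {r. (r, x) \<in> S}"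
proof -
  have "open ((\<lambda>x. (r, x)) -` S)" by (intro open_vimage assms(1) continuous_intros)
  then show o: "open {x. (r, x) \<in> S}" by (simp add: vimage_def)
  have "open ((\<lambda>r. (r, x)) -` S)" by (intro open_vimage assms(1) continuous_intros)
  then show "open {r. (r, x) \<in> S}" by (simp add: vimage_def)
  show "smooth_on {x. (r, x) \<in> S} (\<lambda>x. g (r, x))"
    by (rule smooth_on_compose[OF o assms]) (auto intro!: smooth_intros o)
qed

lemma has_derivative_powr_const:
  assumes "(f has_derivative f') (at r)" "f r > (0::real)"
  shows "((\<lambda>r. f r powr a) has_derivative (\<lambda>v. a * f r powr (a - 1) * f' v)) (at r)"
proof -
  have "((\<lambda>x. x powr a) has_real_derivative a * f r powr (a - 1)) (at (f r))"
    using assms(2) by (auto intro!: derivative_eq_intros)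
  then show ?thesis
    unfolding has_field_derivative_def by (rule has_derivative_compose[OF assms(1)])
qed

locale riem_family = M: compact_riem M + N: riem N
  for M :: "('a::{t2_space,second_countable_topology}, 'm::finite) riemannian"
    and N :: "('b::{t2_space,second_countable_topology}, 'n::finite) riemannian" +
  fixes P :: "'p::euclidean_space set" and F :: "'p \<Rightarrow> 'a \<Rightarrow> 'b"
  assumes open_P: "open P" and family: "smooth_family M N P F"
begin

definition fdom :: "('a, 'm) chart \<Rightarrow> ('b, 'n) chart \<Rightarrow> ('p \<times> (real^'m)) set" where
  "fdom c d = {(r, x). r \<in> P \<and> x \<in> chart_img c \<and> F r (param c x) \<in> chart_dom d}"

definition fexp :: "('a, 'm) chart \<Rightarrow> ('b, 'n) chart \<Rightarrow> 'p \<times> (real^'m) \<Rightarrow> real^'n" where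
  "fexp c d z = coord d (F (fst z) (param c (snd z)))"

lemma open_fdom:
  assumes c: "c \<in> atlas M" and d: "d \<in> atlas N"
  shows "open (fdom c d)"
proof -
  have 1: "continuous_on (P \<times> UNIV) (\<lambda>(r, p). F r p)"
    using family unfolding smooth_family_def by blast
  have 2: "continuous_on (P \<times> chart_img c) (\<lambda>z. (fst z, param c (snd z)))"
    by (intro continuous_on_Pair continuous_on_fst continuous_on_id
        continuous_on_compose2[OF M.continuous_param[OF c] continuous_on_snd[OF continuous_on_id]]) auto
  have "continuous_on (P \<times> chart_img c) (\<lambda>z. (\<lambda>(r, p). F r p) (fst z, param c (snd z)))"
    by (rule continuous_on_compose2[OF 1 2]) auto
  from continuous_open_preimage[OF this open_Times[OF open_P M.open_chart_img[OF c]] N.open_chart_dom[OF d]]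
  have "open ((P \<times> chart_img c) \<inter> (\<lambda>z. F (fst z) (param c (snd z))) -` chart_dom d)" by simp
  moreover have "(P \<times> chart_img c) \<inter> (\<lambda>z. F (fst z) (param c (snd z))) -` chart_dom d = fdom c d"
    by (auto simp: fdom_def)
  ultimately show ?thesis by simp
qed

lemma smooth_fexp:
  assumes c: "c \<in> atlas M" and d: "d \<in> atlas N"
  shows "smooth_on (fdom c d) (fexp c d)"
proof -
  have "(\<lambda>(r, x). coord d (F r (param c x))) = fexp c d" by (auto simp: fexp_def fun_eq_iff)
  moreover have "smooth_on (fdom c d) (\<lambda>(r, x). coord d (F r (param c x)))"
    unfolding fdom_def using family c d unfolding smooth_family_def by blast
  ultimately show ?thesis by simp
qed

lemma fexp_in: "z \<in> fdom c d \<Longrightarrow> fexp c d z \<in> chart_img d"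
  by (auto simp: fdom_def fexp_def)

lemma fdom_iff: "(r, x) \<in> fdom c d \<longleftrightarrow> r \<in> P \<and> x \<in> ldom (F r) c d"
  by (auto simp: fdom_def ldom_def)

lemma loc_fexp: "loc (F r) c d = (\<lambda>x. fexp c d (r, x))"
  by (simp add: loc_def fexp_def fun_eq_iff)

lemma ldom_slice: "r \<in> P \<Longrightarrow> ldom (F r) c d = {x. (r, x) \<in> fdom c d}"
  by (auto simp: fdom_iff)

lemma slice: "r \<in> P \<Longrightarrow> compact_riem_map M N (F r)"
proof
  assume r: "r \<in> P"
  show "smooth_map M N (F r)"
    unfolding smooth_map_def
  proof (intro conjI ballI)
    have 1: "continuous_on (P \<times> UNIV) (\<lambda>(r, p). F r p)"
      using family unfolding smooth_family_def by blast
    have 2: "continuous_on UNIV (\<lambda>p::'a. (r, p))" by (intro continuous_intros)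
    have "continuous_on UNIV (\<lambda>p. (\<lambda>(r, p). F r p) (r, p))"
      by (rule continuous_on_compose2[OF 1 2]) (use r in auto)
    then show "continuous_on UNIV (F r)" by simp
    fix c d assume at: "c \<in> atlas M" "d \<in> atlas N"
    have "coord d \<circ> F r \<circ> param c = (\<lambda>x. fexp c d (r, x))" by (simp add: fexp_def fun_eq_iff)
    then show "smooth_on {x \<in> chart_img c. F r (param c x) \<in> chart_dom d} (coord d \<circ> F r \<circ> param c)"
      using smooth_on_slice(1)[OF open_fdom[OF at] smooth_fexp[OF at]] ldom_slice[OF r, of c d] by (simp add: ldom_def)
  qed
qed

lemma charts_fdom:
  assumes "r \<in> P" "c \<in> charts_at M p" "d \<in> charts_at N (F r p)"
  shows "(r, coord c p) \<in> fdom c d"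
  using assms by (simp add: fdom_def M.charts_at_iff N.charts_at_iff)

section \<open>Smooth functions of a parameter and a point\<close>

definition smooth_pfun :: "('p \<Rightarrow> 'a \<Rightarrow> real) \<Rightarrow> bool" where
  "smooth_pfun G \<longleftrightarrow> (\<forall>c\<in>atlas M. smooth_on (P \<times> chart_img c) (\<lambda>z. G (fst z) (param c (snd z))))"

definition pd :: "'p \<Rightarrow> ('p \<Rightarrow> 'a \<Rightarrow> real) \<Rightarrow> 'p \<Rightarrow> 'a \<Rightarrow> real" where
  "pd a G r p = frechet_derivative (\<lambda>r. G r p) (at r) a"

lemma open_P_img: "c \<in> atlas M \<Longrightarrow> open (P \<times> chart_img c)"
  by (intro open_Times open_P M.open_chart_img)

lemma pd_slice:
  assumes G: "smooth_pfun G" and c: "c \<in> atlas M" and z: "r \<in> P" "x \<in> chart_img c"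
  shows "pd a G r (param c x) = frechet_derivative (\<lambda>z. G (fst z) (param c (snd z))) (at (r, x)) (a, 0)"
    and "(\<lambda>r. G r (param c x)) differentiable (at r)"
  using frechet_derivative_slice(2,4)[of "\<lambda>z. G (fst z) (param c (snd z))" r x]
    smooth_on_differentiable[of "P \<times> chart_img c" "\<lambda>z. G (fst z) (param c (snd z))" "(r, x)"] G c z
  by (simp_all add: pd_def smooth_pfun_def)

lemma smooth_pfun_pd:
  assumes G: "smooth_pfun G"
  shows "smooth_pfun (pd a G)"
  unfolding smooth_pfun_def
proof
  fix c assume c: "c \<in> atlas M"
  have "smooth_on (P \<times> chart_img c) (\<lambda>z. frechet_derivative (\<lambda>z. G (fst z) (param c (snd z))) (at z) (a, 0))"
    using G c by (intro smooth_on_frechet_derivative) (simp add: smooth_pfun_def)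
  then show "smooth_on (P \<times> chart_img c) (\<lambda>z. pd a G (fst z) (param c (snd z)))"
    by (subst smooth_on_cong[OF open_P_img[OF c]]) (auto simp: pd_slice(1)[OF G c])
qed

lemma pfun_differentiable:
  assumes G: "smooth_pfun G" and r: "r \<in> P"
  shows "(\<lambda>r. G r p) differentiable (at r)"
proof -
  obtain c where "c \<in> atlas M" "p \<in> chart_dom c" using M.ex_chart by blast
  then show ?thesis using pd_slice(2)[OF G _ r, of c "coord c p"] by simp
qed

lemma pfun_continuous:
  assumes G: "smooth_pfun G"
  shows "continuous_on (P \<times> UNIV) (\<lambda>(r, p). G r p)"
proof -
  have "continuous_on (P \<times> chart_dom c) (\<lambda>(r, p). G r p)" if c: "c \<in> atlas M" for c
  proof -
    have "continuous_on (P \<times> chart_img c) (\<lambda>z. G (fst z) (param c (snd z)))"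
      by (rule smooth_on_imp_continuous) (use G c in \<open>simp add: smooth_pfun_def\<close>)
    moreover have "continuous_on (P \<times> chart_dom c) (\<lambda>w. (fst w, coord c (snd w)))"
      by (intro continuous_on_Pair continuous_on_fst continuous_on_id
          continuous_on_compose2[OF M.continuous_coord[OF c] continuous_on_snd[OF continuous_on_id]]) auto
    ultimately have "continuous_on (P \<times> chart_dom c) (\<lambda>w. (\<lambda>z. G (fst z) (param c (snd z))) (fst w, coord c (snd w)))"
      by (rule continuous_on_compose2) auto
    then show ?thesis by (rule continuous_on_eq) (auto simp: c)
  qed
  then have "continuous_on (\<Union>c\<in>atlas M. P \<times> chart_dom c) (\<lambda>(r, p). G r p)"
    by (intro continuous_on_open_Union) (auto intro!: open_Times open_P M.open_chart_dom)
  moreover have "(\<Union>c\<in>atlas M. P \<times> chart_dom c) = P \<times> (UNIV :: 'a set)" using M.ex_chart by blast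
  ultimately show ?thesis by simp
qed

lemma pfun_continuous_slice: "smooth_pfun G \<Longrightarrow> r \<in> P \<Longrightarrow> continuous_on UNIV (G r)"
proof -
  assume "smooth_pfun G" "r \<in> P"
  then have "continuous_on UNIV (\<lambda>p. (\<lambda>(r, p). G r p) (r, p))"
    by (intro continuous_on_compose2[OF pfun_continuous] continuous_intros) auto
  then show "continuous_on UNIV (G r)" by simp
qed

lemma pfun_integral_derivative:
  assumes G: "smooth_pfun G" and t: "r + t *\<^sub>R a \<in> P"
  shows "((\<lambda>t. \<integral>p. G (r + t *\<^sub>R a) p \<partial>M.V) has_real_derivative (\<integral>p. pd a G (r + t *\<^sub>R a) p \<partial>M.V)) (at t)"
proof -
  have "open ((\<lambda>t. r + t *\<^sub>R a) -` P)" by (intro open_vimage open_P continuous_intros)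
  then obtain e where e: "e > 0" "\<And>s. \<bar>s - t\<bar> < e \<Longrightarrow> r + s *\<^sub>R a \<in> P"
    using t unfolding open_dist dist_real_def by (metis vimageE vimageI)
  have "continuous_on ({s. \<bar>s - t\<bar> < e} \<times> UNIV) (\<lambda>w. (\<lambda>(r, p). pd a G r p) (r + fst w *\<^sub>R a, snd w))"
    by (rule continuous_on_compose2[OF pfun_continuous[OF smooth_pfun_pd[OF G]]])
      (auto intro!: continuous_intros e(2))
  then have "continuous_on ({s. \<bar>s - t\<bar> < e} \<times> UNIV) (\<lambda>(s, p). pd a G (r + s *\<^sub>R a) p)"
    by (rule continuous_on_eq) auto
  moreover have "((\<lambda>s. G (r + s *\<^sub>R a) p) has_real_derivative pd a G (r + s *\<^sub>R a) p) (at s)" if "\<bar>s - t\<bar> < e" for s p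
    unfolding pd_def by (rule has_derivative_line[OF pfun_differentiable[OF G e(2)[OF that]]])
  ultimately show ?thesis
    using e pfun_continuous_slice[OF G] by (intro M.has_real_derivative_integral_V[where e=e]) auto
qed

section \<open>Density, velocity and acceleration of a family\<close>

definition dens :: "'p \<Rightarrow> 'a \<Rightarrow> real" where
  "dens r p = 1 + (hs_norm M N (F r) p (differential M N (F r) p))\<^sup>2"

definition vel :: "'p \<Rightarrow> 'p \<Rightarrow> 'a \<Rightarrow> ('b, 'n) tvec" where
  "vel a r p = (\<lambda>d. if d \<in> charts_at N (F r p) then frechet_derivative (\<lambda>r. coord d (F r p)) (at r) a else 0)"

text \<open>\<open>accel a b\<close> is \<open>\<nabla>\<^sub>b \<partial>\<^sub>a F\<close>.\<close>

definition accel :: "'p \<Rightarrow> 'p \<Rightarrow> 'p \<Rightarrow> 'a \<Rightarrow> ('b, 'n) tvec" where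
  "accel a b r p = (\<lambda>d. if d \<in> charts_at N (F r p) then
     nab N d (\<lambda>r. coord d (F r p)) (\<lambda>r. frechet_derivative (\<lambda>r. coord d (F r p)) (at r) a) b r else 0)"

lemma dens_eq:
  assumes "r \<in> P"
  shows "dens r p = 1 + hs_inner M N (F r) p (differential M N (F r) p) (differential M N (F r) p)"
proof -
  interpret S: compact_riem_map M N "F r" by (rule slice[OF assms])
  show ?thesis by (simp add: dens_def S.hs_norm_sq[OF S.form_differential])
qed

lemma dens_pos: "dens r p > 0"
  unfolding dens_def by (smt (verit) zero_le_power2)

context
  fixes c :: "('a, 'm) chart" and d :: "('b, 'n) chart"
  assumes c: "c \<in> atlas M" and d: "d \<in> atlas N"
begin

lemma fexp_differentiable: "z \<in> fdom c d \<Longrightarrow> fexp c d differentiable (at z)"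
  by (rule smooth_on_differentiable[OF smooth_fexp[OF c d]])

lemma smooth_fexp_derivative: "smooth_on (fdom c d) (\<lambda>z. frechet_derivative (fexp c d) (at z) w)"
  by (rule smooth_on_frechet_derivative[OF smooth_fexp[OF c d]])

lemma floc_differential_fexp:
  assumes z: "(r, x) \<in> fdom c d"
  shows "floc M (differential M N (F r)) c d x u = frechet_derivative (fexp c d) (at (r, x)) (0, u)"
proof -
  interpret S: compact_riem_map M N "F r" by (rule slice) (use z fdom_iff in blast)
  have "x \<in> ldom (F r) c d" using z by (simp add: fdom_iff)
  then show ?thesis
    using S.floc_differential[OF c d] frechet_derivative_slice(1)[OF fexp_differentiable[OF z]]
    by (simp add: loc_fexp)
qed

lemma vel_fexp:
  assumes z: "(r, x) \<in> fdom c d"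
  shows "vel a r (param c x) d = frechet_derivative (fexp c d) (at (r, x)) (a, 0)"
proof -
  have "d \<in> charts_at N (F r (param c x))" using z d by (simp add: fdom_def N.charts_at_iff)
  moreover have "(\<lambda>r. coord d (F r (param c x))) = (\<lambda>r. fexp c d (r, x))" by (simp add: fexp_def)
  ultimately show ?thesis
    using frechet_derivative_slice(2)[OF fexp_differentiable[OF z]] by (simp add: vel_def)
qed

lemma accel_fexp:
  assumes z: "(r, x) \<in> fdom c d"
  shows "accel a b r (param c x) d = nab N d (fexp c d) (\<lambda>z. frechet_derivative (fexp c d) (at z) (a, 0)) (b, 0) (r, x)"
proof -
  let ?Y = "fexp c d" and ?W = "\<lambda>z. frechet_derivative (fexp c d) (at z) (a, 0)"
  have d': "d \<in> charts_at N (F r (param c x))" using z d by (simp add: fdom_def N.charts_at_iff)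
  have Y: "(\<lambda>r. coord d (F r (param c x))) = (\<lambda>r. ?Y (r, x))" by (simp add: fexp_def)
  have "nab N d (\<lambda>r. ?Y (r, x)) (\<lambda>r'. frechet_derivative (\<lambda>r. ?Y (r, x)) (at r') a) b r =
      nab N d (\<lambda>r. ?Y (r, x)) (\<lambda>r'. ?W (r', x)) b r"
    by (rule nab_cong[OF smooth_on_slice(3)[OF open_fdom[OF c d] smooth_fexp[OF c d], of x]])
      (use z frechet_derivative_slice(2)[OF fexp_differentiable] in auto)
  also have "\<dots> = nab N d ?Y ?W (b, 0) (r, x)"
    by (rule nab_slice(2)[OF fexp_differentiable[OF z] smooth_on_differentiable[OF smooth_fexp_derivative z]])
  finally show ?thesis using d' by (simp add: accel_def Y)
qed

lemma cov_along_fexp: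
  assumes z: "(r, x) \<in> fdom c d" and \<sigma>: "\<sigma> \<in> sections_along M N (F r)" and v: "v \<in> tangent_space M (param c x)"
    and W: "smooth_on (fdom c d) W" and eq: "\<And>x. (r, x) \<in> fdom c d \<Longrightarrow> \<sigma> (param c x) d = W (r, x)"
  shows "cov_along M N (F r) \<sigma> (param c x) v d = nab N d (fexp c d) W (0, v c) (r, x)"
proof -
  interpret S: compact_riem_map M N "F r" by (rule slice) (use z fdom_iff in blast)
  have x: "x \<in> ldom (F r) c d" using z by (simp add: fdom_iff)
  have "cov_along M N (F r) \<sigma> (param c x) v d = nab N d (loc (F r) c d) (\<lambda>x. \<sigma> (param c x) d) (v c) x"
    using S.section_cov_along[OF \<sigma> S.ldom_charts[OF c d x] v] c S.ldom_img[OF x] by simp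
  also have "\<dots> = nab N d (\<lambda>x. fexp c d (r, x)) (\<lambda>x. W (r, x)) (v c) x"
    by (rule nab_cong[OF smooth_on_slice(2)[OF open_fdom[OF c d] smooth_fexp[OF c d], of r]])
      (use z eq loc_fexp in auto)
  also have "\<dots> = nab N d (fexp c d) W (0, v c) (r, x)"
    by (rule nab_slice(1)[OF fexp_differentiable[OF z] smooth_on_differentiable[OF W z]])
  finally show ?thesis .
qed

end

lemma fexp_change:
  assumes "c \<in> atlas M" "d \<in> atlas N" "e \<in> atlas N" "z \<in> fdom c d" "z \<in> fdom c e"
  shows "fexp c e z = transition d e (fexp c d z)" "fexp c d z \<in> overlap d e"
  using assms by (auto simp: fexp_def fdom_def transition_def overlap_def)

lemma fexp_derivative_change:
  assumes at: "c \<in> atlas M" "d \<in> atlas N" "e \<in> atlas N" and z: "z \<in> fdom c d" "z \<in> fdom c e"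
  shows "frechet_derivative (fexp c e) (at z) w = dtrans d e (fexp c d z) (frechet_derivative (fexp c d) (at z) w)"
proof -
  have S: "open (fdom c d \<inter> fdom c e)" by (intro open_Int open_fdom at)
  have "((\<lambda>z. transition d e (fexp c d z)) has_derivative
      (\<lambda>w. dtrans d e (fexp c d z) (frechet_derivative (fexp c d) (at z) w))) (at z)"
    by (rule has_derivative_compose[OF has_derivative_frechet[OF fexp_differentiable[OF at(1,2) z(1)]]
          N.transition_has_derivative[OF at(2,3) fexp_change(2)[OF at z]]])
  then have "(fexp c e has_derivative
      (\<lambda>w. dtrans d e (fexp c d z) (frechet_derivative (fexp c d) (at z) w))) (at z)"
    by (rule has_derivative_transform_within_open[OF _ S]) (use z fexp_change(1)[OF at] in auto)
  from fun_cong[OF frechet_derivative_eqI[OF this]] show ?thesis .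
qed

text \<open>Velocity and acceleration are both given by formulas W on the product. Smoothness in the
  point follows by slicing at r, tangency from the transformation of W between charts of N.\<close>

lemma family_sectionI:
  assumes r: "r \<in> P" and W: "\<And>c d. c \<in> atlas M \<Longrightarrow> d \<in> atlas N \<Longrightarrow> smooth_on (fdom c d) (W c d)"
    and \<sigma>: "\<And>c d x. c \<in> atlas M \<Longrightarrow> d \<in> atlas N \<Longrightarrow> (r, x) \<in> fdom c d \<Longrightarrow> \<sigma> (param c x) d = W c d (r, x)"
    and z: "\<And>p d. d \<notin> charts_at N (F r p) \<Longrightarrow> \<sigma> p d = 0"
    and ch: "\<And>c d e z. c \<in> atlas M \<Longrightarrow> d \<in> atlas N \<Longrightarrow> e \<in> atlas N \<Longrightarrow> z \<in> fdom c d \<Longrightarrow> z \<in> fdom c e \<Longrightarrow>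
      W c e z = dtrans d e (fexp c d z) (W c d z)"
  shows "\<sigma> \<in> sections_along M N (F r)"
proof -
  interpret S: compact_riem_map M N "F r" by (rule slice[OF r])
  show ?thesis
  proof (rule S.sectionI)
    fix p
    show "\<sigma> p \<in> tangent_space N (F r p)"
    proof (rule N.tangent_spaceI[OF N.chart_at_in])
      fix e assume e: "e \<in> charts_at N (F r p)"
      let ?c = "chart_at M p" and ?d = "chart_at N (F r p)"
      note c = M.chart_at_in[of p] and d = N.chart_at_in[of "F r p"]
      have at: "?c \<in> atlas M" "?d \<in> atlas N" "e \<in> atlas N" and p: "param ?c (coord ?c p) = p"
        using c d e by (auto simp: M.charts_at_iff N.charts_at_iff)
      note z = charts_fdom[OF r c d] charts_fdom[OF r c e]
      have "fexp ?c ?d (r, coord ?c p) = coord ?d (F r p)" by (simp add: fexp_def p)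
      then show "\<sigma> p e = dtrans ?d e (coord ?d (F r p)) (\<sigma> p ?d)"
        using ch[OF at z] \<sigma>[OF at(1,2) z(1)] \<sigma>[OF at(1,3) z(2)] by (simp add: p)
    qed (rule z)
  next
    fix c d assume at: "c \<in> atlas M" "d \<in> atlas N"
    show "smooth_on (ldom (F r) c d) (\<lambda>x. \<sigma> (param c x) d)"
    proof (rule smooth_on_cong[OF S.open_ldom[OF at], THEN iffD1])
      show "smooth_on (ldom (F r) c d) (\<lambda>x. W c d (r, x))"
        unfolding ldom_slice[OF r] by (rule smooth_on_slice(1)[OF open_fdom[OF at] W[OF at]])
      show "W c d (r, x) = \<sigma> (param c x) d" if "x \<in> ldom (F r) c d" for x
        by (rule \<sigma>[OF at, symmetric]) (simp add: fdom_iff r that)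
    qed
  qed
qed

lemma vel_section: "r \<in> P \<Longrightarrow> vel a r \<in> sections_along M N (F r)"
  by (rule family_sectionI[where W="\<lambda>c d z. frechet_derivative (fexp c d) (at z) (a, 0)"])
    (assumption | rule smooth_fexp_derivative vel_fexp fexp_derivative_change | simp add: vel_def)+

lemma accel_section: "r \<in> P \<Longrightarrow> accel a b r \<in> sections_along M N (F r)"
proof (rule family_sectionI[where W="\<lambda>c d z. nab N d (fexp c d) (\<lambda>z. frechet_derivative (fexp c d) (at z) (a, 0)) (b, 0) z"])
  fix c d e z assume at: "c \<in> atlas M" "d \<in> atlas N" "e \<in> atlas N" and z: "z \<in> fdom c d" "z \<in> fdom c e"
  have S: "open (fdom c d \<inter> fdom c e)" "z \<in> fdom c d \<inter> fdom c e" using z by (auto intro: open_Int open_fdom at)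
  let ?W = "\<lambda>d z. frechet_derivative (fexp c d) (at z) (a, 0)"
  have "nab N e (fexp c e) (?W e) (b, 0) z = nab N e (\<lambda>z. transition d e (fexp c d z)) (\<lambda>z. dtrans d e (fexp c d z) (?W d z)) (b, 0) z"
    by (rule nab_cong[OF S]) (simp_all add: fexp_change(1)[OF at] fexp_derivative_change[OF at, where w="(a, 0)"])
  also have "\<dots> = dtrans d e (fexp c d z) (nab N d (fexp c d) (?W d) (b, 0) z)"
    by (rule N.nab_transform[OF at(2) S(1) _ _ at(3) _ _ S(2)])
      (auto intro: smooth_on_subset[OF smooth_fexp[OF at(1,2)]] smooth_on_subset[OF smooth_fexp_derivative[OF at(1,2)]]
        fexp_in fexp_change(2)[OF at])
  finally show "nab N e (fexp c e) (?W e) (b, 0) z = dtrans d e (fexp c d z) (nab N d (fexp c d) (?W d) (b, 0) z)" .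
qed (assumption | rule accel_fexp N.smooth_nab open_fdom smooth_fexp fexp_in smooth_fexp_derivative | simp add: accel_def)+

text \<open>Locally the family stays in one chart of N, and the inverse Gram matrix replaces the
  frame; this makes the density an explicit smooth function on the product.\<close>

lemma smooth_pfun_dens: "smooth_pfun dens"
  unfolding smooth_pfun_def
proof
  fix c assume c: "c \<in> atlas M"
  show "smooth_on (P \<times> chart_img c) (\<lambda>z. dens (fst z) (param c (snd z)))"
  proof (rule smooth_on_locally)
    fix z assume "z \<in> P \<times> chart_img c"
    then obtain r x where z: "z = (r, x)" "r \<in> P" "x \<in> chart_img c" by auto
    obtain d where d: "d \<in> atlas N" "F r (param c x) \<in> chart_dom d" using N.ex_chart by blast
    note O = open_fdom[OF c d(1)]
    have sI: "smooth_on (fdom c d) (\<lambda>z. matrix_inv (gram M c (snd z)) $ k $ l)" for k l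
    proof (rule smooth_on_compose[OF O M.open_chart_img[OF c] M.smooth_ginv[OF c]])
      show "smooth_on (fdom c d) snd" using smooth_on_snd[OF O smooth_on_id[OF O]] by simp
    qed (auto simp: fdom_def)
    have "smooth_on (fdom c d) (\<lambda>z. 1 + (\<Sum>k\<in>UNIV. \<Sum>l\<in>UNIV. matrix_inv (gram M c (snd z)) $ k $ l *
        gform N d (fexp c d z) (frechet_derivative (fexp c d) (at z) (0, axis k 1)) (frechet_derivative (fexp c d) (at z) (0, axis l 1))))"
      by (intro smooth_intros O sI d(1) fexp_in smooth_fexp c)
    then have "smooth_on (fdom c d) (\<lambda>z. dens (fst z) (param c (snd z)))"
    proof (rule smooth_on_cong[OF O, THEN iffD1, rotated])
      fix z assume z: "z \<in> fdom c d"
      obtain r x where rx: "z = (r, x)" by (cases z)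
      then have r: "r \<in> P" "x \<in> ldom (F r) c d" using z by (auto simp: fdom_iff)
      interpret S: compact_riem_map M N "F r" by (rule slice[OF r(1)])
      show "1 + (\<Sum>k\<in>UNIV. \<Sum>l\<in>UNIV. matrix_inv (gram M c (snd z)) $ k $ l *
        gform N d (fexp c d z) (frechet_derivative (fexp c d) (at z) (0, axis k 1)) (frechet_derivative (fexp c d) (at z) (0, axis l 1)))
        = dens (fst z) (param c (snd z))"
        using S.hs_inner_loc[OF S.form_differential S.form_differential c d(1) r(2)] z
        by (simp add: rx dens_eq[OF r(1)] floc_differential_fexp[OF c d(1)] loc_fexp)
    qed
    then show "\<exists>T. open T \<and> z \<in> T \<and> smooth_on T (\<lambda>z. dens (fst z) (param c (snd z)))"
      using O z d by (intro exI[of _ "fdom c d"]) (simp add: fdom_def)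
  qed
qed

lemma smooth_pfun_powr: "smooth_pfun G \<Longrightarrow> (\<And>r p. G r p > 0) \<Longrightarrow> smooth_pfun (\<lambda>r p. G r p powr \<alpha>)"
  unfolding smooth_pfun_def by (auto intro!: smooth_intros open_P_img)

lemma alpha_energy_dens: "alpha_energy \<alpha> M N (F r) = (\<integral>p. dens r p powr \<alpha> \<partial>M.V)"
  by (simp add: alpha_energy_def dens_def)

end

section \<open>First and second variation of the density\<close>

context riem_family
begin

text \<open>The parameter derivative falls on the differential of the map; \<open>nab_sym\<close>
  exchanges it with the derivative along the frame vector, which leaves the covariant derivative of
  the velocity.\<close>

lemma pd_dens_fexp:
  assumes c: "c \<in> charts_at M p" and d: "d \<in> atlas N" and z: "(r, coord c p) \<in> fdom c d"
  defines "E \<equiv> \<lambda>i. frame_at M p i c"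
  shows "pd a dens r p = 2 * (\<Sum>i\<in>UNIV. gform N d (fexp c d (r, coord c p))
     (nab N d (fexp c d) (\<lambda>z. frechet_derivative (fexp c d) (at z) (a, 0)) (0, E i) (r, coord c p))
     (frechet_derivative (fexp c d) (at (r, coord c p)) (0, E i)))"
proof -
  let ?x = "coord c p" and ?Y = "fexp c d" and ?V = "\<lambda>w z. frechet_derivative (fexp c d) (at z) w"
  have at: "c \<in> atlas M" "d \<in> atlas N" using c d by (simp_all add: M.charts_at_iff)
  have p: "param c ?x = p" using c by (simp add: M.charts_at_iff)
  note O = open_fdom[OF at] and Y = smooth_fexp[OF at]
  note V = smooth_fexp_derivative[OF at]
  \<comment> \<open>The frame coefficients at p are used at every point, so g is guaranteed to be
    the density only on the slice through p; a derivative in a parameter direction stays in that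
    slice.\<close>
  define g where "g z = 1 + (\<Sum>i\<in>UNIV. gform N d (?Y z) (?V (0, E i) z) (?V (0, E i) z))" for z
  have dens: "dens r p = g (r, ?x)" if z: "(r, ?x) \<in> fdom c d" for r
  proof -
    have r: "r \<in> P" "?x \<in> ldom (F r) c d" using z by (simp_all add: fdom_iff)
    interpret S: compact_riem_map M N "F r" by (rule slice[OF r(1)])
    have d': "d \<in> charts_at N (F r p)" using S.ldom_charts(2)[OF at r(2)] p by simp
    show ?thesis
      unfolding dens_eq[OF r(1)] S.hs_inner_frame[OF S.form_differential S.form_differential c d'] g_def E_def
      by (simp add: floc_differential_fexp[OF at z] loc_fexp)
  qed
  note T = smooth_on_slice(3)[OF O Y, of ?x]
  have g: "(g has_derivative (\<lambda>w. 0 + (\<Sum>i\<in>UNIV. gform N d (?Y z) (nab N d ?Y (?V (0, E i)) w z) (?V (0, E i) z) +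
      gform N d (?Y z) (?V (0, E i) z) (nab N d ?Y (?V (0, E i)) w z)))) (at z)" if "z \<in> fdom c d" for z
    unfolding g_def
    by (intro has_derivative_add has_derivative_const has_derivative_sum N.nab_metric[OF at(2) O Y fexp_in V V that])
  have "pd a dens r p = frechet_derivative (\<lambda>r. g (r, ?x)) (at r) a"
    unfolding pd_def
    by (rule fun_cong[where x=a], rule frechet_derivative_cong_open[OF T]) (use z dens in auto)
  also have "\<dots> = frechet_derivative g (at (r, ?x)) (a, 0)"
    by (rule frechet_derivative_slice(2)) (use g[OF z] in \<open>auto simp: differentiable_def\<close>)
  also have "\<dots> = 2 * (\<Sum>i\<in>UNIV. gform N d (?Y (r, ?x)) (nab N d ?Y (?V (a, 0)) (0, E i) (r, ?x)) (?V (0, E i) (r, ?x)))"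
    unfolding frechet_derivative_eqI[OF g[OF z]] N.gform_sym[OF at(2) fexp_in[OF z], of "?V _ _"]
    by (simp add: N.nab_sym[OF at(2) O Y fexp_in z, of _ "(a, 0)"] sum_distrib_left)
  finally show ?thesis .
qed

text \<open>Here the curvature enters, when the derivative in the direction \<open>b\<close> is moved past the one along \<open>M\<close>.\<close>

lemma pd_pd_dens_fexp:
  assumes c: "c \<in> charts_at M p" and d: "d \<in> atlas N" and z: "(r, coord c p) \<in> fdom c d"
  defines "E \<equiv> \<lambda>i. frame_at M p i c" and "Y \<equiv> fexp c d"
    and "V \<equiv> \<lambda>w z. frechet_derivative (fexp c d) (at z) w" and "n \<equiv> nab N d (fexp c d)" and "x \<equiv> (r, coord c p)"
  shows "pd b (pd a dens) r p = 2 * (\<Sum>i\<in>UNIV.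
     gform N d (Y x) (n (n (V (a, 0)) (b, 0)) (0, E i) x) (V (0, E i) x)
     - gform N d (Y x) (V (a, 0) x) (curv N d (Y x) (V (b, 0) x) (V (0, E i) x) (V (0, E i) x))
     + gform N d (Y x) (n (V (a, 0)) (0, E i) x) (n (V (b, 0)) (0, E i) x))"
proof -
  have at: "c \<in> atlas M" "d \<in> atlas N" using c d by (simp_all add: M.charts_at_iff)
  note O = open_fdom[OF at] and Y = smooth_fexp[OF at, folded Y_def]
  have V: "smooth_on (fdom c d) (V w)" for w unfolding V_def by (rule smooth_fexp_derivative[OF at])
  have Yi: "\<And>z. z \<in> fdom c d \<Longrightarrow> Y z \<in> chart_img d" unfolding Y_def by (rule fexp_in)
  note n_def' = n_def[folded Y_def]
  have nV: "smooth_on (fdom c d) (n (V w) u)" for w u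
    unfolding n_def' by (rule N.smooth_nab[OF at(2) O Y Yi V])
  define h where "h z = 2 * (\<Sum>i\<in>UNIV. gform N d (Y z) (n (V (a, 0)) (0, E i) z) (V (0, E i) z))" for z
  have h: "(h has_derivative (\<lambda>w. 2 * (\<Sum>i\<in>UNIV. gform N d (Y z) (n (n (V (a, 0)) (0, E i)) w z) (V (0, E i) z) +
      gform N d (Y z) (n (V (a, 0)) (0, E i) z) (n (V (0, E i)) w z)))) (at z)" if "z \<in> fdom c d" for z
    unfolding h_def n_def'
    by (intro has_derivative_mult_right has_derivative_sum N.nab_metric[OF at(2) O Y Yi nV[unfolded n_def'] V that])
  have x: "x \<in> fdom c d" using z by (simp add: x_def)
  note T = smooth_on_slice(3)[OF O Y, of "coord c p"]
  have "pd b (pd a dens) r p = frechet_derivative (\<lambda>r. h (r, coord c p)) (at r) b"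
    unfolding pd_def[of b]
    by (rule fun_cong[where x=b], rule frechet_derivative_cong_open[OF T])
      (use z pd_dens_fexp[OF c d] in \<open>auto simp: h_def E_def Y_def V_def n_def\<close>)
  also have "\<dots> = frechet_derivative h (at x) (b, 0)"
    unfolding x_def by (rule frechet_derivative_slice(2)) (use h[OF z] in \<open>auto simp: differentiable_def\<close>)
  also have "\<dots> = 2 * (\<Sum>i\<in>UNIV. gform N d (Y x) (n (n (V (a, 0)) (0, E i)) (b, 0) x) (V (0, E i) x) +
      gform N d (Y x) (n (V (a, 0)) (0, E i) x) (n (V (0, E i)) (b, 0) x))"
    unfolding frechet_derivative_eqI[OF h[OF x]] ..
  also have "\<dots> = 2 * (\<Sum>i\<in>UNIV. gform N d (Y x) (n (n (V (a, 0)) (b, 0)) (0, E i) x) (V (0, E i) x)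
     - gform N d (Y x) (V (a, 0) x) (curv N d (Y x) (V (b, 0) x) (V (0, E i) x) (V (0, E i) x))
     + gform N d (Y x) (n (V (a, 0)) (0, E i) x) (n (V (b, 0)) (0, E i) x))"
  proof (intro arg_cong[where f="\<lambda>t. 2 * t"] sum.cong refl)
    fix i
    let ?R = "curv N d (Y x) (V (b, 0) x) (V (0, E i) x)"
    have "n (V (0, E i)) (b, 0) x = n (V (b, 0)) (0, E i) x"
      unfolding n_def' V_def Y_def[symmetric] by (rule N.nab_sym[OF at(2) O Y Yi x])
    moreover have "n (n (V (a, 0)) (0, E i)) (b, 0) x - n (n (V (a, 0)) (b, 0)) (0, E i) x = ?R (V (a, 0) x)"
      using N.nab_commute[OF at(2) O Y Yi V[of "(a, 0)"] x, where a="(b, 0)" and b="(0, E i)"] unfolding n_def' by (simp add: V_def Y_def)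
    then have "n (n (V (a, 0)) (0, E i)) (b, 0) x = n (n (V (a, 0)) (b, 0)) (0, E i) x + ?R (V (a, 0) x)"
      by (simp add: algebra_simps)
    \<comment> \<open>With the curvature applied to the frame derivative instead of the velocity,
      the sum over the frame becomes \<open>trace_curvature\<close> of the velocity in the direction
      b.\<close>
    moreover have "gform N d (Y x) (?R (V (a, 0) x)) (V (0, E i) x) = - gform N d (Y x) (V (a, 0) x) (?R (V (0, E i) x))"
      using N.gform_curv_skew[OF at(2) O Y Yi V[of "(a, 0)"] V[of "(0, E i)"] x, where a="(b, 0)" and b="(0, E i)"] by (simp add: V_def Y_def)
    ultimately show "gform N d (Y x) (n (n (V (a, 0)) (0, E i)) (b, 0) x) (V (0, E i) x) +
        gform N d (Y x) (n (V (a, 0)) (0, E i) x) (n (V (0, E i)) (b, 0) x) =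
      gform N d (Y x) (n (n (V (a, 0)) (b, 0)) (0, E i) x) (V (0, E i) x)
     - gform N d (Y x) (V (a, 0) x) (?R (V (0, E i) x))
     + gform N d (Y x) (n (V (a, 0)) (0, E i) x) (n (V (b, 0)) (0, E i) x)"
      by (simp add: linear_add[OF N.linear_gform_left[OF at(2) Yi[OF x]]])
  qed
  finally show ?thesis .
qed

context
  fixes r :: 'p and p :: 'a
  assumes r: "r \<in> P"
begin

interpretation S: compact_riem_map M N "F r" by (rule slice[OF r])

text \<open>Dictionary between the invariant objects at (r, p) and the local expressions on the
  product, in the charts picked by \<open>chart_at\<close>; it carries the coordinate formulas for
  the derivatives of the density back to the manifold.\<close>

lemma
  fixes i :: 'm
  defines "c \<equiv> chart_at M p" and "d \<equiv> chart_at N (F r p)"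
  defines "x \<equiv> (r, coord c p)" and "v \<equiv> frame_at M p i"
  shows fexp_base: "fexp c d x = coord d (F r p)"
    and differential_base: "differential M N (F r) p v d = frechet_derivative (fexp c d) (at x) (0, v c)"
    and vel_base: "vel a r p d = frechet_derivative (fexp c d) (at x) (a, 0)"
    and cov_vel_base: "cov_along M N (F r) (vel a r) p v d =
      nab N d (fexp c d) (\<lambda>z. frechet_derivative (fexp c d) (at z) (a, 0)) (0, v c) x"
    and cov_accel_base: "cov_along M N (F r) (accel a b r) p v d =
      nab N d (fexp c d) (nab N d (fexp c d) (\<lambda>z. frechet_derivative (fexp c d) (at z) (a, 0)) (b, 0)) (0, v c) x"
proof -
  note c = M.chart_at_in[of p, folded c_def] and d = N.chart_at_in[of "F r p", folded d_def]
  have at: "c \<in> atlas M" "d \<in> atlas N" using c d by (simp_all add: M.charts_at_iff N.charts_at_iff)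
  have z: "(r, coord c p) \<in> fdom c d" by (rule charts_fdom[OF r c d])
  have p: "param c (coord c p) = p" using c by (simp add: M.charts_at_iff)
  have v: "v \<in> tangent_space M (param c (coord c p))" unfolding p v_def by (rule M.frame_at_tangent)
  show "fexp c d x = coord d (F r p)" by (simp add: fexp_def x_def p)
  show "differential M N (F r) p v d = frechet_derivative (fexp c d) (at x) (0, v c)"
    unfolding x_def S.form_floc[OF S.form_differential c v[unfolded p]] by (rule floc_differential_fexp[OF at z])
  show "vel a r p d = frechet_derivative (fexp c d) (at x) (a, 0)"
    using vel_fexp[OF at z] by (simp add: p x_def)
  show "cov_along M N (F r) (vel a r) p v d =
      nab N d (fexp c d) (\<lambda>z. frechet_derivative (fexp c d) (at z) (a, 0)) (0, v c) x"
    using cov_along_fexp[OF at z vel_section[OF r] v smooth_fexp_derivative[OF at] vel_fexp[OF at]] by (simp add: p x_def)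
  show "cov_along M N (F r) (accel a b r) p v d =
      nab N d (fexp c d) (nab N d (fexp c d) (\<lambda>z. frechet_derivative (fexp c d) (at z) (a, 0)) (b, 0)) (0, v c) x"
    using cov_along_fexp[OF at z accel_section[OF r] v
        N.smooth_nab[OF at(2) open_fdom[OF at] smooth_fexp[OF at] fexp_in smooth_fexp_derivative[OF at]] accel_fexp[OF at]]
    by (simp add: p x_def)
qed

lemma pd_dens: "pd a dens r p = 2 * hs_inner M N (F r) p (cov_along M N (F r) (vel a r) p) (differential M N (F r) p)"
proof -
  let ?c = "chart_at M p" and ?d = "chart_at N (F r p)"
  note c = M.chart_at_in[of p] and d = N.chart_at_in[of "F r p"]
  have d': "?d \<in> atlas N" using d by (simp add: N.charts_at_iff)
  show ?thesis
    unfolding hs_inner_def pd_dens_fexp[OF c d' charts_fdom[OF r c d]]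
    by (simp add: N.metric_eq_gform[OF S.cov_along_tangent[OF vel_section[OF r] M.frame_at_tangent]
          S.differential_tangent[OF M.frame_at_tangent] d] fexp_base cov_vel_base differential_base)
qed

lemma pd_pd_dens: "pd b (pd a dens) r p = 2 *
   (hs_inner M N (F r) p (cov_along M N (F r) (accel a b r) p) (differential M N (F r) p)
    - metric N (F r p) (vel a r p) (trace_curvature M N (F r) (vel b r) p)
    + hs_inner M N (F r) p (cov_along M N (F r) (vel a r) p) (cov_along M N (F r) (vel b r) p))"
proof -
  let ?c = "chart_at M p" and ?d = "chart_at N (F r p)" and ?e = "frame_at M p" and ?m = "metric N (F r p)"
  note c = M.chart_at_in[of p] and d = N.chart_at_in[of "F r p"]
  have d': "?d \<in> atlas N" using d by (simp add: N.charts_at_iff)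
  note tv = S.section_tangent[OF vel_section[OF r]] and td = S.differential_tangent[OF M.frame_at_tangent]
    and tcv = S.cov_along_tangent[OF vel_section[OF r] M.frame_at_tangent]
    and tca = S.cov_along_tangent[OF accel_section[OF r] M.frame_at_tangent]
  note tR = N.curvature_tangent[OF tv td td]
  have "?m (vel a r p) (trace_curvature M N (F r) (vel b r) p) =
      (\<Sum>i\<in>UNIV. ?m (vel a r p) (curvature N (F r p) (vel b r p) (differential M N (F r) p (?e i)) (differential M N (F r) p (?e i))))"
    unfolding trace_curvature_def by (rule S.metric_sum(2)[OF tR tv])
  then show ?thesis
    unfolding hs_inner_def pd_pd_dens_fexp[OF c d' charts_fdom[OF r c d]]
    by (simp add: N.metric_eq_gform[OF tca td d] N.metric_eq_gform[OF tcv tcv d] N.metric_eq_gform[OF tv tR d]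
        N.curvature_eq_curv[OF d] fexp_base cov_vel_base cov_accel_base differential_base vel_base
        sum.distrib sum_subtractf)
qed

end

lemma pd_dens_powr:
  assumes r: "r \<in> P"
  shows "pd a (\<lambda>r p. dens r p powr \<alpha>) r p = \<alpha> * dens r p powr (\<alpha> - 1) * pd a dens r p"
  unfolding pd_def
  by (rule fun_cong[where x=a], rule frechet_derivative_eqI)
    (rule has_derivative_powr_const[OF has_derivative_frechet[OF pfun_differentiable[OF smooth_pfun_dens r]] dens_pos])

lemma pd_pd_dens_powr:
  assumes r: "r \<in> P"
  shows "pd b (pd a (\<lambda>r p. dens r p powr \<alpha>)) r p =
    \<alpha> * (\<alpha> - 1) * dens r p powr (\<alpha> - 2) * pd b dens r p * pd a dens r p +
    \<alpha> * dens r p powr (\<alpha> - 1) * pd b (pd a dens) r p"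
proof -
  note D1 = has_derivative_powr_const[OF has_derivative_frechet[OF pfun_differentiable[OF smooth_pfun_dens r]] dens_pos]
  note D2 = has_derivative_frechet[OF pfun_differentiable[OF smooth_pfun_pd[OF smooth_pfun_dens] r]]
  have "pd b (pd a (\<lambda>r p. dens r p powr \<alpha>)) r p =
      frechet_derivative (\<lambda>r. \<alpha> * dens r p powr (\<alpha> - 1) * pd a dens r p) (at r) b"
    unfolding pd_def[of b]
    by (rule fun_cong[where x=b], rule frechet_derivative_cong_open[OF open_P r], rule pd_dens_powr)
  also have "\<dots> = \<alpha> * dens r p powr (\<alpha> - 1) * pd b (pd a dens) r p +
      (\<alpha> * ((\<alpha> - 1) * dens r p powr (\<alpha> - 1 - 1) * pd b dens r p)) * pd a dens r p"
    unfolding pd_def[of b]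
    by (rule fun_cong[where x=b], rule frechet_derivative_eqI)
      (intro has_derivative_mult has_derivative_mult_right D1 D2)
  finally show ?thesis by (simp add: algebra_simps)
qed

lemma energy_has_derivative:
  assumes "r + t *\<^sub>R a \<in> P"
  shows "((\<lambda>t. alpha_energy \<alpha> M N (F (r + t *\<^sub>R a))) has_real_derivative
    (\<integral>p. pd a (\<lambda>r p. dens r p powr \<alpha>) (r + t *\<^sub>R a) p \<partial>M.V)) (at t)"
  unfolding alpha_energy_dens
  by (rule pfun_integral_derivative[OF smooth_pfun_powr[OF smooth_pfun_dens dens_pos] assms])

end

section \<open>Stationarity\<close>

context compact_riem_map
begin

lemma section_continuous:
  assumes \<sigma>: "\<sigma> \<in> sections_along M N \<psi>" and d: "d \<in> atlas N"
  shows "continuous_on (\<psi> -` chart_dom d) (\<lambda>p. \<sigma> p d)"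
proof -
  have "continuous_on (chart_dom c \<inter> \<psi> -` chart_dom d) (\<lambda>p. \<sigma> p d)" if c: "c \<in> atlas M" for c
  proof -
    have 1: "continuous_on (ldom \<psi> c d) (\<lambda>x. \<sigma> (param c x) d)"
      by (rule smooth_on_imp_continuous[OF section_smooth[OF \<sigma> c d]])
    have "continuous_on (chart_dom c \<inter> \<psi> -` chart_dom d) (coord c)"
      by (rule continuous_on_subset[OF M.continuous_coord[OF c]]) blast
    then have "continuous_on (chart_dom c \<inter> \<psi> -` chart_dom d) (\<lambda>p. \<sigma> (param c (coord c p)) d)"
      by (rule continuous_on_compose2[OF 1]) (auto simp: ldom_def c)
    then show ?thesis by (rule continuous_on_eq) (simp add: c)
  qed
  then have "continuous_on (\<Union>c\<in>atlas M. chart_dom c \<inter> \<psi> -` chart_dom d) (\<lambda>p. \<sigma> p d)"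
    by (intro continuous_on_open_Union) (auto intro!: open_Int M.open_chart_dom open_psi_vimage N.open_chart_dom d)
  moreover have "(\<Union>c\<in>atlas M. chart_dom c \<inter> \<psi> -` chart_dom d) = \<psi> -` chart_dom d" using M.ex_chart by blast
  ultimately show ?thesis by simp
qed

context
  fixes \<sigma> :: "'a \<Rightarrow> ('b, 'n) tvec" and d :: "('b, 'n) chart" and K :: "'a set"
  assumes \<sigma>: "\<sigma> \<in> sections_along M N \<psi>" and d: "d \<in> atlas N"
    and K: "compact K" "K \<subseteq> \<psi> -` chart_dom d" and supp: "\<And>p. p \<notin> K \<Longrightarrow> \<sigma> p = (\<lambda>_. 0)"
begin

definition vary :: "real \<Rightarrow> 'a \<Rightarrow> 'b" where
  "vary t p = (if \<psi> p \<in> chart_dom d then param d (coord d (\<psi> p) + t *\<^sub>R \<sigma> p d) else \<psi> p)"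

lemma vary_off: "p \<notin> K \<Longrightarrow> vary t p = \<psi> p"
  using supp[of p] d by (simp add: vary_def)

lemma vary_0: "vary 0 = \<psi>"
  using d by (simp add: vary_def fun_eq_iff)

lemma vary_range:
  obtains \<delta> where "\<delta> > 0"
    "\<And>t p. \<bar>t\<bar> < \<delta> \<Longrightarrow> \<psi> p \<in> chart_dom d \<Longrightarrow> coord d (\<psi> p) + t *\<^sub>R \<sigma> p d \<in> chart_img d"
proof -
  have "continuous_on K (\<lambda>p. coord d (\<psi> p))"
    by (rule continuous_on_compose2[OF N.continuous_coord[OF d] continuous_on_subset[OF continuous_psi]]) (use K in auto)
  then have cA: "compact ((\<lambda>p. coord d (\<psi> p)) ` K)" by (rule compact_continuous_image[OF _ K(1)])
  have sA: "(\<lambda>p. coord d (\<psi> p)) ` K \<subseteq> chart_img d" using K(2) by auto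
  obtain e where e: "e > 0" "(\<Union>y\<in>(\<lambda>p. coord d (\<psi> p)) ` K. cball y e) \<subseteq> chart_img d"
    using compact_subset_open_imp_cball_epsilon_subset[OF cA N.open_chart_img[OF d] sA] by blast
  have "bounded ((\<lambda>p. \<sigma> p d) ` K)"
    by (intro compact_imp_bounded compact_continuous_image K(1) continuous_on_subset[OF section_continuous[OF \<sigma> d] K(2)])
  then obtain B where B: "\<And>p. p \<in> K \<Longrightarrow> norm (\<sigma> p d) \<le> B" unfolding bounded_iff by auto
  \<comment> \<open>Around the coordinate image of K there is room e inside the chart image, and B
    bounds the field on K; the 1 guards against division by 0.\<close>
  have pos: "e / (\<bar>B\<bar> + 1) > 0" using e(1) by (intro divide_pos_pos) auto
  show thesis
  proof (rule that[OF pos])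
    fix t p assume t: "\<bar>t\<bar> < e / (\<bar>B\<bar> + 1)" and p: "\<psi> p \<in> chart_dom d"
    show "coord d (\<psi> p) + t *\<^sub>R \<sigma> p d \<in> chart_img d"
    proof (cases "p \<in> K")
      case True
      have "norm (t *\<^sub>R \<sigma> p d) \<le> \<bar>t\<bar> * (\<bar>B\<bar> + 1)"
        using B[OF True] by (auto intro!: mult_left_mono)
      also have "\<dots> \<le> e" using t by (simp add: pos_less_divide_eq less_imp_le)
      finally have "coord d (\<psi> p) + t *\<^sub>R \<sigma> p d \<in> cball (coord d (\<psi> p)) e" by (simp add: dist_norm)
      then show ?thesis using e(2) True by blast
    next
      case False
      then show ?thesis using supp p by simp
    qed
  qed
qed

text \<open>Two open sets cover M: the preimage of the domain of d, where the coordinate formula is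
  smooth, and the complement of K, where \<open>vary\<close> equals \<psi> for all t. The hypothesis
  keeps the moved point inside the chart image.\<close>

lemma smooth_family_vary:
  assumes \<delta>: "\<And>t p. \<bar>t\<bar> < \<delta> \<Longrightarrow> \<psi> p \<in> chart_dom d \<Longrightarrow> coord d (\<psi> p) + t *\<^sub>R \<sigma> p d \<in> chart_img d"
  shows "smooth_family M N {-\<delta><..<\<delta>} vary"
proof -
  let ?P = "{-\<delta><..<\<delta>}" and ?W = "\<psi> -` chart_dom d"
  have P: "open ?P" by simp
  have W: "open ?W" by (rule open_psi_vimage[OF N.open_chart_dom[OF d]])
  have oK: "open (- K)" using compact_imp_closed[OF K(1)] by auto
  have WK: "?W \<union> - K = UNIV" using K(2) by blast
  have "continuous_on (?P \<times> ?W) (\<lambda>(t, p). vary t p)"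
  proof -
    have "continuous_on (?P \<times> ?W) (\<lambda>z. coord d (\<psi> (snd z)) + fst z *\<^sub>R \<sigma> (snd z) d)"
      by (intro continuous_on_add continuous_on_scaleR continuous_on_fst continuous_on_id
          continuous_on_compose2[OF section_continuous[OF \<sigma> d] continuous_on_snd[OF continuous_on_id]]
          continuous_on_compose2[OF N.continuous_coord[OF d]]
          continuous_on_compose2[OF continuous_psi continuous_on_snd[OF continuous_on_id]]) auto
    then have "continuous_on (?P \<times> ?W) (\<lambda>z. param d (coord d (\<psi> (snd z)) + fst z *\<^sub>R \<sigma> (snd z) d))"
      by (rule continuous_on_compose2[OF N.continuous_param[OF d]]) (auto intro!: \<delta>)
    then show ?thesis by (rule continuous_on_eq) (auto simp: vary_def)
  qed
  moreover have "continuous_on (?P \<times> - K) (\<lambda>(t, p). vary t p)"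
  proof -
    have "continuous_on (?P \<times> - K) (\<lambda>z. \<psi> (snd z))"
      by (rule continuous_on_compose2[OF continuous_psi continuous_on_snd[OF continuous_on_id]]) auto
    then show ?thesis by (rule continuous_on_eq) (auto simp: vary_off)
  qed
  ultimately have "continuous_on (?P \<times> ?W \<union> ?P \<times> - K) (\<lambda>(t, p). vary t p)"
    by (intro continuous_on_open_Un open_Times P W oK)
  moreover have "?P \<times> ?W \<union> ?P \<times> - K = ?P \<times> (UNIV :: 'a set)" using WK by blast
  ultimately have 1: "continuous_on (?P \<times> UNIV) (\<lambda>(t, p). vary t p)" by simp
  have 2: "smooth_on {(t, x). t \<in> ?P \<and> x \<in> chart_img c \<and> vary t (param c x) \<in> chart_dom e}
      (\<lambda>(t, x). coord e (vary t (param c x)))" if c: "c \<in> atlas M" and e: "e \<in> atlas N" for c e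
  proof (rule smooth_on_locally)
    fix z assume "z \<in> {(t, x). t \<in> ?P \<and> x \<in> chart_img c \<and> vary t (param c x) \<in> chart_dom e}"
    then obtain t x where z: "z = (t, x)" "t \<in> ?P" "x \<in> chart_img c" "vary t (param c x) \<in> chart_dom e" by auto
    show "\<exists>T. open T \<and> z \<in> T \<and> smooth_on T (\<lambda>(t, x). coord e (vary t (param c x)))"
    proof (cases "\<psi> (param c x) \<in> chart_dom d")
      case True
      let ?y = "\<lambda>z. loc \<psi> c d (snd z) + fst z *\<^sub>R \<sigma> (param c (snd z)) d" and ?L = "?P \<times> ldom \<psi> c d"
      have L: "open ?L" by (intro open_Times P open_ldom c d)
      have s1: "smooth_on ?L fst" "smooth_on ?L snd"
        using smooth_on_fst[OF L smooth_on_id[OF L]] smooth_on_snd[OF L smooth_on_id[OF L]] by simp_all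
      have "smooth_on ?L (\<lambda>z. loc \<psi> c d (snd z))" "smooth_on ?L (\<lambda>z. \<sigma> (param c (snd z)) d)"
        by (auto intro: smooth_on_compose[OF L open_ldom[OF c d] smooth_loc[OF c d] s1(2)]
            smooth_on_compose[OF L open_ldom[OF c d] section_smooth[OF \<sigma> c d] s1(2)])
      then have y: "smooth_on ?L ?y" by (intro smooth_intros L s1(1))
      \<comment> \<open>The moved point has to be read in the chart e as well, hence the restriction
        to the overlap of d and e.\<close>
      let ?T = "?L \<inter> ?y -` overlap d e"
      have T: "open ?T"
        using continuous_open_preimage[OF smooth_on_imp_continuous[OF y] L N.open_overlap[OF d e]] .
      have yi: "?y (t, x) \<in> chart_img d" if "(t, x) \<in> ?L" for t x
        using that \<delta>[of t "param c x"] by (auto simp: ldom_def loc_def)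
      have v: "vary t (param c x) = param d (?y (t, x))" if "x \<in> ldom \<psi> c d" for t x
        using that by (simp add: vary_def ldom_def loc_def)
      have zL: "(t, x) \<in> ?L" using z True by (simp add: ldom_def)
      then have "z \<in> ?T" using z v[of x t] yi[OF zL] by (auto simp: overlap_def)
      moreover have "smooth_on ?T (\<lambda>z. transition d e (?y z))"
        by (rule smooth_on_compose[OF T N.open_overlap[OF d e] N.smooth_transition[OF d e] smooth_on_subset[OF y]]) auto
      then have "smooth_on ?T (\<lambda>(t, x). coord e (vary t (param c x)))"
        by (rule smooth_on_cong[OF T, THEN iffD1, rotated]) (auto simp: v transition_def)
      ultimately show ?thesis using T by blast
    next
      case False
      let ?T = "?P \<times> {x \<in> ldom \<psi> c e. param c x \<in> - K}"
      have "{x \<in> ldom \<psi> c e. param c x \<in> - K} = ldom \<psi> c e \<inter> {x \<in> chart_img c. param c x \<in> - K}"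
        by (auto simp: ldom_def)
      then have T: "open ?T" using open_ldom[OF c e] M.open_param_preimage[OF c oK] P by (simp add: open_Times open_Int)
      have nK: "param c x \<notin> K" using False K(2) by blast
      then have "z \<in> ?T" using z vary_off[OF nK] by (simp add: ldom_def)
      moreover have "smooth_on ?T (\<lambda>z. loc \<psi> c e (snd z))"
        by (rule smooth_on_compose[OF T open_ldom[OF c e] smooth_loc[OF c e]])
          (use smooth_on_snd[OF T smooth_on_id[OF T]] in auto)
      then have "smooth_on ?T (\<lambda>(t, x). coord e (vary t (param c x)))"
        by (rule smooth_on_cong[OF T, THEN iffD1, rotated]) (auto simp: vary_off loc_def)
      ultimately show ?thesis using T by blast
    qed
  qed
  show ?thesis unfolding smooth_family_def using 1 2 by blast
qed

text \<open>Harmonicity makes the derivative of the energy along \<open>vary\<close> equal to 0. The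
  velocity of this variation at time 0 is \<sigma>, so the same derivative is 2 \<alpha> times the
  integral in question.\<close>

lemma stationary_local:
  assumes harm: "alpha_harmonic \<alpha> M N \<psi>" and \<alpha>: "\<alpha> \<noteq> 0"
  shows "(\<integral>p. rho p powr (\<alpha> - 1) * hs_inner M N \<psi> p (cov_along M N \<psi> \<sigma> p) (differential M N \<psi> p) \<partial>M.V) = 0"
proof -
  obtain \<delta> where \<delta>: "\<delta> > 0"
    "\<And>t p. \<bar>t\<bar> < \<delta> \<Longrightarrow> \<psi> p \<in> chart_dom d \<Longrightarrow> coord d (\<psi> p) + t *\<^sub>R \<sigma> p d \<in> chart_img d"
    by (rule vary_range) (rule that; assumption)
  let ?P = "{-\<delta><..<\<delta>}"
  interpret R: riem_family M N ?P vary
    by unfold_locales (simp_all add: smooth_family_vary[OF \<delta>(2)])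
  have 0: "0 \<in> ?P" using \<delta>(1) by simp
  have vel: "R.vel 1 0 p = \<sigma> p" for p
  proof (cases "\<psi> p \<in> chart_dom d")
    case True
    have d': "d \<in> charts_at N (\<psi> p)" using True d by (simp add: N.charts_at_iff)
    have "((\<lambda>t. coord d (\<psi> p) + t *\<^sub>R \<sigma> p d) has_derivative (\<lambda>a. a *\<^sub>R \<sigma> p d)) (at 0)"
      by (auto intro!: derivative_eq_intros)
    then have "((\<lambda>t. coord d (vary t p)) has_derivative (\<lambda>a. a *\<^sub>R \<sigma> p d)) (at 0)"
      by (rule has_derivative_transform_within_open[OF _ _ 0])
        (use True d \<delta>(2) in \<open>auto simp: vary_def abs_less_iff\<close>)
    \<comment> \<open>Tangent vectors that agree in one chart around the point are equal, so the
      component in d is enough.\<close>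
    then have "R.vel 1 0 p d = \<sigma> p d"
      using d' by (simp add: R.vel_def vary_0 frechet_derivative_eqI)
    moreover have "R.vel 1 0 p \<in> tangent_space N (\<psi> p)"
      using section_tangent[of "R.vel 1 0" p] R.vel_section[OF 0] by (simp add: vary_0)
    ultimately show ?thesis using N.tangent_eqI section_tangent[OF \<sigma>] d' by blast
  next
    case False
    then have "p \<notin> K" using K(2) by blast
    then show ?thesis by (simp add: R.vel_def vary_off supp fun_eq_iff)
  qed
  have "((\<lambda>t. alpha_energy \<alpha> M N (vary t)) has_real_derivative 0) (at 0)"
    using harm smooth_family_vary[OF \<delta>(2)] \<delta>(1) vary_0 unfolding alpha_harmonic_def by blast
  moreover have "((\<lambda>t. alpha_energy \<alpha> M N (vary t)) has_real_derivative
      (\<integral>p. R.pd 1 (\<lambda>r p. R.dens r p powr \<alpha>) 0 p \<partial>M.V)) (at 0)"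
    using R.energy_has_derivative[of 0 0 1 \<alpha>] 0 by simp
  ultimately have "(\<integral>p. R.pd 1 (\<lambda>r p. R.dens r p powr \<alpha>) 0 p \<partial>M.V) = 0"
    using DERIV_unique by metis
  moreover have "R.pd 1 (\<lambda>r p. R.dens r p powr \<alpha>) 0 p = 2 * \<alpha> *
      (rho p powr (\<alpha> - 1) * hs_inner M N \<psi> p (cov_along M N \<psi> \<sigma> p) (differential M N \<psi> p))" for p
  proof -
    have "R.vel 1 0 = \<sigma>" using vel by (simp add: fun_eq_iff)
    moreover have "R.dens 0 p = rho p" by (simp add: R.dens_def rho_def vary_0)
    ultimately show ?thesis
      by (simp add: R.pd_dens_powr[OF 0] R.pd_dens[OF 0] vary_0)
  qed
  ultimately show ?thesis using \<alpha> by simp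
qed

end

lemma stationary:
  assumes \<sigma>: "\<sigma> \<in> sections_along M N \<psi>" and harm: "alpha_harmonic \<alpha> M N \<psi>" and \<alpha>: "\<alpha> \<noteq> 0"
  shows "(\<integral>p. rho p powr (\<alpha> - 1) * hs_inner M N \<psi> p (cov_along M N \<psi> \<sigma> p) (differential M N \<psi> p) \<partial>M.V) = 0"
proof -
  obtain C :: "'a set" and \<tau> where C: "finite C" "\<sigma> = (\<lambda>p d. \<Sum>q\<in>C. \<tau> q p d)"
    "\<And>q. q \<in> C \<Longrightarrow> \<tau> q \<in> sections_along M N \<psi>"
    "\<And>q. q \<in> C \<Longrightarrow> \<exists>c\<in>atlas M. \<exists>d\<in>atlas N. \<exists>K. compact K \<and> K \<subseteq> chart_dom c \<inter> \<psi> -` chart_dom d \<and>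
       (\<forall>p. p \<notin> K \<longrightarrow> \<tau> q p = (\<lambda>_. 0))"
    by (rule section_decomposition[OF \<sigma>]) (rule that; assumption)
  let ?I = "\<lambda>\<tau> p. rho p powr (\<alpha> - 1) * hs_inner M N \<psi> p (cov_along M N \<psi> \<tau> p) (differential M N \<psi> p)"
  have int: "integrable M.V (?I (\<tau> q))" if "q \<in> C" for q
    by (intro M.continuous_integrable_V M.smooth_fun_continuous M.smooth_fun_mult smooth_fun_rho
        smooth_fun_hs_inner form_cov_along form_differential C(3) that)
  have "?I \<sigma> p = (\<Sum>q\<in>C. ?I (\<tau> q) p)" for p
    unfolding C(2) by (simp add: hs_inner_cov_sum[OF form_differential C(3)] sum_distrib_left)
  then have "(\<integral>p. ?I \<sigma> p \<partial>M.V) = (\<Sum>q\<in>C. \<integral>p. ?I (\<tau> q) p \<partial>M.V)"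
    using int by (simp add: Bochner_Integration.integral_sum)
  also have "\<dots> = 0"
  proof (intro sum.neutral ballI)
    fix q assume q: "q \<in> C"
    obtain d K where "d \<in> atlas N" "compact K" "K \<subseteq> \<psi> -` chart_dom d" "\<forall>p. p \<notin> K \<longrightarrow> \<tau> q p = (\<lambda>_. 0)"
      using C(4)[OF q] by blast
    then show "(\<integral>p. ?I (\<tau> q) p \<partial>M.V) = 0"
      by (intro stationary_local[OF C(3)[OF q] _ _ _ _ harm \<alpha>]) auto
  qed
  finally show ?thesis .
qed

end

section \<open>The second variation\<close>

lemma (in riem_map) hs_inner_scale_right:
  assumes \<theta>: "form_along M N \<psi> \<theta>" and \<eta>: "form_along M N \<psi> \<eta>"
  shows "hs_inner M N \<psi> p (\<theta> p) (\<lambda>v d. f *\<^sub>R \<eta> p v d) = f * hs_inner M N \<psi> p (\<theta> p) (\<eta> p)"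
proof -
  have "metric N (\<psi> p) u (\<lambda>d. f *\<^sub>R v d) = f * metric N (\<psi> p) u v"
    if "u \<in> tangent_space N (\<psi> p)" "v \<in> tangent_space N (\<psi> p)" for u v
    using N.metric_lincomb_left[of v "\<psi> p" v u f 0] N.metric_sym[of u "\<psi> p"] that N.tangent_scaleR[OF that(2), of f] by simp
  then show ?thesis
    using formD(1)[OF \<theta> M.frame_at_tangent] formD(1)[OF \<eta> M.frame_at_tangent]
    by (simp add: hs_inner_def sum_distrib_left)
qed

lemma (in riem_map) metric_alpha_jacobi:
  assumes \<upsilon>: "\<upsilon> \<in> sections_along M N \<psi>" and \<omega>: "\<omega> \<in> sections_along M N \<psi>"
  shows "metric N (\<psi> p) (alpha_jacobi \<alpha> M N \<psi> \<upsilon> p) (\<omega> p) =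
    2 * \<alpha> * rho p powr (\<alpha> - 1) * metric N (\<psi> p) (\<omega> p) (trace_curvature M N \<psi> \<upsilon> p)
    + 4 * \<alpha> * (\<alpha> - 1) * metric N (\<psi> p) (trace_cov M N \<psi> (stress1 \<alpha> \<upsilon>) p) (\<omega> p)
    + 2 * \<alpha> * metric N (\<psi> p) (trace_cov M N \<psi> (stress2 \<alpha> \<upsilon>) p) (\<omega> p)"
proof -
  note T = section_tangent[OF trace_curvature_section[OF \<upsilon>], of p] trace_cov_tangent[OF form_stress(1)[OF \<upsilon>], of \<alpha> p]
    trace_cov_tangent[OF form_stress(2)[OF \<upsilon>], of \<alpha> p] section_tangent[OF \<omega>, of p]
  let ?A = "\<lambda>d. (2 * \<alpha> * rho p powr (\<alpha> - 1)) *\<^sub>R trace_curvature M N \<psi> \<upsilon> p d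
    + (4 * \<alpha> * (\<alpha> - 1)) *\<^sub>R trace_cov M N \<psi> (stress1 \<alpha> \<upsilon>) p d"
  have A: "?A \<in> tangent_space N (\<psi> p)" by (rule N.tangent_lincomb[OF T(1,2)])
  have "alpha_jacobi \<alpha> M N \<psi> \<upsilon> p = (\<lambda>d. 1 *\<^sub>R ?A d + (2 * \<alpha>) *\<^sub>R trace_cov M N \<psi> (stress2 \<alpha> \<upsilon>) p d)"
    by (simp add: alpha_jacobi_eq fun_eq_iff)
  then show ?thesis
    by (simp only: N.metric_lincomb_left[OF A T(3,4)] N.metric_lincomb_left[OF T(1,2,4)]
        N.metric_sym[OF T(1,4)] mult_1)
qed

text \<open>The left integrand is the mixed second derivative of the density to the power \<alpha>,
  with \<zeta> in the place of the covariant acceleration. The \<zeta> term drops out by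
  stationarity, whatever section \<zeta> is, and the two terms with derivatives of \<omega> are
  integrated by parts.\<close>

lemma (in compact_riem_map) integral_second_variation:
  assumes \<upsilon>: "\<upsilon> \<in> sections_along M N \<psi>" and \<omega>: "\<omega> \<in> sections_along M N \<psi>" and \<zeta>: "\<zeta> \<in> sections_along M N \<psi>"
    and harm: "alpha_harmonic \<alpha> M N \<psi>" and \<alpha>: "\<alpha> \<noteq> 0"
  defines "I \<equiv> \<lambda>\<sigma> \<eta> p. hs_inner M N \<psi> p (cov_along M N \<psi> \<sigma> p) (\<eta> p)" and "D \<equiv> differential M N \<psi>"
  shows "(\<integral>p. \<alpha> * (\<alpha> - 1) * rho p powr (\<alpha> - 2) * (2 * I \<upsilon> D p) * (2 * I \<omega> D p)
      + \<alpha> * rho p powr (\<alpha> - 1) * (2 * (I \<zeta> D p - metric N (\<psi> p) (\<omega> p) (trace_curvature M N \<psi> \<upsilon> p)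
          + I \<omega> (cov_along M N \<psi> \<upsilon>) p)) \<partial>M.V) =
    - (\<integral>p. metric N (\<psi> p) (alpha_jacobi \<alpha> M N \<psi> \<upsilon> p) (\<omega> p) \<partial>M.V)"
proof -
  note form = form_cov_along[OF \<upsilon>] form_cov_along[OF \<omega>] form_cov_along[OF \<zeta>] form_differential form_stress[OF \<upsilon>]
  \<comment> \<open>The product of two inner products is a single pairing of the derivative of
    \<omega> with the form \<open>stress1\<close>, as integration by parts requires;
    \<open>stress2\<close> plays the same part below.\<close>
  have s1: "I \<omega> (stress1 \<alpha> \<upsilon>) p = I \<upsilon> D p * rho p powr (\<alpha> - 2) * I \<omega> D p" for p
    unfolding I_def D_def stress1_def by (rule hs_inner_scale_right[OF form(2,4)])
  have s2: "I \<omega> (stress2 \<alpha> \<upsilon>) p = rho p powr (\<alpha> - 1) * I \<omega> (cov_along M N \<psi> \<upsilon>) p" for p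
    unfolding I_def stress2_def by (rule hs_inner_scale_right[OF form(2,1)])
  let ?t1 = "\<lambda>p. metric N (\<psi> p) (trace_cov M N \<psi> (stress1 \<alpha> \<upsilon>) p) (\<omega> p)"
    and ?t2 = "\<lambda>p. metric N (\<psi> p) (trace_cov M N \<psi> (stress2 \<alpha> \<upsilon>) p) (\<omega> p)"
    and ?r = "\<lambda>p. rho p powr (\<alpha> - 1) * metric N (\<psi> p) (\<omega> p) (trace_curvature M N \<psi> \<upsilon> p)"
    and ?z = "\<lambda>p. rho p powr (\<alpha> - 1) * I \<zeta> D p"
  have int: "integrable M.V (I \<omega> (stress1 \<alpha> \<upsilon>))" "integrable M.V (I \<omega> (stress2 \<alpha> \<upsilon>))" "integrable M.V ?t1"
    "integrable M.V ?t2" "integrable M.V ?r" "integrable M.V ?z"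
    unfolding I_def D_def
    by (intro M.continuous_integrable_V M.smooth_fun_continuous M.smooth_fun_mult smooth_fun_rho smooth_fun_hs_inner
        smooth_fun_metric trace_cov_section trace_curvature_section form assms(1,2,3))+
  have "(\<integral>p. \<alpha> * (\<alpha> - 1) * rho p powr (\<alpha> - 2) * (2 * I \<upsilon> D p) * (2 * I \<omega> D p)
      + \<alpha> * rho p powr (\<alpha> - 1) * (2 * (I \<zeta> D p - metric N (\<psi> p) (\<omega> p) (trace_curvature M N \<psi> \<upsilon> p)
          + I \<omega> (cov_along M N \<psi> \<upsilon>) p)) \<partial>M.V) =
    (\<integral>p. 4 * \<alpha> * (\<alpha> - 1) * I \<omega> (stress1 \<alpha> \<upsilon>) p + 2 * \<alpha> * I \<omega> (stress2 \<alpha> \<upsilon>) p + 2 * \<alpha> * ?z p - 2 * \<alpha> * ?r p \<partial>M.V)"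
    by (rule Bochner_Integration.integral_cong) (simp_all add: s1 s2 algebra_simps)
  also have "\<dots> = 4 * \<alpha> * (\<alpha> - 1) * (\<integral>p. I \<omega> (stress1 \<alpha> \<upsilon>) p \<partial>M.V) + 2 * \<alpha> * (\<integral>p. I \<omega> (stress2 \<alpha> \<upsilon>) p \<partial>M.V)
      + 2 * \<alpha> * (\<integral>p. ?z p \<partial>M.V) - 2 * \<alpha> * (\<integral>p. ?r p \<partial>M.V)"
    using int by simp
  \<comment> \<open>Integration by parts supplies the minus sign of the two divergence terms, while
    the curvature term carries its own. The factors 4 and 2 come from the 2 in each derivative of
    the density.\<close>
  also have "\<dots> = - (4 * \<alpha> * (\<alpha> - 1) * (\<integral>p. ?t1 p \<partial>M.V) + 2 * \<alpha> * (\<integral>p. ?t2 p \<partial>M.V) + 2 * \<alpha> * (\<integral>p. ?r p \<partial>M.V))"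
    unfolding I_def D_def integral_hs_inner_cov[OF form(5) \<omega>] integral_hs_inner_cov[OF form(6) \<omega>] stationary[OF \<zeta> harm \<alpha>]
    by simp
  also have "\<dots> = - (\<integral>p. 2 * \<alpha> * ?r p + 4 * \<alpha> * (\<alpha> - 1) * ?t1 p + 2 * \<alpha> * ?t2 p \<partial>M.V)"
    using int by simp
  also have "(\<integral>p. 2 * \<alpha> * ?r p + 4 * \<alpha> * (\<alpha> - 1) * ?t1 p + 2 * \<alpha> * ?t2 p \<partial>M.V) =
      (\<integral>p. metric N (\<psi> p) (alpha_jacobi \<alpha> M N \<psi> \<upsilon> p) (\<omega> p) \<partial>M.V)"
    by (rule Bochner_Integration.integral_cong) (simp_all add: metric_alpha_jacobi[OF \<upsilon> \<omega>] mult.assoc)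
  finally show ?thesis .
qed

text \<open>The variation fields are velocities of curves in N, whereas the variation formulas use
  directional derivatives in the parameters; the chain rule along a parameter curve \<gamma>
  identifies the two.\<close>

lemma (in riem_family) velocity_eq_vel:
  assumes r: "r \<in> P" and \<gamma>: "\<gamma> t = r" "(\<gamma> has_vector_derivative a) (at t)"
  shows "velocity N (\<lambda>t. F (\<gamma> t) p) t = vel a r p"
proof
  fix d
  show "velocity N (\<lambda>t. F (\<gamma> t) p) t d = vel a r p d"
  proof (cases "d \<in> charts_at N (F r p)")
    case True
    note c = M.chart_at_in[of p]
    let ?c = "chart_at M p"
    have at: "?c \<in> atlas M" "d \<in> atlas N" and p: "param ?c (coord ?c p) = p"
      using c True by (auto simp: M.charts_at_iff N.charts_at_iff)
    have "(\<lambda>r. coord d (F r p)) = (\<lambda>r. fexp ?c d (r, coord ?c p))" by (simp add: fexp_def p)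
    then have "(\<lambda>r. coord d (F r p)) differentiable (at r)"
      using frechet_derivative_slice(4)[OF fexp_differentiable[OF at charts_fdom[OF r c True]]] by simp
    then have "((\<lambda>r. coord d (F r p)) has_derivative frechet_derivative (\<lambda>r. coord d (F r p)) (at r)) (at (\<gamma> t))"
      unfolding \<gamma>(1) by (rule has_derivative_frechet)
    from has_derivative_compose[OF \<gamma>(2)[unfolded has_vector_derivative_def] this]
    have "((\<lambda>t. coord d (F (\<gamma> t) p)) has_derivative (\<lambda>x. frechet_derivative (\<lambda>r. coord d (F r p)) (at r) (x *\<^sub>R a))) (at t)" .
    moreover have "linear (frechet_derivative (\<lambda>r. coord d (F r p)) (at r))"
      by (rule linear_frechet_derivative) fact
    ultimately have "((\<lambda>t. coord d (F (\<gamma> t) p)) has_vector_derivative frechet_derivative (\<lambda>r. coord d (F r p)) (at r) a) (at t)"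
      by (simp add: has_vector_derivative_def linear_scale)
    from vector_derivative_at[OF this] show ?thesis
      using True by (simp add: velocity_def vel_def \<gamma>(1))
  qed (simp add: velocity_def vel_def \<gamma>(1))
qed

theorem theorem9:
  fixes M :: "('a::{t2_space,second_countable_topology}, 'm::finite) riemannian"
    and N :: "('b::{t2_space,second_countable_topology}, 'n::finite) riemannian"
    and \<psi> :: "'a \<Rightarrow> 'b"
    and \<psi>\<^sub>t\<^sub>s :: "real \<Rightarrow> real \<Rightarrow> 'a \<Rightarrow> 'b"
    and \<alpha> \<epsilon> :: real
    and \<upsilon> \<omega> :: "'a \<Rightarrow> ('b, 'n) tvec"
  assumes "\<alpha> > 1"
    and "riemannian_manifold M" and "compact (UNIV :: 'a set)"
    and "riemannian_manifold N"
    and "alpha_harmonic \<alpha> M N \<psi>"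
    and "\<epsilon> > 0"
    and "smooth_family M N ({-\<epsilon><..<\<epsilon>} \<times> {-\<epsilon><..<\<epsilon>}) (\<lambda>(t, s). \<psi>\<^sub>t\<^sub>s t s)"
    and "\<psi>\<^sub>t\<^sub>s 0 0 = \<psi>"
    and "\<upsilon> = (\<lambda>p. velocity N (\<lambda>t. \<psi>\<^sub>t\<^sub>s t 0 p) 0)"
    and "\<omega> = (\<lambda>p. velocity N (\<lambda>s. \<psi>\<^sub>t\<^sub>s 0 s p) 0)"
  shows "alpha_jacobi \<alpha> M N \<psi> \<upsilon> \<in> sections_along M N \<psi> \<and>
    (\<forall>t\<in>{-\<epsilon><..<\<epsilon>}. (\<lambda>s. alpha_energy \<alpha> M N (\<psi>\<^sub>t\<^sub>s t s)) differentiable (at 0)) \<and>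
    ((\<lambda>t. deriv (\<lambda>s. alpha_energy \<alpha> M N (\<psi>\<^sub>t\<^sub>s t s)) 0) has_real_derivative
       - (\<integral>p. metric N (\<psi> p) (alpha_jacobi \<alpha> M N \<psi> \<upsilon> p) (\<omega> p) \<partial>riemannian_volume M)) (at 0)"
proof -
  let ?P = "{-\<epsilon><..<\<epsilon>} \<times> {-\<epsilon><..<\<epsilon>}" and ?F = "\<lambda>(t, s). \<psi>\<^sub>t\<^sub>s t s"
  interpret R: riem_family M N ?P ?F
    by unfold_locales (use assms in \<open>auto intro!: open_Times\<close>)
  let ?G = "\<lambda>r p. R.dens r p powr \<alpha>"
  \<comment> \<open>The derivative in s at s = 0, with t kept as a variable: the inner derivative is
    needed for all admissible t before the outer one can be taken.\<close>
  define E where "E = (\<lambda>t. \<integral>p. R.pd (0, 1) ?G (t, 0) p \<partial>R.M.V)"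
  have P0: "(0, 0) \<in> ?P" using assms(6) by simp
  have F0: "?F (0, 0) = \<psi>" using assms(8) by simp
  interpret S: compact_riem_map M N \<psi> using R.slice[OF P0] by (simp add: assms(8))
  have "R.vel (1, 0) (0, 0) p = velocity N (\<lambda>t. ?F (t, 0) p) 0" for p
    by (rule R.velocity_eq_vel[OF P0, symmetric]) (auto intro!: derivative_eq_intros simp: has_vector_derivative_def)
  then have vel_t: "R.vel (1, 0) (0, 0) = \<upsilon>" using assms(9) by (simp add: fun_eq_iff)
  have "R.vel (0, 1) (0, 0) p = velocity N (\<lambda>s. ?F (0, s) p) 0" for p
    by (rule R.velocity_eq_vel[OF P0, symmetric]) (auto intro!: derivative_eq_intros simp: has_vector_derivative_def)
  then have vel_s: "R.vel (0, 1) (0, 0) = \<omega>" using assms(10) by (simp add: fun_eq_iff)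
  have \<upsilon>: "\<upsilon> \<in> sections_along M N \<psi>" and \<omega>: "\<omega> \<in> sections_along M N \<psi>"
    using R.vel_section[OF P0, of "(1, 0)"] R.vel_section[OF P0, of "(0, 1)"] by (simp_all add: vel_t vel_s assms(8))
  \<comment> \<open>The covariant t-derivative of the s-velocity, in the order in which the energy
    is differentiated: first in s, then in t. With this order the curvature acts on the t-velocity
    \<upsilon> and is paired with \<omega>.\<close>
  have \<zeta>: "R.accel (0, 1) (1, 0) (0, 0) \<in> sections_along M N \<psi>"
    using R.accel_section[OF P0] by (simp add: assms(8))
  have ds: "((\<lambda>s. alpha_energy \<alpha> M N (\<psi>\<^sub>t\<^sub>s t s)) has_real_derivative E t) (at 0)" if "t \<in> {-\<epsilon><..<\<epsilon>}" for t
    using R.energy_has_derivative[of "(t, 0)" 0 "(0, 1)" \<alpha>] that assms(6) by (simp add: E_def)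
  have "((\<lambda>t. \<integral>p. R.pd (0, 1) ?G ((0, 0) + t *\<^sub>R (1, 0)) p \<partial>R.M.V) has_real_derivative
      (\<integral>p. R.pd (1, 0) (R.pd (0, 1) ?G) ((0, 0) + 0 *\<^sub>R (1, 0)) p \<partial>R.M.V)) (at 0)"
    by (rule R.pfun_integral_derivative[OF R.smooth_pfun_pd[OF R.smooth_pfun_powr[OF R.smooth_pfun_dens R.dens_pos]]])
      (use P0 in simp)
  then have dt: "(E has_real_derivative (\<integral>p. R.pd (1, 0) (R.pd (0, 1) ?G) (0, 0) p \<partial>R.M.V)) (at 0)"
    by (simp add: E_def)
  have dens: "R.dens (0, 0) p = S.rho p" for p by (simp add: R.dens_def S.rho_def assms(8))
  have "(\<integral>p. R.pd (1, 0) (R.pd (0, 1) ?G) (0, 0) p \<partial>R.M.V) =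
      - (\<integral>p. metric N (\<psi> p) (alpha_jacobi \<alpha> M N \<psi> \<upsilon> p) (\<omega> p) \<partial>R.M.V)"
    using S.integral_second_variation[OF \<upsilon> \<omega> \<zeta> assms(5)] assms(1)
    by (simp add: R.pd_pd_dens_powr[OF P0] R.pd_pd_dens[OF P0] R.pd_dens[OF P0] dens vel_t vel_s assms(8))
  then have "(E has_real_derivative - (\<integral>p. metric N (\<psi> p) (alpha_jacobi \<alpha> M N \<psi> \<upsilon> p) (\<omega> p) \<partial>R.M.V)) (at 0)"
    using dt by simp
  then have "((\<lambda>t. deriv (\<lambda>s. alpha_energy \<alpha> M N (\<psi>\<^sub>t\<^sub>s t s)) 0) has_real_derivative
      - (\<integral>p. metric N (\<psi> p) (alpha_jacobi \<alpha> M N \<psi> \<upsilon> p) (\<omega> p) \<partial>R.M.V)) (at 0)"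
    \<comment> \<open>\<open>deriv\<close> is identified with E only on the open interval of
      admissible t, which is enough for a derivative at 0.\<close>
    by (rule has_field_derivative_transform_within_open[of _ _ _ "{-\<epsilon><..<\<epsilon>}"])
      (use assms(6) DERIV_imp_deriv[OF ds] in auto)
  moreover have "(\<lambda>s. alpha_energy \<alpha> M N (\<psi>\<^sub>t\<^sub>s t s)) differentiable (at 0)" if "t \<in> {-\<epsilon><..<\<epsilon>}" for t
    using ds[OF that] real_differentiable_def by blast
  ultimately show ?thesis using S.alpha_jacobi_section[OF \<upsilon>] by blast
qed

end
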